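(* There are universal constants $C,C'>0$ such that for every $n\geq 1$ and every centrally symmetric convex body $K\subset\mathbb{R}^n$ in isotropic position with $\mathrm{Vol}(K)=\mathrm{Vol}(D_n)$: (1) $M_2(K)\le C\,T_2(X_K)$. (2) If $K\in SL_p^n$ for some $p>0$, then $M_p(K)\le C\sqrt{p_0}$, where $p_0=\max(1,\min(p,n))$. (3) If $K\in BP_k^n$ for some $k\in\{1,\dots,n-1\}$, then $\widetilde{M}_k(K)\ge C'/\mathcal{L}_k$.
   Context: $D_n$ is the Euclidean unit ball of $\mathbb{R}^n$ and $\sigma$ is the Haar probability measure on $S^{n-1}$. A convex body is a compact convex set with non-empty interior. $K$ is in isotropic position if $\int_K\langle x,\theta\rangle^2dx$ is the same for all $\theta\in S^{n-1}$. The isotropic constant $L_K$ of a centrally symmetric convex body is defined by $\int_{K'}\langle x,\theta\rangle^2dx=L_K^2$ for all $\theta\in S^{n-1}$, where $K'$ is an invertible linear image of $K$ of volume 1 in isotropic position (it exists and is unique up to rotation). $\mathcal{L}_k$ is the maximal (supremal) isotropic constant of centrally symmetric convex bodies in $\mathbb{R}^k$. $\|\cdot\|_K$ is the norm with unit ball $K$, $X_K=(\mathbb{R}^n,\|\cdot\|_K)$, $\rho_K(\theta)=\max\{r\ge0:r\theta\in K\}=1/\|\theta\|_K$ for $\theta\in S^{n-1}$, $M_p(K)=\left(\int_{S^{n-1}}\|x\|_K^p\,d\sigma(x)\right)^{1/p}$, and $\widetilde{M}_k(K)=\left(\int_{S^{n-1}}\rho_K(x)^k\,d\sigma(x)\right)^{1/k}$.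 The (Gaussian) type-2 constant $T_2(X)$ of $X=(\mathbb{R}^n,\|\cdot\|)$ is the minimal $T>0$ such that $\left(\mathbb{E}\left\|\sum_{i=1}^m g_ix_i\right\|^2\right)^{1/2}\le T\left(\sum_{i=1}^m\|x_i\|^2\right)^{1/2}$ for all $m\ge1$, $x_1,\dots,x_m\in X$, with $g_i$ independent real standard Gaussians. $SL_p^n$ is the class of unit balls of $n$-dimensional subspaces of $L_p([0,1],dx)$ (i.e. $K\in SL_p^n$ if there is a linear $J:\mathbb{R}^n\to L_p$ with $\|x\|_K=\|Jx\|_{L_p}$ for all $x$). $k$-Busemann-Petty bodies: $G(n,m)$ is the Grassmannian of $m$-dimensional linear subspaces of $\mathbb{R}^n$; $R_m(f)(E)=\int_{S^{n-1}\cap E}f\,d\sigma_E$ for $f\in C(S^{n-1})$, $E\in G(n,m)$, where $\sigma_E$ is the rotation-invariant probability measure on $S^{n-1}\cap E$; $R_m^*$ is the dual map on signed Borel measures, $\int_{S^{n-1}}f\,R_m^*(d\mu)=\int_{G(n,m)}R_m(f)\,d\mu$ for all $f\in C(S^{n-1})$. $K\in BP_k^n$ if $\rho_K^k=R_{n-k}^*(d\mu)$ for some non-negative Borel measure $\mu$ on $G(n,n-k)$ (where $\rho_K^k$ is identified with the measure of density $\rho_K^k$ with respect to $\sigma$). *)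

theory Defs
  imports "HOL-Probability.Probability" "HOL-Library.Function_Algebras"
begin

text \<open>
  The constants of the theorem are uniform in the dimension, so the dimension must be a term and not
  a type. Following the library's \<^const>\<open>Euclidean_space\<close>, the space of dimension \<open>n\<close> consists of the
  functions \<^typ>\<open>nat \<Rightarrow> real\<close> that vanish from index \<open>n\<close> on. The pointwise vector space structure on
  functions makes \<^const>\<open>convex\<close>, \<^const>\<open>linear\<close>, \<^const>\<open>subspace\<close> and \<^const>\<open>dim\<close> available. A linear
  map on such a subspace always extends to all of \<^typ>\<open>nat \<Rightarrow> real\<close>, so quantifying over maps that
  satisfy \<^const>\<open>linear\<close> loses nothing.
\<close>

instantiation "fun" :: (type, scaleR) scaleR
begin
definition scaleR_fun_def: "c *\<^sub>R f = (\<lambda>x. c *\<^sub>R f x)"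
instance ..
end

instance "fun" :: (type, real_vector) real_vector
  by standard (auto simp: scaleR_fun_def plus_fun_def fun_eq_iff scaleR_add_right scaleR_add_left)

abbreviation Rn :: "nat \<Rightarrow> (nat \<Rightarrow> real) set" where
  "Rn n \<equiv> topspace (Euclidean_space n)"

definition dot :: "nat \<Rightarrow> (nat \<Rightarrow> real) \<Rightarrow> (nat \<Rightarrow> real) \<Rightarrow> real" where
  "dot n x y = (\<Sum>i<n. x i * y i)"

definition unit_ball :: "nat \<Rightarrow> (nat \<Rightarrow> real) set" where
  "unit_ball n = {x \<in> Rn n. sqrt (dot n x x) \<le> 1}"

definition unit_sphere :: "nat \<Rightarrow> (nat \<Rightarrow> real) set" where
  "unit_sphere n = {x \<in> Rn n. sqrt (dot n x x) = 1}"

definition Leb :: "nat \<Rightarrow> (nat \<Rightarrow> real) measure" where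
  "Leb n = distr (\<Pi>\<^sub>M i\<in>{..<n}. lborel) borel (\<lambda>x i. if i < n then x i else 0)"

definition convex_body :: "nat \<Rightarrow> (nat \<Rightarrow> real) set \<Rightarrow> bool" where
  "convex_body n K \<longleftrightarrow> compactin (Euclidean_space n) K \<and> convex K \<and>
     (Euclidean_space n) interior_of K \<noteq> {}"

definition centrally_symmetric :: "(nat \<Rightarrow> real) set \<Rightarrow> bool" where
  "centrally_symmetric K \<longleftrightarrow> (\<forall>x\<in>K. - x \<in> K)"


subsection \<open>Haar probability measures on spheres\<close>

text \<open>
  Invariance is required under all linear isometries of \<open>E\<close>, not only under those of determinant
  one: for \<open>dim E = 1\<close> the latter are trivial and would not determine the measure.
\<close>

definition is_sphere_haar :: "nat \<Rightarrow> (nat \<Rightarrow> real) set \<Rightarrow> (nat \<Rightarrow> real) measure \<Rightarrow> bool" where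
  "is_sphere_haar n E \<mu> \<longleftrightarrow>
     prob_space \<mu> \<and>
     sets \<mu> = sets (restrict_space borel (unit_sphere n \<inter> E)) \<and>
     (\<forall>T. linear T \<and> T ` E = E \<and> (\<forall>x\<in>E. dot n (T x) (T x) = dot n x x)
        \<longrightarrow> distr \<mu> \<mu> T = \<mu>)"

definition sphere_haar :: "nat \<Rightarrow> (nat \<Rightarrow> real) set \<Rightarrow> (nat \<Rightarrow> real) measure" where
  "sphere_haar n E = (THE \<mu>. is_sphere_haar n E \<mu>)"

abbreviation sigma_sphere :: "nat \<Rightarrow> (nat \<Rightarrow> real) measure" where
  "sigma_sphere n \<equiv> sphere_haar n (Rn n)"


subsection \<open>Norm, radial function and their means\<close>

definition norm_of :: "(nat \<Rightarrow> real) set \<Rightarrow> (nat \<Rightarrow> real) \<Rightarrow> real" where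
  "norm_of K x = Inf {t. 0 < t \<and> (1 / t) *\<^sub>R x \<in> K}"

definition radial :: "(nat \<Rightarrow> real) set \<Rightarrow> (nat \<Rightarrow> real) \<Rightarrow> real" where
  "radial K \<theta> = Sup {r. 0 \<le> r \<and> r *\<^sub>R \<theta> \<in> K}"

definition mean_norm :: "nat \<Rightarrow> real \<Rightarrow> (nat \<Rightarrow> real) set \<Rightarrow> real" where
  "mean_norm n p K = (LINT \<theta>|sigma_sphere n. norm_of K \<theta> powr p) powr (1 / p)"

definition mean_radial :: "nat \<Rightarrow> nat \<Rightarrow> (nat \<Rightarrow> real) set \<Rightarrow> real" where
  "mean_radial n k K = root k (LINT \<theta>|sigma_sphere n. radial K \<theta> ^ k)"


subsection \<open>Isotropic position and isotropic constants\<close>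

definition isotropic :: "nat \<Rightarrow> (nat \<Rightarrow> real) set \<Rightarrow> bool" where
  "isotropic n K \<longleftrightarrow>
     (\<exists>c. \<forall>\<theta>\<in>unit_sphere n. (LINT x:K|Leb n. (dot n x \<theta>)\<^sup>2) = c)"

definition isotropic_constant :: "nat \<Rightarrow> (nat \<Rightarrow> real) set \<Rightarrow> real" where
  "isotropic_constant n K =
     (THE L. 0 \<le> L \<and>
        (\<exists>T. linear T \<and> bij_betw T (Rn n) (Rn n) \<and>
             measure (Leb n) (T ` K) = 1 \<and> isotropic n (T ` K) \<and>
             (\<forall>\<theta>\<in>unit_sphere n. (LINT x:T ` K|Leb n. (dot n x \<theta>)\<^sup>2) = L\<^sup>2)))"

text \<open>The supremum is taken in \<^typ>\<open>ereal\<close>, so that no finiteness is presupposed.\<close>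

definition max_isotropic_constant :: "nat \<Rightarrow> ereal" where
  "max_isotropic_constant k =
     (SUP K\<in>{K. convex_body k K \<and> centrally_symmetric K}. ereal (isotropic_constant k K))"


subsection \<open>Gaussian type 2\<close>

definition type2_const :: "nat \<Rightarrow> (nat \<Rightarrow> real) set \<Rightarrow> real" where
  "type2_const n K = Inf {T. 0 < T \<and>
     (\<forall>m\<ge>1. \<forall>x :: nat \<Rightarrow> nat \<Rightarrow> real. (\<forall>i<m. x i \<in> Rn n) \<longrightarrow>
        sqrt (LINT g|(\<Pi>\<^sub>M i\<in>{..<m}. density lborel std_normal_density).
                (norm_of K (\<Sum>i<m. g i *\<^sub>R x i))\<^sup>2)
          \<le> T * sqrt (\<Sum>i<m. (norm_of K (x i))\<^sup>2))}"


subsection \<open>Unit balls of subspaces of $L_p$\<close>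

text \<open>
  \<open>J x\<close> is a representative of a class in $L_p([0,1])$, hence \<open>J\<close> is linear only up to null sets.
\<close>

definition in_SL :: "real \<Rightarrow> nat \<Rightarrow> (nat \<Rightarrow> real) set \<Rightarrow> bool" where
  "in_SL p n K \<longleftrightarrow> (\<exists>J :: (nat \<Rightarrow> real) \<Rightarrow> real \<Rightarrow> real.
     (\<forall>x\<in>Rn n. J x \<in> borel_measurable (lebesgue_on {0..1}) \<and>
               integrable (lebesgue_on {0..1}) (\<lambda>t. \<bar>J x t\<bar> powr p)) \<and>
     (\<forall>x\<in>Rn n. \<forall>y\<in>Rn n. \<forall>a b.
        AE t in lebesgue_on {0..1}. J (a *\<^sub>R x + b *\<^sub>R y) t = a * J x t + b * J y t) \<and>
     (\<forall>x\<in>Rn n. norm_of K x = (LINT t|lebesgue_on {0..1}. \<bar>J x t\<bar> powr p) powr (1 / p)))"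


subsection \<open>Busemann-Petty bodies\<close>

definition grassmannian :: "nat \<Rightarrow> nat \<Rightarrow> (nat \<Rightarrow> real) set set" where
  "grassmannian n m = {E. subspace E \<and> E \<subseteq> Rn n \<and> dim E = m}"

definition orth_proj :: "nat \<Rightarrow> (nat \<Rightarrow> real) set \<Rightarrow> (nat \<Rightarrow> real) \<Rightarrow> nat \<Rightarrow> real" where
  "orth_proj n E x = (THE y. y \<in> E \<and> (\<forall>z\<in>E. dot n (x - y) z = 0))"

text \<open>
  The usual topology of the Grassmannian: subspaces converge iff their orthogonal projections do.
  Pointwise convergence of the projections is the same as norm convergence, the dimension
  being finite.
\<close>

definition grassmann_topology :: "nat \<Rightarrow> nat \<Rightarrow> (nat \<Rightarrow> real) set topology" where
  "grassmann_topology n m = pullback_topology (grassmannian n m) (orth_proj n) euclidean"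

definition radon :: "nat \<Rightarrow> ((nat \<Rightarrow> real) \<Rightarrow> real) \<Rightarrow> (nat \<Rightarrow> real) set \<Rightarrow> real" where
  "radon n f E = (LINT \<theta>|sphere_haar n E. f \<theta>)"

text \<open>
  The last clause is the equality of the measure with density $\rho_K^k$ and the dual spherical
  Radon transform of \<open>\<mu>\<close>, both tested against continuous functions.
\<close>

definition in_BP :: "nat \<Rightarrow> nat \<Rightarrow> (nat \<Rightarrow> real) set \<Rightarrow> bool" where
  "in_BP k n K \<longleftrightarrow> (\<exists>\<mu> :: (nat \<Rightarrow> real) set measure.
     finite_measure \<mu> \<and>
     sets \<mu> = sets (sigma (grassmannian n (n - k)) {U. openin (grassmann_topology n (n - k)) U}) \<and>
     (\<forall>f. continuous_on (unit_sphere n) f \<longrightarrow>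
        (LINT \<theta>|sigma_sphere n. f \<theta> * radial K \<theta> ^ k) = (LINT E|\<mu>. radon n f E)))"

end

theory Submission
  imports Defs
begin

text \<open>
  Write \<open>V\<close> for the volume of \<open>K\<close> and \<open>c\<close> for its common second moment. Half of the volume lies
  outside the ball of radius \<open>1/2\<close>, so \<open>c/V \<ge> 1/(8n)\<close>: the uniform measure on \<open>K\<close>, on which the norm
  is at most \<open>1\<close>, is spread at least like the sphere. Each part compares the two measures.

  (1) Some multiple \<open>t \<ge> c/V\<close> of the identity is a finite sum \<open>\<Sum> x\<^sub>i x\<^sub>i\<^sup>T\<close> with \<open>\<Sum> \<parallel>x\<^sub>i\<parallel>\<^sup>2 \<le> 9/8\<close>, since
  the covariance matrix of \<open>K\<close> is a limit of such sums. Then \<open>\<Sum> g\<^sub>i x\<^sub>i\<close> is \<open>sqrt t\<close> times a standard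
  Gaussian vector, and type 2 bounds its norm.

  (2) By Fubini it suffices to compare the \<open>p\<close>-th moments of linear functionals on the sphere, computed
  from even Gaussian moments, with those on \<open>K\<close>, where the one-dimensional marginals are bounded.

  (3) Ball's body of a \<open>k\<close>-dimensional marginal shows that central sections of codimension \<open>k\<close> have
  volume at most \<open>(C \<L>)\<^sup>k\<close> times that of the unit ball, \<open>\<L>\<close> the supremum of the isotropic constants
  of dimension \<open>k\<close>. Testing the Busemann-Petty measure against \<open>\<rho>\<^sup>n\<^sup>-\<^sup>k\<close> and against \<open>1\<close> then gives
  \<open>1 \<le> (C \<L>)\<^sup>k \<integral> \<rho>\<^sup>k d\<sigma>\<close>.
\<close>

section \<open>Coordinate spaces\<close>

text \<open>Ball's body is taken of order \<open>k + 2\<close>: along each ray the power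
  \<open>k + 2\<close> of its radial function is, up to a factor, the moment of order
  \<open>k + 1\<close> of the marginal. With this order its second moments are exactly those of the
  marginal divided by the value at 0, so it inherits isotropy and has an explicit isotropic
  constant. Only its volume is estimated, from above, which costs the factor 54. The section bound
  serves (2) as well as (3): in codimension 1 an interval has isotropic constant at most 1/2, which
  gives an absolute bound on the marginals, while in codimension \<open>k\<close> the supremum of
  the isotropic constants is all that bounds it. The loss of \<open>n\<close> in
  \<open>c/V \<ge> 1/(8n)\<close> is regained in (3) from the volume ratio of the unit balls of
  dimensions \<open>n\<close> and \<open>n - k\<close>. In (1) the covariance is not diagonalised:
  the error of its discretisation is absorbed by enlarging the multiple of the identity until the
  remainder is diagonally dominant and so again a sum of rank one terms. As the dimension is a term,
  linear changes of variables are derived from translation invariance, with the determinant left as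
  an unknown factor.\<close>

lemma scaleR_fun_apply [simp]: "(c *\<^sub>R f) i = c *\<^sub>R f i"
  by (simp add: scaleR_fun_def)

lemma sum_fun_apply: "(sum f A) i = (\<Sum>a\<in>A. f a i)"
  by (induction A rule: infinite_finite_induct) auto

lemma Rn_iff: "x \<in> Rn n \<longleftrightarrow> (\<forall>i\<ge>n. x i = 0)"
  by (simp add: topspace_Euclidean_space)

text \<open>Maps and norms that behave well only on \<open>Rn n\<close> become Borel on the whole
  function space once composed with this projection.\<close>

definition trunc :: "nat \<Rightarrow> (nat \<Rightarrow> real) \<Rightarrow> nat \<Rightarrow> real" where
  "trunc n x = (\<lambda>i. if i < n then x i else 0)"

definition axis_vec :: "nat \<Rightarrow> nat \<Rightarrow> real" where
  "axis_vec a = (\<lambda>i. if i = a then 1 else 0)"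

definition nrm :: "nat \<Rightarrow> (nat \<Rightarrow> real) \<Rightarrow> real" where
  "nrm n x = sqrt (dot n x x)"

lemma trunc_in_Rn [simp]: "trunc n x \<in> Rn n"
  by (auto simp: Rn_iff trunc_def)

lemma trunc_id: "x \<in> Rn n \<Longrightarrow> trunc n x = x"
  by (auto simp: Rn_iff trunc_def fun_eq_iff)

lemma linear_trunc: "linear (trunc n)"
  by (rule linearI) (auto simp: trunc_def fun_eq_iff)

lemma axis_vec_in_Rn: "i < n \<Longrightarrow> axis_vec i \<in> Rn n"
  by (auto simp: axis_vec_def Rn_iff)

lemma Rn_subspace: "subspace (Rn n)"
  by (auto simp: subspace_def Rn_iff)

lemma Rn_closed_ops [simp, intro]:
  "x \<in> Rn n \<Longrightarrow> y \<in> Rn n \<Longrightarrow> x + y \<in> Rn n"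
  "x \<in> Rn n \<Longrightarrow> y \<in> Rn n \<Longrightarrow> x - y \<in> Rn n"
  "x \<in> Rn n \<Longrightarrow> - x \<in> Rn n"
  "x \<in> Rn n \<Longrightarrow> c *\<^sub>R x \<in> Rn n"
  "0 \<in> Rn n"
  by (auto simp: Rn_iff)

lemma Rn_mono: "m \<le> n \<Longrightarrow> x \<in> Rn m \<Longrightarrow> x \<in> Rn n"
  by (auto simp: Rn_iff)

lemma Rn_sum: "(\<And>i. i \<in> A \<Longrightarrow> f i \<in> Rn n) \<Longrightarrow> sum f A \<in> Rn n"
  by (auto simp: Rn_iff sum_fun_apply)

lemma Rn_Suc_upd: "y \<in> Rn j \<Longrightarrow> y(j := t) \<in> Rn (Suc j)"
  by (auto simp: Rn_iff)

lemma Rn_expand: "x \<in> Rn n \<Longrightarrow> x = (\<Sum>i<n. x i *\<^sub>R axis_vec i)"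
  by (auto simp: fun_eq_iff sum_fun_apply axis_vec_def Rn_iff if_distrib cong: if_cong)

lemma dot_commute: "dot n x y = dot n y x"
  by (simp add: dot_def mult.commute)

lemma dot_simps [simp]:
  "dot n (x + y) z = dot n x z + dot n y z"
  "dot n z (x + y) = dot n z x + dot n z y"
  "dot n (x - y) z = dot n x z - dot n y z"
  "dot n z (x - y) = dot n z x - dot n z y"
  "dot n (- x) z = - dot n x z"
  "dot n z (- x) = - dot n z x"
  "dot n (c *\<^sub>R x) z = c * dot n x z"
  "dot n z (c *\<^sub>R x) = c * dot n z x"
  "dot n 0 z = 0"
  "dot n z 0 = 0"
  by (auto simp: dot_def algebra_simps sum.distrib sum_subtractf sum_negf sum_distrib_left)

lemma dot_sum_left:
  fixes f :: "'a \<Rightarrow> nat \<Rightarrow> real"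
  shows "dot n (sum f A) z = (\<Sum>a\<in>A. dot n (f a) z)"
  by (rule linear_sum[of "\<lambda>x. dot n x z"]) (auto intro!: linearI)

lemma dot_axis: "i < n \<Longrightarrow> dot n x (axis_vec i) = x i"
  by (auto simp: dot_def axis_vec_def if_distrib cong: if_cong)

lemma dot_trunc [simp]: "dot n (trunc n x) y = dot n x y" "dot n x (trunc n y) = dot n x y"
  by (auto simp: dot_def trunc_def)

lemma dot_self_nonneg [simp]: "0 \<le> dot n x x"
  by (auto simp: dot_def intro: sum_nonneg)

lemma dot_upd: "dot (Suc n) (x(n := a)) (y(n := b)) = dot n x y + a * b"
  by (auto simp: dot_def)

lemma nrm_L2: "nrm n x = L2_set x {..<n}"
  by (simp add: nrm_def L2_set_def dot_def power2_eq_square)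

lemma nrm_nonneg [simp]: "0 \<le> nrm n x"
  by (simp add: nrm_def)

lemma nrm_sq: "(nrm n x)\<^sup>2 = dot n x x"
  by (simp add: nrm_def)

lemma nrm_trunc [simp]: "nrm n (trunc n x) = nrm n x"
  by (simp add: nrm_def)

lemma nrm_scaleR [simp]: "nrm n (c *\<^sub>R x) = \<bar>c\<bar> * nrm n x"
  by (simp add: nrm_def real_sqrt_mult mult.assoc [symmetric])

lemma nrm_minus [simp]: "nrm n (- x) = nrm n x"
  by (simp add: nrm_def)

lemma nrm_diff_commute: "nrm n (x - y) = nrm n (y - x)"
  by (simp add: nrm_def algebra_simps)

lemma nrm_zero [simp]: "nrm n 0 = 0"
  by (simp add: nrm_def)

lemma nrm_triangle: "nrm n (x + y) \<le> nrm n x + nrm n y"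
  using L2_set_triangle_ineq [of x y "{..<n}"] by (simp add: nrm_L2 plus_fun_def)

lemma nrm_eq_0_iff: "x \<in> Rn n \<Longrightarrow> nrm n x = 0 \<longleftrightarrow> x = 0"
  by (auto simp: nrm_L2 L2_set_eq_0_iff Rn_iff fun_eq_iff) (meson lessThan_iff not_le)

lemma nrm_pos: "x \<in> Rn n \<Longrightarrow> x \<noteq> 0 \<Longrightarrow> 0 < nrm n x"
  using nrm_eq_0_iff [of x n] nrm_nonneg [of n x] by linarith

lemma coord_le_nrm: "i < n \<Longrightarrow> \<bar>x i\<bar> \<le> nrm n x"
  using member_le_L2_set [of "{..<n}" i "\<lambda>i. \<bar>x i\<bar>"] by (simp add: nrm_L2 L2_set_def)

lemma nrm_le_sum: "nrm n x \<le> (\<Sum>i<n. \<bar>x i\<bar>)"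
  unfolding nrm_L2 by (rule L2_set_le_sum_abs)

lemma dot_le_nrm: "\<bar>dot n x y\<bar> \<le> nrm n x * nrm n y"
  unfolding dot_def nrm_L2
  by (rule order_trans [OF sum_abs]) (simp add: abs_mult L2_set_mult_ineq)

lemma nrm_axis: "i < n \<Longrightarrow> nrm n (axis_vec i) = 1"
  using dot_axis[of i n "axis_vec i"] by (simp add: nrm_def) (simp add: axis_vec_def)

lemma unit_sphere_iff: "x \<in> unit_sphere n \<longleftrightarrow> x \<in> Rn n \<and> nrm n x = 1"
  by (simp add: unit_sphere_def nrm_def)

lemma unit_ball_iff: "x \<in> unit_ball n \<longleftrightarrow> x \<in> Rn n \<and> nrm n x \<le> 1"
  by (simp add: unit_ball_def nrm_def)

text \<open>
  A linear isometry of \<open>\<real>\<^sup>m\<close> onto the subset \<open>E\<close> of \<open>\<real>\<^sup>n\<close>; nothing is required of the values outside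
  \<open>\<real>\<^sup>m\<close>, where a linear map on \<^typ>\<open>nat \<Rightarrow> real\<close> need not even be measurable.
\<close>
definition iso_onto :: "nat \<Rightarrow> nat \<Rightarrow> (nat \<Rightarrow> real) set \<Rightarrow> ((nat \<Rightarrow> real) \<Rightarrow> nat \<Rightarrow> real) \<Rightarrow> bool" where
  "iso_onto m n E T \<longleftrightarrow> linear T \<and> T ` Rn m = E \<and> E \<subseteq> Rn n \<and>
     (\<forall>x\<in>Rn m. dot n (T x) (T x) = dot m x x)"

text \<open>Polarisation: expand the squared norm of \<open>T (x + y)\<close>.\<close>

lemma iso_onto_dot:
  assumes "iso_onto m n E T" "x \<in> Rn m" "y \<in> Rn m"
  shows "dot n (T x) (T y) = dot m x y"
proof -
  have T: "linear T" "\<And>x. x \<in> Rn m \<Longrightarrow> dot n (T x) (T x) = dot m x x"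
    using assms by (auto simp: iso_onto_def)
  have "dot n (T (x + y)) (T (x + y)) = dot m (x + y) (x + y)"
    using assms by (intro T) auto
  thus ?thesis
    using T(2)[OF assms(2)] T(2)[OF assms(3)]
    using dot_commute[of n "T y" "T x"] dot_commute[of m y x] by (simp add: linear_add[OF T(1)])
qed

lemma iso_onto_nrm: "iso_onto m n E T \<Longrightarrow> x \<in> Rn m \<Longrightarrow> nrm n (T x) = nrm m x"
  by (auto simp: iso_onto_def nrm_def)

lemma iso_onto_id: "iso_onto n n (Rn n) (\<lambda>x. x)"
  by (auto simp: iso_onto_def linear_id [unfolded id_def])

lemma iso_onto_mem: "iso_onto m n E T \<Longrightarrow> x \<in> Rn m \<Longrightarrow> T x \<in> E \<and> T x \<in> Rn n"
  by (auto simp: iso_onto_def)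

lemma iso_onto_linear: "iso_onto m n E T \<Longrightarrow> linear T"
  by (simp add: iso_onto_def)

lemma iso_onto_inj: "iso_onto m n E T \<Longrightarrow> x \<in> Rn m \<Longrightarrow> y \<in> Rn m \<Longrightarrow> T x = T y \<Longrightarrow> x = y"
proof -
  assume a: "iso_onto m n E T" "x \<in> Rn m" "y \<in> Rn m" "T x = T y"
  have "nrm n (T (x - y)) = nrm m (x - y)" by (intro iso_onto_nrm[OF a(1)] Rn_closed_ops a)
  moreover have "T (x - y) = 0" using a by (simp add: iso_onto_linear linear_diff)
  ultimately have "nrm m (x - y) = 0" by simp
  thus ?thesis using a nrm_eq_0_iff[OF Rn_closed_ops(2)[OF a(2,3)]] by simp
qed

lemma iso_onto_compose:
  assumes "iso_onto l m (Rn m) S" "iso_onto m n E T"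
  shows "iso_onto l n E (\<lambda>x. T (S x))"
proof -
  have "linear (T \<circ> S)" using assms by (auto intro: linear_compose simp: iso_onto_def)
  thus ?thesis using assms unfolding iso_onto_def
    by (auto simp: image_iff o_def) (metis image_iff, metis image_eqI)
qed

subsection \<open>Measurability\<close>

lemma borel_measurable_coord [measurable (raw)]: "(\<lambda>x::nat \<Rightarrow> real. x i) \<in> borel_measurable borel"
  by (rule measurable_product_coordinates)

lemma measurable_funI:
  fixes f :: "'a \<Rightarrow> nat \<Rightarrow> real"
  shows "(\<And>i. (\<lambda>x. f x i) \<in> borel_measurable M) \<Longrightarrow> f \<in> borel_measurable M"
  by (rule measurable_coordinatewise_then_product)

lemma measurable_apply [measurable_dest]:
  fixes f :: "'a \<Rightarrow> nat \<Rightarrow> real"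
  shows "f \<in> borel_measurable M \<Longrightarrow> (\<lambda>x. f x i) \<in> borel_measurable M"
  using measurable_compose[OF _ borel_measurable_coord] .

lemma measurable_fun_ops [measurable (raw)]:
  fixes f g :: "'a \<Rightarrow> nat \<Rightarrow> real"
  assumes [measurable]: "f \<in> borel_measurable M" "g \<in> borel_measurable M" "c \<in> borel_measurable M"
  shows "(\<lambda>x. f x + g x) \<in> borel_measurable M" "(\<lambda>x. f x - g x) \<in> borel_measurable M"
    "(\<lambda>x. c x *\<^sub>R g x) \<in> borel_measurable M" "(\<lambda>x. - g x) \<in> borel_measurable M"
    "(\<lambda>x. (f x)(j := c x)) \<in> borel_measurable M" "(\<lambda>x. trunc n (f x)) \<in> borel_measurable M"
    "(\<lambda>x. dot n (f x) (g x)) \<in> borel_measurable M" "(\<lambda>x. nrm n (f x)) \<in> borel_measurable M"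
  by (auto intro!: measurable_funI simp: trunc_def dot_def nrm_def)

lemma measurable_fun_sum [measurable (raw)]:
  fixes f :: "'b \<Rightarrow> 'a \<Rightarrow> nat \<Rightarrow> real"
  assumes [measurable]: "\<And>i. i \<in> A \<Longrightarrow> f i \<in> borel_measurable M"
  shows "(\<lambda>x. \<Sum>i\<in>A. f i x) \<in> borel_measurable M"
  by (intro measurable_funI) (auto simp: sum_fun_apply intro!: borel_measurable_sum)

lemma Rn_borel [measurable]: "Rn n \<in> sets borel"
proof -
  have "Rn n = (\<Inter>i\<in>{n..}. {x. x i = (0::real)})" by (auto simp: Rn_iff)
  also have "\<dots> \<in> sets borel" by (intro sets.countable_INT'') auto
  finally show ?thesis .
qed

lemma linear_trunc_expand:
  assumes "linear T" shows "T (trunc n x) = (\<Sum>i<n. x i *\<^sub>R T (axis_vec i))"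
proof -
  have "trunc n x = (\<Sum>i<n. trunc n x i *\<^sub>R axis_vec i)" by (rule Rn_expand) simp
  also have "\<dots> = (\<Sum>i<n. x i *\<^sub>R axis_vec i)" by (auto simp: trunc_def intro!: sum.cong)
  finally have *: "trunc n x = (\<Sum>i<n. x i *\<^sub>R axis_vec i)" .
  show ?thesis unfolding * by (simp add: linear_sum[OF assms] linear_scale[OF assms])
qed

text \<open>After truncation the map is a finite combination of fixed vectors with coordinates as
  coefficients, whatever it does on the rest of the infinite-dimensional space.\<close>

lemma measurable_linear_trunc:
  fixes T :: "(nat \<Rightarrow> real) \<Rightarrow> nat \<Rightarrow> real"
  assumes "linear T" shows "(\<lambda>x. T (trunc n x)) \<in> borel_measurable borel"
proof -
  have "(\<lambda>x. x i *\<^sub>R T (axis_vec i)) \<in> borel_measurable borel" for i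
    by (intro measurable_funI) simp
  thus ?thesis unfolding linear_trunc_expand[OF assms] by (intro measurable_fun_sum)
qed

section \<open>Lebesgue measure\<close>

lemma sets_Leb [simp, measurable_cong]: "sets (Leb n) = sets borel"
  by (simp add: Leb_def)

lemma space_Leb [simp]: "space (Leb n) = UNIV"
  by (simp add: Leb_def)

lemma measurable_trunc_PiM:
  "trunc n \<in> measurable (\<Pi>\<^sub>M i\<in>{..<n}. lborel) borel"
  proof (rule measurable_funI)
  fix i show "(\<lambda>x. trunc n x i) \<in> borel_measurable (\<Pi>\<^sub>M i\<in>{..<n}. lborel)"
    using measurable_component_singleton[of i "{..<n}" "\<lambda>_. lborel :: real measure"]
    by (cases "i < n") (simp_all add: trunc_def)
qed

lemma nn_Leb:
  assumes "f \<in> borel_measurable borel"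
  shows "(\<integral>\<^sup>+x. f x \<partial>Leb n) = (\<integral>\<^sup>+x. f (trunc n x) \<partial>(\<Pi>\<^sub>M i\<in>{..<n}. lborel))"
  unfolding Leb_def trunc_def[symmetric]
  using assms measurable_trunc_PiM by (subst nn_integral_distr) (simp_all add: trunc_def[symmetric])

lemma AE_Leb_Rn: "AE x in Leb n. x \<in> Rn n"
proof -
  have "AE x in (\<Pi>\<^sub>M i\<in>{..<n}. lborel). trunc n x \<in> Rn n" by simp
  thus ?thesis unfolding Leb_def trunc_def[symmetric]
    using measurable_trunc_PiM
    by (subst AE_distr_iff) (simp_all add: trunc_def[symmetric])
qed

lemma nn_Leb_cong:
  "(\<And>x. x \<in> Rn n \<Longrightarrow> f x = g x) \<Longrightarrow> (\<integral>\<^sup>+x. f x \<partial>Leb n) = (\<integral>\<^sup>+x. g x \<partial>Leb n)"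
  by (intro nn_integral_cong_AE) (use AE_Leb_Rn[of n] in auto)

lemma nn_Leb_0:
  assumes "f \<in> borel_measurable borel"
  shows "(\<integral>\<^sup>+x. f x \<partial>Leb 0) = f 0"
proof -
  interpret product_sigma_finite "\<lambda>i::nat. lborel :: real measure" ..
  have "trunc 0 x = 0" for x by (auto simp: trunc_def)
  thus ?thesis using nn_Leb[OF assms, of 0] by (simp add: nn_integral_empty del: nn_integral_const)
qed

lemma emeasure_Leb_nrm_le:
  assumes "0 < r"
  shows "emeasure (Leb n) {x. nrm n x \<le> r} = ennreal (unit_ball_vol (real n) * r ^ n)"
proof -
  let ?P = "\<Pi>\<^sub>M i\<in>{..<n}. lborel :: real measure"
  have "emeasure (distr ?P borel (trunc n)) {x. nrm n x \<le> r} =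
      emeasure ?P (trunc n -` {x. nrm n x \<le> r} \<inter> space ?P)"
    by (rule emeasure_distr[OF measurable_trunc_PiM]) measurable
  hence "emeasure (Leb n) {x. nrm n x \<le> r} = emeasure ?P (trunc n -` {x. nrm n x \<le> r} \<inter> space ?P)"
    by (simp only: Leb_def trunc_def[abs_def])
  also have "trunc n -` {x. nrm n x \<le> r} \<inter> space ?P = {f. sqrt (\<Sum>i\<in>{..<n}. (f i)\<^sup>2) \<le> r} \<inter> space ?P"
    using nrm_trunc[of n] by (auto simp: nrm_def dot_def power2_eq_square)
  also have "emeasure ?P \<dots> = ennreal (unit_ball_vol (real n) * r ^ n)"
    using emeasure_cball_aux[of "{..<n}" r] assms by simp
  finally show ?thesis .
qed

interpretation Leb: sigma_finite_measure "Leb n" for n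
proof
  show "\<exists>A. countable A \<and> A \<subseteq> sets (Leb n) \<and> \<Union> A = space (Leb n) \<and> (\<forall>a\<in>A. emeasure (Leb n) a \<noteq> \<infinity>)"
  proof (intro exI[of _ "range (\<lambda>N::nat. {x. nrm n x \<le> real (Suc N)})"] conjI ballI)
    show "\<Union> (range (\<lambda>N::nat. {x. nrm n x \<le> real (Suc N)})) = space (Leb n)"
    proof -
      have "\<exists>N. nrm n x \<le> 1 + real N" for x
        by (metis add.commute le_add_same_cancel2 of_nat_0_le_iff order_trans real_arch_simple zero_le_one add_increasing2)
      thus ?thesis by auto
    qed
    fix a assume "a \<in> range (\<lambda>N::nat. {x. nrm n x \<le> real (Suc N)})"
    then obtain N :: nat where "a = {x. nrm n x \<le> real (Suc N)}" by auto
    thus "emeasure (Leb n) a \<noteq> \<infinity>"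
      using emeasure_Leb_nrm_le[of "real (Suc N)" n] by simp
  qed auto
qed

lemma pair_sigma_finite_Leb: "pair_sigma_finite (Leb m) (Leb n)"
  by (simp add: pair_sigma_finite_def Leb.sigma_finite_measure_axioms)

text \<open>Splitting off the last coordinate. Translations, dilations, Gaussian weights and
  marginals are all treated by induction on the dimension through this step.\<close>

lemma nn_Leb_Suc:
  assumes [measurable]: "f \<in> borel_measurable borel"
  shows "(\<integral>\<^sup>+x. f x \<partial>Leb (Suc n)) = (\<integral>\<^sup>+y. (\<integral>\<^sup>+t. f (y(n := t)) \<partial>lborel) \<partial>Leb n)"
proof -
  interpret product_sigma_finite "\<lambda>i::nat. lborel :: real measure" ..
  have m: "(\<lambda>x. f (trunc (Suc n) x)) \<in> borel_measurable (Pi\<^sub>M (insert n {..<n}) (\<lambda>i. lborel))"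
    using measurable_compose[OF measurable_trunc_PiM[of "Suc n"] assms] by (simp add: lessThan_Suc)
  have "(\<integral>\<^sup>+x. f x \<partial>Leb (Suc n)) = (\<integral>\<^sup>+x. f (trunc (Suc n) x) \<partial>(Pi\<^sub>M (insert n {..<n}) (\<lambda>i. lborel)))"
    by (simp add: nn_Leb lessThan_Suc)
  also have "\<dots> = (\<integral>\<^sup>+x. (\<integral>\<^sup>+t. f (trunc (Suc n) (x(n := t))) \<partial>lborel) \<partial>(Pi\<^sub>M {..<n} (\<lambda>i. lborel)))"
    by (rule product_nn_integral_insert) (use m in auto)
  also have "(\<integral>\<^sup>+x. (\<integral>\<^sup>+t. f (trunc (Suc n) (x(n := t))) \<partial>lborel) \<partial>(Pi\<^sub>M {..<n} (\<lambda>i. lborel))) =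
      (\<integral>\<^sup>+x. (\<integral>\<^sup>+t. f ((trunc n x)(n := t)) \<partial>lborel) \<partial>(Pi\<^sub>M {..<n} (\<lambda>i. lborel)))"
    by (intro nn_integral_cong arg_cong[where f = f]) (auto simp: trunc_def)
  also have "\<dots> = (\<integral>\<^sup>+y. (\<integral>\<^sup>+t. f (y(n := t)) \<partial>lborel) \<partial>Leb n)"
    by (rule nn_Leb[symmetric]) measurable
  finally show ?thesis .
qed

lemma nn_Leb_translate:
  assumes "f \<in> borel_measurable borel" "a \<in> Rn n"
  shows "(\<integral>\<^sup>+x. f (x + a) \<partial>Leb n) = (\<integral>\<^sup>+x. f x \<partial>Leb n)"
  using assms
proof (induction n arbitrary: f a)
  case 0
  note [measurable] = 0(1)
  have "a = 0" using 0 by (auto simp: Rn_iff)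
  thus ?case by simp
next
  case (Suc n)
  note [measurable] = Suc.prems(1)
  define G where "G y = (\<integral>\<^sup>+t. f (y(n := t)) \<partial>lborel)" for y
  have [measurable]: "G \<in> borel_measurable borel" unfolding G_def by measurable
  have "(\<integral>\<^sup>+x. f (x + a) \<partial>Leb (Suc n)) = (\<integral>\<^sup>+y. (\<integral>\<^sup>+t. f (y(n := t) + a) \<partial>lborel) \<partial>Leb n)"
    by (rule nn_Leb_Suc) measurable
  also have "\<dots> = (\<integral>\<^sup>+y. G (y + trunc n a) \<partial>Leb n)"
  proof (rule nn_Leb_cong)
    fix y assume y: "y \<in> Rn n"
    have e: "y(n := t) + a = (y + trunc n a)(n := a n + 1 * t)" for t
      using y Suc.prems(2) by (auto simp: fun_eq_iff trunc_def Rn_iff)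
    show "(\<integral>\<^sup>+t. f (y(n := t) + a) \<partial>lborel) = G (y + trunc n a)"
      unfolding G_def e
      by (subst nn_integral_real_affine[of "\<lambda>t. f ((y + trunc n a)(n := t))" 1 "a n"]) auto
  qed
  also have "\<dots> = (\<integral>\<^sup>+y. G y \<partial>Leb n)" by (rule Suc.IH) auto
  also have "\<dots> = (\<integral>\<^sup>+x. f x \<partial>Leb (Suc n))" unfolding G_def by (rule nn_Leb_Suc[symmetric]) measurable
  finally show ?case .
qed

lemma nn_Leb_scale:
  assumes "f \<in> borel_measurable borel" "c \<noteq> 0"
  shows "(\<integral>\<^sup>+x. f x \<partial>Leb n) = ennreal (\<bar>c\<bar> ^ n) * (\<integral>\<^sup>+x. f (c *\<^sub>R x) \<partial>Leb n)"
  using assms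
proof (induction n arbitrary: f)
  case 0
  note [measurable] = 0(1)
  have "(\<integral>\<^sup>+x. f (c *\<^sub>R x) \<partial>Leb 0) = f (c *\<^sub>R 0)" by (rule nn_Leb_0) measurable
  moreover have "(\<integral>\<^sup>+x. f x \<partial>Leb 0) = f (c *\<^sub>R 0)" by (simp add: nn_Leb_0)
  ultimately show ?case by (simp only: power_0 ennreal_1 mult_1)
next
  case (Suc n)
  note [measurable] = Suc.prems(1)
  define G where "G y = (\<integral>\<^sup>+t. f (y(n := t)) \<partial>lborel)" for y
  have [measurable]: "G \<in> borel_measurable borel" unfolding G_def by measurable
  have "(\<integral>\<^sup>+x. f x \<partial>Leb (Suc n)) = (\<integral>\<^sup>+y. G y \<partial>Leb n)" unfolding G_def by (rule nn_Leb_Suc) measurable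
  also have "\<dots> = ennreal (\<bar>c\<bar> ^ n) * (\<integral>\<^sup>+y. G (c *\<^sub>R y) \<partial>Leb n)" using Suc.prems by (intro Suc.IH) auto
  also have "(\<integral>\<^sup>+y. G (c *\<^sub>R y) \<partial>Leb n) = (\<integral>\<^sup>+y. ennreal \<bar>c\<bar> * (\<integral>\<^sup>+t. f (c *\<^sub>R (y(n := t))) \<partial>lborel) \<partial>Leb n)"
  proof (rule nn_integral_cong)
    fix y :: "nat \<Rightarrow> real"
    have "c *\<^sub>R (y(n := t)) = (c *\<^sub>R y)(n := 0 + c * t)" for t by (auto simp: fun_eq_iff)
    thus "G (c *\<^sub>R y) = ennreal \<bar>c\<bar> * (\<integral>\<^sup>+t. f (c *\<^sub>R (y(n := t))) \<partial>lborel)"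
      unfolding G_def using Suc.prems
      by (subst nn_integral_real_affine[of "\<lambda>t. f ((c *\<^sub>R y)(n := t))" c 0]) auto
  qed
  also have "\<dots> = ennreal \<bar>c\<bar> * (\<integral>\<^sup>+y. (\<integral>\<^sup>+t. f (c *\<^sub>R (y(n := t))) \<partial>lborel) \<partial>Leb n)"
    by (rule nn_integral_cmult) measurable
  also have "(\<integral>\<^sup>+y. (\<integral>\<^sup>+t. f (c *\<^sub>R (y(n := t))) \<partial>lborel) \<partial>Leb n) = (\<integral>\<^sup>+x. f (c *\<^sub>R x) \<partial>Leb (Suc n))"
    by (rule nn_Leb_Suc[symmetric]) measurable
  also have "ennreal (\<bar>c\<bar> ^ n) * (ennreal \<bar>c\<bar> * (\<integral>\<^sup>+x. f (c *\<^sub>R x) \<partial>Leb (Suc n))) =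
      ennreal (\<bar>c\<bar> ^ Suc n) * (\<integral>\<^sup>+x. f (c *\<^sub>R x) \<partial>Leb (Suc n))"
    by (simp add: mult.assoc[symmetric] ennreal_mult[symmetric] mult.commute)
  finally show ?case .
qed

text \<open>
  Integrating \<open>f (T x + y) * indicator B y\<close> over both variables, with \<open>B\<close> the unit ball, and
  translating once in \<open>x\<close> and once in \<open>y\<close> shows that \<open>T\<close> changes the integral of \<open>f\<close> by the same
  factor as that of the indicator of \<open>B\<close>.
\<close>
lemma nn_Leb_linear:
  assumes [measurable]: "f \<in> borel_measurable borel" and lin: "linear T" and onto: "T ` Rn n = Rn n"
  shows "(\<integral>\<^sup>+x. f (T x) \<partial>Leb n) * ennreal (unit_ball_vol (real n)) =
    (\<integral>\<^sup>+x. f x \<partial>Leb n) * emeasure (Leb n) {x. nrm n (T (trunc n x)) \<le> 1}"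
proof -
  interpret pair_sigma_finite "Leb n" "Leb n" by (rule pair_sigma_finite_Leb)
  define g :: "(nat \<Rightarrow> real) \<Rightarrow> ennreal" where "g = indicator {x. nrm n x \<le> 1}"
  define S where "S x = T (trunc n x)" for x
  have [measurable]: "S \<in> borel_measurable borel" unfolding S_def by (rule measurable_linear_trunc[OF lin])
  have [measurable]: "g \<in> borel_measurable borel" unfolding g_def by measurable
  have S_Rn: "S x \<in> Rn n" for x using onto by (auto simp: S_def)
  have S_eq: "S x = T x" if "x \<in> Rn n" for x using that by (simp add: S_def trunc_id)
  define v where "v = (\<integral>\<^sup>+x. g x \<partial>Leb n)"
  have v: "v = ennreal (unit_ball_vol (real n))"
    unfolding v_def g_def using emeasure_Leb_nrm_le[of 1 n] by simp
  define w where "w = emeasure (Leb n) {x. nrm n (S x) \<le> 1}"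
  have "(\<integral>\<^sup>+x. f (S x) \<partial>Leb n) * v = (\<integral>\<^sup>+y. (\<integral>\<^sup>+x. f (S x) * g y \<partial>Leb n) \<partial>Leb n)"
    unfolding v_def by (simp add: nn_integral_cmult nn_integral_multc)
  also have "\<dots> = (\<integral>\<^sup>+y. (\<integral>\<^sup>+x. f (S x + y) * g y \<partial>Leb n) \<partial>Leb n)"
  proof (rule nn_Leb_cong)
    fix y assume "y \<in> Rn n"
    then obtain b where b: "b \<in> Rn n" "y = T b" using onto by blast
    have "(\<integral>\<^sup>+x. f (S x + y) * g y \<partial>Leb n) = (\<integral>\<^sup>+x. f (S (x + b)) * g y \<partial>Leb n)"
      by (rule nn_Leb_cong) (use b in \<open>auto simp: S_eq linear_add[OF lin]\<close>)
    also have "\<dots> = (\<integral>\<^sup>+x. f (S x) * g y \<partial>Leb n)"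
      by (rule nn_Leb_translate) (use b in auto)
    finally show "(\<integral>\<^sup>+x. f (S x) * g y \<partial>Leb n) = (\<integral>\<^sup>+x. f (S x + y) * g y \<partial>Leb n)" ..
  qed
  also have "\<dots> = (\<integral>\<^sup>+x. (\<integral>\<^sup>+y. f (S x + y) * g y \<partial>Leb n) \<partial>Leb n)"
    by (rule Fubini') measurable
  also have "\<dots> = (\<integral>\<^sup>+x. (\<integral>\<^sup>+y. f y * g (y - S x) \<partial>Leb n) \<partial>Leb n)"
  proof (rule nn_Leb_cong)
    fix x :: "nat \<Rightarrow> real"
    have "(\<integral>\<^sup>+y. f (y + S x) * g ((y + S x) - S x) \<partial>Leb n) = (\<integral>\<^sup>+y. f y * g (y - S x) \<partial>Leb n)"
      by (rule nn_Leb_translate) (use S_Rn in auto)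
    thus "(\<integral>\<^sup>+y. f (S x + y) * g y \<partial>Leb n) = (\<integral>\<^sup>+y. f y * g (y - S x) \<partial>Leb n)"
      by (simp add: add.commute)
  qed
  also have "\<dots> = (\<integral>\<^sup>+y. (\<integral>\<^sup>+x. f y * g (y - S x) \<partial>Leb n) \<partial>Leb n)"
    by (rule Fubini') measurable
  \<comment> \<open>For \<open>y = T b\<close> a translation by \<open>b\<close> makes the inner
    integral independent of \<open>y\<close>. The factor \<open>w\<close> stays implicit, as the
    volume of the preimage of the ball.\<close>
  also have "\<dots> = (\<integral>\<^sup>+y. f y * w \<partial>Leb n)"
  proof (rule nn_Leb_cong)
    fix y assume "y \<in> Rn n"
    then obtain b where b: "b \<in> Rn n" "y = T b" using onto by blast
    have "(\<integral>\<^sup>+x. g (y - S x) \<partial>Leb n) = (\<integral>\<^sup>+x. indicator {x. nrm n (S x) \<le> 1} (x + - b) \<partial>Leb n)"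
    proof (rule nn_Leb_cong)
      fix x assume x: "x \<in> Rn n"
      have "y - S x = - S (x + - b)" using x b by (simp add: S_eq linear_diff[OF lin])
      hence "nrm n (y - S x) = nrm n (S (x + - b))" by (simp only: nrm_minus)
      thus "g (y - S x) = indicator {x. nrm n (S x) \<le> 1} (x + - b)" by (simp add: g_def indicator_def)
    qed
    also have "\<dots> = (\<integral>\<^sup>+x. indicator {x. nrm n (S x) \<le> 1} x \<partial>Leb n)"
      by (rule nn_Leb_translate) (measurable, rule Rn_closed_ops, rule b)
    also have "\<dots> = w" unfolding w_def by simp
    finally have "(\<integral>\<^sup>+x. g (y - S x) \<partial>Leb n) = w" .
    thus "(\<integral>\<^sup>+x. f y * g (y - S x) \<partial>Leb n) = f y * w" by (simp add: nn_integral_cmult)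
  qed
  also have "\<dots> = (\<integral>\<^sup>+y. f y \<partial>Leb n) * w" by (simp add: nn_integral_multc)
  finally have "(\<integral>\<^sup>+x. f (S x) \<partial>Leb n) * v = (\<integral>\<^sup>+y. f y \<partial>Leb n) * w" .
  moreover have "(\<integral>\<^sup>+x. f (S x) \<partial>Leb n) = (\<integral>\<^sup>+x. f (T x) \<partial>Leb n)"
    by (rule nn_Leb_cong) (simp only: S_eq)
  ultimately show ?thesis by (simp only: v w_def S_def)
qed

text \<open>An isometry maps the unit ball onto itself, so the unknown factor of
  \<open>nn_Leb_linear\<close> is the volume of the ball and cancels.\<close>

lemma nn_Leb_isometry:
  assumes f: "f \<in> borel_measurable borel" and T: "iso_onto n n (Rn n) T"
  shows "(\<integral>\<^sup>+x. f (T x) \<partial>Leb n) = (\<integral>\<^sup>+x. f x \<partial>Leb n)"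
proof -
  have "nrm n (T (trunc n x)) = nrm n x" for x using iso_onto_nrm[OF T, of "trunc n x"] by simp
  moreover have "linear T" "T ` Rn n = Rn n" using T by (auto simp: iso_onto_def)
  ultimately have "(\<integral>\<^sup>+x. f (T x) \<partial>Leb n) * ennreal (unit_ball_vol (real n)) =
      (\<integral>\<^sup>+x. f x \<partial>Leb n) * ennreal (unit_ball_vol (real n))"
    using nn_Leb_linear[OF f, of T n] emeasure_Leb_nrm_le[of 1 n] by simp
  thus ?thesis
    using unit_ball_vol_pos[of "real n", THEN less_imp_neq]
    by (auto simp: ennreal_mult_cancel_left mult.commute)
qed

section \<open>Haar measures on spheres\<close>

subsection \<open>Reflections\<close>

text \<open>The reflection in the hyperplane orthogonal to \<open>w\<close>. If
  \<open>dot n w w = 0\<close>, division by zero makes it the identity.\<close>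

definition householder :: "nat \<Rightarrow> (nat \<Rightarrow> real) \<Rightarrow> (nat \<Rightarrow> real) \<Rightarrow> nat \<Rightarrow> real" where
  "householder n w z = z - (2 * dot n z w / dot n w w) *\<^sub>R w"

lemma linear_householder: "linear (householder n w)"
  by (rule linearI)
     (auto simp: householder_def fun_eq_iff algebra_simps add_divide_distrib)

lemma dot_householder: "dot n (householder n w z) (householder n w z) = dot n z z"
  by (cases "dot n w w = 0")
     (simp_all add: householder_def dot_commute[of n w z] field_simps power2_eq_square)

lemma householder_involution: "householder n w (householder n w z) = z"
proof (cases "dot n w w = 0")
  case True thus ?thesis by (simp add: householder_def)
next
  case False
  hence "dot n (householder n w z) w = - dot n z w" by (simp add: householder_def)
  thus ?thesis by (simp add: householder_def[of n w "householder n w z"])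
    (simp add: householder_def fun_eq_iff)
qed

lemma householder_image:
  assumes "subspace E" "w \<in> E" shows "householder n w ` E = E"
proof -
  have *: "householder n w z \<in> E" if "z \<in> E" for z
    unfolding householder_def by (intro subspace_diff subspace_scale assms that)
  show ?thesis
  proof
    show "E \<subseteq> householder n w ` E"
      by (metis * householder_involution image_eqI subsetI)
  qed (use * in auto)
qed

text \<open>Two unit vectors are exchanged by the reflection in the hyperplane that bisects them. As
  \<open>x - y\<close> lies in every subspace that contains both, this yields transitivity on the
  sphere of any subspace.\<close>

lemma householder_swap:
  assumes "x \<in> unit_sphere n" "y \<in> unit_sphere n"
  shows "householder n (x - y) x = y"
proof (cases "x = y")
  case True thus ?thesis by (simp add: householder_def)
next
  case False
  have xy: "dot n x x = 1" "dot n y y = 1" "x \<in> Rn n" "y \<in> Rn n"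
    using assms by (auto simp: unit_sphere_iff nrm_sq[symmetric])
  have "dot n (x - y) (x - y) \<noteq> 0"
    using nrm_pos[OF Rn_closed_ops(2)[OF xy(3,4)]] False by (auto simp: nrm_def simp del: dot_simps)
  hence "2 * dot n x (x - y) / dot n (x - y) (x - y) = 1"
    using xy dot_commute[of n y x] by (simp add: field_simps)
  thus ?thesis by (simp only: householder_def) simp
qed

lemma householder_iso:
  assumes "subspace E" "E \<subseteq> Rn n" "w \<in> E"
  shows "linear (householder n w) \<and> householder n w ` E = E \<and>
    (\<forall>x\<in>E. dot n (householder n w x) (householder n w x) = dot n x x)"
  using linear_householder dot_householder householder_image[OF assms(1,3)] by blast

subsection \<open>Uniqueness\<close>

lemma sphere_haar_facts:
  assumes "is_sphere_haar n E \<mu>"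
  shows "prob_space \<mu>" "sets \<mu> = sets (restrict_space borel (unit_sphere n \<inter> E))"
    "space \<mu> = unit_sphere n \<inter> E"
proof -
  show *: "prob_space \<mu>" "sets \<mu> = sets (restrict_space borel (unit_sphere n \<inter> E))"
    using assms by (auto simp: is_sphere_haar_def)
  show "space \<mu> = unit_sphere n \<inter> E"
    using sets_eq_imp_space_eq[OF *(2)] by (simp add: space_restrict_space)
qed

lemma Int_in_restrict_space: "B \<in> sets M \<Longrightarrow> S \<inter> B \<in> sets (restrict_space M S)"
  unfolding sets_restrict_space by (rule imageI)

lemma measurable_sphere:
  assumes "sets \<mu> = sets (restrict_space borel (unit_sphere n \<inter> E))" "f \<in> measurable borel N"
  shows "f \<in> measurable \<mu> N"
  using measurable_restrict_space1[OF assms(2)] measurable_cong_sets[OF assms(1) refl] by blast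

lemma nn_sphere_invariant:
  assumes \<mu>: "is_sphere_haar n E \<mu>" and f: "f \<in> borel_measurable borel"
    and E: "E \<subseteq> Rn n"
    and T: "linear T" "T ` E = E" "\<forall>x\<in>E. dot n (T x) (T x) = dot n x x"
  shows "(\<integral>\<^sup>+x. f (T x) \<partial>\<mu>) = (\<integral>\<^sup>+x. f x \<partial>\<mu>)"
proof -
  note F = sphere_haar_facts[OF \<mu>]
  have "T \<in> measurable \<mu> (restrict_space borel (unit_sphere n \<inter> E))"
  proof (rule measurable_restrict_space2)
    show "T \<in> space \<mu> \<rightarrow> unit_sphere n \<inter> E"
    proof
      fix x assume x: "x \<in> space \<mu>"
      hence "x \<in> E" "nrm n x = 1" by (auto simp: F(3) unit_sphere_iff)
      moreover have "T x \<in> E" using \<open>x \<in> E\<close> T(2) by blast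
      ultimately show "T x \<in> unit_sphere n \<inter> E" using T(3) E by (auto simp: unit_sphere_iff nrm_def)
    qed
    \<comment> \<open>Measurability is known only for the truncated map, which agrees with
      \<open>T\<close> on the sphere because \<open>E\<close> lies in \<open>Rn n\<close>.\<close>
    have "(\<lambda>x. T (trunc n x)) \<in> measurable \<mu> borel"
      by (rule measurable_sphere[OF F(2) measurable_linear_trunc[OF T(1)]])
    also have "?this \<longleftrightarrow> T \<in> measurable \<mu> borel"
      by (rule measurable_cong) (use E in \<open>auto simp: F(3) trunc_id\<close>)
    finally show "T \<in> measurable \<mu> borel" .
  qed
  hence m: "T \<in> measurable \<mu> \<mu>" using measurable_cong_sets[OF refl F(2)] by blast
  have "(\<integral>\<^sup>+x. f x \<partial>\<mu>) = (\<integral>\<^sup>+x. f x \<partial>distr \<mu> \<mu> T)"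
    using \<mu> T by (simp add: is_sphere_haar_def)
  also have "\<dots> = (\<integral>\<^sup>+x. f (T x) \<partial>\<mu>)"
    using measurable_sphere[OF F(2) f] by (intro nn_integral_distr[OF m]) simp
  finally show ?thesis ..
qed

text \<open>Caps of radius \<open>e\<close>, written as a kernel in centre and point so that its
  symmetry can be combined with Fubini.\<close>

definition cap_kernel :: "nat \<Rightarrow> real \<Rightarrow> (nat \<Rightarrow> real) \<Rightarrow> (nat \<Rightarrow> real) \<Rightarrow> ennreal" where
  "cap_kernel n e x y = indicator {z. nrm n z < e} (x - y)"

lemma cap_kernel_measurable [measurable (raw)]:
  assumes [measurable]: "f \<in> borel_measurable M" "g \<in> borel_measurable M"
  shows "(\<lambda>x. cap_kernel n e (f x) (g x)) \<in> borel_measurable M"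
proof -
  have "(\<lambda>x. f x - g x) \<in> borel_measurable M" by measurable
  moreover have "indicator {z. nrm n z < e} \<in> borel_measurable borel" by measurable
  ultimately show ?thesis unfolding cap_kernel_def by (rule measurable_compose)
qed

lemma cap_kernel_commute: "cap_kernel n e x y = cap_kernel n e y x"
  by (simp add: cap_kernel_def indicator_def nrm_diff_commute)

text \<open>The reflection that exchanges the two centres carries one cap onto the other.\<close>

lemma cap_measure_const:
  assumes \<mu>: "is_sphere_haar n E \<mu>" and E: "subspace E" "E \<subseteq> Rn n"
    and x: "x \<in> unit_sphere n \<inter> E" "x' \<in> unit_sphere n \<inter> E"
  shows "(\<integral>\<^sup>+y. cap_kernel n e x y \<partial>\<mu>) = (\<integral>\<^sup>+y. cap_kernel n e x' y \<partial>\<mu>)"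
proof -
  let ?T = "householder n (x - x')"
  note F = sphere_haar_facts[OF \<mu>]
  have w: "x - x' \<in> E" using x E by (auto intro: subspace_diff)
  note T = householder_iso[OF E w]
  have Tx: "?T x = x'" using x by (intro householder_swap) auto
  have "(\<integral>\<^sup>+y. cap_kernel n e x' y \<partial>\<mu>) = (\<integral>\<^sup>+y. cap_kernel n e x' (?T y) \<partial>\<mu>)"
    by (rule nn_sphere_invariant[symmetric, OF \<mu> _ E(2)]) (use T in auto)
  also have "\<dots> = (\<integral>\<^sup>+y. cap_kernel n e x y \<partial>\<mu>)"
  proof (rule nn_integral_cong)
    fix y assume "y \<in> space \<mu>"
    have "nrm n (x' - ?T y) = nrm n (?T (x - y))"
      by (simp add: linear_diff[OF linear_householder] Tx)
    also have "\<dots> = nrm n (x - y)" by (simp only: nrm_def dot_householder)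
    finally show "cap_kernel n e x' (?T y) = cap_kernel n e x y"
      by (simp add: cap_kernel_def indicator_def)
  qed
  finally show ?thesis ..
qed

lemma continuous_nrm_diff: "continuous_on UNIV (\<lambda>y::nat \<Rightarrow> real. nrm n (x - y))"
  unfolding nrm_def dot_def minus_apply
  by (intro continuous_intros continuous_on_product_then_coordinatewise continuous_on_id)

text \<open>Otherwise the sphere would be a countable union of null sets, cut out by balls about a
  countable dense set. Their centres may lie off the sphere; the radius \<open>e / 2\<close> lets
  each of them be enclosed in a cap centred at one of its own points.\<close>

lemma cap_measure_pos:
  assumes \<mu>: "is_sphere_haar n E \<mu>" and e: "0 < e"
  shows "\<exists>x\<in>unit_sphere n \<inter> E. 0 < (\<integral>\<^sup>+y. cap_kernel n e x y \<partial>\<mu>)"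
proof (rule ccontr)
  assume neg: "\<not> ?thesis"
  note F = sphere_haar_facts[OF \<mu>]
  interpret prob_space \<mu> by (rule F(1))
  obtain D :: "(nat \<Rightarrow> real) set" where D: "countable D"
    "\<And>X. open X \<Longrightarrow> X \<noteq> {} \<Longrightarrow> \<exists>d\<in>D. d \<in> X"
    using countable_dense_setE by blast
  define U where "U d = {y \<in> space \<mu>. nrm n (d - y) < e / 2}" for d
  have [measurable]: "U d \<in> sets \<mu>" for d
  proof -
    have "{y. nrm n (d - y) < e / 2} \<in> sets borel" by measurable
    hence "(unit_sphere n \<inter> E) \<inter> {y. nrm n (d - y) < e / 2} \<in> sets \<mu>"
      unfolding F(2) by (rule Int_in_restrict_space)
    also have "(unit_sphere n \<inter> E) \<inter> {y. nrm n (d - y) < e / 2} = U d" unfolding U_def F(3) by blast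
    finally show ?thesis .
  qed
  have "emeasure \<mu> (U d) = 0" for d
  proof (cases "U d = {}")
    case False
    then obtain x where x: "x \<in> U d" by auto
    have "emeasure \<mu> (U d) = (\<integral>\<^sup>+y. indicator (U d) y \<partial>\<mu>)" by simp
    also have "\<dots> \<le> (\<integral>\<^sup>+y. cap_kernel n e x y \<partial>\<mu>)"
    proof (intro nn_integral_mono)
      fix y
      show "indicator (U d) y \<le> cap_kernel n e x y"
      proof (cases "y \<in> U d")
        case True
        have "nrm n (x - y) \<le> nrm n (x - d) + nrm n (d - y)"
          using nrm_triangle[of n "x - d" "d - y"] by simp
        also have "\<dots> < e" using True x by (simp add: U_def nrm_diff_commute[of n x d])
        finally show ?thesis by (simp add: cap_kernel_def indicator_def)
      qed simp
    qed
    also have "\<dots> = 0" using neg x by (auto simp: U_def F(3) not_less)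
    finally show ?thesis by simp
  qed simp
  hence "emeasure \<mu> (\<Union>d\<in>D. U d) = 0"
    using D(1) \<open>\<And>d. U d \<in> sets \<mu>\<close> by (intro null_setsD1 null_sets_UN') auto
  moreover have "(\<Union>d\<in>D. U d) = space \<mu>"
  proof safe
    fix y assume y: "y \<in> space \<mu>"
    have "open {z. nrm n (y - z) < e / 2}"
      by (rule open_Collect_less[OF continuous_nrm_diff continuous_on_const])
    moreover have "y \<in> {z. nrm n (y - z) < e / 2}" using e by simp
    ultimately obtain d where "d \<in> D" "nrm n (y - d) < e / 2" using D(2) by blast
    thus "y \<in> (\<Union>d\<in>D. U d)" using y by (auto simp: U_def nrm_diff_commute)
  qed (auto simp: U_def)
  ultimately show False using emeasure_space_1 by simp
qed

text \<open>
  Both measures give all caps of a given radius the same mass \<open>c\<close>, independent of the centre and,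
  by Fubini, of the measure. Hence \<open>c\<close> times either integral of \<open>f\<close> is close to the
  double integral of \<open>f\<close> against the cap kernel.
\<close>
lemma sphere_haar_lipschitz_le:
  assumes \<mu>: "is_sphere_haar n E \<mu>" and \<nu>: "is_sphere_haar n E \<nu>"
    and E: "subspace E" "E \<subseteq> Rn n"
    and f[measurable]: "f \<in> borel_measurable borel" and "0 \<le> L"
    and lip: "\<And>x y. f x \<le> f y + ennreal (L * nrm n (x - y))"
  shows "(\<integral>\<^sup>+x. f x \<partial>\<mu>) \<le> (\<integral>\<^sup>+x. f x \<partial>\<nu>)"
proof (rule ennreal_le_epsilon)
  fix \<epsilon> :: real assume \<epsilon>: "0 < \<epsilon>"
  \<comment> \<open>A cap radius on which a function with Lipschitz constant \<open>L\<close> varies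
    by at most \<open>\<epsilon>\<close>; the summand 1 covers \<open>L = 0\<close>.\<close>
  define e where "e = \<epsilon> / (L + 1)"
  have e: "0 < e" "L * e \<le> \<epsilon>" using \<epsilon> \<open>0 \<le> L\<close> by (auto simp: e_def field_simps)
  note F = sphere_haar_facts[OF \<mu>] and G = sphere_haar_facts[OF \<nu>]
  interpret M: prob_space \<mu> by (rule F(1))
  interpret N: prob_space \<nu> by (rule G(1))
  interpret pair_sigma_finite \<nu> \<mu> ..
  let ?k = "cap_kernel n e"
  have id: "(\<lambda>x. x) \<in> borel_measurable \<mu>" "(\<lambda>x. x) \<in> borel_measurable \<nu>"
    by (intro measurable_sphere[OF F(2)] measurable_sphere[OF G(2)] measurable_ident_sets refl)+
  have [measurable]: "fst \<in> borel_measurable (\<nu> \<Otimes>\<^sub>M \<mu>)" "snd \<in> borel_measurable (\<nu> \<Otimes>\<^sub>M \<mu>)"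
    by (rule measurable_compose[OF measurable_fst id(2)] measurable_compose[OF measurable_snd id(1)])+
  have ka: "(\<lambda>x. ?k a x) \<in> borel_measurable borel" for a by measurable
  note [measurable] = measurable_sphere[OF F(2) ka] measurable_sphere[OF G(2) ka]
    measurable_sphere[OF F(2) f] measurable_sphere[OF G(2) f]
  obtain x0 where x0: "x0 \<in> unit_sphere n \<inter> E" "0 < (\<integral>\<^sup>+y. ?k x0 y \<partial>\<mu>)"
    using cap_measure_pos[OF \<mu> e(1)] by blast
  define c where "c = (\<integral>\<^sup>+y. ?k x0 y \<partial>\<mu>)"
  have c\<mu>: "(\<integral>\<^sup>+y. ?k x y \<partial>\<mu>) = c" if "x \<in> unit_sphere n \<inter> E" for x
    unfolding c_def by (rule cap_measure_const[OF \<mu> E that x0(1)])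
  define d where "d = (\<integral>\<^sup>+y. ?k x0 y \<partial>\<nu>)"
  have c\<nu>': "(\<integral>\<^sup>+y. ?k x y \<partial>\<nu>) = d" if "x \<in> unit_sphere n \<inter> E" for x
    unfolding d_def by (rule cap_measure_const[OF \<nu> E that x0(1)])
  have "c = (\<integral>\<^sup>+x. c \<partial>\<nu>)" by (simp add: N.emeasure_space_1)
  also have "\<dots> = (\<integral>\<^sup>+x. (\<integral>\<^sup>+y. ?k x y \<partial>\<mu>) \<partial>\<nu>)"
    by (rule nn_integral_cong) (simp add: c\<mu> G(3))
  also have "\<dots> = (\<integral>\<^sup>+y. (\<integral>\<^sup>+x. ?k x y \<partial>\<nu>) \<partial>\<mu>)"
    by (rule Fubini'[symmetric]) measurable
  also have "\<dots> = (\<integral>\<^sup>+y. d \<partial>\<mu>)"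
  proof (rule nn_integral_cong)
    fix y assume "y \<in> space \<mu>"
    thus "(\<integral>\<^sup>+x. ?k x y \<partial>\<nu>) = d"
      using c\<nu>'[of y] by (simp only: cap_kernel_commute[of n e _ y] F(3))
  qed
  also have "\<dots> = d" by (simp add: M.emeasure_space_1)
  finally have c\<nu>: "(\<integral>\<^sup>+y. ?k x y \<partial>\<nu>) = c" if "x \<in> unit_sphere n \<inter> E" for x
    using c\<nu>' that by simp
  have "c \<le> (\<integral>\<^sup>+y. 1 \<partial>\<mu>)" unfolding c_def
    by (intro nn_integral_mono) (simp add: cap_kernel_def indicator_def)
  hence c1: "c \<le> 1" by (simp add: M.emeasure_space_1)
  have "(\<integral>\<^sup>+x. f x \<partial>\<mu>) * c = (\<integral>\<^sup>+x. f x * c \<partial>\<mu>)" by (simp add: nn_integral_multc)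
  also have "\<dots> = (\<integral>\<^sup>+x. (\<integral>\<^sup>+y. f x * ?k x y \<partial>\<nu>) \<partial>\<mu>)"
    by (rule nn_integral_cong) (simp add: nn_integral_cmult c\<nu> F(3))
  also have "\<dots> \<le> (\<integral>\<^sup>+x. (\<integral>\<^sup>+y. (f y + ennreal \<epsilon>) * ?k x y \<partial>\<nu>) \<partial>\<mu>)"
  proof (intro nn_integral_mono)
    fix x y
    show "f x * ?k x y \<le> (f y + ennreal \<epsilon>) * ?k x y"
    proof (cases "nrm n (x - y) < e")
      case True
      have "f x \<le> f y + ennreal (L * nrm n (x - y))" by (rule lip)
      also have "L * nrm n (x - y) \<le> L * e" using True \<open>0 \<le> L\<close> by (intro mult_left_mono) auto
      also note e(2)
      finally have "f x \<le> f y + ennreal \<epsilon>" by (simp add: ennreal_leI)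
      thus ?thesis by (rule mult_right_mono) simp
    qed (simp add: cap_kernel_def)
  qed
  also have "\<dots> = (\<integral>\<^sup>+y. (\<integral>\<^sup>+x. (f y + ennreal \<epsilon>) * ?k x y \<partial>\<mu>) \<partial>\<nu>)"
    by (rule Fubini') measurable
  also have "\<dots> = (\<integral>\<^sup>+y. (f y + ennreal \<epsilon>) * c \<partial>\<nu>)"
  proof (rule nn_integral_cong)
    fix y assume "y \<in> space \<nu>"
    hence "(\<integral>\<^sup>+x. ?k x y \<partial>\<mu>) = c"
      using c\<mu>[of y] by (simp only: cap_kernel_commute[of n e _ y] G(3))
    moreover have "(\<lambda>x. ?k x y) \<in> borel_measurable \<mu>"
      by (rule measurable_sphere[OF F(2)]) measurable
    ultimately show "(\<integral>\<^sup>+x. (f y + ennreal \<epsilon>) * ?k x y \<partial>\<mu>) = (f y + ennreal \<epsilon>) * c"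
      by (simp only: nn_integral_cmult)
  qed
  also have "\<dots> = ((\<integral>\<^sup>+y. f y \<partial>\<nu>) + ennreal \<epsilon>) * c"
    by (simp add: nn_integral_multc nn_integral_add N.emeasure_space_1)
  finally have "(\<integral>\<^sup>+x. f x \<partial>\<mu>) * c \<le> ((\<integral>\<^sup>+y. f y \<partial>\<nu>) + ennreal \<epsilon>) * c" .
  moreover have "c \<noteq> 0" "c \<noteq> top" using x0 c1 by (auto simp: c_def top_unique)
  ultimately show "(\<integral>\<^sup>+x. f x \<partial>\<mu>) \<le> (\<integral>\<^sup>+x. f x \<partial>\<nu>) + ennreal \<epsilon>"
    by (simp add: ennreal_mult_le_mult_iff mult.commute[of _ c])
qed

text \<open>Orthants in the first \<open>n\<close> coordinates generate because the other
  coordinates vanish on \<open>S\<close>. They are stable under intersection, as the uniqueness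
  theorem for measures requires.\<close>

lemma sphere_generator:
  assumes S: "S \<subseteq> Rn n"
  shows "sets (restrict_space borel S) = sigma_sets S (range (\<lambda>a. {x\<in>S. \<forall>i<n. x i \<le> a i}))"
    (is "_ = sigma_sets S ?G")
proof
  have G: "?G \<subseteq> Pow S" by auto
  show "sigma_sets S ?G \<subseteq> sets (restrict_space borel S)"
  proof -
    have "?G \<subseteq> sets (restrict_space borel S)"
    proof safe
      fix a :: "nat \<Rightarrow> real"
      have "{x. \<forall>i<n. x i \<le> a i} \<in> sets (borel :: (nat \<Rightarrow> real) measure)" by measurable
      moreover have "{x\<in>S. \<forall>i<n. x i \<le> a i} = S \<inter> {x. \<forall>i<n. x i \<le> a i}" by auto
      ultimately show "{x\<in>S. \<forall>i<n. x i \<le> a i} \<in> sets (restrict_space borel S)"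
        by (simp only: Int_in_restrict_space)
    qed
    thus ?thesis using sets.sigma_sets_subset[of ?G "restrict_space borel S"]
      by (simp add: space_restrict_space)
  qed
next
  let ?N = "sigma S ?G"
  have sN: "space ?N = S" "sets ?N = sigma_sets S ?G" by (auto intro!: space_measure_of sets_measure_of)
  have "(\<lambda>x. x) \<in> measurable ?N (borel :: (nat \<Rightarrow> real) measure)"
  proof (rule measurable_funI)
    fix i
    show "(\<lambda>x. x i) \<in> borel_measurable ?N"
    proof (cases "i < n")
      case True
      show ?thesis
      proof (rule borel_measurable_iff_le[THEN iffD2], rule allI)
        fix t :: real
        \<comment> \<open>Points have bounded coordinates, so a half-space is a countable union of
          orthants whose other bounds \<open>N\<close> tend to infinity.\<close>
        have "{x \<in> space ?N. x i \<le> t} = (\<Union>N::nat. {x\<in>S. \<forall>j<n. x j \<le> ((\<lambda>_. real N)(i := t)) j})"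
        proof safe
          fix x assume x: "x \<in> space ?N" "x i \<le> t"
          obtain N :: nat where "nrm n x \<le> real N" using real_arch_simple by blast
          hence "x j \<le> real N" if "j < n" for j using coord_le_nrm[OF that, of x] by linarith
          thus "x \<in> (\<Union>N::nat. {x\<in>S. \<forall>j<n. x j \<le> ((\<lambda>_. real N)(i := t)) j})"
            using x by (auto simp: sN)
        qed (use True in \<open>auto simp: sN split: if_splits\<close>)
        also have "\<dots> \<in> sets ?N" unfolding sN by (intro sigma_sets.Union sigma_sets.Basic) auto
        finally show "{x \<in> space ?N. x i \<le> t} \<in> sets ?N" .
      qed
    next
      case False
      hence "(\<lambda>x. x i) \<in> borel_measurable ?N \<longleftrightarrow> (\<lambda>x::nat \<Rightarrow> real. 0 :: real) \<in> borel_measurable ?N"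
        using S by (intro measurable_cong) (auto simp: sN Rn_iff)
      thus ?thesis by simp
    qed
  qed
  hence "S \<inter> B \<in> sets ?N" if "B \<in> sets borel" for B
    using measurable_sets[of "\<lambda>x. x" ?N borel B] that sN by (simp add: vimage_def Int_def conj_commute)
  thus "sets (restrict_space borel S) \<subseteq> sigma_sets S ?G"
    by (auto simp: sets_restrict_space sN)
qed

text \<open>The indicator of an orthant is a decreasing limit of Lipschitz functions, on which
  \<open>sphere_haar_lipschitz_le\<close>, applied in both directions, makes the two measures
  agree.\<close>

lemma sphere_haar_unique:
  assumes \<mu>: "is_sphere_haar n E \<mu>" and \<nu>: "is_sphere_haar n E \<nu>" and E: "subspace E" "E \<subseteq> Rn n"
  shows "\<mu> = \<nu>"
proof -
  note F = sphere_haar_facts[OF \<mu>] and G = sphere_haar_facts[OF \<nu>]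
  interpret M: prob_space \<mu> by (rule F(1))
  interpret N: prob_space \<nu> by (rule G(1))
  define S where "S = unit_sphere n \<inter> E"
  have S: "S \<subseteq> Rn n" using E by (auto simp: S_def)
  define box where "box a = {x\<in>S. \<forall>i<n. x i \<le> a i}" for a :: "nat \<Rightarrow> real"
  have box_sets: "box a \<in> sets \<mu>" "box a \<in> sets \<nu>" for a
    unfolding F(2) G(2) S_def[symmetric] sphere_generator[OF S] by (auto simp: box_def)
  have eq: "emeasure \<mu> (box a) = emeasure \<nu> (box a)" for a
  proof -
    \<comment> \<open>On \<open>S\<close> the function \<open>h\<close> vanishes exactly on the
      orthant, so the positive part of \<open>1 - j * h\<close> tends to the indicator.\<close>
    define h where "h x = (\<Sum>i<n. max 0 (x i - a i))" for x
    define f where "f j x = max 0 (1 - real j * h x)" for j x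
    have hm [measurable]: "h \<in> borel_measurable borel" unfolding h_def by measurable
    have fm: "f j \<in> borel_measurable borel" for j unfolding f_def by measurable
    have h0: "0 \<le> h x" for x by (auto simp: h_def intro: sum_nonneg)
    have hlip: "\<bar>h x - h y\<bar> \<le> real n * nrm n (x - y)" for x y
    proof -
      have "\<bar>h x - h y\<bar> \<le> (\<Sum>i<n. \<bar>max 0 (x i - a i) - max 0 (y i - a i)\<bar>)"
        unfolding h_def sum_subtractf[symmetric] by (rule sum_abs)
      also have "\<dots> \<le> (\<Sum>i<n. nrm n (x - y))"
      proof (rule sum_mono)
        fix i assume "i \<in> {..<n}"
        hence "\<bar>(x - y) i\<bar> \<le> nrm n (x - y)" by (intro coord_le_nrm) auto
        thus "\<bar>max 0 (x i - a i) - max 0 (y i - a i)\<bar> \<le> nrm n (x - y)" by (auto simp: max_def)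
      qed
      finally show ?thesis by simp
    qed
    have flip: "ennreal (f j x) \<le> ennreal (f j y) + ennreal (real j * real n * nrm n (x - y))" for j x y
    proof -
      have "real j * h y - real j * h x \<le> real j * (real n * nrm n (x - y))"
        using hlip[of x y] by (simp add: right_diff_distrib[symmetric] mult_left_mono)
      hence "f j x \<le> f j y + real j * real n * nrm n (x - y)"
        by (auto simp: f_def max_def mult.assoc)
      moreover have "0 \<le> f j y" by (simp add: f_def)
      ultimately show ?thesis
        by (subst ennreal_plus[symmetric]) (auto intro!: ennreal_leI simp del: ennreal_plus)
    qed
    have same: "(\<integral>\<^sup>+x. f j x \<partial>\<mu>) = (\<integral>\<^sup>+x. f j x \<partial>\<nu>)" for j
    proof (rule antisym)
      show "(\<integral>\<^sup>+x. f j x \<partial>\<mu>) \<le> (\<integral>\<^sup>+x. f j x \<partial>\<nu>)"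
        by (rule sphere_haar_lipschitz_le[OF \<mu> \<nu> E _ _ flip]) (use fm in auto)
      show "(\<integral>\<^sup>+x. f j x \<partial>\<nu>) \<le> (\<integral>\<^sup>+x. f j x \<partial>\<mu>)"
        by (rule sphere_haar_lipschitz_le[OF \<nu> \<mu> E _ _ flip]) (use fm in auto)
    qed
    have lim: "(\<lambda>j. ennreal (f j x)) \<longlonglongrightarrow> indicator (box a) x" if x: "x \<in> S" for x
    proof (cases "h x = 0")
      case True
      hence "\<forall>i<n. max 0 (x i - a i) = 0" by (auto simp: h_def sum_nonneg_eq_0_iff)
      hence "x \<in> box a" using x by (auto simp: box_def max_def split: if_splits)
      thus ?thesis using True by (simp add: f_def)
    next
      case False
      hence hx: "0 < h x" using h0[of x] by simp
      have "h x = 0" if "x \<in> box a" using that by (auto simp: h_def box_def max_def intro!: sum.neutral)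
      hence "x \<notin> box a" using False by auto
      moreover have "eventually (\<lambda>j. f j x = 0) sequentially"
      proof -
        obtain N :: nat where N: "1 / h x \<le> real N" using real_arch_simple by blast
        show ?thesis
        proof (rule eventually_sequentiallyI[of N])
          fix j assume "N \<le> j"
          hence "1 / h x \<le> real j" using N by linarith
          hence "1 \<le> real j * h x" using hx by (simp add: field_simps)
          thus "f j x = 0" by (simp add: f_def)
        qed
      qed
      hence "eventually (\<lambda>j. ennreal (f j x) = 0) sequentially" by eventually_elim simp
      ultimately show ?thesis by (simp add: tendsto_eventually)
    qed
    have conv: "(\<lambda>j. \<integral>\<^sup>+x. f j x \<partial>\<rho>) \<longlonglongrightarrow> emeasure \<rho> (box a)" if \<rho>: "is_sphere_haar n E \<rho>" for \<rho>
    proof -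
      note H = sphere_haar_facts[OF \<rho>]
      interpret R: prob_space \<rho> by (rule H(1))
      have b: "box a \<in> sets \<rho>" using box_sets F(2) H(2) by simp
      have "(\<lambda>j. \<integral>\<^sup>+x. f j x \<partial>\<rho>) \<longlonglongrightarrow> (\<integral>\<^sup>+x. indicator (box a) x \<partial>\<rho>)"
      proof (rule nn_integral_dominated_convergence[where w = "\<lambda>_. 1"])
        show "(\<lambda>x. ennreal (f j x)) \<in> borel_measurable \<rho>" for j
          by (rule measurable_sphere[OF H(2)]) (use fm[of j] in measurable)
        show "AE x in \<rho>. (\<lambda>j. ennreal (f j x)) \<longlonglongrightarrow> indicator (box a) x"
          by (rule AE_I2) (use lim H(3) in \<open>auto simp: S_def\<close>)
        show "AE x in \<rho>. ennreal (f j x) \<le> 1" for j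
          using h0 by (auto simp: f_def)
      qed (use b in \<open>auto simp: R.emeasure_space_1\<close>)
      thus ?thesis using b by simp
    qed
    show ?thesis using LIMSEQ_unique[OF conv[OF \<mu>]] conv[OF \<nu>] same by simp
  qed
  show ?thesis
  proof (rule measure_eqI_generator_eq[where E = "range box" and \<Omega> = S and A = "\<lambda>N. box (\<lambda>_. real N)"])
    show "Int_stable (range box)"
    proof (rule Int_stableI_image)
      fix a b :: "nat \<Rightarrow> real"
      show "\<exists>c\<in>UNIV. box a \<inter> box b = box c"
        by (intro bexI[of _ "\<lambda>i. min (a i) (b i)"]) (auto simp: box_def)
    qed
    show "range box \<subseteq> Pow S" by (auto simp: box_def)
    show "sets \<mu> = sigma_sets S (range box)" "sets \<nu> = sigma_sets S (range box)"
      using F(2) G(2) sphere_generator[OF S] by (simp_all add: S_def box_def[abs_def])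
    show "(\<Union>N. box (\<lambda>_. real N)) = S"
    proof safe
      fix x assume x: "x \<in> S"
      obtain N :: nat where "nrm n x \<le> real N" using real_arch_simple by blast
      hence "x j \<le> real N" if "j < n" for j using coord_le_nrm[OF that, of x] by linarith
      thus "x \<in> (\<Union>N. box (\<lambda>_. real N))" using x by (auto simp: box_def)
    qed (auto simp: box_def)
  qed (use eq in auto)
qed


subsection \<open>Existence and polar coordinates\<close>

lemma emeasure_Leb_origin:
  assumes m: "1 \<le> m" shows "emeasure (Leb m) {x. nrm m x \<le> 0} = 0"
proof -
  have "emeasure (Leb m) {x. nrm m x \<le> 0} \<le> 0 + ennreal e" if e: "0 < e" for e
  proof -
    let ?r = "min 1 (e / unit_ball_vol (real m))"
    have r: "0 < ?r" "?r \<le> 1" using e by auto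
    have "emeasure (Leb m) {x. nrm m x \<le> 0} \<le> emeasure (Leb m) {x. nrm m x \<le> ?r}"
      using r by (intro emeasure_mono) auto
    also have "\<dots> = ennreal (unit_ball_vol (real m) * ?r ^ m)" by (rule emeasure_Leb_nrm_le[OF r(1)])
    also have "?r ^ m \<le> ?r ^ 1" using r m by (intro power_decreasing) auto
    hence "unit_ball_vol (real m) * ?r ^ m \<le> unit_ball_vol (real m) * (e / unit_ball_vol (real m))"
      by (intro mult_left_mono) auto
    also have "\<dots> = e" using unit_ball_vol_pos[of "real m"] by (simp add: less_imp_neq[symmetric])
    finally show ?thesis by (simp add: ennreal_leI)
  qed
  thus ?thesis
    using ennreal_le_epsilon[of 0 "emeasure (Leb m) {x. nrm m x \<le> 0}"] by (simp add: bot_unique)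
qed

text \<open>The arbitrary unit vector at the origin gives the map values in the sphere everywhere,
  as a push-forward to the sphere requires.\<close>

definition direction :: "nat \<Rightarrow> (nat \<Rightarrow> real) \<Rightarrow> nat \<Rightarrow> real" where
  "direction m x = (if nrm m x = 0 then axis_vec 0 else (1 / nrm m x) *\<^sub>R trunc m x)"

lemma direction_sphere: "1 \<le> m \<Longrightarrow> direction m x \<in> unit_sphere m"
  by (auto simp: direction_def unit_sphere_iff axis_vec_in_Rn nrm_axis abs_of_nonneg)

lemma direction_polar: "x \<in> Rn m \<Longrightarrow> nrm m x *\<^sub>R direction m x = x"
  by (auto simp: direction_def nrm_eq_0_iff trunc_id)

lemma direction_measurable [measurable]: "direction m \<in> borel_measurable borel"
  unfolding direction_def by measurable

lemma iso_onto_direction_measurable: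
  assumes \<iota>: "iso_onto m n E \<iota>" and m: "1 \<le> m"
  shows "(\<lambda>x. \<iota> (direction m x)) \<in> measurable borel (restrict_space borel (unit_sphere n \<inter> E))"
proof (rule measurable_restrict_space2)
  show "(\<lambda>x. \<iota> (direction m x)) \<in> space borel \<rightarrow> unit_sphere n \<inter> E"
    using direction_sphere[OF m] iso_onto_nrm[OF \<iota>] iso_onto_mem[OF \<iota>]
    by (auto simp: unit_sphere_iff)
  have "(\<lambda>x. \<iota> (trunc m (direction m x))) \<in> borel_measurable borel"
    by (rule measurable_compose[OF direction_measurable measurable_linear_trunc[OF iso_onto_linear[OF \<iota>]]])
  thus "(\<lambda>x. \<iota> (direction m x)) \<in> borel_measurable borel"
    using direction_sphere[OF m] by (simp add: trunc_id unit_sphere_iff)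
qed

lemma iso_onto_subspace: "iso_onto m n E \<iota> \<Longrightarrow> subspace E"
  using linear_subspace_image[OF _ Rn_subspace, of \<iota> m] by (auto simp: iso_onto_def)

text \<open>Conjugation by the parametrisation \<open>\<iota>\<close>: invariance under the
  isometries of \<open>E\<close> is thereby reduced to invariance of \<open>Leb m\<close>.\<close>

lemma iso_onto_pullback:
  assumes \<iota>: "iso_onto m n E \<iota>"
    and T: "linear T" "T ` E = E" "\<forall>x\<in>E. dot n (T x) (T x) = dot n x x"
  obtains T' where "iso_onto m m (Rn m) T'" "\<And>x. x \<in> Rn m \<Longrightarrow> T (\<iota> x) = \<iota> (T' x)"
proof -
  \<comment> \<open>The inverse of \<open>\<iota>\<close> on \<open>E\<close>, written with scalar
    products so that it is linear on the whole space.\<close>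
  define \<kappa> where "\<kappa> z = (\<lambda>i. if i < m then dot n z (\<iota> (axis_vec i)) else 0)" for z
  have lin\<kappa>: "linear \<kappa>" by (rule linearI) (auto simp: \<kappa>_def fun_eq_iff)
  have \<kappa>_Rn: "\<kappa> z \<in> Rn m" for z by (auto simp: \<kappa>_def Rn_iff)
  have \<kappa>\<iota>: "\<kappa> (\<iota> x) = x" if x: "x \<in> Rn m" for x
  proof
    fix i
    show "\<kappa> (\<iota> x) i = x i"
    proof (cases "i < m")
      case True
      thus ?thesis using x by (simp add: \<kappa>_def iso_onto_dot[OF \<iota>] axis_vec_in_Rn dot_axis)
    qed (use x in \<open>auto simp: \<kappa>_def Rn_iff\<close>)
  qed
  have \<iota>\<kappa>: "\<iota> (\<kappa> z) = z" if "z \<in> E" for z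
    using that \<iota> \<kappa>\<iota> by (auto simp: iso_onto_def)
  define T' where "T' = \<kappa> \<circ> (T \<circ> \<iota>)"
  have TE: "T (\<iota> x) \<in> E" if "x \<in> Rn m" for x using that T(2) iso_onto_mem[OF \<iota> that] by auto
  have eq: "T (\<iota> x) = \<iota> (T' x)" if "x \<in> Rn m" for x
    using \<iota>\<kappa>[OF TE[OF that]] by (simp add: T'_def)
  have "linear T'" unfolding T'_def
    by (intro linear_compose lin\<kappa> T(1) iso_onto_linear[OF \<iota>])
  moreover have "T' ` Rn m = Rn m"
  proof
    show "T' ` Rn m \<subseteq> Rn m" using \<kappa>_Rn by (auto simp: T'_def)
    show "Rn m \<subseteq> T' ` Rn m"
    proof
      fix y assume y: "y \<in> Rn m"
      have "\<iota> y \<in> T ` \<iota> ` Rn m" using y T(2) \<iota> by (auto simp: iso_onto_def)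
      then obtain x where x: "x \<in> Rn m" "\<iota> y = T (\<iota> x)" by auto
      hence "T' x = y" using \<kappa>\<iota>[OF y] by (simp add: T'_def)
      thus "y \<in> T' ` Rn m" using x by auto
    qed
  qed
  moreover have "dot m (T' x) (T' x) = dot m x x" if x: "x \<in> Rn m" for x
  proof -
    have "dot m (T' x) (T' x) = dot n (\<iota> (T' x)) (\<iota> (T' x))"
      using \<kappa>_Rn by (simp add: iso_onto_dot[OF \<iota>] T'_def)
    also have "\<dots> = dot m x x" using x T(3) iso_onto_mem[OF \<iota> x]
      by (simp add: eq[symmetric] iso_onto_dot[OF \<iota>])
    finally show ?thesis .
  qed
  ultimately have "iso_onto m m (Rn m) T'" by (auto simp: iso_onto_def)
  thus ?thesis using eq that by blast
qed

text \<open>The direction of a random vector with a radial density has a rotation invariant law.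
  Leaving \<open>\<phi>\<close> free is what later makes radius and direction independent:
  restricting the radius to a set leads to the same, unique, law of the direction.\<close>

lemma is_sphere_haar_push:
  assumes \<iota>: "iso_onto m n E \<iota>" and m: "1 \<le> m"
    and [measurable]: "\<phi> \<in> borel_measurable borel"
    and one: "(\<integral>\<^sup>+x. \<phi> (nrm m x) \<partial>Leb m) = 1"
  shows "is_sphere_haar n E (distr (density (Leb m) (\<lambda>x. \<phi> (nrm m x)))
    (restrict_space borel (unit_sphere n \<inter> E)) (\<lambda>x. \<iota> (direction m x)))" (is "is_sphere_haar n E ?\<mu>")
proof -
  let ?R = "restrict_space borel (unit_sphere n \<inter> E) :: (nat \<Rightarrow> real) measure"
  let ?D = "density (Leb m) (\<lambda>x. \<phi> (nrm m x))"
  let ?d = "\<lambda>x. \<iota> (direction m x)"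
  have E: "subspace E" "E \<subseteq> Rn n" using \<iota> iso_onto_subspace by (auto simp: iso_onto_def)
  have dm: "?d \<in> measurable ?D ?R"
    using iso_onto_direction_measurable[OF \<iota> m] by (simp add: measurable_def)
  have "emeasure ?D (space ?D) = 1"
    using one by (simp add: emeasure_density)
  hence "prob_space ?D" by (rule prob_spaceI)
  hence ps: "prob_space ?\<mu>" by (rule prob_space.prob_space_distr) (rule dm)
  have nn: "(\<integral>\<^sup>+u. g u \<partial>?\<mu>) = (\<integral>\<^sup>+x. \<phi> (nrm m x) * g (?d x) \<partial>Leb m)"
    if g: "g \<in> borel_measurable ?R" for g
  proof -
    have "(\<integral>\<^sup>+u. g u \<partial>?\<mu>) = (\<integral>\<^sup>+x. g (?d x) \<partial>?D)"
      using g by (intro nn_integral_distr[OF dm]) simp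
    also have "\<dots> = (\<integral>\<^sup>+x. \<phi> (nrm m x) * g (?d x) \<partial>Leb m)"
    proof (rule nn_integral_density)
      show "(\<lambda>x. g (?d x)) \<in> borel_measurable (Leb m)"
        using measurable_compose[OF iso_onto_direction_measurable[OF \<iota> m] g] by (simp add: measurable_def)
    qed measurable
    finally show ?thesis .
  qed
  have "distr ?\<mu> ?\<mu> T = ?\<mu>"
    if T: "linear T" "T ` E = E" "\<forall>x\<in>E. dot n (T x) (T x) = dot n x x" for T
  proof (rule measure_eqI)
    obtain T' where T': "iso_onto m m (Rn m) T'" "\<And>x. x \<in> Rn m \<Longrightarrow> T (\<iota> x) = \<iota> (T' x)"
      using iso_onto_pullback[OF \<iota> T] by blast
    have "(\<lambda>x. T (trunc n x)) \<in> measurable ?R borel"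
      by (rule measurable_restrict_space1[OF measurable_linear_trunc[OF T(1)]])
    also have "?this \<longleftrightarrow> T \<in> measurable ?R borel"
      by (rule measurable_cong) (use E in \<open>auto simp: space_restrict_space trunc_id\<close>)
    finally have TR: "T \<in> measurable ?R ?R"
    proof (intro measurable_restrict_space2)
      show "T \<in> space ?R \<rightarrow> unit_sphere n \<inter> E"
      proof
        fix x assume x: "x \<in> space ?R"
        hence "x \<in> E" "nrm n x = 1" by (auto simp: space_restrict_space unit_sphere_iff)
        moreover have "T x \<in> E" using \<open>x \<in> E\<close> T(2) by blast
        ultimately show "T x \<in> unit_sphere n \<inter> E" using T(3) E by (auto simp: unit_sphere_iff nrm_def)
      qed
    qed
    fix A assume "A \<in> sets (distr ?\<mu> ?\<mu> T)"
    hence A: "A \<in> sets ?R" by simp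
    have "emeasure (distr ?\<mu> ?\<mu> T) A = (\<integral>\<^sup>+u. indicator A (T u) \<partial>?\<mu>)"
    proof -
      have "emeasure (distr ?\<mu> ?\<mu> T) A = (\<integral>\<^sup>+u. indicator A u \<partial>distr ?\<mu> ?\<mu> T)" using A by simp
      also have "\<dots> = (\<integral>\<^sup>+u. indicator A (T u) \<partial>?\<mu>)"
        using TR A by (intro nn_integral_distr) auto
      finally show ?thesis .
    qed
    also have "\<dots> = (\<integral>\<^sup>+x. \<phi> (nrm m x) * indicator A (T (?d x)) \<partial>Leb m)"
      using measurable_compose[OF TR borel_measurable_indicator[OF A]] by (rule nn)
    also have "\<dots> = (\<integral>\<^sup>+x. \<phi> (nrm m (T' x)) * indicator A (?d (T' x)) \<partial>Leb m)"
    proof (rule nn_integral_cong_AE)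
      \<comment> \<open>At the origin \<open>direction\<close> is an arbitrary choice that does not
        commute with \<open>T'\<close>; the origin is a null set because
        \<open>m \<ge> 1\<close>.\<close>
      have "AE x in Leb m. x \<noteq> 0"
      proof (rule AE_I[where N = "{x. nrm m x \<le> 0}"])
        show "emeasure (Leb m) {x. nrm m x \<le> 0} = 0" by (rule emeasure_Leb_origin[OF m])
      qed (auto simp: nrm_def)
      thus "AE x in Leb m. \<phi> (nrm m x) * indicator A (T (?d x)) =
          \<phi> (nrm m (T' x)) * indicator A (?d (T' x))"
        using AE_Leb_Rn[of m]
      proof eventually_elim
        fix x :: "nat \<Rightarrow> real" assume x: "x \<noteq> 0" "x \<in> Rn m"
        have n: "nrm m (T' x) = nrm m x" using iso_onto_nrm[OF T'(1) x(2)] .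
        have T'x: "T' x \<in> Rn m" using iso_onto_mem[OF T'(1) x(2)] by simp
        have "direction m (T' x) = T' (direction m x)"
          using x nrm_pos[of x m] T'x
          by (simp add: direction_def n trunc_id linear_scale[OF iso_onto_linear[OF T'(1)]])
        moreover have "direction m x \<in> Rn m" using direction_sphere[OF m] by (simp add: unit_sphere_iff)
        ultimately have "T (?d x) = ?d (T' x)" using T'(2) by simp
        thus "\<phi> (nrm m x) * indicator A (T (?d x)) = \<phi> (nrm m (T' x)) * indicator A (?d (T' x))"
          by (simp add: n)
      qed
    qed
    also have "\<dots> = (\<integral>\<^sup>+x. \<phi> (nrm m x) * indicator A (?d x) \<partial>Leb m)"
    proof (rule nn_Leb_isometry[OF _ T'(1)])
      have "(\<lambda>x. indicator A (?d x) :: ennreal) \<in> borel_measurable borel"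
        by (rule measurable_compose[OF iso_onto_direction_measurable[OF \<iota> m] borel_measurable_indicator[OF A]])
      thus "(\<lambda>x. \<phi> (nrm m x) * indicator A (?d x)) \<in> borel_measurable borel" by measurable
    qed
    also have "\<dots> = (\<integral>\<^sup>+u. indicator A u \<partial>?\<mu>)" by (rule nn[symmetric]) (use A in simp)
    also have "\<dots> = emeasure ?\<mu> A" using A by simp
    finally show "emeasure (distr ?\<mu> ?\<mu> T) A = emeasure ?\<mu> A" .
  qed simp
  thus ?thesis using ps by (simp add: is_sphere_haar_def)
qed

lemma Leb_unit_ball_density:
  "(\<integral>\<^sup>+x. indicator {..1} (nrm m x) / ennreal (unit_ball_vol (real m)) \<partial>Leb m) = 1"
proof -
  have "(\<integral>\<^sup>+x. indicator {..1} (nrm m x) / ennreal (unit_ball_vol (real m)) \<partial>Leb m) =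
      (\<integral>\<^sup>+x. indicator {x. nrm m x \<le> 1} x / ennreal (unit_ball_vol (real m)) \<partial>Leb m)"
    by (intro nn_integral_cong) (auto simp: indicator_def)
  also have "\<dots> = emeasure (Leb m) {x. nrm m x \<le> 1} / ennreal (unit_ball_vol (real m))"
    by (simp add: nn_integral_divide)
  also have "\<dots> = 1"
    using unit_ball_vol_pos[of "real m"]
    by (simp add: emeasure_Leb_nrm_le divide_ennreal less_imp_neq[symmetric])
  finally show ?thesis .
qed

text \<open>Existence, from the uniform density on the ball, together with uniqueness gives the
  definite description in \<open>sphere_haar\<close> its meaning.\<close>

lemma sphere_haar_is_haar:
  assumes \<iota>: "iso_onto m n E \<iota>" and m: "1 \<le> m"
  shows "is_sphere_haar n E (sphere_haar n E)"
proof -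
  let ?\<phi> = "\<lambda>r::real. indicator {..1} r / ennreal (unit_ball_vol (real m))"
  have "?\<phi> \<in> borel_measurable borel"
    by (intro borel_measurable_divide_ennreal borel_measurable_indicator) auto
  from is_sphere_haar_push[OF \<iota> m this Leb_unit_ball_density]
  obtain \<mu> where \<mu>: "is_sphere_haar n E \<mu>" by blast
  have "E \<subseteq> Rn n" using \<iota> by (simp add: iso_onto_def)
  hence "\<nu> = \<mu>" if "is_sphere_haar n E \<nu>" for \<nu>
    using sphere_haar_unique[OF that \<mu> iso_onto_subspace[OF \<iota>]] by simp
  thus ?thesis unfolding sphere_haar_def using \<mu> by (metis theI)
qed

lemma sphere_haar_eq:
  assumes \<iota>: "iso_onto m n E \<iota>" and m: "1 \<le> m" and \<mu>: "is_sphere_haar n E \<mu>"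
  shows "sphere_haar n E = \<mu>"
  using sphere_haar_unique[OF sphere_haar_is_haar[OF \<iota> m] \<mu> iso_onto_subspace[OF \<iota>]] \<iota>
  by (simp add: iso_onto_def)

section \<open>Integration in polar coordinates\<close>

definition radial_measure :: "nat \<Rightarrow> real measure" where
  "radial_measure m = density lborel (\<lambda>r. ennreal (real m * unit_ball_vol (real m) * r ^ (m - 1)) * indicator {0<..} r)"

lemma sets_radial_measure [simp, measurable_cong]: "sets (radial_measure m) = sets borel"
  by (simp add: radial_measure_def)

lemma space_radial_measure [simp]: "space (radial_measure m) = UNIV"
  by (simp add: radial_measure_def)

lemma emeasure_radial_measure:
  assumes m: "1 \<le> m"
  shows "emeasure (radial_measure m) {..a} = ennreal (unit_ball_vol (real m) * max 0 a ^ m)"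
proof -
  let ?v = "unit_ball_vol (real m)"
  have "emeasure (radial_measure m) {..a} =
      (\<integral>\<^sup>+r. ennreal (real m * ?v * r ^ (m - 1)) * indicator {0<..} r * indicator {..a} r \<partial>lborel)"
    unfolding radial_measure_def by (subst emeasure_density) auto
  also have "\<dots> = (\<integral>\<^sup>+r. ennreal (real m * ?v * r ^ (m - 1)) * indicator {0..max 0 a} r \<partial>lborel)"
    by (rule nn_integral_cong_AE, rule AE_I[where N = "{0}"]) (auto simp: indicator_def)
  also have "\<dots> = ennreal (?v * max 0 a ^ m - ?v * 0 ^ m)"
    by (rule nn_integral_FTC_Icc) (use m in \<open>auto intro!: derivative_eq_intros simp: algebra_simps\<close>)
  finally show ?thesis using m by simp
qed

lemma distr_nrm_Leb:
  assumes m: "1 \<le> m"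
  shows "distr (Leb m) borel (nrm m) = radial_measure m"
proof (rule measure_eqI_generator_eq[where E = "range (\<lambda>a::real. {..a})" and \<Omega> = UNIV and A = "\<lambda>N. {..real N}"])
  show "Int_stable (range (\<lambda>a::real. {..a}))"
    by (rule Int_stableI_image) (auto intro!: exI[of _ "min _ _"])
  show "sets (distr (Leb m) borel (nrm m)) = sigma_sets UNIV (range (\<lambda>a::real. {..a}))"
    "sets (radial_measure m) = sigma_sets UNIV (range (\<lambda>a::real. {..a}))"
    by (simp_all add: borel_eq_atMost)
  have e: "emeasure (distr (Leb m) borel (nrm m)) {..a} = ennreal (unit_ball_vol (real m) * max 0 a ^ m)" for a
  proof -
    have *: "emeasure (distr (Leb m) borel (nrm m)) {..a} = emeasure (Leb m) {x. nrm m x \<le> a}"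
      by (subst emeasure_distr) (auto simp: vimage_def)
    consider "a < 0" | "a = 0" | "0 < a" by linarith
    thus ?thesis
    proof cases
      case 1
      have "{x. nrm m x \<le> a} = {}" using 1 nrm_nonneg order.strict_trans1 by (metis (mono_tags, lifting) Collect_empty_eq not_less)
      thus ?thesis using 1 m * by simp
    next
      case 2
      thus ?thesis using 2 m * emeasure_Leb_origin[OF m] by simp
    next
      case 3
      thus ?thesis using * by (simp add: emeasure_Leb_nrm_le)
    qed
  qed
  show "emeasure (distr (Leb m) borel (nrm m)) X = emeasure (radial_measure m) X"
    if "X \<in> range (\<lambda>a::real. {..a})" for X
    using that by (auto simp: e emeasure_radial_measure[OF m])
  show "emeasure (distr (Leb m) borel (nrm m)) {..real i} \<noteq> \<infinity>" for i by (simp add: e)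
  show "(\<Union>N. {..real N}) = UNIV" by (auto intro: real_arch_simple)
qed auto

lemma radial_sigma_finite: "1 \<le> m \<Longrightarrow> sigma_finite_measure (radial_measure m)"
proof
  assume m: "1 \<le> m"
  show "\<exists>A. countable A \<and> A \<subseteq> sets (radial_measure m) \<and> \<Union> A = space (radial_measure m) \<and>
      (\<forall>a\<in>A. emeasure (radial_measure m) a \<noteq> \<infinity>)"
    by (intro exI[of _ "range (\<lambda>N::nat. {..real N})"])
       (use m in \<open>auto simp: emeasure_radial_measure space_radial_measure intro: real_arch_simple\<close>)
qed

text \<open>For a set \<open>C\<close> of radii of finite positive mass, the normalised restriction
  of \<open>Leb m\<close> to radii in \<open>C\<close> pushes forward to a Haar measure, and
  uniqueness says that it does not depend on \<open>C\<close>. So the two sides agree on rectangles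
  over such \<open>C\<close>; radii sets of infinite mass are exhausted by bounded ones.\<close>

lemma polar_product:
  assumes \<iota>: "iso_onto m n E \<iota>" and m: "1 \<le> m"
  shows "radial_measure m \<Otimes>\<^sub>M sphere_haar n E =
    distr (Leb m) (borel \<Otimes>\<^sub>M restrict_space borel (unit_sphere n \<inter> E))
      (\<lambda>x. (nrm m x, \<iota> (direction m x)))" (is "_ = ?P")
proof (rule pair_measure_eqI)
  let ?R = "restrict_space borel (unit_sphere n \<inter> E) :: (nat \<Rightarrow> real) measure"
  let ?d = "\<lambda>x. \<iota> (direction m x)"
  note H = sphere_haar_is_haar[OF \<iota> m] and F = sphere_haar_facts[OF sphere_haar_is_haar[OF \<iota> m]]
  interpret H: prob_space "sphere_haar n E" by (rule F(1))
  show "sigma_finite_measure (radial_measure m)" by (rule radial_sigma_finite[OF m])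
  show "sigma_finite_measure (sphere_haar n E)" ..
  show "sets (radial_measure m \<Otimes>\<^sub>M sphere_haar n E) = sets ?P"
    by (simp add: F(2) cong: sets_pair_measure_cong)
  note dm[measurable] = iso_onto_direction_measurable[OF \<iota> m]
  have Pm: "(\<lambda>x. (nrm m x, ?d x)) \<in> measurable (Leb m) (borel \<Otimes>\<^sub>M ?R)" by measurable
  fix A B assume A: "A \<in> sets (radial_measure m)" and B: "B \<in> sets (sphere_haar n E)"
  have A'[measurable]: "A \<in> sets borel" and B'[measurable]: "B \<in> sets ?R" using A B F(2) by auto
  have P: "emeasure ?P (C \<times> B) = (\<integral>\<^sup>+x. indicator C (nrm m x) * indicator B (?d x) \<partial>Leb m)"
    if [measurable]: "C \<in> sets borel" for C
  proof -
    have "emeasure ?P (C \<times> B) = (\<integral>\<^sup>+z. indicator (C \<times> B) z \<partial>?P)" by simp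
    also have "\<dots> = (\<integral>\<^sup>+x. indicator (C \<times> B) (nrm m x, ?d x) \<partial>Leb m)"
      by (intro nn_integral_distr Pm) simp
    finally show ?thesis by (simp add: indicator_times)
  qed
  have M1: "emeasure (radial_measure m) C = (\<integral>\<^sup>+x. indicator C (nrm m x) \<partial>Leb m)"
    if [measurable]: "C \<in> sets borel" for C
  proof -
    have "emeasure (radial_measure m) C = (\<integral>\<^sup>+r. indicator C r \<partial>distr (Leb m) borel (nrm m))"
      unfolding distr_nrm_Leb[OF m] by simp
    also have "\<dots> = (\<integral>\<^sup>+x. indicator C (nrm m x) \<partial>Leb m)" by (intro nn_integral_distr) auto
    finally show ?thesis .
  qed
  have fin: "emeasure (radial_measure m) C * emeasure (sphere_haar n E) B = emeasure ?P (C \<times> B)"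
    if C[measurable]: "C \<in> sets borel" and f: "emeasure (radial_measure m) C \<noteq> \<infinity>" for C
  proof (cases "emeasure (radial_measure m) C = 0")
    case True
    have "emeasure ?P (C \<times> B) \<le> emeasure (radial_measure m) C"
      unfolding P[OF C] M1[OF C] by (intro nn_integral_mono) (auto simp: indicator_def)
    thus ?thesis using True by simp
  next
    case False
    define z where "z = emeasure (radial_measure m) C"
    have z: "z \<noteq> 0" "z \<noteq> top" using False f by (auto simp: z_def)
    have "(\<integral>\<^sup>+x. indicator C (nrm m x) / z \<partial>Leb m) = 1"
      using z by (simp add: nn_integral_divide M1[OF C, symmetric] z_def[symmetric] divide_eq_1_ennreal)
    hence hp: "is_sphere_haar n E (distr (density (Leb m) (\<lambda>x. indicator C (nrm m x) / z)) ?R ?d)"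
      by (intro is_sphere_haar_push[OF \<iota> m]) measurable
    have "emeasure (sphere_haar n E) B = emeasure (distr (density (Leb m) (\<lambda>x. indicator C (nrm m x) / z)) ?R ?d) B"
      using sphere_haar_eq[OF \<iota> m hp] by simp
    also have "\<dots> = emeasure (density (Leb m) (\<lambda>x. indicator C (nrm m x) / z)) (?d -` B \<inter> UNIV)"
      by (subst emeasure_distr) auto
    also have "\<dots> = (\<integral>\<^sup>+x. indicator C (nrm m x) / z * indicator (?d -` B) x \<partial>Leb m)"
      using measurable_sets[OF dm B'] by (subst emeasure_density) auto
    also have "\<dots> = (\<integral>\<^sup>+x. (indicator C (nrm m x) * indicator B (?d x)) / z \<partial>Leb m)"
      by (intro nn_integral_cong) (auto simp: indicator_def)
    also have "\<dots> = emeasure ?P (C \<times> B) / z"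
      unfolding P[OF C] by (rule nn_integral_divide) measurable
    finally show ?thesis
      using mult_divide_eq_ennreal[OF z, of "emeasure ?P (C \<times> B)"]
      by (simp add: z_def[symmetric] ennreal_times_divide mult.commute[of z])
  qed
  define A' where "A' N = A \<inter> {..real N}" for N
  have A'm: "A' N \<in> sets borel" for N by (simp add: A'_def)
  have UA: "(\<Union>N. A' N) = A" by (auto simp: A'_def intro: real_arch_simple)
  have inc: "incseq A'" by (auto simp: A'_def incseq_def)
  have "(\<lambda>N. emeasure (radial_measure m) (A' N)) \<longlonglongrightarrow> emeasure (radial_measure m) A"
    using Lim_emeasure_incseq[of A' "radial_measure m"] A'm inc UA by auto
  hence 1: "(\<lambda>N. emeasure (sphere_haar n E) B * emeasure (radial_measure m) (A' N))
      \<longlonglongrightarrow> emeasure (sphere_haar n E) B * emeasure (radial_measure m) A"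
    by (intro ennreal_tendsto_cmult) (auto simp: less_top[symmetric])
  have 2: "(\<lambda>N. emeasure ?P (A' N \<times> B)) \<longlonglongrightarrow> emeasure ?P (\<Union>N. A' N \<times> B)"
    using A'm B' inc by (intro Lim_emeasure_incseq) (auto simp: incseq_def)
  have "emeasure (radial_measure m) (A' N) \<noteq> \<infinity>" for N
  proof -
    have "emeasure (radial_measure m) (A' N) \<le> emeasure (radial_measure m) {..real N}"
      by (intro emeasure_mono) (auto simp: A'_def)
    thus ?thesis using m by (auto simp: emeasure_radial_measure top_unique)
  qed
  hence "emeasure (sphere_haar n E) B * emeasure (radial_measure m) (A' N) = emeasure ?P (A' N \<times> B)" for N
    using fin[OF A'm] by (simp add: mult.commute)
  hence "emeasure (sphere_haar n E) B * emeasure (radial_measure m) A = emeasure ?P (\<Union>N. A' N \<times> B)"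
    using LIMSEQ_unique[OF 1] 2 by simp
  also have "(\<Union>N. A' N \<times> B) = A \<times> B" using UA by auto
  finally show "emeasure (radial_measure m) A * emeasure (sphere_haar n E) B = emeasure ?P (A \<times> B)"
    by (simp add: mult.commute)
qed

theorem nn_polar:
  assumes \<iota>: "iso_onto m n E \<iota>" and m: "1 \<le> m" and F[measurable]: "F \<in> borel_measurable borel"
  shows "(\<integral>\<^sup>+x. F (\<iota> x) \<partial>Leb m) =
    (\<integral>\<^sup>+u. (\<integral>\<^sup>+r. F (r *\<^sub>R u) \<partial>radial_measure m) \<partial>sphere_haar n E)"
proof -
  let ?R = "restrict_space borel (unit_sphere n \<inter> E) :: (nat \<Rightarrow> real) measure"
  note H = sphere_haar_facts[OF sphere_haar_is_haar[OF \<iota> m]]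
  interpret H: prob_space "sphere_haar n E" by (rule H(1))
  interpret R: sigma_finite_measure "radial_measure m" by (rule radial_sigma_finite[OF m])
  interpret pair_sigma_finite "radial_measure m" "sphere_haar n E" ..
  note dm[measurable] = iso_onto_direction_measurable[OF \<iota> m]
  have id: "(\<lambda>x. x) \<in> borel_measurable ?R"
    by (intro measurable_restrict_space1) simp
  have [measurable]: "snd \<in> borel_measurable (borel \<Otimes>\<^sub>M ?R)"
    using measurable_compose[OF measurable_snd id] .
  have Fm: "(\<lambda>z. F (fst z *\<^sub>R snd z)) \<in> borel_measurable (borel \<Otimes>\<^sub>M ?R)"
    by measurable
  have "(\<integral>\<^sup>+x. F (\<iota> x) \<partial>Leb m) = (\<integral>\<^sup>+x. F (nrm m x *\<^sub>R \<iota> (direction m x)) \<partial>Leb m)"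
  proof (rule nn_Leb_cong)
    fix x assume "x \<in> Rn m"
    thus "F (\<iota> x) = F (nrm m x *\<^sub>R \<iota> (direction m x))"
      using linear_scale[OF iso_onto_linear[OF \<iota>], of "nrm m x" "direction m x"]
      by (simp add: direction_polar)
  qed
  also have "\<dots> = (\<integral>\<^sup>+z. F (fst z *\<^sub>R snd z) \<partial>distr (Leb m) (borel \<Otimes>\<^sub>M ?R) (\<lambda>x. (nrm m x, \<iota> (direction m x))))"
    by (subst nn_integral_distr) (use Fm in auto)
  also have "\<dots> = (\<integral>\<^sup>+z. F (fst z *\<^sub>R snd z) \<partial>(radial_measure m \<Otimes>\<^sub>M sphere_haar n E))"
    by (simp only: polar_product[OF \<iota> m])
  also have "\<dots> = (\<integral>\<^sup>+u. (\<integral>\<^sup>+r. F (r *\<^sub>R u) \<partial>radial_measure m) \<partial>sphere_haar n E)"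
  proof (subst nn_integral_snd[symmetric])
    have "sets (radial_measure m \<Otimes>\<^sub>M sphere_haar n E) = sets (borel \<Otimes>\<^sub>M ?R)"
      by (intro sets_pair_measure_cong H(2)) simp
    thus "(\<lambda>z. F (fst z *\<^sub>R snd z)) \<in> borel_measurable (radial_measure m \<Otimes>\<^sub>M sphere_haar n E)"
      using Fm measurable_cong_sets by blast
  qed simp
  finally show ?thesis .
qed

lemma nn_radial:
  assumes [measurable]: "f \<in> borel_measurable borel"
  shows "(\<integral>\<^sup>+r. f r \<partial>radial_measure m) =
    (\<integral>\<^sup>+r. ennreal (real m * unit_ball_vol (real m) * r ^ (m - 1)) * indicator {0<..} r * f r \<partial>lborel)"
  unfolding radial_measure_def by (rule nn_integral_density) auto

lemma nn_radial_nrm: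
  assumes "1 \<le> m" and [measurable]: "f \<in> borel_measurable borel"
  shows "(\<integral>\<^sup>+r. f r \<partial>radial_measure m) = (\<integral>\<^sup>+x. f (nrm m x) \<partial>Leb m)"
  unfolding distr_nrm_Leb[OF assms(1), symmetric] by (rule nn_integral_distr) auto

section \<open>Rotating subspaces into coordinate position\<close>

text \<open>The subspace occupies the last coordinates, since marginals integrate these out and
  leave functions of the first \<open>n - m\<close>.\<close>

definition tail_space :: "nat \<Rightarrow> nat \<Rightarrow> (nat \<Rightarrow> real) set" where
  "tail_space n m = {x \<in> Rn n. \<forall>i<n - m. x i = 0}"

definition shift_by :: "nat \<Rightarrow> (nat \<Rightarrow> real) \<Rightarrow> nat \<Rightarrow> real" where
  "shift_by k x = (\<lambda>i. if i < k then 0 else x (i - k))"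

lemma subspace_tail_space: "subspace (tail_space n m)"
  by (auto simp: tail_space_def subspace_def Rn_iff)

lemma tail_space_full: "tail_space n n = Rn n"
  by (auto simp: tail_space_def)

lemma iso_onto_shift_by:
  assumes "m \<le> n" shows "iso_onto m n (tail_space n m) (shift_by (n - m))"
  unfolding iso_onto_def
proof (intro conjI ballI)
  show "linear (shift_by (n - m))" by (rule linearI) (auto simp: shift_by_def fun_eq_iff)
  show "shift_by (n - m) ` Rn m = tail_space n m"
  proof (intro equalityI subsetI)
    fix y assume y: "y \<in> tail_space n m"
    have "y = shift_by (n - m) (\<lambda>i. y (i + (n - m)))" using y by (auto simp: shift_by_def tail_space_def fun_eq_iff)
    moreover have "(\<lambda>i. y (i + (n - m))) \<in> Rn m" using y by (auto simp: tail_space_def Rn_iff)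
    ultimately show "y \<in> shift_by (n - m) ` Rn m" by blast
  qed (use assms in \<open>auto simp: shift_by_def tail_space_def Rn_iff\<close>)
  show "tail_space n m \<subseteq> Rn n" by (auto simp: tail_space_def)
  fix x assume "x \<in> Rn m"
  have "dot n (shift_by (n - m) x) (shift_by (n - m) x) = (\<Sum>i\<in>{n-m..<n}. x (i - (n - m)) * x (i - (n - m)))"
    unfolding dot_def by (rule sum.mono_neutral_cong_right) (auto simp: shift_by_def)
  also have "\<dots> = dot m x x" unfolding dot_def
    by (rule sum.reindex_bij_witness[of _ "\<lambda>i. i + (n - m)" "\<lambda>i. i - (n - m)"]) (use assms in auto)
  finally show "dot n (shift_by (n - m) x) (shift_by (n - m) x) = dot m x x" .
qed

lemma householder_iso_onto: "w \<in> Rn n \<Longrightarrow> iso_onto n n (Rn n) (householder n w)"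
  using householder_iso[OF Rn_subspace, of n n w] by (auto simp: iso_onto_def)

lemma unit_vec_in_subspace:
  assumes "subspace E" "E \<subseteq> Rn n" "E \<noteq> {0}"
  obtains u where "u \<in> E" "u \<in> unit_sphere n"
proof -
  obtain v where v: "v \<in> E" "v \<noteq> 0" using assms subspace_0 by blast
  hence "0 < nrm n v" using assms by (intro nrm_pos) auto
  hence "(1 / nrm n v) *\<^sub>R v \<in> E" "(1 / nrm n v) *\<^sub>R v \<in> unit_sphere n"
    using v assms by (auto simp: unit_sphere_iff intro!: subspace_scale Rn_closed_ops(4))
  thus ?thesis using that by blast
qed

text \<open>Induction on the dimension. A reflection moves a unit vector of \<open>E\<close> to the
  last axis; the image of \<open>E\<close> is then the sum of this axis and its intersection with
  \<open>Rn n\<close>, which the induction hypothesis rotates.\<close>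

lemma subspace_rotate:
  assumes "subspace E" "E \<subseteq> Rn n"
  shows "\<exists>m\<le>n. \<exists>U. iso_onto n n (Rn n) U \<and> U ` tail_space n m = E"
  using assms
proof (induction n arbitrary: E)
  case 0
  have "E = {0}" using 0 subspace_0 by (force simp: Rn_iff)
  moreover have "tail_space 0 0 = {0}" by (auto simp: tail_space_def Rn_iff)
  ultimately show ?case using iso_onto_id[of 0] by auto
next
  case (Suc n)
  show ?case
  proof (cases "E = {0}")
    case True
    moreover have "tail_space (Suc n) 0 = {0}"
      by (auto simp: tail_space_def Rn_iff fun_eq_iff) (metis not_le)
    ultimately show ?thesis using iso_onto_id[of "Suc n"] by (metis image_ident le0)
  next
    case False
    obtain u where u: "u \<in> E" "u \<in> unit_sphere (Suc n)"
      using unit_vec_in_subspace[OF Suc.prems False] .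
    let ?e = "axis_vec n"
    have e: "?e \<in> unit_sphere (Suc n)" by (auto simp: unit_sphere_iff axis_vec_in_Rn nrm_axis)
    define H where "H = householder (Suc n) (u - ?e)"
    have HH: "H (H x) = x" for x by (simp add: H_def householder_involution)
    have Hu: "H u = ?e" unfolding H_def by (rule householder_swap[OF u(2) e])
    have Hiso: "iso_onto (Suc n) (Suc n) (Rn (Suc n)) H"
      unfolding H_def by (rule householder_iso_onto) (use u e in \<open>auto simp: unit_sphere_iff\<close>)
    define E1 where "E1 = H ` E"
    have E1: "subspace E1" "E1 \<subseteq> Rn (Suc n)" "?e \<in> E1"
    proof -
      show "subspace E1" unfolding E1_def
        by (rule linear_subspace_image[OF iso_onto_linear[OF Hiso] Suc.prems(1)])
      show "E1 \<subseteq> Rn (Suc n)" using Suc.prems(2) iso_onto_mem[OF Hiso] by (auto simp: E1_def)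
      show "?e \<in> E1" unfolding E1_def Hu[symmetric] by (rule imageI[OF u(1)])
    qed
    have "subspace (E1 \<inter> Rn n)" by (intro subspace_inter E1 Rn_subspace)
    then obtain m U' where m: "m \<le> n" and U': "iso_onto n n (Rn n) U'" "U' ` tail_space n m = E1 \<inter> Rn n"
      using Suc.IH[of "E1 \<inter> Rn n"] by auto
    note linU' = iso_onto_linear[OF U'(1)]
    \<comment> \<open>\<open>U'\<close> extended to the next dimension by fixing the last
      axis.\<close>
    define V where "V x = U' (trunc n x) + x n *\<^sub>R ?e" for x
    have linV: "linear V"
      by (rule linearI)
         (simp_all add: V_def linear_add[OF linear_trunc] linear_add[OF linU']
            linear_scale[OF linear_trunc] linear_scale[OF linU'] scaleR_add_left scaleR_add_right)
    have U'_Rn: "U' (trunc n x) \<in> Rn n" for x using iso_onto_mem[OF U'(1), of "trunc n x"] by simp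
    have V_upd: "V x = (U' (trunc n x))(n := x n)" for x
      using U'_Rn[of x] by (auto simp: V_def axis_vec_def Rn_iff fun_eq_iff)
    have V_surj: "V (z(n := y n)) = y" if "y \<in> Rn (Suc n)" "z \<in> Rn n" "U' z = trunc n y" for y z
    proof -
      have "trunc n (z(n := y n)) = z" using that(2) by (auto simp: trunc_def Rn_iff fun_eq_iff)
      thus ?thesis using that by (auto simp: V_upd trunc_def Rn_iff fun_eq_iff)
    qed
    have Viso: "iso_onto (Suc n) (Suc n) (Rn (Suc n)) V"
      unfolding iso_onto_def
    proof (intro conjI ballI linV)
      show "V ` Rn (Suc n) = Rn (Suc n)"
      proof (intro equalityI subsetI)
        fix y assume y: "y \<in> Rn (Suc n)"
        obtain z where z: "z \<in> Rn n" "U' z = trunc n y"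
          using U'(1) trunc_in_Rn[of n y] unfolding iso_onto_def by (metis imageE)
        show "y \<in> V ` Rn (Suc n)" using V_surj[OF y z] Rn_Suc_upd[OF z(1)] by (metis imageI)
      qed (use U'_Rn in \<open>auto simp: V_upd intro: Rn_Suc_upd\<close>)
      fix x assume "x \<in> Rn (Suc n)"
      have "dot (Suc n) (V x) (V x) = dot n (U' (trunc n x)) (U' (trunc n x)) + x n * x n"
        unfolding V_upd by (rule dot_upd)
      also have "dot n (U' (trunc n x)) (U' (trunc n x)) = dot n x x"
        by (subst iso_onto_dot[OF U'(1)]) auto
      finally show "dot (Suc n) (V x) (V x) = dot (Suc n) x x" by (simp add: dot_def)
    qed simp
    have "V ` tail_space (Suc n) (Suc m) = E1"
    proof (intro equalityI subsetI)
      fix y assume "y \<in> V ` tail_space (Suc n) (Suc m)"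
      then obtain x where x: "x \<in> tail_space (Suc n) (Suc m)" "y = V x" by auto
      have "trunc n x \<in> tail_space n m" using x(1) by (auto simp: tail_space_def) (simp add: trunc_def)
      hence "U' (trunc n x) \<in> E1" using U'(2) by blast
      thus "y \<in> E1" unfolding x V_def by (intro subspace_add subspace_scale E1)
    next
      fix y assume y: "y \<in> E1"
      hence yR: "y \<in> Rn (Suc n)" using E1 by auto
      have "y - y n *\<^sub>R ?e \<in> E1" by (intro subspace_diff subspace_scale E1 y)
      also have "y - y n *\<^sub>R ?e = trunc n y"
        using yR by (auto simp: fun_eq_iff axis_vec_def trunc_def Rn_iff)
      finally have "trunc n y \<in> U' ` tail_space n m" using U'(2) by simp
      then obtain z where z: "z \<in> tail_space n m" "U' z = trunc n y" by (metis imageE)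
      have "z(n := y n) \<in> tail_space (Suc n) (Suc m)"
        using z(1) by (auto simp: tail_space_def Rn_iff)
      moreover have "V (z(n := y n)) = y" using z yR by (intro V_surj) (auto simp: tail_space_def)
      ultimately show "y \<in> V ` tail_space (Suc n) (Suc m)" by (metis imageI)
    qed
    hence "(\<lambda>x. H (V x)) ` tail_space (Suc n) (Suc m) = E"
      by (simp add: image_image[symmetric] E1_def) (simp add: image_image HH)
    moreover have "iso_onto (Suc n) (Suc n) (Rn (Suc n)) (\<lambda>x. H (V x))"
      by (rule iso_onto_compose[OF Viso Hiso])
    ultimately show ?thesis using m by (intro exI[of _ "Suc m"]) auto
  qed
qed

section \<open>Dimensions and parametrisations of subspaces\<close>

lemma dim_tail_space:
  assumes "m \<le> n" shows "dim (tail_space n m) = m"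
proof (rule dim_unique)
  let ?B = "axis_vec ` {n-m..<n}"
  have inj: "inj_on axis_vec A" for A by (auto simp: inj_on_def axis_vec_def fun_eq_iff split: if_splits)
  show "?B \<subseteq> tail_space n m" by (auto simp: tail_space_def axis_vec_in_Rn) (simp add: axis_vec_def)
  show "card ?B = m" using assms by (simp add: card_image[OF inj])
  show "tail_space n m \<subseteq> span ?B"
  proof
    fix x assume x: "x \<in> tail_space n m"
    have "x = (\<Sum>i<n. x i *\<^sub>R axis_vec i)" using x by (intro Rn_expand) (auto simp: tail_space_def)
    also have "\<dots> \<in> span ?B"
    proof (rule span_sum)
      fix i assume "i \<in> {..<n}"
      thus "x i *\<^sub>R axis_vec i \<in> span ?B"
        using x by (cases "i < n - m") (auto simp: tail_space_def span_zero intro!: span_scale[OF span_base])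
    qed
    finally show "x \<in> span ?B" .
  qed
  show "independent ?B"
    unfolding independent_explicit_finite_subsets
  proof (intro allI impI ballI)
    fix A u v assume A: "A \<subseteq> ?B" "finite A" "(\<Sum>v\<in>A. u v *\<^sub>R v) = 0" "v \<in> A"
    then obtain i where i: "v = axis_vec i" by auto
    have "0 = (\<Sum>v\<in>A. u v *\<^sub>R v) i" using A by simp
    also have "\<dots> = (\<Sum>w\<in>A. u w * w i)" by (simp add: sum_fun_apply)
    also have "\<dots> = (\<Sum>w\<in>A. if w = v then u v else 0)"
    proof (rule sum.cong[OF refl])
      fix w assume "w \<in> A"
      then obtain j where j: "w = axis_vec j" using A(1) by auto
      have "axis_vec j = axis_vec i \<longleftrightarrow> j = i" using inj[of UNIV] by (auto simp: inj_on_def)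
      thus "u w * w i = (if w = v then u v else 0)" by (simp add: i j) (simp add: axis_vec_def)
    qed
    also have "\<dots> = u v" using A by simp
    finally show "u v = 0" by simp
  qed
qed

lemma dim_iso_image:
  assumes U: "iso_onto n l F U" and "E \<subseteq> Rn n" "subspace E"
  shows "dim (U ` E) = dim E"
proof -
  note lin = iso_onto_linear[OF U]
  obtain B where B: "B \<subseteq> E" "independent B" "E \<subseteq> span B" "card B = dim E"
    using basis_exists[of E] by blast
  have "span B \<subseteq> E" using B(1) assms(3) by (rule span_minimal)
  hence inj: "inj_on U (span B)" using assms(2) iso_onto_inj[OF U] unfolding inj_on_def by blast
  show ?thesis
  proof (rule dim_unique)
    show "U ` B \<subseteq> U ` E" using B by auto
    show "U ` E \<subseteq> span (U ` B)" using B(3) by (auto simp: linear_span_image[OF lin])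
    show "independent (U ` B)" by (rule linear_independent_injective_image[OF lin B(2) inj])
    show "card (U ` B) = dim E"
      using B(4) inj span_superset[of B] by (subst card_image) (auto intro: inj_on_subset)
  qed
qed

lemma grassmannian_rotate:
  assumes "E \<in> grassmannian n m"
  obtains U where "m \<le> n" "iso_onto n n (Rn n) U" "U ` tail_space n m = E"
proof -
  obtain j U where j: "j \<le> n" "iso_onto n n (Rn n) U" "U ` tail_space n j = E"
    using subspace_rotate[of E n] assms by (auto simp: grassmannian_def)
  have "m = dim E" using assms by (simp add: grassmannian_def)
  also have "\<dots> = j"
    using dim_iso_image[OF j(2), of "tail_space n j"] j subspace_tail_space[of n j] dim_tail_space[OF j(1)]
    by (simp add: tail_space_def)
  finally show ?thesis using j that by blast
qed

lemma grassmannian_section: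
  assumes "m \<le> n" "iso_onto n n (Rn n) U" "U ` tail_space n m = E"
  shows "iso_onto m n E (\<lambda>x. U (shift_by (n - m) x))"
proof -
  note S = iso_onto_shift_by[OF assms(1)]
  have "linear (U \<circ> shift_by (n - m))"
    by (intro linear_compose iso_onto_linear[OF S] iso_onto_linear[OF assms(2)])
  moreover have "(\<lambda>x. U (shift_by (n - m) x)) ` Rn m = E"
    using S assms(3) by (auto simp: iso_onto_def image_image[symmetric])
  moreover have "E \<subseteq> Rn n" using assms iso_onto_mem[OF assms(2)] by (auto simp: tail_space_def)
  moreover have "dot n (U (shift_by (n - m) x)) (U (shift_by (n - m) x)) = dot m x x" if "x \<in> Rn m" for x
    using iso_onto_mem[OF S that] iso_onto_dot[OF S that that]
    by (simp add: iso_onto_dot[OF assms(2)])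
  ultimately show ?thesis by (auto simp: iso_onto_def o_def)
qed

text \<open>Surjectivity is a matter of dimension: the image is an \<open>n\<close>-dimensional
  subspace of \<open>Rn n\<close>, hence a rotated copy of \<open>Rn n\<close>, which is
  \<open>Rn n\<close> itself.\<close>

lemma iso_ontoI:
  assumes "linear T" "T ` Rn n \<subseteq> Rn n" "\<And>x. x \<in> Rn n \<Longrightarrow> dot n (T x) (T x) = dot n x x"
  shows "iso_onto n n (Rn n) T"
proof -
  have T: "iso_onto n n (T ` Rn n) T" using assms by (auto simp: iso_onto_def)
  have "dim (T ` Rn n) = n"
    using dim_iso_image[OF T, of "Rn n"] dim_tail_space[of n n] Rn_subspace by (simp add: tail_space_full)
  hence "T ` Rn n \<in> grassmannian n n"
    using assms iso_onto_subspace[OF T] by (auto simp: grassmannian_def)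
  then obtain U where "iso_onto n n (Rn n) U" "U ` tail_space n n = T ` Rn n"
    by (rule grassmannian_rotate)
  hence "T ` Rn n = Rn n" by (auto simp: tail_space_full iso_onto_def)
  thus ?thesis using assms by (auto simp: iso_onto_def)
qed

lemma rotate_axis:
  assumes "v \<in> unit_sphere n" "i < n"
  obtains U where "iso_onto n n (Rn n) U" "U (axis_vec i) = v"
proof
  have e: "axis_vec i \<in> unit_sphere n" using assms(2) by (simp add: unit_sphere_iff axis_vec_in_Rn nrm_axis)
  show "iso_onto n n (Rn n) (householder n (axis_vec i - v))"
    by (rule householder_iso_onto) (use assms e in \<open>auto simp: unit_sphere_iff\<close>)
  show "householder n (axis_vec i - v) (axis_vec i) = v" by (rule householder_swap[OF e assms(1)])
qed

section \<open>Symmetric convex bodies and their norms\<close>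

lemma Euclidean_space_euclidean: "Euclidean_space n = top_of_set {x. \<forall>i\<ge>n. x i = 0}"
  by (simp add: Euclidean_space_def euclidean_product_topology)

lemma compactin_Euclidean: "compactin (Euclidean_space n) K \<longleftrightarrow> compact K \<and> K \<subseteq> Rn n"
  by (simp add: Euclidean_space_euclidean compactin_subtopology)

lemma continuous_nrm: "continuous_on S (\<lambda>x::nat \<Rightarrow> real. nrm n x)"
  using continuous_on_subset[OF continuous_nrm_diff[of n 0], of S] by simp

lemma nrm_lipschitz_continuous:
  fixes f :: "(nat \<Rightarrow> real) \<Rightarrow> real"
  assumes "\<And>x y. \<bar>f x - f y\<bar> \<le> L * nrm n (x - y)"
  shows "continuous_on S f"
proof (rule continuous_on_subset[OF _ subset_UNIV])
  show "continuous_on UNIV f"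
    unfolding continuous_on_def
  proof
    fix x :: "nat \<Rightarrow> real"
    have "((\<lambda>y. nrm n (x - y)) \<longlongrightarrow> nrm n (x - x)) (at x)"
      using continuous_nrm_diff[of n x] unfolding continuous_on_def by blast
    hence "((\<lambda>y. L * nrm n (x - y)) \<longlongrightarrow> L * nrm n (x - x)) (at x)" by (intro tendsto_mult tendsto_const)
    hence lim: "((\<lambda>y. L * nrm n (x - y)) \<longlongrightarrow> 0) (at x)" by simp
    have "((\<lambda>y. f y - f x) \<longlongrightarrow> 0) (at x)"
      by (rule Lim_null_comparison[OF _ lim]) (use assms in \<open>auto simp: abs_minus_commute nrm_diff_commute\<close>)
    thus "(f \<longlongrightarrow> f x) (at x)" by (simp add: LIM_zero_iff)
  qed
qed

text \<open>On \<open>Rn n\<close> the product topology is the Euclidean one: from index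
  \<open>n\<close> on two points agree, and below \<open>n\<close> only finitely many radii have to
  be respected.\<close>

lemma open_nrm_ball:
  assumes "open V" "x \<in> V" "x \<in> Rn n"
  obtains e where "0 < e" "\<And>y. y \<in> Rn n \<Longrightarrow> nrm n (y - x) < e \<Longrightarrow> y \<in> V"
proof -
  have "openin (product_topology (\<lambda>i. euclideanreal) UNIV) V"
    using assms(1) by (simp add: euclidean_product_topology)
  from product_topology_open_contains_basis[OF this assms(2)]
  obtain X where X: "x \<in> (\<Pi>\<^sub>E i\<in>UNIV. X i)" "\<And>i. openin euclideanreal (X i)" "(\<Pi>\<^sub>E i\<in>UNIV. X i) \<subseteq> V"
    by blast
  have "\<exists>e>0. \<forall>t. \<bar>t - x i\<bar> < e \<longrightarrow> t \<in> X i" for i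
  proof -
    have "open (X i)" "x i \<in> X i" using X by auto
    thus ?thesis unfolding open_dist by (auto simp: dist_real_def)
  qed
  then obtain e where e: "\<And>i. 0 < e i" "\<And>i t. \<bar>t - x i\<bar> < e i \<Longrightarrow> t \<in> X i" by metis
  define d where "d = Min (insert 1 (e ` {..<n}))"
  have d: "0 < d" "\<And>i. i < n \<Longrightarrow> d \<le> e i" using e(1) by (auto simp: d_def)
  show ?thesis
  proof (rule that[OF d(1)])
    fix y assume y: "y \<in> Rn n" "nrm n (y - x) < d"
    have "y i \<in> X i" for i
    proof (cases "i < n")
      case True
      hence "\<bar>(y - x) i\<bar> < e i" using coord_le_nrm[OF True, of "y - x"] y(2) d(2)[OF True] by linarith
      thus ?thesis using e(2) by simp
    next
      case False
      hence "y i = x i" using y assms by (simp add: Rn_iff)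
      thus ?thesis using X(1) by auto
    qed
    thus "y \<in> V" using X(3) by auto
  qed
qed

definition sym_body :: "nat \<Rightarrow> (nat \<Rightarrow> real) set \<Rightarrow> bool" where
  "sym_body n K \<longleftrightarrow> convex_body n K \<and> centrally_symmetric K"

lemma sym_body_uminus: "sym_body n K \<Longrightarrow> x \<in> K \<Longrightarrow> - x \<in> K"
  by (simp add: sym_body_def centrally_symmetric_def)

lemma sym_body_convex: "sym_body n K \<Longrightarrow> convex K"
  by (simp add: sym_body_def convex_body_def)

lemma sym_body_compact: "sym_body n K \<Longrightarrow> compact K" "sym_body n K \<Longrightarrow> K \<subseteq> Rn n"
  by (simp_all add: sym_body_def convex_body_def compactin_Euclidean)

lemma sym_body_closed: "sym_body n K \<Longrightarrow> closed K"
  using sym_body_compact(1) by (rule compact_imp_closed)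

lemma sym_body_borel [measurable]: "sym_body n K \<Longrightarrow> K \<in> sets borel"
  using sym_body_closed by (rule borel_closed)

text \<open>Symmetry and convexity turn a ball about an interior point into a ball about the origin,
  as \<open>y\<close> is the midpoint of \<open>x + y\<close> and \<open>- (x - y)\<close>.\<close>

lemma sym_body_bounds:
  assumes K: "sym_body n K"
  obtains d R where "0 < d" "0 < R" "\<And>y. y \<in> Rn n \<Longrightarrow> nrm n y \<le> d \<Longrightarrow> y \<in> K"
    "\<And>y. y \<in> K \<Longrightarrow> nrm n y \<le> R"
proof -
  note KR = sym_body_compact[OF K]
  have "Euclidean_space n interior_of K \<noteq> {}" using K by (simp add: sym_body_def convex_body_def)
  then obtain x U where U: "x \<in> U" "openin (Euclidean_space n) U" "U \<subseteq> K" by (auto simp: interior_of_def)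
  then obtain V where V: "open V" "U = Rn n \<inter> V"
    by (auto simp: Euclidean_space_euclidean openin_open)
  have x: "x \<in> Rn n" "x \<in> V" using U V by auto
  obtain e where e: "0 < e" "\<And>y. y \<in> Rn n \<Longrightarrow> nrm n (y - x) < e \<Longrightarrow> y \<in> V"
    using open_nrm_ball[OF V(1) x(2,1)] by blast
  have d: "y \<in> K" if y: "y \<in> Rn n" "nrm n y \<le> e / 2" for y
  proof -
    have "x + y \<in> K" using e(2)[of "x + y"] e(1) x y U V by auto
    moreover have "x - y \<in> K" using e(2)[of "x - y"] e(1) x y U V by (auto simp: nrm_diff_commute)
    hence "- (x - y) \<in> K" by (rule sym_body_uminus[OF K])
    ultimately have "(1/2) *\<^sub>R (x + y) + (1/2) *\<^sub>R (- (x - y)) \<in> K"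
      by (intro convexD[OF sym_body_convex[OF K]]) auto
    also have "(1/2) *\<^sub>R (x + y) + (1/2) *\<^sub>R (- (x - y)) = y" by (auto simp: fun_eq_iff field_simps)
    finally show ?thesis .
  qed
  have "compact (nrm n ` K)" by (rule compact_continuous_image[OF continuous_nrm KR(1)])
  hence "bounded (nrm n ` K)" by (rule compact_imp_bounded)
  then obtain R where "\<forall>t\<in>nrm n ` K. norm t \<le> R" by (auto simp: bounded_iff)
  hence R: "nrm n y \<le> max 1 R" if "y \<in> K" for y using that by fastforce
  show ?thesis by (rule that[of "e / 2" "max 1 R"]) (use e d R in auto)
qed

lemma norm_of_aux:
  assumes K: "sym_body n K" and x: "x \<in> Rn n"
  shows norm_of_nonneg: "0 \<le> norm_of K x"
    and norm_of_le_iff: "0 < t \<Longrightarrow> norm_of K x \<le> t \<longleftrightarrow> (1 / t) *\<^sub>R x \<in> K"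
proof -
  obtain d R where d: "0 < d" "0 < R" "\<And>y. y \<in> Rn n \<Longrightarrow> nrm n y \<le> d \<Longrightarrow> y \<in> K"
    "\<And>y. y \<in> K \<Longrightarrow> nrm n y \<le> R" using sym_body_bounds[OF K] by metis
  let ?A = "{t. 0 < t \<and> (1 / t) *\<^sub>R x \<in> K}"
  have zero: "0 \<in> K" using d(1) d(3)[of 0] by simp
  have ne: "nrm n x / d + 1 \<in> ?A"
  proof -
    have p: "0 < nrm n x / d + 1" using d(1) nrm_nonneg[of n x] by (simp add: add_nonneg_pos)
    have "1 * nrm n x \<le> (nrm n x / d + 1) * d" using d(1) by (simp add: field_simps)
    hence "nrm n x / (nrm n x / d + 1) \<le> d" using p by (simp add: pos_divide_le_eq mult.commute)
    thus ?thesis using p x by (auto intro!: d(3) Rn_closed_ops(4) simp: abs_of_pos)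
  qed
  have bdd: "bdd_below ?A" by (intro bdd_belowI[of _ 0]) auto
  show "0 \<le> norm_of K x" unfolding norm_of_def using ne by (intro cInf_greatest) auto
  have up: "(1 / t) *\<^sub>R x \<in> K" if "s \<in> ?A" "s \<le> t" for s t
  proof -
    have "(s / t) *\<^sub>R ((1 / s) *\<^sub>R x) + (1 - s / t) *\<^sub>R 0 \<in> K"
      by (rule convexD[OF sym_body_convex[OF K]]) (use that zero in auto)
    thus ?thesis using that by simp
  qed
  assume t: "0 < t"
  show "norm_of K x \<le> t \<longleftrightarrow> (1 / t) *\<^sub>R x \<in> K"
  proof
    assume "(1 / t) *\<^sub>R x \<in> K"
    thus "norm_of K x \<le> t" unfolding norm_of_def using t by (intro cInf_lower bdd) auto
  next
    assume le: "norm_of K x \<le> t"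
    \<comment> \<open>Closedness along the ray: the infimum in \<open>norm_of\<close> is attained,
      so the equivalence holds with \<open>\<le>\<close> and not merely with
      \<open><\<close>.\<close>
    let ?C = "(\<lambda>c. c *\<^sub>R x) -` K"
    have "continuous_on UNIV (\<lambda>c. c *\<^sub>R x)"
      by (rule continuous_on_coordinatewise_then_product) (simp add: continuous_intros)
    hence closed: "closed ?C" by (intro continuous_closed_vimage sym_body_closed[OF K]) (auto simp: continuous_on_eq_continuous_at)
    have "{0<..<1/t} \<subseteq> ?C"
    proof
      fix c assume c: "c \<in> {0<..<1/t}"
      hence "t < 1 / c" using t by (simp add: field_simps)
      hence "Inf ?A < 1 / c" using le by (simp add: norm_of_def)
      moreover have "?A \<noteq> {}" using ne by blast
      ultimately obtain s where "s \<in> ?A" "s < 1 / c" by (auto simp: cInf_less_iff[OF _ bdd])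
      hence "(1 / (1 / c)) *\<^sub>R x \<in> K" by (intro up) auto
      thus "c \<in> ?C" by simp
    qed
    hence "closure {0<..<1/t} \<subseteq> ?C" using closed by (rule closure_minimal)
    hence "1 / t \<in> ?C" using t by (auto simp: closure_greaterThanLessThan subset_iff)
    thus "(1 / t) *\<^sub>R x \<in> K" by simp
  qed
qed

lemma norm_of_le_1_iff: "sym_body n K \<Longrightarrow> x \<in> Rn n \<Longrightarrow> norm_of K x \<le> 1 \<longleftrightarrow> x \<in> K"
  using norm_of_le_iff[of n K x 1] by simp

lemma norm_of_le: "sym_body n K \<Longrightarrow> x \<in> K \<Longrightarrow> norm_of K x \<le> 1"
  using norm_of_le_1_iff sym_body_compact(2) by blast

lemma norm_of_equiv:
  assumes K: "sym_body n K"
  obtains a b where "0 < a" "0 < b" "\<And>x. x \<in> Rn n \<Longrightarrow> a * nrm n x \<le> norm_of K x"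
    "\<And>x. x \<in> Rn n \<Longrightarrow> norm_of K x \<le> b * nrm n x"
proof -
  obtain d R where d: "0 < d" "0 < R" "\<And>y. y \<in> Rn n \<Longrightarrow> nrm n y \<le> d \<Longrightarrow> y \<in> K"
    "\<And>y. y \<in> K \<Longrightarrow> nrm n y \<le> R" using sym_body_bounds[OF K] by metis
  have le: "norm_of K x \<le> (1 / d) * nrm n x" if x: "x \<in> Rn n" for x
  proof (cases "x = 0")
    case True
    have "norm_of K x \<le> 0 + e" if "0 < e" for e
      using that d True norm_of_le_iff[OF K x that] by simp
    thus ?thesis using True field_le_epsilon[of "norm_of K x" 0] by simp
  next
    case False
    hence "0 < nrm n x" by (rule nrm_pos[OF x])
    moreover from this have "(1 / (nrm n x / d)) *\<^sub>R x \<in> K"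
      using d(1) x by (intro d(3) Rn_closed_ops(4)) auto
    ultimately show ?thesis using norm_of_le_iff[OF K x, of "nrm n x / d"] d(1) by simp
  qed
  have ge: "(1 / R) * nrm n x \<le> norm_of K x" if x: "x \<in> Rn n" for x
  proof (rule field_le_epsilon)
    fix e :: real assume e: "0 < e"
    let ?t = "norm_of K x + e"
    have t: "0 < ?t" using e norm_of_nonneg[OF K x] by simp
    hence "(1 / ?t) *\<^sub>R x \<in> K" using norm_of_le_iff[OF K x t] e by simp
    hence "nrm n ((1 / ?t) *\<^sub>R x) \<le> R" by (rule d(4))
    hence "nrm n x \<le> R * ?t" using t by (simp add: field_simps)
    thus "(1 / R) * nrm n x \<le> norm_of K x + e" using d(2) by (simp add: field_simps)
  qed
  show ?thesis by (rule that[OF _ _ ge le]) (use d in auto)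
qed

lemma norm_of_zero: "sym_body n K \<Longrightarrow> norm_of K 0 = 0"
  by (rule norm_of_equiv[of n K]) (use Rn_closed_ops(5)[of n] nrm_zero[of n] in fastforce)+

lemma norm_of_pos: "sym_body n K \<Longrightarrow> x \<in> Rn n \<Longrightarrow> x \<noteq> 0 \<Longrightarrow> 0 < norm_of K x"
  by (rule norm_of_equiv[of n K]) (auto intro: less_le_trans[OF mult_pos_pos] nrm_pos)

lemma norm_of_scale_pos:
  assumes K: "sym_body n K" and x: "x \<in> Rn n" and c: "0 < c"
  shows "norm_of K (c *\<^sub>R x) = c * norm_of K x"
proof -
  have le: "norm_of K (c *\<^sub>R x) \<le> c * norm_of K x" if x: "x \<in> Rn n" and c: "0 < c" for x c
  proof (cases "x = 0")
    case True thus ?thesis using norm_of_zero[OF K] by simp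
  next
    case False
    have p: "0 < norm_of K x" by (rule norm_of_pos[OF K x False])
    have "(1 / norm_of K x) *\<^sub>R x \<in> K" using norm_of_le_iff[OF K x p] by simp
    thus ?thesis using norm_of_le_iff[OF K Rn_closed_ops(4)[OF x], of "c * norm_of K x" c] c p by simp
  qed
  have "norm_of K ((1 / c) *\<^sub>R (c *\<^sub>R x)) \<le> (1 / c) * norm_of K (c *\<^sub>R x)"
    by (rule le) (use x c in auto)
  hence "c * norm_of K x \<le> norm_of K (c *\<^sub>R x)" using c by (simp add: field_simps)
  thus ?thesis using le[OF x c] by simp
qed

lemma norm_of_minus:
  assumes K: "sym_body n K" and x: "x \<in> Rn n" shows "norm_of K (- x) = norm_of K x"
proof -
  have "(1 / t) *\<^sub>R (- x) \<in> K \<longleftrightarrow> (1 / t) *\<^sub>R x \<in> K" for t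
    using sym_body_uminus[OF K, of "(1 / t) *\<^sub>R x"] sym_body_uminus[OF K, of "(1 / t) *\<^sub>R (- x)"]
    by (auto simp: scaleR_minus_right)
  thus ?thesis by (simp only: norm_of_def)
qed

lemma norm_of_scale:
  assumes K: "sym_body n K" and x: "x \<in> Rn n"
  shows "norm_of K (c *\<^sub>R x) = \<bar>c\<bar> * norm_of K x"
proof -
  consider "0 < c" | "c = 0" | "0 < - c" by linarith
  thus ?thesis
  proof cases
    case 3
    have "norm_of K (c *\<^sub>R x) = norm_of K (- ((- c) *\<^sub>R x))" by simp
    also have "\<dots> = norm_of K ((- c) *\<^sub>R x)" by (rule norm_of_minus[OF K Rn_closed_ops(4)[OF x]])
    also have "\<dots> = (- c) * norm_of K x" by (rule norm_of_scale_pos[OF K x 3])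
    finally show ?thesis using 3 by simp
  qed (use norm_of_scale_pos[OF K x] norm_of_zero[OF K] in auto)
qed

lemma norm_of_triangle:
  assumes K: "sym_body n K" and x: "x \<in> Rn n" and y: "y \<in> Rn n"
  shows "norm_of K (x + y) \<le> norm_of K x + norm_of K y"
proof (cases "x = 0 \<or> y = 0")
  case True thus ?thesis using norm_of_zero[OF K] by auto
next
  case False
  let ?s = "norm_of K x" and ?t = "norm_of K y"
  have p: "0 < ?s" "0 < ?t" using False norm_of_pos[OF K] x y by auto
  have "(1 / ?s) *\<^sub>R x \<in> K" "(1 / ?t) *\<^sub>R y \<in> K"
    using norm_of_le_iff[OF K x p(1)] norm_of_le_iff[OF K y p(2)] by auto
  hence "(?s / (?s + ?t)) *\<^sub>R ((1 / ?s) *\<^sub>R x) + (?t / (?s + ?t)) *\<^sub>R ((1 / ?t) *\<^sub>R y) \<in> K"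
    by (rule convexD[OF sym_body_convex[OF K]]) (use p in \<open>auto simp: add_divide_distrib[symmetric]\<close>)
  hence "(1 / (?s + ?t)) *\<^sub>R (x + y) \<in> K" using p by (simp add: scaleR_add_right)
  thus ?thesis using norm_of_le_iff[OF K Rn_closed_ops(1)[OF x y], of "?s + ?t"] p by simp
qed

lemma norm_of_lipschitz:
  assumes K: "sym_body n K"
  obtains L where "0 < L" "\<And>x y. \<bar>norm_of K (trunc n x) - norm_of K (trunc n y)\<bar> \<le> L * nrm n (x - y)"
proof -
  obtain a b where ab: "0 < a" "0 < b" "\<And>x. x \<in> Rn n \<Longrightarrow> a * nrm n x \<le> norm_of K x"
    "\<And>x. x \<in> Rn n \<Longrightarrow> norm_of K x \<le> b * nrm n x" using norm_of_equiv[OF K] by blast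
  have one: "norm_of K (trunc n x) - norm_of K (trunc n y) \<le> b * nrm n (x - y)" for x y
  proof -
    have t: "trunc n x = trunc n y + trunc n (x - y)" by (auto simp: trunc_def fun_eq_iff)
    have "norm_of K (trunc n x) \<le> norm_of K (trunc n y) + norm_of K (trunc n (x - y))"
      unfolding t by (rule norm_of_triangle[OF K]) auto
    also have "norm_of K (trunc n (x - y)) \<le> b * nrm n (x - y)" using ab(4)[of "trunc n (x - y)"] by simp
    finally show ?thesis by simp
  qed
  have "\<bar>norm_of K (trunc n x) - norm_of K (trunc n y)\<bar> \<le> b * nrm n (x - y)" for x y
    using one[of x y] one[of y x] by (simp add: abs_le_iff nrm_diff_commute)
  thus ?thesis using that ab by blast
qed

lemma norm_of_continuous: "sym_body n K \<Longrightarrow> continuous_on S (\<lambda>x. norm_of K (trunc n x))"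
  using norm_of_lipschitz nrm_lipschitz_continuous by metis

lemma norm_of_measurable: "sym_body n K \<Longrightarrow> (\<lambda>x. norm_of K (trunc n x)) \<in> borel_measurable borel"
  using norm_of_continuous by (rule borel_measurable_continuous_onI)

lemma radial_eq:
  assumes K: "sym_body n K" and x: "x \<in> Rn n" "x \<noteq> 0"
  shows "radial K x = 1 / norm_of K x"
proof -
  have p: "0 < norm_of K x" by (rule norm_of_pos[OF K x])
  have "{r. 0 \<le> r \<and> r *\<^sub>R x \<in> K} = {0..1 / norm_of K x}"
    using p x by (auto simp: norm_of_le_1_iff[OF K, symmetric] Rn_closed_ops(4) norm_of_scale[OF K x(1)] field_simps)
  thus ?thesis using p by (simp add: radial_def)
qed

lemma sym_body_of_norm:
  assumes ab: "0 < a" "0 < b"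
    and N: "\<And>x. x \<in> Rn k \<Longrightarrow> a * nrm k x \<le> N x" "\<And>x. x \<in> Rn k \<Longrightarrow> N x \<le> b * nrm k x"
    "\<And>x c. x \<in> Rn k \<Longrightarrow> N (c *\<^sub>R x) = \<bar>c\<bar> * N x"
    "\<And>x y. x \<in> Rn k \<Longrightarrow> y \<in> Rn k \<Longrightarrow> N (x + y) \<le> N x + N y"
  shows "sym_body k {x \<in> Rn k. N x \<le> 1}" (is "sym_body k ?K")
proof -
  have one: "N (trunc k x) - N (trunc k y) \<le> b * nrm k (x - y)" for x y
  proof -
    have t: "trunc k x = trunc k y + trunc k (x - y)" by (auto simp: trunc_def fun_eq_iff)
    have "N (trunc k x) \<le> N (trunc k y) + N (trunc k (x - y))"
      unfolding t by (rule N(4)) auto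
    also have "N (trunc k (x - y)) \<le> b * nrm k (x - y)" using N(2)[of "trunc k (x - y)"] by simp
    finally show ?thesis by simp
  qed
  have "\<bar>N (trunc k x) - N (trunc k y)\<bar> \<le> b * nrm k (x - y)" for x y
    using one[of x y] one[of y x] by (simp add: abs_le_iff nrm_diff_commute)
  hence cont: "continuous_on UNIV (\<lambda>x. N (trunc k x))" by (rule nrm_lipschitz_continuous)
  have "closed (Rn k)" using closedin_Euclidean_space[of k] by (simp add: euclidean_product_topology)
  moreover have "closed {x. N (trunc k x) \<le> 1}"
    by (rule closed_Collect_le[OF cont continuous_on_const])
  moreover have eq: "?K = Rn k \<inter> {x. N (trunc k x) \<le> 1}"
    using trunc_id by auto
  ultimately have cl: "closed ?K" by (metis closed_Int)
  \<comment> \<open>The body is a closed subset of a product of compact intervals, trivial from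
    index \<open>k\<close> on; Tychonoff's theorem makes it compact.\<close>
  define X where "X i = (if i < k then {-1/a..1/a} else {0::real})" for i
  have "compactin (product_topology (\<lambda>i. euclideanreal) UNIV) (\<Pi>\<^sub>E i\<in>UNIV. X i)"
    unfolding compactin_PiE by (auto simp: X_def)
  hence cX: "compact (\<Pi>\<^sub>E i\<in>UNIV. X i)" by (simp add: euclidean_product_topology)
  have "?K \<subseteq> (\<Pi>\<^sub>E i\<in>UNIV. X i)"
  proof (intro subsetI PiE_I)
    fix x i assume x: "x \<in> ?K"
    hence "a * nrm k x \<le> 1" using N(1)[of x] by auto
    hence "nrm k x \<le> 1 / a" using ab by (simp add: field_simps)
    thus "x i \<in> X i" using x coord_le_nrm[of i k x] by (auto simp: X_def Rn_iff abs_le_iff)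
  qed simp
  hence "(\<Pi>\<^sub>E i\<in>UNIV. X i) \<inter> ?K = ?K" by blast
  with compact_Int_closed[OF cX cl] have comp: "compact ?K" by (simp only:)
  have conv: "convex ?K"
  proof (rule convexI)
    fix x y :: "nat \<Rightarrow> real" and u v :: real
    assume a: "x \<in> ?K" "y \<in> ?K" "0 \<le> u" "0 \<le> v" "u + v = 1"
    have "N (u *\<^sub>R x + v *\<^sub>R y) \<le> N (u *\<^sub>R x) + N (v *\<^sub>R y)" using a by (intro N(4) Rn_closed_ops) auto
    also have "\<dots> = u * N x + v * N y" using a by (simp add: N(3))
    also have "\<dots> \<le> u * 1 + v * 1" using a by (intro add_mono mult_left_mono) auto
    finally show "u *\<^sub>R x + v *\<^sub>R y \<in> ?K" using a by (auto intro!: Rn_closed_ops)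
  qed
  have "open {x. nrm k x < 1 / b}" by (rule open_Collect_less[OF continuous_nrm continuous_on_const])
  hence "openin (Euclidean_space k) (Rn k \<inter> {x. nrm k x < 1 / b})"
    by (auto simp: Euclidean_space_euclidean openin_open)
  moreover have "Rn k \<inter> {x. nrm k x < 1 / b} \<subseteq> ?K"
  proof
    fix x assume x: "x \<in> Rn k \<inter> {x. nrm k x < 1 / b}"
    hence "b * nrm k x < 1" using ab by (simp add: field_simps)
    thus "x \<in> ?K" using x N(2)[of x] by auto
  qed
  ultimately have "Rn k \<inter> {x. nrm k x < 1 / b} \<subseteq> Euclidean_space k interior_of ?K"
    by (simp add: interior_of_maximal)
  moreover have "0 \<in> Rn k \<inter> {x. nrm k x < 1 / b}" using ab by simp
  ultimately have int: "Euclidean_space k interior_of ?K \<noteq> {}" by blast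
  have "- x \<in> ?K" if "x \<in> ?K" for x
    using that N(3)[of x "-1"] by auto
  thus ?thesis using comp conv int
    by (auto simp: sym_body_def convex_body_def centrally_symmetric_def compactin_Euclidean)
qed

subsection \<open>Second moments\<close>

lemma emeasure_sym_body_finite:
  assumes K: "sym_body n K" shows "emeasure (Leb n) K < \<infinity>"
proof -
  obtain d R where d: "0 < R" "\<And>y. y \<in> K \<Longrightarrow> nrm n y \<le> R" using sym_body_bounds[OF K] by metis
  have "emeasure (Leb n) K \<le> emeasure (Leb n) {x. nrm n x \<le> R}"
    using d by (intro emeasure_mono) auto
  also have "\<dots> < \<infinity>" using d by (simp add: emeasure_Leb_nrm_le)
  finally show ?thesis .
qed

lemma measure_sym_body_pos:
  assumes K: "sym_body n K" shows "0 < measure (Leb n) K"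
proof -
  obtain d R where d: "0 < d" "\<And>y. y \<in> Rn n \<Longrightarrow> nrm n y \<le> d \<Longrightarrow> y \<in> K" using sym_body_bounds[OF K] by metis
  have "0 < unit_ball_vol (real n) * d ^ n" using d by simp
  hence "0 < emeasure (Leb n) {x. nrm n x \<le> d}" using d by (simp add: emeasure_Leb_nrm_le)
  also have "\<dots> = emeasure (Leb n) ({x. nrm n x \<le> d} \<inter> Rn n)"
    using AE_Leb_Rn[of n] by (intro emeasure_eq_AE) auto
  also have "\<dots> \<le> emeasure (Leb n) K" using d K by (intro emeasure_mono) auto
  finally show ?thesis using emeasure_sym_body_finite[OF K] by (simp add: measure_def enn2real_positive_iff)
qed

text \<open>The nonnegative form of the Bochner integral in \<open>isotropic\<close>; changes of
  variables and Fubini carry no integrability conditions for it.\<close>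

definition second_moment :: "nat \<Rightarrow> (nat \<Rightarrow> real) set \<Rightarrow> (nat \<Rightarrow> real) \<Rightarrow> ennreal" where
  "second_moment n K v = (\<integral>\<^sup>+x. indicator K x * ennreal ((dot n x v)\<^sup>2) \<partial>Leb n)"

lemma sym_body_integrable:
  fixes f :: "(nat \<Rightarrow> real) \<Rightarrow> real"
  assumes K: "sym_body n K" and [measurable]: "f \<in> borel_measurable borel"
    and B: "\<And>x. x \<in> K \<Longrightarrow> \<bar>f x\<bar> \<le> B"
  shows "set_integrable (Leb n) K f"
  unfolding set_integrable_def
proof (rule Bochner_Integration.integrable_bound[where f = "\<lambda>x. B * indicator K x :: real"])
  have [measurable]: "K \<in> sets borel" using K by measurable
  have "integrable (Leb n) (indicator K :: _ \<Rightarrow> real)"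
    using emeasure_sym_body_finite[OF K] by (simp add: integrable_indicator_iff)
  thus "integrable (Leb n) (\<lambda>x. B * indicator K x :: real)" by (rule integrable_mult_right)
  show "(\<lambda>x. indicator K x *\<^sub>R f x) \<in> borel_measurable (Leb n)" by measurable
  show "AE x in Leb n. norm (indicator K x *\<^sub>R f x) \<le> norm (B * indicator K x)"
  proof (rule AE_I2)
    fix x
    show "norm (indicator K x *\<^sub>R f x) \<le> norm (B * indicator K x)"
      using B[of x] by (cases "x \<in> K") auto
  qed
qed

lemma nn_integral_sym_body:
  assumes K: "sym_body n K" and [measurable]: "f \<in> borel_measurable borel"
    and B: "\<And>x. x \<in> K \<Longrightarrow> \<bar>f x\<bar> \<le> B" and f0: "\<And>x. 0 \<le> f x"
  shows "(\<integral>\<^sup>+x. indicator K x * ennreal (f x) \<partial>Leb n) = ennreal (LINT x:K|Leb n. f x)"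
proof -
  have "(\<integral>\<^sup>+x. indicator K x * ennreal (f x) \<partial>Leb n) = (\<integral>\<^sup>+x. ennreal (indicator K x *\<^sub>R f x) \<partial>Leb n)"
    by (intro nn_integral_cong) (auto simp: indicator_def)
  also have "\<dots> = ennreal (\<integral>x. indicator K x *\<^sub>R f x \<partial>Leb n)"
    using sym_body_integrable[OF assms(1,2) B] f0
    by (intro nn_integral_eq_integral) (auto simp: set_integrable_def)
  finally show ?thesis by (simp add: set_lebesgue_integral_def)
qed

lemma dot_bounded_on_body:
  assumes K: "sym_body n K" shows "\<exists>B\<ge>0. \<forall>x\<in>K. \<bar>dot n x v\<bar> \<le> B"
proof -
  obtain d R where d: "0 < R" "\<And>y. y \<in> K \<Longrightarrow> nrm n y \<le> R" using sym_body_bounds[OF K] by metis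
  have "\<bar>dot n x v\<bar> \<le> R * nrm n v" if "x \<in> K" for x
    using dot_le_nrm[of n x v] mult_right_mono[OF d(2)[OF that] nrm_nonneg[of n v]] by linarith
  thus ?thesis using d(1) by (intro exI[of _ "R * nrm n v"]) auto
qed

lemma second_moment_LINT:
  assumes K: "sym_body n K"
  shows "second_moment n K v = ennreal (LINT x:K|Leb n. (dot n x v)\<^sup>2)"
proof -
  obtain B where B: "0 \<le> B" "\<And>x. x \<in> K \<Longrightarrow> \<bar>dot n x v\<bar> \<le> B" using dot_bounded_on_body[OF K] by metis
  have "\<bar>(dot n x v)\<^sup>2\<bar> \<le> B\<^sup>2" if "x \<in> K" for x using power_mono[OF B(2)[OF that], of 2] by simp
  thus ?thesis unfolding second_moment_def by (intro nn_integral_sym_body[OF K]) auto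
qed

lemma second_moment_scale: "second_moment n K (c *\<^sub>R v) = ennreal (c\<^sup>2) * second_moment n K v"
  if "K \<in> sets borel"
proof -
  note [measurable] = that
  have "second_moment n K (c *\<^sub>R v) = (\<integral>\<^sup>+x. ennreal (c\<^sup>2) * (indicator K x * ennreal ((dot n x v)\<^sup>2)) \<partial>Leb n)"
    unfolding second_moment_def
    by (intro nn_integral_cong) (simp add: power_mult_distrib ennreal_mult mult.left_commute)
  also have "\<dots> = ennreal (c\<^sup>2) * second_moment n K v"
    unfolding second_moment_def by (rule nn_integral_cmult) measurable
  finally show ?thesis .
qed

lemma isotropic_iff:
  assumes K: "sym_body n K" and n: "1 \<le> n"
  shows "isotropic n K \<longleftrightarrow> (\<exists>c\<ge>0. \<forall>v\<in>Rn n. second_moment n K v = ennreal (c * (nrm n v)\<^sup>2))"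
proof
  assume "isotropic n K"
  then obtain c where c: "\<And>\<theta>. \<theta> \<in> unit_sphere n \<Longrightarrow> (LINT x:K|Leb n. (dot n x \<theta>)\<^sup>2) = c"
    by (auto simp: isotropic_def)
  have "axis_vec 0 \<in> unit_sphere n" using n by (auto simp: unit_sphere_iff axis_vec_in_Rn nrm_axis)
  hence "c = (LINT x:K|Leb n. (dot n x (axis_vec 0))\<^sup>2)" by (simp add: c)
  hence c0: "0 \<le> c" by (auto simp: set_lebesgue_integral_def intro!: integral_nonneg)
  have "second_moment n K v = ennreal (c * (nrm n v)\<^sup>2)" if v: "v \<in> Rn n" for v
  proof (cases "v = 0")
    case True thus ?thesis by (simp add: second_moment_def)
  next
    case False
    hence p: "0 < nrm n v" by (rule nrm_pos[OF v])
    let ?\<theta> = "(1 / nrm n v) *\<^sub>R v"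
    have "?\<theta> \<in> unit_sphere n" using p v by (auto simp: unit_sphere_iff intro!: Rn_closed_ops(4))
    hence "second_moment n K ?\<theta> = ennreal c" by (simp only: second_moment_LINT[OF K] c)
    moreover have "second_moment n K (nrm n v *\<^sub>R ?\<theta>) = ennreal ((nrm n v)\<^sup>2) * second_moment n K ?\<theta>"
      using K by (intro second_moment_scale) measurable
    moreover have "nrm n v *\<^sub>R ?\<theta> = v" using p by simp
    ultimately show ?thesis using c0 by (simp add: ennreal_mult mult.commute)
  qed
  thus "\<exists>c\<ge>0. \<forall>v\<in>Rn n. second_moment n K v = ennreal (c * (nrm n v)\<^sup>2)" using c0 by blast
next
  assume "\<exists>c\<ge>0. \<forall>v\<in>Rn n. second_moment n K v = ennreal (c * (nrm n v)\<^sup>2)"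
  then obtain c where c: "0 \<le> c" "\<And>v. v \<in> Rn n \<Longrightarrow> second_moment n K v = ennreal (c * (nrm n v)\<^sup>2)" by blast
  have "(LINT x:K|Leb n. (dot n x \<theta>)\<^sup>2) = c" if "\<theta> \<in> unit_sphere n" for \<theta>
  proof -
    have "ennreal (LINT x:K|Leb n. (dot n x \<theta>)\<^sup>2) = ennreal c"
      using that c(2)[of \<theta>] by (simp add: second_moment_LINT[OF K] unit_sphere_iff)
    moreover have "0 \<le> (LINT x:K|Leb n. (dot n x \<theta>)\<^sup>2)"
      by (auto simp: set_lebesgue_integral_def intro!: integral_nonneg)
    ultimately show ?thesis using c(1) by (simp add: ennreal_inj)
  qed
  thus "isotropic n K" by (auto simp: isotropic_def)
qed

lemma unit_ball_measure: "measure (Leb n) (unit_ball n) = unit_ball_vol (real n)"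
proof -
  have "unit_ball n = {x. nrm n x \<le> 1} \<inter> Rn n" by (auto simp: unit_ball_iff)
  hence "emeasure (Leb n) (unit_ball n) = emeasure (Leb n) {x. nrm n x \<le> 1}"
    using AE_Leb_Rn[of n] by (intro emeasure_eq_AE) auto
  thus ?thesis by (simp add: measure_def emeasure_Leb_nrm_le)
qed

text \<open>At least half of the volume of \<open>K\<close> lies outside the ball of radius \<open>1/2\<close>.\<close>
lemma isotropic_moment_lower:
  assumes K: "sym_body n K" and n: "1 \<le> n" and V: "measure (Leb n) K = unit_ball_vol (real n)"
    and c: "0 \<le> c" "\<And>v. v \<in> Rn n \<Longrightarrow> second_moment n K v = ennreal (c * (nrm n v)\<^sup>2)"
  shows "unit_ball_vol (real n) \<le> 8 * real n * c"
proof -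
  let ?v = "unit_ball_vol (real n)"
  have [measurable]: "K \<in> sets borel" using K by measurable
  have eK: "emeasure (Leb n) K = ennreal ?v"
    using V emeasure_sym_body_finite[OF K] by (metis emeasure_eq_ennreal_measure infinity_ennreal_def less_irrefl)
  let ?H = "{x. nrm n x \<le> 1 / 2}"
  have H: "emeasure (Leb n) ?H = ennreal (?v * (1/2) ^ n)" by (rule emeasure_Leb_nrm_le) simp
  have "(1/2) ^ n \<le> (1/2 :: real) ^ 1" using n by (intro power_decreasing) auto
  hence "?v * (1/2) ^ n \<le> ?v * (1/2)" by (intro mult_left_mono) auto
  hence H': "emeasure (Leb n) ?H \<le> ennreal (?v / 2)" unfolding H by (intro ennreal_leI) simp
  have "ennreal (?v / 2) + ennreal (?v / 2) = emeasure (Leb n) K"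
    unfolding eK by (subst ennreal_plus[symmetric]) auto
  also have "\<dots> \<le> emeasure (Leb n) ((K - ?H) \<union> ?H)" by (intro emeasure_mono) auto
  also have "\<dots> \<le> emeasure (Leb n) (K - ?H) + emeasure (Leb n) ?H" by (rule emeasure_subadditive) auto
  also have "\<dots> \<le> emeasure (Leb n) (K - ?H) + ennreal (?v / 2)" by (intro add_mono H') simp
  finally have "ennreal (?v / 2) \<le> emeasure (Leb n) (K - ?H)"
    by (simp add: ennreal_add_left_cancel_le add.commute)
  hence "ennreal (1/4) * ennreal (?v / 2) \<le> ennreal (1/4) * emeasure (Leb n) (K - ?H)" by (rule mult_left_mono) simp
  also have "\<dots> = (\<integral>\<^sup>+x. ennreal (1/4) * indicator (K - ?H) x \<partial>Leb n)" by (simp add: nn_integral_cmult)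
  also have "\<dots> \<le> (\<integral>\<^sup>+x. indicator K x * ennreal ((nrm n x)\<^sup>2) \<partial>Leb n)"
  proof (rule nn_integral_mono)
    fix x
    have "1/4 \<le> (nrm n x)\<^sup>2" if "1/2 < nrm n x" using power_mono[of "1/2" "nrm n x" 2] that by (simp add: power2_eq_square)
    thus "ennreal (1/4) * indicator (K - ?H) x \<le> indicator K x * ennreal ((nrm n x)\<^sup>2)"
      by (auto simp: indicator_def not_le intro!: ennreal_leI)
  qed
  also have "\<dots> = (\<integral>\<^sup>+x. (\<Sum>i<n. indicator K x * ennreal ((dot n x (axis_vec i))\<^sup>2)) \<partial>Leb n)"
  proof (rule nn_integral_cong)
    fix x
    have "ennreal ((nrm n x)\<^sup>2) = (\<Sum>i<n. ennreal ((dot n x (axis_vec i))\<^sup>2))"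
      unfolding nrm_sq by (subst sum_ennreal) (auto simp: dot_axis, simp add: dot_def power2_eq_square)
    thus "indicator K x * ennreal ((nrm n x)\<^sup>2) = (\<Sum>i<n. indicator K x * ennreal ((dot n x (axis_vec i))\<^sup>2))"
      by (simp only: sum_distrib_left)
  qed
  also have "\<dots> = (\<Sum>i<n. second_moment n K (axis_vec i))"
    unfolding second_moment_def by (rule nn_integral_sum) measurable
  also have "\<dots> = (\<Sum>i<n. ennreal c)"
    by (intro sum.cong refl) (simp add: c(2) axis_vec_in_Rn nrm_axis)
  also have "\<dots> = ennreal (real n * c)" using c(1) by (simp add: ennreal_of_nat_eq_real_of_nat ennreal_mult)
  finally have "ennreal (1/4 * (?v / 2)) \<le> ennreal (real n * c)" by (simp add: ennreal_mult[symmetric] del: ennreal_plus)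
  hence "1/4 * (?v / 2) \<le> real n * c" using c(1) by (subst (asm) ennreal_le_iff) auto
  thus ?thesis by simp
qed

section \<open>Gaussian measures\<close>

definition gauss_weight :: "nat \<Rightarrow> (nat \<Rightarrow> real) \<Rightarrow> real" where
  "gauss_weight n x = (1 / sqrt (2 * pi)) ^ n * exp (- (nrm n x)\<^sup>2 / 2)"

abbreviation gauss :: "nat \<Rightarrow> (nat \<Rightarrow> real) measure" where
  "gauss m \<equiv> (\<Pi>\<^sub>M i\<in>{..<m}. density lborel std_normal_density)"

lemma measurable_upd_const: "(\<lambda>t. y(n := t)) \<in> borel_measurable (borel :: real measure)"
  for y :: "nat \<Rightarrow> real"
  by (intro measurable_funI) simp

lemma measurable_scaleR_const: "(\<lambda>t. t *\<^sub>R y) \<in> borel_measurable (borel :: real measure)"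
  for y :: "nat \<Rightarrow> real"
  by (intro measurable_funI) simp

lemma gauss_weight_pos: "0 < gauss_weight n x"
  by (simp add: gauss_weight_def)

lemma gauss_weight_nonneg [simp]: "0 \<le> gauss_weight n x"
  using gauss_weight_pos[of n x] by simp

lemma gauss_weight_measurable [measurable]: "gauss_weight n \<in> borel_measurable borel"
  unfolding gauss_weight_def[abs_def] by measurable

lemma gauss_weight_Suc:
  "gauss_weight (Suc n) (y(n := t)) = gauss_weight n y * std_normal_density t"
proof -
  have "(nrm (Suc n) (y(n := t)))\<^sup>2 = (nrm n y)\<^sup>2 + t\<^sup>2"
    unfolding nrm_sq by (simp add: dot_upd power2_eq_square)
  thus ?thesis
    by (simp add: gauss_weight_def std_normal_density_def exp_add[symmetric] add_divide_distrib)
qed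

lemma nn_std_normal: "(\<integral>\<^sup>+t. ennreal (std_normal_density t) \<partial>lborel) = 1"
proof -
  interpret prob_space "density lborel std_normal_density" by (rule prob_space_normal_density) simp
  show ?thesis using emeasure_space_1 by (simp add: emeasure_density)
qed

lemma gauss_measurable_trunc [measurable]: "trunc n \<in> measurable (gauss n) borel"
proof (rule measurable_funI)
  fix i show "(\<lambda>x. trunc n x i) \<in> borel_measurable (gauss n)"
    using measurable_component_singleton[of i "{..<n}" "\<lambda>_. density lborel std_normal_density"]
    by (cases "i < n") (simp_all add: trunc_def)
qed

text \<open>The product measure in the definition of type 2 lives on functions that are undefined
  from index \<open>n\<close> on; truncation carries it to \<open>Rn n\<close>, where it has the
  density \<open>gauss_weight n\<close>.\<close>

lemma nn_gauss:
  assumes "f \<in> borel_measurable borel"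
  shows "(\<integral>\<^sup>+g. f (trunc n g) \<partial>gauss n) = (\<integral>\<^sup>+x. f x * ennreal (gauss_weight n x) \<partial>Leb n)"
  using assms
proof (induction n arbitrary: f)
  case 0
  note [measurable] = 0
  interpret product_sigma_finite "\<lambda>i::nat. density lborel std_normal_density"
    by (simp add: product_sigma_finite_def prob_space_normal_density prob_space_imp_sigma_finite)
  have t: "trunc 0 = (\<lambda>_. 0)" by (auto simp: trunc_def fun_eq_iff)
  have "(\<integral>\<^sup>+g. f (trunc 0 g) \<partial>gauss 0) = f 0"
    unfolding t by (simp add: nn_integral_empty del: nn_integral_const)
  moreover have "(\<integral>\<^sup>+x. f x * ennreal (gauss_weight 0 x) \<partial>Leb 0) = f 0 * ennreal (gauss_weight 0 0)"
    by (rule nn_Leb_0) measurable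
  moreover have "nrm 0 x = 0" for x by (simp add: nrm_def dot_def)
  ultimately show ?case by (simp add: gauss_weight_def)
next
  case (Suc n)
  note [measurable] = Suc.prems
  interpret product_sigma_finite "\<lambda>i::nat. density lborel std_normal_density"
    by (simp add: product_sigma_finite_def prob_space_normal_density prob_space_imp_sigma_finite)
  define G where "G y = (\<integral>\<^sup>+t. ennreal (std_normal_density t) * f (y(n := t)) \<partial>lborel)" for y
  have [measurable]: "G \<in> borel_measurable borel" unfolding G_def by measurable
  have m: "(\<lambda>x. f (trunc (Suc n) x)) \<in> borel_measurable (Pi\<^sub>M (insert n {..<n}) (\<lambda>i. density lborel std_normal_density))"
    using measurable_compose[OF gauss_measurable_trunc[of "Suc n"] Suc.prems] by (simp add: lessThan_Suc)
  have "(\<integral>\<^sup>+g. f (trunc (Suc n) g) \<partial>gauss (Suc n)) =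
      (\<integral>\<^sup>+g. (\<integral>\<^sup>+t. f (trunc (Suc n) (g(n := t))) \<partial>density lborel std_normal_density) \<partial>gauss n)"
    unfolding lessThan_Suc by (rule product_nn_integral_insert) (use m in auto)
  also have "\<dots> = (\<integral>\<^sup>+g. G (trunc n g) \<partial>gauss n)"
  proof (rule nn_integral_cong)
    fix g :: "nat \<Rightarrow> real"
    have "trunc (Suc n) (g(n := t)) = (trunc n g)(n := t)" for t by (auto simp: trunc_def)
    thus "(\<integral>\<^sup>+t. f (trunc (Suc n) (g(n := t))) \<partial>density lborel std_normal_density) = G (trunc n g)"
      unfolding G_def using measurable_compose[OF measurable_upd_const[of "trunc n g" n] Suc.prems]
      by (simp add: nn_integral_density[of _ lborel] del: fun_upd_apply)
  qed
  also have "\<dots> = (\<integral>\<^sup>+x. G x * ennreal (gauss_weight n x) \<partial>Leb n)" by (rule Suc.IH) measurable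
  also have "\<dots> = (\<integral>\<^sup>+y. (\<integral>\<^sup>+t. f (y(n := t)) * ennreal (gauss_weight (Suc n) (y(n := t))) \<partial>lborel) \<partial>Leb n)"
  proof (rule nn_integral_cong)
    fix y :: "nat \<Rightarrow> real"
    have "G y * ennreal (gauss_weight n y) =
        (\<integral>\<^sup>+t. ennreal (std_normal_density t) * f (y(n := t)) * ennreal (gauss_weight n y) \<partial>lborel)"
      unfolding G_def using measurable_compose[OF measurable_upd_const[of y n] Suc.prems]
      by (intro nn_integral_multc[symmetric] borel_measurable_times) auto
    thus "G y * ennreal (gauss_weight n y) =
        (\<integral>\<^sup>+t. f (y(n := t)) * ennreal (gauss_weight (Suc n) (y(n := t))) \<partial>lborel)"
      by (simp add: gauss_weight_Suc ennreal_mult mult_ac)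
  qed
  also have "\<dots> = (\<integral>\<^sup>+x. f x * ennreal (gauss_weight (Suc n) x) \<partial>Leb (Suc n))"
    by (rule nn_Leb_Suc[symmetric]) measurable
  finally show ?case .
qed

lemma gauss_marginal:
  assumes [measurable]: "G \<in> borel_measurable borel"
  shows "(\<integral>\<^sup>+z. G (trunc n z) * ennreal (gauss_weight (n + m) z) \<partial>Leb (n + m)) =
    (\<integral>\<^sup>+x. G x * ennreal (gauss_weight n x) \<partial>Leb n)"
proof (induction m)
  case 0
  show ?case unfolding add_0_right by (rule nn_Leb_cong) (metis trunc_id)
next
  case (Suc m)
  have "(\<integral>\<^sup>+z. G (trunc n z) * ennreal (gauss_weight (n + Suc m) z) \<partial>Leb (n + Suc m)) =
      (\<integral>\<^sup>+y. (\<integral>\<^sup>+t. G (trunc n (y(n + m := t))) * ennreal (gauss_weight (Suc (n + m)) (y(n + m := t))) \<partial>lborel) \<partial>Leb (n + m))"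
    unfolding add_Suc_right by (rule nn_Leb_Suc) measurable
  also have "\<dots> = (\<integral>\<^sup>+y. G (trunc n y) * ennreal (gauss_weight (n + m) y) \<partial>Leb (n + m))"
  proof (rule nn_integral_cong)
    fix y :: "nat \<Rightarrow> real"
    have "trunc n (y(n + m := t)) = trunc n y" for t by (auto simp: trunc_def)
    hence "(\<integral>\<^sup>+t. G (trunc n (y(n + m := t))) * ennreal (gauss_weight (Suc (n + m)) (y(n + m := t))) \<partial>lborel) =
        (\<integral>\<^sup>+t. (G (trunc n y) * ennreal (gauss_weight (n + m) y)) * ennreal (std_normal_density t) \<partial>lborel)"
      by (simp add: gauss_weight_Suc ennreal_mult mult_ac)
    also have "\<dots> = G (trunc n y) * ennreal (gauss_weight (n + m) y)"
      by (subst nn_integral_cmult) (auto simp: nn_std_normal)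
    finally show "(\<integral>\<^sup>+t. G (trunc n (y(n + m := t))) * ennreal (gauss_weight (Suc (n + m)) (y(n + m := t))) \<partial>lborel) =
        G (trunc n y) * ennreal (gauss_weight (n + m) y)" .
  qed
  finally show ?case using Suc.IH by simp
qed

lemma nn_gauss_weight: "(\<integral>\<^sup>+x. ennreal (gauss_weight n x) \<partial>Leb n) = 1"
proof -
  have "prob_space (gauss n)" by (intro prob_space_PiM prob_space_normal_density) simp
  then interpret prob_space "gauss n" .
  show ?thesis using nn_gauss[of "\<lambda>_. 1" n] emeasure_space_1 by simp
qed

lemma sum_lessThan_add: "(\<Sum>j<n + m. f j) = (\<Sum>j<n. f j) + (\<Sum>l<m. f (n + l))"
  for f :: "nat \<Rightarrow> 'a::comm_monoid_add"
  by (induction m) (simp_all add: add.assoc)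

text \<open>
  For a matrix \<open>A\<close> with orthonormal rows, \<open>(z, q) \<mapsto> (A z, z + A\<^sup>T (q - A z))\<close> is an isometry of
  \<open>\<real>\<^sup>m \<times> \<real>\<^sup>n\<close>. Thus \<open>A\<close> is a projection after a rotation, without a completion of the rows of \<open>A\<close> to
  an orthonormal basis.
\<close>
lemma gauss_linear_image:
  assumes H[measurable]: "H \<in> borel_measurable borel" and y: "\<And>i. i < m \<Longrightarrow> y i \<in> Rn n" and s: "0 < s"
    and orth: "\<And>a b. a < n \<Longrightarrow> b < n \<Longrightarrow> (\<Sum>i<m. y i a * y i b) = (if a = b then s\<^sup>2 else 0)"
  shows "(\<integral>\<^sup>+x. H (\<Sum>i<m. x i *\<^sub>R y i) * ennreal (gauss_weight m x) \<partial>Leb m) =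
    (\<integral>\<^sup>+x. H (s *\<^sub>R x) * ennreal (gauss_weight n x) \<partial>Leb n)"
proof -
  define A where "A a i = y i a / s" for a i
  have AA: "(\<Sum>i<m. A a i * A b i) = (if a = b then 1 else 0)" if "a < n" "b < n" for a b
    using orth[OF that] s by (simp add: A_def sum_divide_distrib[symmetric] power2_eq_square)
  define p where "p z a = (\<Sum>i<m. A a i * z i)" for z :: "nat \<Rightarrow> real" and a
  define r where "r z l = z l + (\<Sum>a<n. A a l * (z (m + a) - p z a))" for z :: "nat \<Rightarrow> real" and l
  define W where "W z = (\<lambda>j. if j < n then p z j else if j < n + m then r z (j - n) else 0)" for z
  have p_lin: "p (u + v) a = p u a + p v a" "p (c *\<^sub>R u) a = c * p u a" for u v a c
    by (simp_all add: p_def algebra_simps sum.distrib sum_distrib_left)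
  have "linear W"
  proof (rule linearI)
    fix u v :: "nat \<Rightarrow> real" and c :: real
    have "r (u + v) l = r u l + r v l" for l
      unfolding r_def p_lin by (simp add: algebra_simps sum.distrib sum_subtractf)
    thus "W (u + v) = W u + W v" by (auto simp: W_def p_lin fun_eq_iff)
    have "r (c *\<^sub>R u) l = c * r u l" for l
      unfolding r_def p_lin by (simp add: algebra_simps sum_subtractf sum_distrib_left)
    thus "W (c *\<^sub>R u) = c *\<^sub>R W u" by (auto simp: W_def p_lin fun_eq_iff)
  qed
  moreover have "W z \<in> Rn (n + m)" for z by (auto simp: W_def Rn_iff)
  moreover have dotW: "dot (n + m) (W z) (W z) = dot (n + m) z z" for z
  proof -
    define d where "d a = z (m + a) - p z a" for a
    have "dot (n + m) (W z) (W z) = (\<Sum>a<n. p z a * p z a) + (\<Sum>l<m. r z l * r z l)"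
      unfolding dot_def sum_lessThan_add by (simp add: W_def)
    also have "(\<Sum>l<m. r z l * r z l) = (\<Sum>l<m. z l * z l) + 2 * (\<Sum>l<m. z l * (\<Sum>a<n. A a l * d a))
        + (\<Sum>l<m. (\<Sum>a<n. A a l * d a) * (\<Sum>b<n. A b l * d b))"
    proof -
      define t where "t l = (\<Sum>a<n. A a l * d a)" for l
      have "r z l = z l + t l" for l by (simp add: r_def d_def t_def)
      hence "r z l * r z l = z l * z l + 2 * (z l * t l) + t l * t l" for l
        by (simp add: algebra_simps)
      thus ?thesis by (simp add: t_def[symmetric] sum.distrib sum_distrib_left)
    qed
    also have "(\<Sum>l<m. z l * (\<Sum>a<n. A a l * d a)) = (\<Sum>a<n. p z a * d a)"
      unfolding p_def sum_distrib_left sum_distrib_right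
      by (subst sum.swap) (simp add: mult_ac)
    also have "(\<Sum>l<m. (\<Sum>a<n. A a l * d a) * (\<Sum>b<n. A b l * d b)) = (\<Sum>a<n. d a * d a)"
    proof -
      have "(\<Sum>l<m. (\<Sum>a<n. A a l * d a) * (\<Sum>b<n. A b l * d b)) =
          (\<Sum>l<m. \<Sum>a<n. \<Sum>b<n. d a * d b * (A a l * A b l))"
        unfolding sum_product by (intro sum.cong refl) (simp add: mult_ac)
      also have "\<dots> = (\<Sum>a<n. \<Sum>l<m. \<Sum>b<n. d a * d b * (A a l * A b l))" by (rule sum.swap)
      also have "\<dots> = (\<Sum>a<n. \<Sum>b<n. \<Sum>l<m. d a * d b * (A a l * A b l))"
        by (intro sum.cong refl sum.swap)
      also have "\<dots> = (\<Sum>a<n. \<Sum>b<n. d a * d b * (if a = b then 1 else 0))"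
        by (intro sum.cong refl) (simp add: sum_distrib_left[symmetric] AA)
      also have "\<dots> = (\<Sum>a<n. d a * d a)" by (intro sum.cong refl) (simp add: if_distrib cong: if_cong)
      finally show ?thesis .
    qed
    finally have "dot (n + m) (W z) (W z) =
        (\<Sum>a<n. p z a * p z a + 2 * (p z a * d a) + d a * d a) + (\<Sum>l<m. z l * z l)"
      by (simp add: sum.distrib sum_distrib_left)
    also have "(\<Sum>a<n. p z a * p z a + 2 * (p z a * d a) + d a * d a) = (\<Sum>a<n. z (m + a) * z (m + a))"
      by (intro sum.cong refl) (simp add: d_def algebra_simps)
    also have "\<dots> + (\<Sum>l<m. z l * z l) = dot (n + m) z z"
      unfolding dot_def add.commute[of n m] sum_lessThan_add by simp
    finally show ?thesis .
  qed
  ultimately have W: "iso_onto (n + m) (n + m) (Rn (n + m)) W" by (intro iso_ontoI) blast+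
  have Wy: "s *\<^sub>R trunc n (W z) = (\<Sum>i<m. z i *\<^sub>R y i)" for z
  proof
    fix a
    show "(s *\<^sub>R trunc n (W z)) a = (\<Sum>i<m. z i *\<^sub>R y i) a"
    proof (cases "a < n")
      case True
      thus ?thesis using s
        by (simp add: trunc_def W_def p_def A_def sum_fun_apply sum_distrib_left mult.commute)
    next
      case False
      thus ?thesis using y by (simp add: trunc_def sum_fun_apply Rn_iff)
    qed
  qed
  have [measurable]: "(\<lambda>x. H (\<Sum>i<m. x i *\<^sub>R y i)) \<in> borel_measurable borel"
    by measurable
  \<comment> \<open>Adjoins \<open>n\<close> independent Gaussian coordinates, the \<open>q\<close>
    of the isometry \<open>W\<close>, and drops the last \<open>m\<close> coordinates after
    \<open>W\<close> has been applied.\<close>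
  have "(\<integral>\<^sup>+x. H (\<Sum>i<m. x i *\<^sub>R y i) * ennreal (gauss_weight m x) \<partial>Leb m) =
      (\<integral>\<^sup>+z. H (\<Sum>i<m. trunc m z i *\<^sub>R y i) * ennreal (gauss_weight (m + n) z) \<partial>Leb (m + n))"
    by (rule gauss_marginal[symmetric]) measurable
  also have "\<dots> = (\<integral>\<^sup>+z. H (s *\<^sub>R trunc n (W z)) * ennreal (gauss_weight (n + m) (W z)) \<partial>Leb (n + m))"
    unfolding add.commute[of m n]
  proof (rule nn_integral_cong)
    fix z :: "nat \<Rightarrow> real"
    have "(\<Sum>i<m. trunc m z i *\<^sub>R y i) = (\<Sum>i<m. z i *\<^sub>R y i)"
      by (intro sum.cong refl) (simp add: trunc_def)
    thus "H (\<Sum>i<m. trunc m z i *\<^sub>R y i) * ennreal (gauss_weight (n + m) z) =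
        H (s *\<^sub>R trunc n (W z)) * ennreal (gauss_weight (n + m) (W z))"
      unfolding Wy gauss_weight_def nrm_sq dotW by simp
  qed
  also have "\<dots> = (\<integral>\<^sup>+z. H (s *\<^sub>R trunc n z) * ennreal (gauss_weight (n + m) z) \<partial>Leb (n + m))"
    by (rule nn_Leb_isometry[OF _ W]) measurable
  also have "\<dots> = (\<integral>\<^sup>+x. H (s *\<^sub>R x) * ennreal (gauss_weight n x) \<partial>Leb n)"
    by (rule gauss_marginal) measurable
  finally show ?thesis .
qed

section \<open>Gaussian moments of linear functionals and of the norm\<close>

lemma nn_std_normal_moment:
  "(\<integral>\<^sup>+t. ennreal (t ^ (2 * j)) * ennreal (std_normal_density t) \<partial>lborel) = ennreal (fact (2 * j) / (2 ^ j * fact j))"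
proof -
  have "has_bochner_integral lborel (\<lambda>x. std_normal_density x * x ^ (2 * j)) (fact (2 * j) / (2 ^ j * fact j))"
    by (rule std_normal_moment_even)
  hence "(\<integral>\<^sup>+t. ennreal (std_normal_density t * t ^ (2 * j)) \<partial>lborel) = ennreal (fact (2 * j) / (2 ^ j * fact j))"
    by (intro nn_integral_eq_integral[THEN trans]) (auto simp: has_bochner_integral_iff)
  thus ?thesis
    by (subst ennreal_mult[symmetric]) (auto simp: mult.commute zero_le_even_power)
qed

text \<open>Under a Gaussian measure a linear functional is a one-dimensional Gaussian:
  \<open>gauss_linear_image\<close> with the single row \<open>v\<close>.\<close>

lemma gauss_dot_moment:
  assumes n: "1 \<le> n"
  shows "(\<integral>\<^sup>+x. ennreal ((dot n x v) ^ (2 * j)) * ennreal (gauss_weight n x) \<partial>Leb n) =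
    ennreal ((nrm n v) ^ (2 * j) * (fact (2 * j) / (2 ^ j * fact j)))"
proof (cases "nrm n v = 0")
  case True
  have d0: "dot n x v = 0" for x using dot_le_nrm[of n x v] True by simp
  show ?thesis using True nn_gauss_weight[of n] by (cases j) (simp_all add: d0)
next
  case False
  hence s: "0 < nrm n v" using nrm_nonneg[of n v] by linarith
  define H :: "(nat \<Rightarrow> real) \<Rightarrow> ennreal" where "H x = ennreal ((x 0) ^ (2 * j))" for x
  have [measurable]: "H \<in> borel_measurable borel" unfolding H_def by measurable
  let ?y = "\<lambda>i. v i *\<^sub>R axis_vec 0"
  have "(\<integral>\<^sup>+x. ennreal ((dot n x v) ^ (2 * j)) * ennreal (gauss_weight n x) \<partial>Leb n) =
      (\<integral>\<^sup>+x. H (\<Sum>i<n. x i *\<^sub>R ?y i) * ennreal (gauss_weight n x) \<partial>Leb n)"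
    by (intro nn_integral_cong) (simp add: H_def sum_fun_apply dot_def axis_vec_def)
  also have "\<dots> = (\<integral>\<^sup>+x. H (nrm n v *\<^sub>R x) * ennreal (gauss_weight 1 x) \<partial>Leb 1)"
  proof (rule gauss_linear_image[OF _ _ s])
    fix a b :: nat assume "a < 1" "b < 1"
    thus "(\<Sum>i<n. ?y i a * ?y i b) = (if a = b then (nrm n v)\<^sup>2 else 0)"
      by (simp add: axis_vec_def nrm_sq dot_def)
  qed (auto simp: Rn_iff axis_vec_def)
  also have "\<dots> = (\<integral>\<^sup>+y. (\<integral>\<^sup>+t. H (nrm n v *\<^sub>R (y(0 := t))) * ennreal (gauss_weight 1 (y(0 := t))) \<partial>lborel) \<partial>Leb 0)"
    unfolding One_nat_def by (rule nn_Leb_Suc) measurable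
  also have "\<dots> = (\<integral>\<^sup>+t. H (nrm n v *\<^sub>R (0(0 := t))) * ennreal (gauss_weight 1 (0(0 := t))) \<partial>lborel)"
    by (rule nn_Leb_0) measurable
  also have "\<dots> = (\<integral>\<^sup>+t. ennreal ((nrm n v) ^ (2 * j)) * (ennreal (t ^ (2 * j)) * ennreal (std_normal_density t)) \<partial>lborel)"
  proof (rule nn_integral_cong)
    fix t :: real
    have "gauss_weight 1 (0(0 := t)) = std_normal_density t"
      using gauss_weight_Suc[of 0 0 t] by (simp add: gauss_weight_def[of 0] nrm_def[of 0] dot_def[of 0])
    thus "H (nrm n v *\<^sub>R (0(0 := t))) * ennreal (gauss_weight 1 (0(0 := t))) =
        ennreal ((nrm n v) ^ (2 * j)) * (ennreal (t ^ (2 * j)) * ennreal (std_normal_density t))"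
      by (simp add: H_def power_mult_distrib ennreal_mult mult.assoc)
  qed
  also have "\<dots> = ennreal ((nrm n v) ^ (2 * j)) * ennreal (fact (2 * j) / (2 ^ j * fact j))"
    by (subst nn_integral_cmult) (auto simp: nn_std_normal_moment)
  also have "\<dots> = ennreal ((nrm n v) ^ (2 * j) * (fact (2 * j) / (2 ^ j * fact j)))"
    by (rule ennreal_mult[symmetric]) auto
  finally show ?thesis .
qed

lemma gauss_nrm_sq:
  assumes n: "1 \<le> n"
  shows "(\<integral>\<^sup>+x. ennreal ((nrm n x)\<^sup>2) * ennreal (gauss_weight n x) \<partial>Leb n) = ennreal (real n)"
proof -
  have "(\<integral>\<^sup>+x. ennreal ((nrm n x)\<^sup>2) * ennreal (gauss_weight n x) \<partial>Leb n) =
      (\<integral>\<^sup>+x. (\<Sum>i<n. ennreal ((dot n x (axis_vec i)) ^ (2 * 1)) * ennreal (gauss_weight n x)) \<partial>Leb n)"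
  proof (rule nn_integral_cong)
    fix x
    have "ennreal ((nrm n x)\<^sup>2) = ennreal (\<Sum>i<n. (dot n x (axis_vec i)) ^ (2 * 1))"
      unfolding nrm_sq dot_def[of n x x] by (intro arg_cong[where f = ennreal] sum.cong refl) (simp add: dot_axis power2_eq_square)
    also have "\<dots> = (\<Sum>i<n. ennreal ((dot n x (axis_vec i)) ^ (2 * 1)))" by (rule sum_ennreal[symmetric]) simp
    finally show "ennreal ((nrm n x)\<^sup>2) * ennreal (gauss_weight n x) =
        (\<Sum>i<n. ennreal ((dot n x (axis_vec i)) ^ (2 * 1)) * ennreal (gauss_weight n x))"
      by (simp only: sum_distrib_right)
  qed
  also have "\<dots> = (\<Sum>i<n. \<integral>\<^sup>+x. ennreal ((dot n x (axis_vec i)) ^ (2 * 1)) * ennreal (gauss_weight n x) \<partial>Leb n)"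
    by (rule nn_integral_sum) measurable
  also have "\<dots> = (\<Sum>i<n. ennreal 1)"
    by (intro sum.cong refl, subst gauss_dot_moment[OF n]) (simp add: nrm_axis fact_numeral)
  finally show ?thesis by (simp add: ennreal_of_nat_eq_real_of_nat)
qed

text \<open>For a function homogeneous of degree \<open>p\<close>, radius and direction separate.
  This carries Gaussian computations to the sphere.\<close>

lemma gauss_polar:
  assumes n: "1 \<le> n" and [measurable]: "F \<in> borel_measurable borel"
    and hom: "\<And>r u. 0 < r \<Longrightarrow> u \<in> unit_sphere n \<Longrightarrow> F (r *\<^sub>R u) = ennreal (r powr p) * F u"
  shows "(\<integral>\<^sup>+x. F x * ennreal (gauss_weight n x) \<partial>Leb n) =
    (\<integral>\<^sup>+x. ennreal (nrm n x powr p) * ennreal (gauss_weight n x) \<partial>Leb n) * (\<integral>\<^sup>+u. F u \<partial>sigma_sphere n)"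
proof -
  note S = sphere_haar_facts[OF sphere_haar_is_haar[OF iso_onto_id n]]
  define w where "w r = (1 / sqrt (2 * pi)) ^ n * exp (- r\<^sup>2 / 2)" for r :: real
  have gw: "gauss_weight n x = w (nrm n x)" for x by (simp add: gauss_weight_def w_def)
  have [measurable]: "w \<in> borel_measurable borel" unfolding w_def by measurable
  let ?I = "\<integral>\<^sup>+r. ennreal (r powr p) * ennreal (w r) \<partial>radial_measure n"
  have "(\<integral>\<^sup>+x. F x * ennreal (gauss_weight n x) \<partial>Leb n) =
      (\<integral>\<^sup>+u. (\<integral>\<^sup>+r. F (r *\<^sub>R u) * ennreal (gauss_weight n (r *\<^sub>R u)) \<partial>radial_measure n) \<partial>sigma_sphere n)"
    by (rule nn_polar[OF iso_onto_id n]) measurable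
  also have "\<dots> = (\<integral>\<^sup>+u. ?I * F u \<partial>sigma_sphere n)"
  proof (rule nn_integral_cong)
    fix u assume "u \<in> space (sigma_sphere n)"
    hence u: "u \<in> unit_sphere n" by (simp add: S(3))
    have "AE r in radial_measure n. 0 < r"
      unfolding radial_measure_def by (subst AE_density) (auto simp: indicator_def)
    hence "(\<integral>\<^sup>+r. F (r *\<^sub>R u) * ennreal (gauss_weight n (r *\<^sub>R u)) \<partial>radial_measure n) =
        (\<integral>\<^sup>+r. (ennreal (r powr p) * ennreal (w r)) * F u \<partial>radial_measure n)"
    proof (intro nn_integral_cong_AE, eventually_elim)
      fix r :: real assume r: "0 < r"
      have "nrm n (r *\<^sub>R u) = r" using u r by (simp add: unit_sphere_iff)
      thus "F (r *\<^sub>R u) * ennreal (gauss_weight n (r *\<^sub>R u)) = ennreal (r powr p) * ennreal (w r) * F u"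
        by (simp add: hom[OF r u] gw mult_ac)
    qed
    also have "\<dots> = ?I * F u"
    proof (rule nn_integral_multc)
      have "(\<lambda>r. ennreal (r powr p) * ennreal (w r)) \<in> borel_measurable borel" by measurable
      thus "(\<lambda>r. ennreal (r powr p) * ennreal (w r)) \<in> borel_measurable (radial_measure n)"
        by (simp add: measurable_cong_sets[OF sets_radial_measure refl])
    qed
    finally show "(\<integral>\<^sup>+r. F (r *\<^sub>R u) * ennreal (gauss_weight n (r *\<^sub>R u)) \<partial>radial_measure n) = ?I * F u" .
  qed
  also have "\<dots> = ?I * (\<integral>\<^sup>+u. F u \<partial>sigma_sphere n)"
    by (rule nn_integral_cmult[OF measurable_sphere[OF S(2)]]) measurable
  also have "?I = (\<integral>\<^sup>+x. ennreal (nrm n x powr p) * ennreal (w (nrm n x)) \<partial>Leb n)"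
    by (rule nn_radial_nrm[OF n, of "\<lambda>r. ennreal (r powr p) * ennreal (w r)"]) measurable
  finally show ?thesis by (simp add: gw)
qed

section \<open>Type 2 and the mean norm\<close>

text \<open>A divergent Bochner integral would have the default value 0, so the type 2 inequality
  says something about the norm only once the integral is known to be finite. A crude comparison
  with the Euclidean norm gives this, with a constant independent of \<open>m\<close> and of the
  vectors.\<close>

lemma gauss_norm_LINT:
  assumes K: "sym_body n K" and n: "1 \<le> n" and m: "1 \<le> m" and x: "\<And>i. i < m \<Longrightarrow> x i \<in> Rn n"
  shows "ennreal (LINT g|gauss m. (norm_of K (\<Sum>i<m. g i *\<^sub>R x i))\<^sup>2) =
      (\<integral>\<^sup>+z. ennreal ((norm_of K (trunc n (\<Sum>i<m. z i *\<^sub>R x i)))\<^sup>2) * ennreal (gauss_weight m z) \<partial>Leb m)"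
    and "\<exists>b. \<forall>m x. 1 \<le> m \<longrightarrow> (\<forall>i<m. x i \<in> Rn n) \<longrightarrow>
      (\<integral>\<^sup>+z. ennreal ((norm_of K (trunc n (\<Sum>i<m. z i *\<^sub>R x i)))\<^sup>2) * ennreal (gauss_weight m z) \<partial>Leb m)
        \<le> ennreal (b\<^sup>2 * (\<Sum>i<m. (norm_of K (x i))\<^sup>2))"
proof -
  obtain a b where ab: "0 < a" "0 < b" "\<And>x. x \<in> Rn n \<Longrightarrow> a * nrm n x \<le> norm_of K x"
    "\<And>x. x \<in> Rn n \<Longrightarrow> norm_of K x \<le> b * nrm n x" using norm_of_equiv[OF K] by blast
  note [measurable] = norm_of_measurable[OF K]
  have le: "(\<integral>\<^sup>+z. ennreal ((norm_of K (trunc n (\<Sum>i<m. z i *\<^sub>R x i)))\<^sup>2) * ennreal (gauss_weight m z) \<partial>Leb m)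
        \<le> ennreal ((b / a)\<^sup>2 * (\<Sum>i<m. (norm_of K (x i))\<^sup>2))" (is "?Q \<le> _")
    if m: "1 \<le> m" and x: "\<And>i. i < m \<Longrightarrow> x i \<in> Rn n" for m and x :: "nat \<Rightarrow> nat \<Rightarrow> real"
  proof -
    let ?c = "\<lambda>k i. x i k"
    have "?Q \<le> (\<integral>\<^sup>+z. (\<Sum>k<n. ennreal (b\<^sup>2) * (ennreal ((dot m z (?c k)) ^ (2 * 1)) * ennreal (gauss_weight m z))) \<partial>Leb m)"
    proof (rule nn_integral_mono)
      fix z :: "nat \<Rightarrow> real"
      let ?s = "\<Sum>i<m. z i *\<^sub>R x i"
      have "(norm_of K (trunc n ?s))\<^sup>2 \<le> (b * nrm n (trunc n ?s))\<^sup>2"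
        by (intro power_mono ab norm_of_nonneg[OF K]) auto
      also have "\<dots> = b\<^sup>2 * dot n ?s ?s" by (simp add: power_mult_distrib nrm_sq)
      also have "\<dots> = (\<Sum>k<n. b\<^sup>2 * (dot m z (?c k)) ^ (2 * 1))"
        unfolding dot_def[of n] by (simp add: sum_fun_apply dot_def power2_eq_square sum_distrib_left)
      finally have "ennreal ((norm_of K (trunc n ?s))\<^sup>2) \<le> (\<Sum>k<n. ennreal (b\<^sup>2) * ennreal ((dot m z (?c k)) ^ (2 * 1)))"
        by (simp add: ennreal_mult[symmetric] sum_ennreal ennreal_leI del: One_nat_def)
      hence "ennreal ((norm_of K (trunc n ?s))\<^sup>2) * ennreal (gauss_weight m z) \<le>
          (\<Sum>k<n. ennreal (b\<^sup>2) * ennreal ((dot m z (?c k)) ^ (2 * 1))) * ennreal (gauss_weight m z)"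
        by (rule mult_right_mono) simp
      thus "ennreal ((norm_of K (trunc n ?s))\<^sup>2) * ennreal (gauss_weight m z) \<le>
          (\<Sum>k<n. ennreal (b\<^sup>2) * (ennreal ((dot m z (?c k)) ^ (2 * 1)) * ennreal (gauss_weight m z)))"
        by (simp only: sum_distrib_right mult.assoc)
    qed
    also have "\<dots> = (\<Sum>k<n. \<integral>\<^sup>+z. ennreal (b\<^sup>2) * (ennreal ((dot m z (?c k)) ^ (2 * 1)) * ennreal (gauss_weight m z)) \<partial>Leb m)"
      by (rule nn_integral_sum) measurable
    also have "\<dots> = (\<Sum>k<n. ennreal (b\<^sup>2) * ennreal ((nrm m (?c k)) ^ (2 * 1) * (fact (2 * 1) / (2 ^ 1 * fact 1))))"
      by (intro sum.cong refl, subst nn_integral_cmult, measurable, subst gauss_dot_moment[OF m]) simp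
    also have "\<dots> = (\<Sum>k<n. ennreal (b\<^sup>2 * (nrm m (?c k))\<^sup>2))"
      by (intro sum.cong refl) (simp add: ennreal_mult fact_numeral)
    also have "\<dots> = ennreal (\<Sum>k<n. b\<^sup>2 * (nrm m (?c k))\<^sup>2)" by (rule sum_ennreal) simp
    finally have nn: "?Q \<le> ennreal (\<Sum>k<n. b\<^sup>2 * (nrm m (?c k))\<^sup>2)" .
    have "(\<Sum>k<n. b\<^sup>2 * (nrm m (?c k))\<^sup>2) = b\<^sup>2 * (\<Sum>i<m. (nrm n (x i))\<^sup>2)"
      unfolding nrm_sq dot_def sum_distrib_left[symmetric] by (subst sum.swap) simp
    also have "\<dots> \<le> b\<^sup>2 * (\<Sum>i<m. (norm_of K (x i) / a)\<^sup>2)"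
    proof (intro mult_left_mono sum_mono power_mono)
      fix i assume "i \<in> {..<m}"
      hence "a * nrm n (x i) \<le> norm_of K (x i)" by (intro ab x) simp
      thus "nrm n (x i) \<le> norm_of K (x i) / a" using ab(1) by (simp add: field_simps)
    qed auto
    also have "\<dots> = (b / a)\<^sup>2 * (\<Sum>i<m. (norm_of K (x i))\<^sup>2)"
      by (simp add: power_divide sum_divide_distrib[symmetric])
    finally show ?thesis by (rule order_trans[OF nn ennreal_leI])
  qed
  thus "\<exists>b. \<forall>m x. 1 \<le> m \<longrightarrow> (\<forall>i<m. x i \<in> Rn n) \<longrightarrow>
      (\<integral>\<^sup>+z. ennreal ((norm_of K (trunc n (\<Sum>i<m. z i *\<^sub>R x i)))\<^sup>2) * ennreal (gauss_weight m z) \<partial>Leb m)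
        \<le> ennreal (b\<^sup>2 * (\<Sum>i<m. (norm_of K (x i))\<^sup>2))" by blast
  define f where "f z = (norm_of K (trunc n (\<Sum>i<m. z i *\<^sub>R x i)))\<^sup>2" for z
  have [measurable]: "f \<in> borel_measurable borel"
    unfolding f_def
    by (intro borel_measurable_power measurable_compose[OF _ norm_of_measurable[OF K]]) measurable
  have f_eq: "(norm_of K (\<Sum>i<m. g i *\<^sub>R x i))\<^sup>2 = f (trunc m g)" for g
  proof -
    have "(\<Sum>i<m. trunc m g i *\<^sub>R x i) = (\<Sum>i<m. g i *\<^sub>R x i)"
      by (intro sum.cong refl) (simp add: trunc_def)
    moreover have "(\<Sum>i<m. g i *\<^sub>R x i) \<in> Rn n" using x by (intro Rn_sum Rn_closed_ops(4)) auto
    ultimately show ?thesis by (simp add: f_def trunc_id del: topspace_Euclidean_space)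
  qed
  have fm: "(\<lambda>g. f (trunc m g)) \<in> borel_measurable (gauss m)"
    by (rule measurable_compose[OF gauss_measurable_trunc]) measurable
  have nn: "(\<integral>\<^sup>+g. ennreal (f (trunc m g)) \<partial>gauss m) = (\<integral>\<^sup>+z. ennreal (f z) * ennreal (gauss_weight m z) \<partial>Leb m)"
    by (rule nn_gauss) measurable
  have "(\<integral>\<^sup>+z. ennreal (f z) * ennreal (gauss_weight m z) \<partial>Leb m) < \<top>"
    using le[OF m x] unfolding f_def by (rule order.strict_trans1) simp_all
  hence "ennreal (LINT g|gauss m. f (trunc m g)) = (\<integral>\<^sup>+g. ennreal (f (trunc m g)) \<partial>gauss m)"
    using fm nn by (subst integral_eq_nn_integral) (auto simp: f_def)
  thus "ennreal (LINT g|gauss m. (norm_of K (\<Sum>i<m. g i *\<^sub>R x i))\<^sup>2) =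
      (\<integral>\<^sup>+z. ennreal ((norm_of K (trunc n (\<Sum>i<m. z i *\<^sub>R x i)))\<^sup>2) * ennreal (gauss_weight m z) \<partial>Leb m)"
    by (simp add: f_eq nn) (simp add: f_def)
qed

definition type2_bound :: "nat \<Rightarrow> (nat \<Rightarrow> real) set \<Rightarrow> real \<Rightarrow> bool" where
  "type2_bound n K T \<longleftrightarrow> 0 < T \<and>
     (\<forall>m\<ge>1. \<forall>x :: nat \<Rightarrow> nat \<Rightarrow> real. (\<forall>i<m. x i \<in> Rn n) \<longrightarrow>
        sqrt (LINT g|gauss m. (norm_of K (\<Sum>i<m. g i *\<^sub>R x i))\<^sup>2)
          \<le> T * sqrt (\<Sum>i<m. (norm_of K (x i))\<^sup>2))"

text \<open>A lower bound for the infimum in \<open>type2_const\<close> requires the set of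
  admissible constants to be nonempty.\<close>

lemma type2_bound_exists:
  assumes K: "sym_body n K" and n: "1 \<le> n"
  shows "\<exists>T. type2_bound n K T"
proof -
  obtain b where b: "\<And>m x. 1 \<le> m \<Longrightarrow> (\<And>i. i < m \<Longrightarrow> x i \<in> Rn n) \<Longrightarrow>
      (\<integral>\<^sup>+z. ennreal ((norm_of K (trunc n (\<Sum>i<m. z i *\<^sub>R x i)))\<^sup>2) * ennreal (gauss_weight m z) \<partial>Leb m)
        \<le> ennreal (b\<^sup>2 * (\<Sum>i<m. (norm_of K (x i))\<^sup>2))"
    using gauss_norm_LINT(2)[OF K n, of 1 "\<lambda>_. 0"] by auto
  have "type2_bound n K (\<bar>b\<bar> + 1)"
    unfolding type2_bound_def
  proof (intro conjI allI impI)
    fix m and x :: "nat \<Rightarrow> nat \<Rightarrow> real" assume m: "1 \<le> m" and x: "\<forall>i<m. x i \<in> Rn n"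
    have "ennreal (LINT g|gauss m. (norm_of K (\<Sum>i<m. g i *\<^sub>R x i))\<^sup>2) \<le> ennreal (b\<^sup>2 * (\<Sum>i<m. (norm_of K (x i))\<^sup>2))"
      using gauss_norm_LINT(1)[OF K n m, of x] b[OF m, of x] x by simp
    hence "(LINT g|gauss m. (norm_of K (\<Sum>i<m. g i *\<^sub>R x i))\<^sup>2) \<le> b\<^sup>2 * (\<Sum>i<m. (norm_of K (x i))\<^sup>2)"
      by (subst (asm) ennreal_le_iff) (auto intro!: mult_nonneg_nonneg sum_nonneg)
    hence "sqrt (LINT g|gauss m. (norm_of K (\<Sum>i<m. g i *\<^sub>R x i))\<^sup>2) \<le> sqrt (b\<^sup>2 * (\<Sum>i<m. (norm_of K (x i))\<^sup>2))"
      by (rule real_sqrt_le_mono)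
    also have "\<dots> = \<bar>b\<bar> * sqrt (\<Sum>i<m. (norm_of K (x i))\<^sup>2)" by (simp add: real_sqrt_mult)
    also have "\<dots> \<le> (\<bar>b\<bar> + 1) * sqrt (\<Sum>i<m. (norm_of K (x i))\<^sup>2)"
      by (intro mult_right_mono) (auto intro: sum_nonneg)
    finally show "sqrt (LINT g|gauss m. (norm_of K (\<Sum>i<m. g i *\<^sub>R x i))\<^sup>2)
        \<le> (\<bar>b\<bar> + 1) * sqrt (\<Sum>i<m. (norm_of K (x i))\<^sup>2)" .
  qed simp
  thus ?thesis by blast
qed

subsection \<open>Decomposition of the covariance\<close>

text \<open>\<open>M\<close> is a finite sum of rank one matrices \<open>x x\<^sup>T\<close> with
  \<open>\<Sum> \<parallel>x\<parallel>\<^sup>2 \<le> q\<close>. Lists admit repeated vectors and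
  make addition a concatenation.\<close>

definition gram :: "nat \<Rightarrow> (nat \<Rightarrow> real) set \<Rightarrow> (nat \<Rightarrow> nat \<Rightarrow> real) \<Rightarrow> real \<Rightarrow> bool" where
  "gram n K M q \<longleftrightarrow> (\<exists>xs. set xs \<subseteq> Rn n \<and>
     (\<forall>a<n. \<forall>b<n. (\<Sum>x\<leftarrow>xs. x a * x b) = M a b) \<and> (\<Sum>x\<leftarrow>xs. (norm_of K x)\<^sup>2) \<le> q)"

lemma gram_cong:
  "gram n K M q \<Longrightarrow> (\<And>a b. a < n \<Longrightarrow> b < n \<Longrightarrow> M a b = M' a b) \<Longrightarrow> q \<le> q' \<Longrightarrow> gram n K M' q'"
  unfolding gram_def by (elim exE conjE, intro exI conjI) auto

lemma gram_zero: "gram n K (\<lambda>_ _. 0) 0"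
  unfolding gram_def by (intro exI[of _ "[]"]) auto

lemma gram_add:
  assumes "gram n K M q" "gram n K M' q'"
  shows "gram n K (\<lambda>a b. M a b + M' a b) (q + q')"
proof -
  obtain xs where xs: "set xs \<subseteq> Rn n" "\<And>a b. a < n \<Longrightarrow> b < n \<Longrightarrow> (\<Sum>x\<leftarrow>xs. x a * x b) = M a b"
    "(\<Sum>x\<leftarrow>xs. (norm_of K x)\<^sup>2) \<le> q" using assms(1) unfolding gram_def by blast
  obtain ys where ys: "set ys \<subseteq> Rn n" "\<And>a b. a < n \<Longrightarrow> b < n \<Longrightarrow> (\<Sum>x\<leftarrow>ys. x a * x b) = M' a b"
    "(\<Sum>x\<leftarrow>ys. (norm_of K x)\<^sup>2) \<le> q'" using assms(2) unfolding gram_def by blast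
  show ?thesis unfolding gram_def
    by (intro exI[of _ "xs @ ys"]) (use xs ys in \<open>auto intro: add_mono\<close>)
qed

lemma gram_sum:
  assumes "finite I" "\<And>i. i \<in> I \<Longrightarrow> gram n K (M i) (q i)"
  shows "gram n K (\<lambda>a b. \<Sum>i\<in>I. M i a b) (\<Sum>i\<in>I. q i)"
  using assms by (induction I rule: finite_induct) (auto intro: gram_zero gram_add)

lemma gram_single:
  assumes K: "sym_body n K" and "0 \<le> t" "v \<in> Rn n"
  shows "gram n K (\<lambda>a b. t * (v a * v b)) (t * (norm_of K v)\<^sup>2)"
  unfolding gram_def
  by (intro exI[of _ "[sqrt t *\<^sub>R v]"])
     (use assms in \<open>auto simp: norm_of_scale[OF K] power_mult_distrib Rn_iff mult_ac\<close>)

text \<open>With the rank one matrices of the vectors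
  \<open>e\<^sub>a - sgn (E a b) e\<^sub>b\<close>, weighted by
  \<open>\<bar>E a b\<bar> / 2\<close>, one obtains the diagonal matrix of the absolute row sums of
  \<open>E\<close> minus \<open>E\<close>. The diagonal missing to \<open>n e\<close> is nonnegative
  and is supplied by the axis vectors.\<close>

lemma gram_diagonally_dominant:
  assumes K: "sym_body n K"
    and E: "\<And>a b. a < n \<Longrightarrow> b < n \<Longrightarrow> E a b = E b a" "\<And>a b. a < n \<Longrightarrow> b < n \<Longrightarrow> \<bar>E a b\<bar> \<le> e"
    and \<beta>: "\<And>i. i < n \<Longrightarrow> norm_of K (axis_vec i) \<le> \<beta>" and e: "0 \<le> e" "0 \<le> \<beta>"
  shows "gram n K (\<lambda>p q. (if p = q then real n * e else 0) - E p q) (3 * (real n)\<^sup>2 * e * \<beta>\<^sup>2)"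
proof -
  define \<rho> where "\<rho> p = (\<Sum>b<n. \<bar>E p b\<bar>)" for p
  have \<rho>: "\<rho> p \<le> real n * e" if "p < n" for p
    using sum_bounded_above[of "{..<n}" "\<lambda>b. \<bar>E p b\<bar>" e] E(2)[OF that] by (simp add: \<rho>_def)
  define v where "v a b = axis_vec a - sgn (E a b) *\<^sub>R axis_vec b" for a b
  have vR: "v a b \<in> Rn n" if "a < n" "b < n" for a b
    using that unfolding v_def by (intro Rn_closed_ops axis_vec_in_Rn)
  have vN: "norm_of K (v a b) \<le> 2 * \<beta>" if ab: "a < n" "b < n" for a b
  proof -
    have "norm_of K (v a b) = norm_of K (axis_vec a + (- sgn (E a b)) *\<^sub>R axis_vec b)"
      by (simp add: v_def)
    also have "\<dots> \<le> norm_of K (axis_vec a) + norm_of K ((- sgn (E a b)) *\<^sub>R axis_vec b)"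
      by (intro norm_of_triangle[OF K] Rn_closed_ops axis_vec_in_Rn ab)
    also have "norm_of K ((- sgn (E a b)) *\<^sub>R axis_vec b) = \<bar>- sgn (E a b)\<bar> * norm_of K (axis_vec b)"
      by (intro norm_of_scale[OF K] axis_vec_in_Rn ab)
    also have "\<dots> \<le> 1 * \<beta>" using \<beta>[OF ab(2)] e
      by (intro mult_mono) (auto simp: abs_sgn_eq norm_of_nonneg[OF K axis_vec_in_Rn[OF ab(2)]])
    finally show ?thesis using \<beta>[OF ab(1)] by simp
  qed
  have 1: "gram n K (\<lambda>p q. \<Sum>a<n. \<Sum>b<n. \<bar>E a b\<bar> / 2 * (v a b p * v a b q))
      (\<Sum>a<n. \<Sum>b<n. \<bar>E a b\<bar> / 2 * (norm_of K (v a b))\<^sup>2)"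
    by (intro gram_sum gram_single[OF K] vR) auto
  have 2: "gram n K (\<lambda>p q. \<Sum>a<n. (real n * e - \<rho> a) * (axis_vec a p * axis_vec a q))
      (\<Sum>a<n. (real n * e - \<rho> a) * (norm_of K (axis_vec a))\<^sup>2)"
    by (intro gram_sum gram_single[OF K] axis_vec_in_Rn) (use \<rho> in auto)
  \<comment> \<open>The vectors \<open>v a b\<close> cost
    \<open>2 n\<^sup>2 e \<beta>\<^sup>2\<close> and the diagonal costs
    \<open>n\<^sup>2 e \<beta>\<^sup>2\<close>, whence the factor 3.\<close>
  have q1: "(\<Sum>a<n. \<Sum>b<n. \<bar>E a b\<bar> / 2 * (norm_of K (v a b))\<^sup>2) \<le> (\<Sum>a<n. \<Sum>b<n. e / 2 * (2 * \<beta>)\<^sup>2)"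
    using E(2) vN vR norm_of_nonneg[OF K] e by (intro sum_mono mult_mono power_mono) auto
  have q2: "(\<Sum>a<n. (real n * e - \<rho> a) * (norm_of K (axis_vec a))\<^sup>2) \<le> (\<Sum>a<n. (real n * e) * \<beta>\<^sup>2)"
    using \<beta> norm_of_nonneg[OF K axis_vec_in_Rn] e
    by (intro sum_mono mult_mono power_mono) (auto simp: \<rho>_def sum_nonneg)
  show ?thesis
  proof (rule gram_cong[OF gram_add[OF 1 2]])
    fix p q assume p: "p < n" and q: "q < n"
    have ab: "\<bar>E a b\<bar> / 2 * (v a b p * v a b q) =
        (if a = p then (if a = q then \<bar>E a b\<bar> / 2 else 0) else 0) +
        (if b = p then (if b = q then \<bar>E a b\<bar> / 2 else 0) else 0)
        - (if a = p then (if b = q then E a b / 2 else 0) else 0)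
        - (if a = q then (if b = p then E a b / 2 else 0) else 0)" for a b
      by (cases "E a b" "0 :: real" rule: linorder_cases) (auto simp: v_def axis_vec_def)
    have "(\<Sum>a<n. \<Sum>b<n. \<bar>E a b\<bar> / 2 * (v a b p * v a b q)) =
        (if p = q then \<rho> p / 2 else 0) + (if p = q then (\<Sum>a<n. \<bar>E a p\<bar>) / 2 else 0) - E p q / 2 - E q p / 2"
    proof -
      have s1: "(\<Sum>a<n. \<Sum>b<n. (if a = p then (if a = q then \<bar>E a b\<bar> / 2 else 0) else 0)) = (if p = q then \<rho> p / 2 else 0)"
      proof -
        have "(\<Sum>a<n. \<Sum>b<n. (if a = p then (if a = q then \<bar>E a b\<bar> / 2 else 0) else 0)) =
            (\<Sum>a<n. if a = p then (if p = q then \<rho> p / 2 else 0) else 0)"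
          by (intro sum.cong refl) (auto simp: \<rho>_def sum_divide_distrib)
        thus ?thesis using p by simp
      qed
      have s2: "(\<Sum>a<n. \<Sum>b<n. (if b = p then (if b = q then \<bar>E a b\<bar> / 2 else 0) else 0)) =
          (if p = q then (\<Sum>a<n. \<bar>E a p\<bar>) / 2 else 0)"
        using p by (simp add: sum_divide_distrib)
      have s3: "(\<Sum>a<n. \<Sum>b<n. (if a = x then (if b = y then E a b / 2 else 0) else 0)) = E x y / 2"
        if "x < n" "y < n" for x y
      proof -
        have "(\<Sum>a<n. \<Sum>b<n. (if a = x then (if b = y then E a b / 2 else 0) else 0)) =
            (\<Sum>a<n. if a = x then E x y / 2 else 0)"
          using that by (intro sum.cong refl) auto
        thus ?thesis using that by simp
      qed
      show ?thesis unfolding ab sum.distrib sum_subtractf s1 s2 s3[OF p q] s3[OF q p] ..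
    qed
    also have "(\<Sum>a<n. \<bar>E a p\<bar>) = \<rho> p" unfolding \<rho>_def using E(1) p by (intro sum.cong refl) simp
    also have "E q p = E p q" by (rule E(1)[OF q p])
    finally have A: "(\<Sum>a<n. \<Sum>b<n. \<bar>E a b\<bar> / 2 * (v a b p * v a b q)) = (if p = q then \<rho> p else 0) - E p q"
      by simp
    have B: "(\<Sum>a<n. (real n * e - \<rho> a) * (axis_vec a p * axis_vec a q)) = (if p = q then real n * e - \<rho> p else 0)"
    proof -
      have "(\<Sum>a<n. (real n * e - \<rho> a) * (axis_vec a p * axis_vec a q)) =
          (\<Sum>a<n. if a = p then (if p = q then real n * e - \<rho> p else 0) else 0)"
        by (intro sum.cong refl) (auto simp: axis_vec_def)
      thus ?thesis using p by simp
    qed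
    show "(\<Sum>a<n. \<Sum>b<n. \<bar>E a b\<bar> / 2 * (v a b p * v a b q)) +
        (\<Sum>a<n. (real n * e - \<rho> a) * (axis_vec a p * axis_vec a q)) = (if p = q then real n * e else 0) - E p q"
      unfolding A B by simp
  next
    have "(\<Sum>a<n. \<Sum>b<n. e / 2 * (2 * \<beta>)\<^sup>2) + (\<Sum>a<n. (real n * e) * \<beta>\<^sup>2) = 3 * (real n)\<^sup>2 * e * \<beta>\<^sup>2"
      by (simp add: power2_eq_square algebra_simps)
    thus "(\<Sum>a<n. \<Sum>b<n. \<bar>E a b\<bar> / 2 * (norm_of K (v a b))\<^sup>2) +
        (\<Sum>a<n. (real n * e - \<rho> a) * (norm_of K (axis_vec a))\<^sup>2) \<le> 3 * (real n)\<^sup>2 * e * \<beta>\<^sup>2"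
      using q1 q2 by linarith
  qed
qed


text \<open>If \<open>f\<close> is not integrable, its integral is 0 by convention and again at most
  \<open>r\<close>.\<close>

lemma LINT_le_nn:
  assumes "\<And>x. x \<in> space M \<Longrightarrow> 0 \<le> f x" "(\<integral>\<^sup>+x. ennreal (f x) \<partial>M) \<le> ennreal r" "0 \<le> r"
  shows "(LINT x|M. f x) \<le> r"
proof (cases "integrable M f")
  case True
  hence "ennreal (LINT x|M. f x) \<le> ennreal r"
    using assms(1,2) by (subst nn_integral_eq_integral[symmetric]) (auto intro!: AE_I2)
  thus ?thesis using assms(3) by (simp add: ennreal_le_iff)
qed (use assms in \<open>simp add: not_integrable_integral_eq\<close>)

text \<open>Polarisation: the second moment in the direction \<open>e\<^sub>a + e\<^sub>b\<close> is
  \<open>2 c\<close>, which the two diagonal terms already exhaust.\<close>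

lemma isotropic_coordinates:
  assumes K: "sym_body n K" and c: "0 \<le> c" "\<And>v. v \<in> Rn n \<Longrightarrow> second_moment n K v = ennreal (c * (nrm n v)\<^sup>2)"
    and ab: "a < n" "b < n"
  shows "(LINT x:K|Leb n. x a * x b) = (if a = b then c else 0)"
proof -
  have sq: "(LINT x:K|Leb n. (dot n x v)\<^sup>2) = c * (nrm n v)\<^sup>2" if v: "v \<in> Rn n" for v
  proof -
    have "ennreal (LINT x:K|Leb n. (dot n x v)\<^sup>2) = ennreal (c * (nrm n v)\<^sup>2)"
      using c(2)[OF v] by (simp only: second_moment_LINT[OF K])
    moreover have "0 \<le> (LINT x:K|Leb n. (dot n x v)\<^sup>2)"
      by (auto simp: set_lebesgue_integral_def intro!: integral_nonneg)
    ultimately show ?thesis using c(1) by (simp add: ennreal_inj)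
  qed
  have diag: "(LINT x:K|Leb n. x i * x i) = c" if "i < n" for i
    using sq[OF axis_vec_in_Rn[OF that]] that by (simp add: dot_axis nrm_axis power2_eq_square)
  obtain R where R: "0 < R" "\<And>y. y \<in> K \<Longrightarrow> nrm n y \<le> R" using sym_body_bounds[OF K] by metis
  have int: "set_integrable (Leb n) K (\<lambda>x. x i * x j)" if ij: "i < n" "j < n" for i j
  proof (rule sym_body_integrable[OF K, where B = "R * R"])
    fix x assume "x \<in> K"
    thus "\<bar>x i * x j\<bar> \<le> R * R" using coord_le_nrm[OF ij(1), of x] coord_le_nrm[OF ij(2), of x] R
      unfolding abs_mult by (intro mult_mono) (auto intro: order_trans)
  qed measurable
  show ?thesis
  proof (cases "a = b")
    case True thus ?thesis using diag ab by simp
  next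
    case False
    let ?v = "axis_vec a + axis_vec b"
    have "(nrm n ?v)\<^sup>2 = 2" using ab False
      by (simp add: nrm_sq dot_axis axis_vec_in_Rn) (simp add: axis_vec_def)
    hence "2 * c = (LINT x:K|Leb n. (dot n x ?v)\<^sup>2)"
      using ab sq[of ?v] by (simp add: axis_vec_in_Rn Rn_closed_ops(1) del: dot_simps)
    also have "\<dots> = (LINT x:K|Leb n. x a * x a + (2 * (x a * x b) + x b * x b))"
      using ab by (simp add: dot_axis power2_eq_square algebra_simps)
    also have "\<dots> = (LINT x:K|Leb n. x a * x a) + (2 * (LINT x:K|Leb n. x a * x b) + (LINT x:K|Leb n. x b * x b))"
    proof -
      have i2: "set_integrable (Leb n) K (\<lambda>x. 2 * (x a * x b))" using int[OF ab] by simp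
      have "(LINT x:K|Leb n. 2 * (x a * x b) + x b * x b) = 2 * (LINT x:K|Leb n. x a * x b) + (LINT x:K|Leb n. x b * x b)"
        using set_integral_add(2)[OF i2 int[OF ab(2) ab(2)]] by simp
      thus ?thesis using set_integral_add(2)[OF int[OF ab(1) ab(1)] set_integral_add(1)[OF i2 int[OF ab(2) ab(2)]]]
        by simp
    qed
    finally show ?thesis using diag ab False by simp
  qed
qed

text \<open>A Riemann sum. A grid of mesh \<open>1 / N\<close> cuts \<open>K\<close> into finitely
  many cells, and each cell is replaced by one of its points, weighted by its share of the volume.
  The weights sum to 1 and the norm is at most 1 on \<open>K\<close>, whence the bound 1.\<close>

lemma covariance_gram:
  assumes K: "sym_body n K" and V: "V = measure (Leb n) K"
    and c: "0 \<le> c" "\<And>v. v \<in> Rn n \<Longrightarrow> second_moment n K v = ennreal (c * (nrm n v)\<^sup>2)" and e: "0 < e"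
  shows "\<exists>A. gram n K A 1 \<and> (\<forall>a<n. \<forall>b<n. A a b = A b a \<and> \<bar>A a b - (if a = b then c / V else 0)\<bar> \<le> e)"
proof -
  obtain R where R: "0 < R" "\<And>y. y \<in> K \<Longrightarrow> nrm n y \<le> R" using sym_body_bounds[OF K] by metis
  have coord: "\<bar>x i\<bar> \<le> R" if "x \<in> K" "i < n" for x i
    using coord_le_nrm[OF that(2), of x] R(2)[OF that(1)] by linarith
  note KR = sym_body_compact(2)[OF K]
  have Km[measurable]: "K \<in> sets borel" using K by measurable
  have Vpos: "0 < V" unfolding V by (rule measure_sym_body_pos[OF K])
  \<comment> \<open>Within a cell the product of two coordinates varies by at most
    \<open>2 * R / N\<close>.\<close>
  obtain N0 :: nat where N0: "2 * R / e \<le> real N0" using real_arch_simple by blast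
  define N where "N = real (Suc N0)"
  have N: "0 < N" "2 * R / N \<le> e"
  proof -
    show "0 < N" by (simp add: N_def)
    have "2 * R / e \<le> N" using N0 by (simp add: N_def)
    thus "2 * R / N \<le> e" using e \<open>0 < N\<close> by (simp add: field_simps)
  qed
  define key where "key x = map (\<lambda>i. \<lfloor>N * x i\<rfloor>) [0..<n]" for x :: "nat \<Rightarrow> real"
  have key_eq: "key x = key y \<Longrightarrow> i < n \<Longrightarrow> \<bar>x i - y i\<bar> \<le> 1 / N" for x y i
  proof -
    assume "key x = key y" "i < n"
    hence "\<lfloor>N * x i\<rfloor> = \<lfloor>N * y i\<rfloor>" by (simp add: key_def)
    hence "\<bar>N * x i - N * y i\<bar> \<le> 1" by linarith
    hence "N * \<bar>x i - y i\<bar> \<le> 1" using N by (simp add: right_diff_distrib[symmetric] abs_mult)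
    thus "\<bar>x i - y i\<bar> \<le> 1 / N" using N by (simp add: field_simps)
  qed
  define I where "I = key ` K"
  have fin: "finite I"
  proof (rule finite_subset)
    show "I \<subseteq> {xs. set xs \<subseteq> {\<lfloor>- (N * R)\<rfloor>..\<lfloor>N * R\<rfloor>} \<and> length xs = n}"
    proof -
      have "\<lfloor>- (N * R)\<rfloor> \<le> \<lfloor>N * x i\<rfloor> \<and> \<lfloor>N * x i\<rfloor> \<le> \<lfloor>N * R\<rfloor>" if "x \<in> K" "i < n" for x i
      proof -
        have "N * \<bar>x i\<bar> \<le> N * R" using coord[OF that] N by (intro mult_left_mono) auto
        hence "\<bar>N * x i\<bar> \<le> N * R" using N by (simp add: abs_mult)
        thus ?thesis by (intro conjI floor_mono) auto
      qed
      thus ?thesis by (auto simp: I_def key_def)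
    qed
  qed (rule finite_lists_length_eq, simp)
  define rep where "rep \<kappa> = (SOME x. x \<in> K \<and> key x = \<kappa>)" for \<kappa>
  have rep: "rep \<kappa> \<in> K" "key (rep \<kappa>) = \<kappa>" if "\<kappa> \<in> I" for \<kappa>
    using that someI_ex[of "\<lambda>x. x \<in> K \<and> key x = \<kappa>"] by (auto simp: I_def rep_def)
  define cell where "cell \<kappa> = {x \<in> K. key x = \<kappa>}" for \<kappa>
  have cell[measurable]: "cell \<kappa> \<in> sets borel" for \<kappa>
  proof (cases "length \<kappa> = n")
    case True
    hence "cell \<kappa> = K \<inter> {x. \<forall>i<n. \<lfloor>N * x i\<rfloor> = \<kappa> ! i}"
      by (auto simp: cell_def key_def list_eq_iff_nth_eq)
    also have "\<dots> \<in> sets borel" by measurable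
    finally show ?thesis .
  next
    case False
    hence "cell \<kappa> = {}" by (auto simp: cell_def key_def)
    thus ?thesis by simp
  qed
  have cfin: "emeasure (Leb n) (cell \<kappa>) < \<infinity>" for \<kappa>
    by (rule order.strict_trans1[OF emeasure_mono emeasure_sym_body_finite[OF K]]) (auto simp: cell_def)
  have step: "integrable (Leb n) (\<lambda>x. indicator K x * g (key x))"
    "(LINT x|Leb n. indicator K x * g (key x)) = (\<Sum>\<kappa>\<in>I. g \<kappa> * measure (Leb n) (cell \<kappa>))" for g :: "int list \<Rightarrow> real"
  proof -
    have eq: "indicator K x * g (key x) = (\<Sum>\<kappa>\<in>I. g \<kappa> * indicator (cell \<kappa>) x)" for x
    proof (cases "x \<in> K")
      case True
      have "(\<Sum>\<kappa>\<in>I. g \<kappa> * indicator (cell \<kappa>) x) = (\<Sum>\<kappa>\<in>I. if \<kappa> = key x then g (key x) else 0)"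
        using True by (intro sum.cong) (auto simp: cell_def)
      thus ?thesis using True fin by (simp add: I_def)
    qed (simp add: cell_def)
    have int: "integrable (Leb n) (\<lambda>x. g \<kappa> * indicator (cell \<kappa>) x)" for \<kappa>
      using cfin[of \<kappa>] by (intro integrable_mult_right) (simp add: integrable_indicator_iff)
    show "integrable (Leb n) (\<lambda>x. indicator K x * g (key x))"
      unfolding eq using int by (intro Bochner_Integration.integrable_sum)
    show "(LINT x|Leb n. indicator K x * g (key x)) = (\<Sum>\<kappa>\<in>I. g \<kappa> * measure (Leb n) (cell \<kappa>))"
      unfolding eq using int by (subst Bochner_Integration.integral_sum) auto
  qed
  define w where "w \<kappa> = measure (Leb n) (cell \<kappa>) / V" for \<kappa>
  have w: "0 \<le> w \<kappa>" for \<kappa> using Vpos by (simp add: w_def)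
  have wsum: "(\<Sum>\<kappa>\<in>I. w \<kappa>) = 1"
    using step(2)[of "\<lambda>_. 1"] Vpos by (simp add: w_def sum_divide_distrib[symmetric] V)
  define A where "A a b = (\<Sum>\<kappa>\<in>I. w \<kappa> * (rep \<kappa> a * rep \<kappa> b))" for a b
  have "gram n K A (\<Sum>\<kappa>\<in>I. w \<kappa> * (norm_of K (rep \<kappa>))\<^sup>2)"
    unfolding A_def using KR rep w by (intro gram_sum[OF fin] gram_single[OF K]) blast+
  moreover have "(\<Sum>\<kappa>\<in>I. w \<kappa> * (norm_of K (rep \<kappa>))\<^sup>2) \<le> (\<Sum>\<kappa>\<in>I. w \<kappa> * 1)"
  proof (intro sum_mono mult_left_mono w)
    fix \<kappa> assume "\<kappa> \<in> I"
    hence "norm_of K (rep \<kappa>) \<le> 1" "0 \<le> norm_of K (rep \<kappa>)"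
      using rep(1) norm_of_le[OF K] norm_of_nonneg[OF K] KR by blast+
    thus "(norm_of K (rep \<kappa>))\<^sup>2 \<le> 1" by (simp add: power_le_one)
  qed
  ultimately have gram: "gram n K A 1" using wsum by (auto elim: gram_cong)
  have "\<bar>A a b - (if a = b then c / V else 0)\<bar> \<le> e" if ab: "a < n" "b < n" for a b
  proof -
    define g where "g \<kappa> = rep \<kappa> a * rep \<kappa> b" for \<kappa>
    have intp: "integrable (Leb n) (\<lambda>x. indicator K x * (x a * x b))"
    proof -
      have "set_integrable (Leb n) K (\<lambda>x. x a * x b)"
      proof (rule sym_body_integrable[OF K, where B = "R * R"])
        fix x assume "x \<in> K"
        thus "\<bar>x a * x b\<bar> \<le> R * R" using coord[OF _ ab(1)] coord[OF _ ab(2)] R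
          unfolding abs_mult by (intro mult_mono) auto
      qed measurable
      thus ?thesis by (simp add: set_integrable_def)
    qed
    have Ag: "V * A a b = (LINT x|Leb n. indicator K x * g (key x))"
      using step(2)[of g] Vpos by (simp add: A_def g_def w_def sum_distrib_left mult_ac)
    have "(LINT x|Leb n. indicator K x * (x a * x b)) = (if a = b then c else 0)"
      using isotropic_coordinates[OF K c ab] by (simp add: set_lebesgue_integral_def)
    hence "V * A a b - (if a = b then c else 0) =
        (LINT x|Leb n. indicator K x * g (key x) - indicator K x * (x a * x b))"
      unfolding Ag using step(1) intp by simp
    also have "\<bar>\<dots>\<bar> \<le> (LINT x|Leb n. e * indicator K x)"
    proof (rule order_trans[OF integral_abs_bound], rule integral_mono)
      show "integrable (Leb n) (\<lambda>x. \<bar>indicator K x * g (key x) - indicator K x * (x a * x b)\<bar>)"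
        using step(1) intp by (intro integrable_abs Bochner_Integration.integrable_diff)
      show "integrable (Leb n) (\<lambda>x. e * indicator K x)"
        using emeasure_sym_body_finite[OF K] by (intro integrable_mult_right) (simp add: integrable_indicator_iff)
      fix x
      show "\<bar>indicator K x * g (key x) - indicator K x * (x a * x b)\<bar> \<le> e * indicator K x"
      proof (cases "x \<in> K")
        case True
        hence kI: "key x \<in> I" by (simp add: I_def)
        let ?y = "rep (key x)"
        note y = rep[OF kI]
        have "\<bar>?y a * ?y b - x a * x b\<bar> = \<bar>(?y a - x a) * ?y b + x a * (?y b - x b)\<bar>"
          by (simp add: algebra_simps)
        also have "\<dots> \<le> \<bar>?y a - x a\<bar> * \<bar>?y b\<bar> + \<bar>x a\<bar> * \<bar>?y b - x b\<bar>"
          by (rule order_trans[OF abs_triangle_ineq]) (simp add: abs_mult)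
        also have "\<dots> \<le> (1 / N) * R + R * (1 / N)"
          using key_eq[OF y(2) ab(1)] key_eq[OF y(2) ab(2)] coord[OF y(1) ab(2)] coord[OF True ab(1)] R N
          by (intro add_mono mult_mono) auto
        also have "\<dots> \<le> e" using N by simp
        finally show ?thesis using True by (simp add: g_def)
      qed simp
    qed
    also have "\<dots> = e * V" by (simp add: V)
    finally have le: "\<bar>V * A a b - (if a = b then c else 0)\<bar> \<le> e * V" .
    have "A a b - (if a = b then c / V else 0) = (V * A a b - (if a = b then c else 0)) / V"
      using Vpos by (simp add: field_simps)
    also have "\<bar>\<dots>\<bar> \<le> e" using le Vpos by (simp add: abs_divide pos_divide_le_eq)
    finally show ?thesis .
  qed
  moreover have "A a b = A b a" for a b by (simp add: A_def mult.commute)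
  ultimately show ?thesis using gram by blast
qed

text \<open>With \<open>A\<close> the approximate covariance and \<open>E = A - (c / V) I\<close>,
  the matrix \<open>(c / V + n e) I\<close> is the sum of \<open>A\<close> and
  \<open>n e I - E\<close>. The error \<open>e\<close> is chosen so that the second summand costs
  1/8, which gives 9/8 in total.\<close>

lemma scaled_identity_gram:
  assumes K: "sym_body n K" and n: "1 \<le> n" and V: "V = measure (Leb n) K"
    and c: "0 \<le> c" "\<And>v. v \<in> Rn n \<Longrightarrow> second_moment n K v = ennreal (c * (nrm n v)\<^sup>2)"
  shows "\<exists>t>0. c / V \<le> t \<and> gram n K (\<lambda>a b. if a = b then t else 0) (9 / 8)"
proof -
  obtain b where b: "0 < b" "\<And>x. x \<in> Rn n \<Longrightarrow> norm_of K x \<le> b * nrm n x" using norm_of_equiv[OF K] by metis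
  have \<beta>: "norm_of K (axis_vec i) \<le> b" if "i < n" for i
    using b(2)[OF axis_vec_in_Rn[OF that]] nrm_axis[OF that] by simp
  define e where "e = 1 / (8 * (3 * (real n)\<^sup>2 * b\<^sup>2))"
  have e: "0 < e" "3 * (real n)\<^sup>2 * e * b\<^sup>2 = 1 / 8" using n b by (auto simp: e_def)
  obtain A where A: "gram n K A 1" "\<And>p q. p < n \<Longrightarrow> q < n \<Longrightarrow> A p q = A q p"
    "\<And>p q. p < n \<Longrightarrow> q < n \<Longrightarrow> \<bar>A p q - (if p = q then c / V else 0)\<bar> \<le> e"
    using covariance_gram[OF K V c e(1)] by blast
  define E where "E p q = A p q - (if p = q then c / V else 0)" for p q
  have D: "gram n K (\<lambda>p q. (if p = q then real n * e else 0) - E p q) (3 * (real n)\<^sup>2 * e * b\<^sup>2)"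
    by (rule gram_diagonally_dominant[OF K _ _ \<beta>]) (use A e b in \<open>auto simp: E_def\<close>)
  have "gram n K (\<lambda>p q. if p = q then c / V + real n * e else 0) (9 / 8)"
    by (rule gram_cong[OF gram_add[OF A(1) D]]) (use e(2) in \<open>auto simp: E_def\<close>)
  moreover have "0 < real n * e" using n e by simp
  moreover have "0 \<le> c / V" using c V by simp
  ultimately show ?thesis by (intro exI[of _ "c / V + real n * e"]) auto
qed

section \<open>Mean norm against type 2\<close>

text \<open>Origin of the constant: type 2 gives \<open>t n M\<^sup>2 \<le> 9/8 T\<^sup>2\<close>
  for the mean norm \<open>M\<close>, and \<open>t n \<ge> 1/8\<close>, so that
  \<open>M\<^sup>2 \<le> 9 T\<^sup>2\<close>.\<close>

theorem mean_norm_le_type2: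
  assumes K: "sym_body n K" and n: "1 \<le> n" and iso: "isotropic n K"
    and V: "measure (Leb n) K = unit_ball_vol (real n)" and T: "type2_bound n K T"
  shows "mean_norm n 2 K \<le> 3 * T"
proof -
  obtain c where c: "0 \<le> c" "\<And>v. v \<in> Rn n \<Longrightarrow> second_moment n K v = ennreal (c * (nrm n v)\<^sup>2)"
    using iso isotropic_iff[OF K n] by blast
  have cV: "1 / 8 \<le> real n * (c / unit_ball_vol (real n))"
    using isotropic_moment_lower[OF K n V c] unit_ball_vol_pos[of "real n"] by (simp add: field_simps)
  obtain t where t: "0 < t" "c / unit_ball_vol (real n) \<le> t" "gram n K (\<lambda>a b. if a = b then t else 0) (9 / 8)"
    using scaled_identity_gram[OF K n V[symmetric] c] by blast
  obtain xs where xs: "set xs \<subseteq> Rn n" "\<And>a b. a < n \<Longrightarrow> b < n \<Longrightarrow> (\<Sum>x\<leftarrow>xs. x a * x b) = (if a = b then t else 0)"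
    "(\<Sum>x\<leftarrow>xs. (norm_of K x)\<^sup>2) \<le> 9 / 8"
    using t(3) unfolding gram_def by blast
  define m where "m = length xs"
  define x where "x i = xs ! i" for i
  \<comment> \<open>Type 2 is required for \<open>m \<ge> 1\<close> only; an empty list would have
    the zero matrix as its Gram matrix.\<close>
  have m: "1 \<le> m"
  proof (rule ccontr)
    assume "\<not> 1 \<le> m"
    hence "xs = []" by (cases xs) (auto simp: m_def)
    thus False using xs(2)[of 0 0] n t(1) by simp
  qed
  have xR: "x i \<in> Rn n" if "i < m" for i using that xs(1) nth_mem[of i xs] unfolding x_def m_def by blast
  have xorth: "(\<Sum>i<m. x i a * x i b) = (if a = b then (sqrt t)\<^sup>2 else 0)" if "a < n" "b < n" for a b
    using xs(2)[OF that] t(1) by (simp add: sum_list_sum_nth x_def m_def atLeast0LessThan)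
  have xq: "(\<Sum>i<m. (norm_of K (x i))\<^sup>2) \<le> 9 / 8"
    using xs(3) by (simp add: sum_list_sum_nth x_def m_def atLeast0LessThan)
  define H where "H z = ennreal ((norm_of K (trunc n z))\<^sup>2)" for z
  have Hm[measurable]: "H \<in> borel_measurable borel"
    unfolding H_def using norm_of_measurable[OF K] by measurable
  define m2 where "m2 = (\<integral>\<^sup>+u. H u \<partial>sigma_sphere n)"
  let ?Q = "LINT g|gauss m. (norm_of K (\<Sum>i<m. g i *\<^sub>R x i))\<^sup>2"
  have hom: "H (r *\<^sub>R u) = ennreal (r powr 2) * H u" if "0 < r" for r u
  proof -
    have "trunc n (r *\<^sub>R u) = r *\<^sub>R trunc n u" by (auto simp: trunc_def fun_eq_iff)
    thus ?thesis using that by (simp add: H_def norm_of_scale[OF K] power_mult_distrib ennreal_mult)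
  qed
  have "ennreal ?Q = (\<integral>\<^sup>+z. H (\<Sum>i<m. z i *\<^sub>R x i) * ennreal (gauss_weight m z) \<partial>Leb m)"
    unfolding H_def by (rule gauss_norm_LINT(1)[OF K n m xR])
  also have "\<dots> = (\<integral>\<^sup>+z. H (sqrt t *\<^sub>R z) * ennreal (gauss_weight n z) \<partial>Leb n)"
    by (rule gauss_linear_image[OF Hm xR _ xorth]) (use t in auto)
  also have "\<dots> = (\<integral>\<^sup>+z. ennreal t * (H z * ennreal (gauss_weight n z)) \<partial>Leb n)"
    using t(1) by (simp add: hom mult.assoc)
  also have "\<dots> = ennreal t * (\<integral>\<^sup>+z. H z * ennreal (gauss_weight n z) \<partial>Leb n)"
    by (rule nn_integral_cmult) measurable
  also have "(\<integral>\<^sup>+z. H z * ennreal (gauss_weight n z) \<partial>Leb n) =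
      (\<integral>\<^sup>+x. ennreal (nrm n x powr 2) * ennreal (gauss_weight n x) \<partial>Leb n) * m2"
    unfolding m2_def by (rule gauss_polar[OF n Hm hom])
  also have "(\<integral>\<^sup>+x. ennreal (nrm n x powr 2) * ennreal (gauss_weight n x) \<partial>Leb n) = ennreal (real n)"
    using gauss_nrm_sq[OF n] by simp
  finally have Q: "ennreal ?Q = ennreal t * (ennreal (real n) * m2)" .
  have "sqrt ?Q \<le> T * sqrt (\<Sum>i<m. (norm_of K (x i))\<^sup>2)" using T m xR by (simp add: type2_bound_def)
  also have "\<dots> \<le> T * sqrt (9 / 8)" using T xq by (intro mult_left_mono) (auto simp: type2_bound_def)
  finally have "sqrt ?Q \<le> T * sqrt (9 / 8)" .
  hence "?Q \<le> (T * sqrt (9 / 8))\<^sup>2" by (rule sqrt_le_D)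
  hence Q2: "?Q \<le> T\<^sup>2 * (9 / 8)" by (simp add: power_mult_distrib)
  have tn: "1 / 8 \<le> t * real n"
    using order_trans[OF cV mult_left_mono[OF t(2), of "real n"]] by (simp only: mult.commute of_nat_0_le_iff)
  have "ennreal (1 / 8) * m2 \<le> ennreal (t * real n) * m2"
    by (intro mult_right_mono ennreal_leI tn) simp
  also have "\<dots> = ennreal ?Q" unfolding Q using t(1) by (simp add: ennreal_mult mult.assoc)
  also have "\<dots> \<le> ennreal (T\<^sup>2 * (9 / 8))" using Q2 by (rule ennreal_leI)
  finally have "ennreal 8 * (ennreal (1 / 8) * m2) \<le> ennreal 8 * ennreal (T\<^sup>2 * (9 / 8))"
    by (rule mult_left_mono) simp
  moreover have "ennreal 8 * ennreal (1 / 8) = 1" by (subst ennreal_mult[symmetric]) auto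
  moreover have "ennreal 8 * ennreal (T\<^sup>2 * (9 / 8)) = ennreal (9 * T\<^sup>2)"
    by (subst ennreal_mult[symmetric]) auto
  ultimately have m2: "m2 \<le> ennreal (9 * T\<^sup>2)" by (simp only: mult.assoc[symmetric] mult_1_left)
  note S = sphere_haar_facts[OF sphere_haar_is_haar[OF iso_onto_id n]]
  have "(LINT \<theta>|sigma_sphere n. norm_of K \<theta> powr 2) \<le> 9 * T\<^sup>2"
  proof (rule LINT_le_nn)
    have "(\<integral>\<^sup>+\<theta>. ennreal (norm_of K \<theta> powr 2) \<partial>sigma_sphere n) = m2"
      unfolding m2_def
    proof (rule nn_integral_cong)
      fix u assume "u \<in> space (sigma_sphere n)"
      hence u: "u \<in> Rn n" by (simp add: S(3) unit_sphere_iff)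
      thus "ennreal (norm_of K u powr 2) = H u"
        using norm_of_nonneg[OF K u] by (simp add: H_def trunc_id del: topspace_Euclidean_space)
    qed
    thus "(\<integral>\<^sup>+\<theta>. ennreal (norm_of K \<theta> powr 2) \<partial>sigma_sphere n) \<le> ennreal (9 * T\<^sup>2)" using m2 by simp
  qed auto
  hence "mean_norm n 2 K \<le> (9 * T\<^sup>2) powr (1 / 2)"
    unfolding mean_norm_def by (intro powr_mono2) (auto intro: integral_nonneg)
  also have "\<dots> = 3 * T" using T by (simp add: powr_half_sqrt real_sqrt_mult type2_bound_def)
  finally show ?thesis .
qed

section \<open>Log-concave marginals\<close>

lemma emeasure_convex_real:
  fixes S :: "real set"
  assumes "S \<in> sets borel" "convex S" "S \<noteq> {}" "bounded S"
  shows "emeasure lborel S = ennreal (Sup S - Inf S)"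
proof (rule antisym)
  have b: "bdd_above S" "bdd_below S" using assms(4) by (auto simp: bounded_imp_bdd_above bounded_imp_bdd_below)
  have le: "Inf S \<le> Sup S" by (rule cInf_le_cSup[OF assms(3) b])
  have "S \<subseteq> {Inf S..Sup S}" using b by (auto intro: cInf_lower cSup_upper)
  hence "emeasure lborel S \<le> emeasure lborel {Inf S..Sup S}" by (intro emeasure_mono) auto
  thus "emeasure lborel S \<le> ennreal (Sup S - Inf S)" using le by simp
  have "{Inf S<..<Sup S} \<subseteq> S"
  proof
    fix x assume "x \<in> {Inf S<..<Sup S}"
    then obtain u v where uv: "u \<in> S" "u < x" "v \<in> S" "x < v"
      using assms(3) b by (auto simp: cInf_less_iff less_cSup_iff)
    have "is_interval S" using assms(2) by (simp add: is_interval_convex_1)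
    thus "x \<in> S" using uv unfolding is_interval_1 by (meson less_imp_le)
  qed
  hence "emeasure lborel {Inf S<..<Sup S} \<le> emeasure lborel S" by (intro emeasure_mono) (use assms in auto)
  thus "ennreal (Sup S - Inf S) \<le> emeasure lborel S" using le by simp
qed

text \<open>On the line convex sets are intervals up to end points, and the inequality follows from
  the behaviour of suprema and infima under convex combinations.\<close>

lemma brunn_minkowski_intervals:
  fixes I J C :: "real set"
  assumes "I \<in> sets borel" "convex I" "I \<noteq> {}" "bounded I"
    and "J \<in> sets borel" "convex J" "J \<noteq> {}" "bounded J"
    and "C \<in> sets borel" "convex C" "bounded C"
    and t: "0 < t" "t < 1" and sub: "\<And>x y. x \<in> I \<Longrightarrow> y \<in> J \<Longrightarrow> (1 - t) * x + t * y \<in> C"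
  shows "ennreal (1 - t) * emeasure lborel I + ennreal t * emeasure lborel J \<le> emeasure lborel C"
proof -
  have C: "C \<noteq> {}" using sub assms(3,7) by blast
  have bC: "bdd_above C" "bdd_below C" using assms(11) by (auto simp: bounded_imp_bdd_above bounded_imp_bdd_below)
  have bI: "bdd_above I" "bdd_below I" using assms(4) by (auto simp: bounded_imp_bdd_above bounded_imp_bdd_below)
  have bJ: "bdd_above J" "bdd_below J" using assms(8) by (auto simp: bounded_imp_bdd_above bounded_imp_bdd_below)
  have sup: "(1 - t) * Sup I + t * Sup J \<le> Sup C"
  proof -
    have "x \<le> (Sup C - t * Sup J) / (1 - t)" if x: "x \<in> I" for x
    proof -
      have "y \<le> (Sup C - (1 - t) * x) / t" if "y \<in> J" for y
        using cSup_upper[OF sub[OF x that] bC(1)] t by (simp add: field_simps)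
      hence "Sup J \<le> (Sup C - (1 - t) * x) / t" by (intro cSup_least assms)
      thus ?thesis using t by (simp add: field_simps)
    qed
    hence "Sup I \<le> (Sup C - t * Sup J) / (1 - t)" by (intro cSup_least assms)
    thus ?thesis using t by (simp add: field_simps)
  qed
  have inf: "Inf C \<le> (1 - t) * Inf I + t * Inf J"
  proof -
    have "(Inf C - t * Inf J) / (1 - t) \<le> x" if x: "x \<in> I" for x
    proof -
      have "(Inf C - (1 - t) * x) / t \<le> y" if "y \<in> J" for y
        using cInf_lower[OF sub[OF x that] bC(2)] t by (simp add: field_simps)
      hence "(Inf C - (1 - t) * x) / t \<le> Inf J" by (intro cInf_greatest assms)
      thus ?thesis using t by (simp add: field_simps)
    qed
    hence "(Inf C - t * Inf J) / (1 - t) \<le> Inf I" by (intro cInf_greatest assms)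
    thus ?thesis using t by (simp add: field_simps)
  qed
  have le: "Inf I \<le> Sup I" "Inf J \<le> Sup J" using assms(3,7) bI bJ by (auto intro: cInf_le_cSup)
  have "ennreal (1 - t) * emeasure lborel I + ennreal t * emeasure lborel J =
      ennreal ((1 - t) * (Sup I - Inf I) + t * (Sup J - Inf J))"
    unfolding emeasure_convex_real[OF assms(1-4)] emeasure_convex_real[OF assms(5-8)]
    by (subst ennreal_plus) (use t le in \<open>auto simp: ennreal_mult\<close>)
  also have "\<dots> \<le> ennreal (Sup C - Inf C)"
    using sup inf by (intro ennreal_leI) (simp add: algebra_simps)
  also have "\<dots> = emeasure lborel C" using C by (simp add: emeasure_convex_real assms)
  finally show ?thesis .
qed

lemma layer_cake_01:
  fixes f :: "real \<Rightarrow> real"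
  assumes [measurable]: "f \<in> borel_measurable borel" and f0: "\<And>u. 0 \<le> f u"
  shows "(\<integral>\<^sup>+c. indicator {0<..<1} c * emeasure lborel {u. c < f u} \<partial>lborel) = (\<integral>\<^sup>+u. ennreal (min 1 (f u)) \<partial>lborel)"
proof -
  have m: "(\<lambda>(c, u). indicator {0<..<1} c * indicator {p. fst p < f (snd p)} (c, u) :: ennreal)
      \<in> borel_measurable (lborel \<Otimes>\<^sub>M lborel)"
    by measurable
  have "(\<integral>\<^sup>+c. indicator {0<..<1} c * emeasure lborel {u. c < f u} \<partial>lborel) =
      (\<integral>\<^sup>+c. (\<integral>\<^sup>+u. indicator {0<..<1} c * indicator {p. fst p < f (snd p)} (c, u) \<partial>lborel) \<partial>lborel)"
  proof (rule nn_integral_cong)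
    fix c :: real
    have "(\<integral>\<^sup>+u. indicator {0<..<1} c * indicator {p. fst p < f (snd p)} (c, u) \<partial>lborel) =
        (\<integral>\<^sup>+u. indicator {0<..<1} c * indicator {u. c < f u} u \<partial>lborel)"
      by (intro nn_integral_cong) (auto simp: indicator_def)
    also have "\<dots> = indicator {0<..<1} c * emeasure lborel {u. c < f u}" by (simp add: nn_integral_cmult)
    finally show "indicator {0<..<1} c * emeasure lborel {u. c < f u} =
        (\<integral>\<^sup>+u. indicator {0<..<1} c * indicator {p. fst p < f (snd p)} (c, u) \<partial>lborel)" ..
  qed
  also have "\<dots> = (\<integral>\<^sup>+u. (\<integral>\<^sup>+c. indicator {0<..<1} c * indicator {p. fst p < f (snd p)} (c, u) \<partial>lborel) \<partial>lborel)"
    using m by (intro lborel_pair.Fubini'[symmetric])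
  also have "\<dots> = (\<integral>\<^sup>+u. ennreal (min 1 (f u)) \<partial>lborel)"
  proof (rule nn_integral_cong)
    fix u
    have "(\<integral>\<^sup>+c. indicator {0<..<1} c * indicator {p. fst p < f (snd p)} (c, u) \<partial>lborel) =
        (\<integral>\<^sup>+c. indicator {0<..<min 1 (f u)} c \<partial>lborel)"
      by (intro nn_integral_cong) (auto simp: indicator_def)
    thus "(\<integral>\<^sup>+c. indicator {0<..<1} c * indicator {p. fst p < f (snd p)} (c, u) \<partial>lborel) = ennreal (min 1 (f u))"
      using f0[of u] by simp
  qed
  finally show ?thesis .
qed

text \<open>
  The common core of the inequalities of Prekopa--Leindler and of Borell--Brascamp--Lieb: after
  normalising the suprema, the superlevel sets at each height \<open>c\<close> obey the Brunn--Minkowski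
  inequality.
\<close>
lemma superlevel_inequality:
  fixes f g h :: "real \<Rightarrow> real"
  assumes m[measurable]: "f \<in> borel_measurable borel" "g \<in> borel_measurable borel" "h \<in> borel_measurable borel"
    and f: "\<And>u. 0 \<le> f u" "\<And>u. f u \<le> \<alpha>" "\<And>c. c < \<alpha> \<Longrightarrow> \<exists>u. c < f u"
    and g: "\<And>u. 0 \<le> g u" "\<And>u. g u \<le> \<beta>" "\<And>c. c < \<beta> \<Longrightarrow> \<exists>u. c < g u"
    and h: "\<And>u. 0 \<le> h u"
    and conv: "\<And>c. 0 < c \<Longrightarrow> convex {u. c < f u} \<and> bounded {u. c < f u}"
      "\<And>c. 0 < c \<Longrightarrow> convex {u. c < g u} \<and> bounded {u. c < g u}"
      "\<And>c. 0 < c \<Longrightarrow> convex {u. c < h u} \<and> bounded {u. c < h u}"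
    and t: "0 < t" "t < 1" and pos: "0 < \<alpha>" "0 < \<beta>" "0 < \<kappa>"
    and sub: "\<And>c u v. 0 < c \<Longrightarrow> c < 1 \<Longrightarrow> \<alpha> * c < f u \<Longrightarrow> \<beta> * c < g v \<Longrightarrow> \<kappa> * c < h ((1 - t) * u + t * v)"
  shows "ennreal (1 - t) * (\<integral>\<^sup>+u. ennreal (f u / \<alpha>) \<partial>lborel) + ennreal t * (\<integral>\<^sup>+u. ennreal (g u / \<beta>) \<partial>lborel)
    \<le> (\<integral>\<^sup>+u. ennreal (h u / \<kappa>) \<partial>lborel)"
proof -
  have lvl: "{u. c < p u / \<gamma>} = {u. \<gamma> * c < p u}" if "0 < \<gamma>" for c \<gamma> :: real and p :: "real \<Rightarrow> real"
    using that by (auto simp: field_simps)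
  have cake: "(\<integral>\<^sup>+u. ennreal (min 1 (p u / \<gamma>)) \<partial>lborel) =
      (\<integral>\<^sup>+c. indicator {0<..<1} c * emeasure lborel {u. \<gamma> * c < p u} \<partial>lborel)"
    if "p \<in> borel_measurable borel" "\<And>u. 0 \<le> p u" "0 < \<gamma>" for p :: "real \<Rightarrow> real" and \<gamma> :: real
    using layer_cake_01[of "\<lambda>u. p u / \<gamma>"] that by (simp add: lvl[OF that(3)])
  have mm: "(\<lambda>c. indicator {0<..<1} c * emeasure lborel {u. \<gamma> * c < p u}) \<in> borel_measurable lborel"
    if [measurable]: "p \<in> borel_measurable borel" for p :: "real \<Rightarrow> real" and \<gamma> :: real
  proof -
    have "{x \<in> space (lborel \<Otimes>\<^sub>M lborel). \<gamma> * fst x < p (snd x)} \<in> sets (lborel \<Otimes>\<^sub>M lborel)" by measurable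
    hence "(\<lambda>c. emeasure lborel (Pair c -` {x \<in> space (lborel \<Otimes>\<^sub>M lborel). \<gamma> * fst x < p (snd x)})) \<in> borel_measurable lborel"
      by (rule lborel.measurable_emeasure_Pair)
    also have "(\<lambda>c. emeasure lborel (Pair c -` {x \<in> space (lborel \<Otimes>\<^sub>M lborel). \<gamma> * fst x < p (snd x)})) =
        (\<lambda>c. emeasure lborel {u. \<gamma> * c < p u})"
      by (intro ext arg_cong[where f = "emeasure lborel"]) (auto simp: space_pair_measure)
    finally show ?thesis by (intro borel_measurable_times_ennreal) auto
  qed
  have "(\<integral>\<^sup>+u. ennreal (f u / \<alpha>) \<partial>lborel) = (\<integral>\<^sup>+u. ennreal (min 1 (f u / \<alpha>)) \<partial>lborel)"
    using f(2) pos by (intro nn_integral_cong) (simp add: min_absorb2 divide_le_eq_1_pos)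
  also have "\<dots> = (\<integral>\<^sup>+c. indicator {0<..<1} c * emeasure lborel {u. \<alpha> * c < f u} \<partial>lborel)"
    by (rule cake) (use f pos in auto)
  finally have F: "(\<integral>\<^sup>+u. ennreal (f u / \<alpha>) \<partial>lborel) = \<dots>" .
  have "(\<integral>\<^sup>+u. ennreal (g u / \<beta>) \<partial>lborel) = (\<integral>\<^sup>+u. ennreal (min 1 (g u / \<beta>)) \<partial>lborel)"
    using g(2) pos by (intro nn_integral_cong) (simp add: min_absorb2 divide_le_eq_1_pos)
  also have "\<dots> = (\<integral>\<^sup>+c. indicator {0<..<1} c * emeasure lborel {u. \<beta> * c < g u} \<partial>lborel)"
    by (rule cake) (use g pos in auto)
  finally have G: "(\<integral>\<^sup>+u. ennreal (g u / \<beta>) \<partial>lborel) = \<dots>" .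
  have "ennreal (1 - t) * (\<integral>\<^sup>+u. ennreal (f u / \<alpha>) \<partial>lborel) + ennreal t * (\<integral>\<^sup>+u. ennreal (g u / \<beta>) \<partial>lborel) =
      (\<integral>\<^sup>+c. ennreal (1 - t) * (indicator {0<..<1} c * emeasure lborel {u. \<alpha> * c < f u}) +
         ennreal t * (indicator {0<..<1} c * emeasure lborel {u. \<beta> * c < g u}) \<partial>lborel)"
    unfolding F G using mm[OF m(1)] mm[OF m(2)]
    by (subst nn_integral_add) (simp_all add: nn_integral_cmult)
  also have "\<dots> \<le> (\<integral>\<^sup>+c. indicator {0<..<1} c * emeasure lborel {u. \<kappa> * c < h u} \<partial>lborel)"
  proof (rule nn_integral_mono)
    fix c :: real
    show "ennreal (1 - t) * (indicator {0<..<1} c * emeasure lborel {u. \<alpha> * c < f u}) +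
         ennreal t * (indicator {0<..<1} c * emeasure lborel {u. \<beta> * c < g u})
         \<le> indicator {0<..<1} c * emeasure lborel {u. \<kappa> * c < h u}"
    proof (cases "0 < c \<and> c < 1")
      case True
      have "ennreal (1 - t) * emeasure lborel {u. \<alpha> * c < f u} + ennreal t * emeasure lborel {u. \<beta> * c < g u}
          \<le> emeasure lborel {u. \<kappa> * c < h u}"
      proof (rule brunn_minkowski_intervals[OF _ _ _ _ _ _ _ _ _ _ _ t])
        show "{u. \<alpha> * c < f u} \<noteq> {}" using f(3)[of "\<alpha> * c"] pos True by auto
        show "{u. \<beta> * c < g u} \<noteq> {}" using g(3)[of "\<beta> * c"] pos True by auto
      qed (use conv pos True sub in auto)
      thus ?thesis using True by simp
    qed (auto simp: indicator_def)
  qed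
  also have "\<dots> = (\<integral>\<^sup>+u. ennreal (min 1 (h u / \<kappa>)) \<partial>lborel)"
    by (rule cake[symmetric]) (use h pos in auto)
  \<comment> \<open>Only heights below 1 were compared. For \<open>f\<close> and \<open>g\<close>
    this loses nothing, their normalised suprema being 1; for \<open>h\<close> the truncation goes
    in the right direction.\<close>
  also have "\<dots> \<le> (\<integral>\<^sup>+u. ennreal (h u / \<kappa>) \<partial>lborel)" by (intro nn_integral_mono ennreal_leI) simp
  finally show ?thesis .
qed

lemma ennreal_combination_leD:
  assumes "ennreal s * ennreal a + ennreal t * ennreal b \<le> ennreal c" "0 \<le> s" "0 \<le> t" "0 \<le> a" "0 \<le> b" "0 \<le> c"
  shows "s * a + t * b \<le> c"
proof -
  have "ennreal (s * a + t * b) = ennreal s * ennreal a + ennreal t * ennreal b"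
    using assms by (subst ennreal_plus) (auto simp: ennreal_mult)
  thus ?thesis using assms by (metis ennreal_le_iff)
qed

section \<open>Marginals of even log-concave functions\<close>

text \<open>\<open>B\<close> bounds the values and \<open>R\<close> the coordinates of the support;
  they are carried along so that the next marginal is again finite. Convexity, symmetry and
  boundedness of a body are all contained in this property of its indicator.\<close>

definition sym_logconc :: "nat \<Rightarrow> real \<Rightarrow> real \<Rightarrow> ((nat \<Rightarrow> real) \<Rightarrow> real) \<Rightarrow> bool" where
  "sym_logconc j B R F \<longleftrightarrow> F \<in> borel_measurable borel \<and> 0 < R \<and> (\<forall>x. 0 \<le> F x) \<and>
     (\<forall>x\<in>Rn j. F x \<le> B) \<and> (\<forall>x\<in>Rn j. \<forall>i<j. F x \<noteq> 0 \<longrightarrow> \<bar>x i\<bar> \<le> R) \<and> (\<forall>x\<in>Rn j. F (- x) = F x) \<and>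
     (\<forall>x\<in>Rn j. \<forall>y\<in>Rn j. \<forall>t. 0 < t \<longrightarrow> t < 1 \<longrightarrow>
        F x powr (1 - t) * F y powr t \<le> F ((1 - t) *\<^sub>R x + t *\<^sub>R y))"

lemma sym_logconcD:
  assumes "sym_logconc j B R F"
  shows "F \<in> borel_measurable borel" "0 < R" "\<And>x. 0 \<le> F x" "\<And>x. x \<in> Rn j \<Longrightarrow> F x \<le> B"
    "\<And>x i. x \<in> Rn j \<Longrightarrow> i < j \<Longrightarrow> F x \<noteq> 0 \<Longrightarrow> \<bar>x i\<bar> \<le> R" "\<And>x. x \<in> Rn j \<Longrightarrow> F (- x) = F x"
    "\<And>x y t. x \<in> Rn j \<Longrightarrow> y \<in> Rn j \<Longrightarrow> 0 < t \<Longrightarrow> t < 1 \<Longrightarrow>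
       F x powr (1 - t) * F y powr t \<le> F ((1 - t) *\<^sub>R x + t *\<^sub>R y)"
  using assms unfolding sym_logconc_def by blast+

lemma powr_mean_gt:
  fixes a b c :: real
  assumes "0 < c" "c < a" "c < b" "0 < t" "t < 1"
  shows "c < a powr (1 - t) * b powr t"
proof -
  have "c = c powr (1 - t) * c powr t" using assms by (simp add: powr_add[symmetric])
  also have "\<dots> < a powr (1 - t) * b powr t"
    using assms by (intro mult_strict_mono powr_less_mono2) auto
  finally show ?thesis .
qed

definition marginal :: "nat \<Rightarrow> ((nat \<Rightarrow> real) \<Rightarrow> real) \<Rightarrow> (nat \<Rightarrow> real) \<Rightarrow> real" where
  "marginal j F y = (LINT t|lborel. F (y(j := t)))"

lemma marginal_nn:
  assumes F: "sym_logconc (Suc j) B R F" and y: "y \<in> Rn j"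
  shows "ennreal (marginal j F y) = (\<integral>\<^sup>+t. ennreal (F (y(j := t))) \<partial>lborel)"
    and "marginal j F y \<le> 2 * R * B"
proof -
  note D = sym_logconcD[OF F]
  have m: "(\<lambda>t. F (y(j := t))) \<in> borel_measurable borel"
    by (rule measurable_compose[OF measurable_upd_const D(1)])
  have yR: "y(j := t) \<in> Rn (Suc j)" for t by (rule Rn_Suc_upd[OF y])
  have B: "0 \<le> B" using D(3)[of "y(j := 0)"] D(4)[OF yR[of 0]] by linarith
  have bd: "F (y(j := t)) \<le> B * indicator {-R..R} t" for t
    using D(4)[OF yR[of t]] D(5)[OF yR[of t], of j] by (cases "F (y(j := t)) = 0") (auto simp: indicator_def B abs_le_iff)
  have ib: "integrable lborel (\<lambda>t. B * indicator {-R..R} t)"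
    by (intro integrable_mult_right) (simp add: integrable_indicator_iff emeasure_lborel_Icc_eq)
  have int: "integrable lborel (\<lambda>t. F (y(j := t)))"
  proof (rule Bochner_Integration.integrable_bound[OF ib])
    show "AE t in lborel. norm (F (y(j := t))) \<le> norm (B * indicator {-R..R} t)"
      using bd D(3) order_trans[OF bd abs_ge_self] by (intro AE_I2) (simp only: real_norm_def abs_of_nonneg)
  qed (use m in simp)
  show "ennreal (marginal j F y) = (\<integral>\<^sup>+t. ennreal (F (y(j := t))) \<partial>lborel)"
    unfolding marginal_def by (rule nn_integral_eq_integral[symmetric, OF int]) (use D(3) in auto)
  have "marginal j F y \<le> (LINT t|lborel. B * indicator {-R..R} t)"
    unfolding marginal_def by (rule integral_mono[OF int ib bd])
  also have "\<dots> = 2 * R * B" using D(2) by simp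
  finally show "marginal j F y \<le> 2 * R * B" .
qed

text \<open>Prekopa--Leindler on the fibres. Normalised by the suprema, the fibre integrals satisfy
  the inequality even with the arithmetic mean; Young's inequality passes to the geometric mean, and
  the suprema cancel.\<close>

lemma marginal_logconc:
  assumes F: "sym_logconc (Suc j) B R F"
  shows "sym_logconc j (2 * R * B) R (marginal j F)"
  unfolding sym_logconc_def
proof (intro conjI ballI allI impI)
  note D = sym_logconcD[OF F]
  note [measurable] = D(1)
  show "marginal j F \<in> borel_measurable borel" unfolding marginal_def by measurable
  show "0 < R" by (rule D(2))
  show nonneg: "0 \<le> marginal j F x" for x unfolding marginal_def by (intro Bochner_Integration.integral_nonneg D(3))
  fix x assume x: "x \<in> Rn j"
  have xR: "x(j := t) \<in> Rn (Suc j)" for t by (rule Rn_Suc_upd[OF x])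
  show "marginal j F x \<le> 2 * R * B" by (rule marginal_nn(2)[OF F x])
  show "\<bar>x i\<bar> \<le> R" if "i < j" "marginal j F x \<noteq> 0" for i
  proof (rule ccontr)
    assume "\<not> \<bar>x i\<bar> \<le> R"
    hence "F (x(j := t)) = 0" for t using D(5)[OF xR[of t], of i] that(1) by auto
    thus False using that(2) by (simp add: marginal_def)
  qed
  show "marginal j F (- x) = marginal j F x"
  proof -
    have "F ((- x)(j := t)) = F (x(j := - t))" for t
    proof -
      have "(- x)(j := t) = - (x(j := - t))" by (auto simp: fun_eq_iff)
      thus ?thesis using D(6)[OF xR[of "- t"]] by simp
    qed
    hence "marginal j F (- x) = (LINT t|lborel. F (x(j := 0 + (- 1) * t)))" by (simp add: marginal_def)
    also have "\<dots> = marginal j F x"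
      unfolding marginal_def using lborel_integral_real_affine[of "-1" "\<lambda>t. F (x(j := t))" 0] by simp
    finally show ?thesis .
  qed
  fix y t assume y: "y \<in> Rn j" and t: "0 < (t::real)" "t < 1"
  have yR: "y(j := t) \<in> Rn (Suc j)" for t by (rule Rn_Suc_upd[OF y])
  define z where "z = (1 - t) *\<^sub>R x + t *\<^sub>R y"
  have z: "z \<in> Rn j" unfolding z_def by (intro Rn_closed_ops x y)
  show "marginal j F x powr (1 - t) * marginal j F y powr t \<le> marginal j F z"
  proof (cases "marginal j F x = 0 \<or> marginal j F y = 0")
    case True thus ?thesis using nonneg t by auto
  next
    case False
    define f where "f w u = F (w(j := u))" for w u
    have fm: "f w \<in> borel_measurable borel" for w
      unfolding f_def by (rule measurable_compose[OF measurable_upd_const D(1)])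
    have f0: "0 \<le> f w u" for w u by (simp add: f_def D(3))
    have fB: "f w u \<le> B" if "w \<in> Rn j" for w u unfolding f_def by (intro D(4) Rn_Suc_upd that)
    define s where "s w = Sup (range (f w))" for w
    have bdd: "bdd_above (range (f w))" if "w \<in> Rn j" for w using fB[OF that] by (auto simp: bdd_above_def)
    have fs: "f w u \<le> s w" if "w \<in> Rn j" for w u unfolding s_def by (rule cSup_upper[OF _ bdd[OF that]]) simp
    have sf: "\<exists>u. c < f w u" if "w \<in> Rn j" "c < s w" for w c
      using that(2) unfolding s_def by (subst (asm) less_cSup_iff[OF _ bdd[OF that(1)]]) auto
    have spos: "0 < s w" if "w \<in> Rn j" "marginal j F w \<noteq> 0" for w
    proof (rule ccontr)
      assume "\<not> 0 < s w"
      hence "f w u = 0" for u using fs[OF that(1), of u] f0[of w u] by linarith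
      thus False using that(2) by (simp add: marginal_def f_def)
    qed
    have mix: "f w u powr (1 - t) * f w' v powr t \<le> f ((1 - t) *\<^sub>R w + t *\<^sub>R w') ((1 - t) * u + t * v)"
      if "w \<in> Rn j" "w' \<in> Rn j" "0 < t" "t < 1" for w w' u v t
    proof -
      have "(1 - t) *\<^sub>R (w(j := u)) + t *\<^sub>R (w'(j := v)) = ((1 - t) *\<^sub>R w + t *\<^sub>R w')(j := (1 - t) * u + t * v)"
        by (auto simp: fun_eq_iff)
      thus ?thesis unfolding f_def using D(7)[OF Rn_Suc_upd[OF that(1)] Rn_Suc_upd[OF that(2)] that(3,4)] by metis
    qed
    have conv: "convex {u. c < f w u} \<and> bounded {u. c < f w u}" if w: "w \<in> Rn j" and c: "0 < c" for w c
    proof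
      show "convex {u. c < f w u}"
        unfolding convex_alt
      proof (intro ballI allI impI, elim conjE)
        fix u v \<tau> :: real assume uv: "u \<in> {u. c < f w u}" "v \<in> {u. c < f w u}" and \<tau>: "0 \<le> \<tau>" "\<tau> \<le> 1"
        consider "\<tau> = 0" | "\<tau> = 1" | "0 < \<tau>" "\<tau> < 1" using \<tau> by linarith
        thus "(1 - \<tau>) *\<^sub>R u + \<tau> *\<^sub>R v \<in> {u. c < f w u}"
        proof cases
          case 3
          have "c < f w u powr (1 - \<tau>) * f w v powr \<tau>" using uv c 3 by (intro powr_mean_gt) auto
          also have "\<dots> \<le> f ((1 - \<tau>) *\<^sub>R w + \<tau> *\<^sub>R w) ((1 - \<tau>) * u + \<tau> * v)" by (rule mix[OF w w 3])
          also have "(1 - \<tau>) *\<^sub>R w + \<tau> *\<^sub>R w = w" by (simp add: scaleR_add_left[symmetric])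
          finally show ?thesis by simp
        qed (use uv in auto)
      qed
      have "{u. c < f w u} \<subseteq> {-R..R}"
        using D(5)[OF Rn_Suc_upd[OF w], of j] c by (auto simp: f_def abs_le_iff) (smt (verit) fun_upd_same)+
      thus "bounded {u. c < f w u}" by (rule bounded_subset[OF bounded_closed_interval])
    qed
    \<comment> \<open>At the geometric mean \<open>\<kappa>\<close> of the suprema, the level sets
      at heights \<open>\<alpha> * c\<close> and \<open>\<beta> * c\<close> combine into the one at
      height \<open>\<kappa> * c\<close>.\<close>
    define \<alpha> \<beta> \<kappa> where "\<alpha> = s x" and "\<beta> = s y" and "\<kappa> = \<alpha> powr (1 - t) * \<beta> powr t"
    have pos: "0 < \<alpha>" "0 < \<beta>" using spos x y False by (auto simp: \<alpha>_def \<beta>_def)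
    hence "0 < \<kappa>" by (simp add: \<kappa>_def)
    note pos = pos this
    have "ennreal (1 - t) * (\<integral>\<^sup>+u. ennreal (f x u / \<alpha>) \<partial>lborel) + ennreal t * (\<integral>\<^sup>+u. ennreal (f y u / \<beta>) \<partial>lborel)
        \<le> (\<integral>\<^sup>+u. ennreal (f z u / \<kappa>) \<partial>lborel)"
    proof (rule superlevel_inequality[OF fm fm fm f0 _ _ f0 _ _ f0 _ _ _ t pos])
      fix c u v assume c: "0 < c" "c < 1" "\<alpha> * c < f x u" "\<beta> * c < f y v"
      have "\<kappa> * c = (\<alpha> * c) powr (1 - t) * (\<beta> * c) powr t"
        using c pos by (simp add: \<kappa>_def powr_mult mult_ac powr_add[symmetric])
      also have "\<dots> < f x u powr (1 - t) * f y v powr t"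
      proof -
        have "0 < \<alpha> * c" "0 < \<beta> * c" using c pos by auto
        thus ?thesis using c t by (intro mult_strict_mono powr_less_mono2) auto
      qed
      also have "\<dots> \<le> f z ((1 - t) * u + t * v)" unfolding z_def by (rule mix[OF x y t])
      finally show "\<kappa> * c < f z ((1 - t) * u + t * v)" .
    qed (use fs sf conv x y z in \<open>auto simp: \<alpha>_def \<beta>_def\<close>)
    moreover have "(\<integral>\<^sup>+u. ennreal (f w u / \<gamma>) \<partial>lborel) = ennreal (marginal j F w / \<gamma>)"
      if "w \<in> Rn j" "0 < \<gamma>" for w \<gamma>
    proof -
      have "(\<integral>\<^sup>+u. ennreal (f w u / \<gamma>) \<partial>lborel) = (\<integral>\<^sup>+u. ennreal (f w u) / ennreal \<gamma> \<partial>lborel)"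
        using f0 that by (intro nn_integral_cong) (simp add: divide_ennreal)
      also have "\<dots> = (\<integral>\<^sup>+u. ennreal (f w u) \<partial>lborel) / ennreal \<gamma>"
        using fm by (intro nn_integral_divide) auto
      also have "(\<integral>\<^sup>+u. ennreal (f w u) \<partial>lborel) = ennreal (marginal j F w)"
        unfolding f_def by (rule marginal_nn(1)[OF F that(1), symmetric])
      finally show ?thesis using nonneg that by (simp add: divide_ennreal)
    qed
    ultimately have "ennreal (1 - t) * ennreal (marginal j F x / \<alpha>) + ennreal t * ennreal (marginal j F y / \<beta>)
        \<le> ennreal (marginal j F z / \<kappa>)" using x y z pos by simp
    hence "(1 - t) * (marginal j F x / \<alpha>) + t * (marginal j F y / \<beta>) \<le> marginal j F z / \<kappa>"
      by (rule ennreal_combination_leD) (use t pos nonneg in auto)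
    moreover have "(marginal j F x / \<alpha>) powr (1 - t) * (marginal j F y / \<beta>) powr t
        \<le> (1 - t) * (marginal j F x / \<alpha>) + t * (marginal j F y / \<beta>)"
      using t pos nonneg False by (intro Youngs_inequality_0) (auto simp: less_le)
    ultimately have "(marginal j F x / \<alpha>) powr (1 - t) * (marginal j F y / \<beta>) powr t \<le> marginal j F z / \<kappa>"
      by linarith
    moreover have "(marginal j F x / \<alpha>) powr (1 - t) * (marginal j F y / \<beta>) powr t =
        (marginal j F x powr (1 - t) * marginal j F y powr t) / \<kappa>"
      using pos nonneg by (simp add: \<kappa>_def powr_divide)
    ultimately show ?thesis using pos by (simp add: divide_le_cancel)
  qed
qed

fun marginals :: "nat \<Rightarrow> nat \<Rightarrow> ((nat \<Rightarrow> real) \<Rightarrow> real) \<Rightarrow> (nat \<Rightarrow> real) \<Rightarrow> real" where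
  "marginals k 0 F = F"
| "marginals k (Suc m) F = marginals k m (marginal (k + m) F)"

lemma marginals_logconc:
  "sym_logconc (k + m) B R F \<Longrightarrow> \<exists>B'. sym_logconc k B' R (marginals k m F)"
proof (induction m arbitrary: B F)
  case (Suc m)
  have "sym_logconc (k + m) (2 * R * B) R (marginal (k + m) F)"
    by (rule marginal_logconc) (use Suc.prems in simp)
  from Suc.IH[OF this] show ?case by simp
qed auto

lemma marginals_nn:
  assumes "sym_logconc (k + m) B R F" "w \<in> borel_measurable borel"
    "\<And>y j t. k \<le> j \<Longrightarrow> w (y(j := t)) = w y"
  shows "(\<integral>\<^sup>+x. w x * ennreal (F x) \<partial>Leb (k + m)) = (\<integral>\<^sup>+y. w y * ennreal (marginals k m F y) \<partial>Leb k)"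
  using assms(1)
proof (induction m arbitrary: B F)
  case (Suc m)
  note [measurable] = sym_logconcD(1)[OF Suc.prems] assms(2)
  have F: "sym_logconc (Suc (k + m)) B R F" using Suc.prems by simp
  have "(\<integral>\<^sup>+x. w x * ennreal (F x) \<partial>Leb (k + Suc m)) =
      (\<integral>\<^sup>+y. (\<integral>\<^sup>+t. w (y(k + m := t)) * ennreal (F (y(k + m := t))) \<partial>lborel) \<partial>Leb (k + m))"
    unfolding add_Suc_right by (rule nn_Leb_Suc) measurable
  also have "\<dots> = (\<integral>\<^sup>+y. w y * ennreal (marginal (k + m) F y) \<partial>Leb (k + m))"
  proof (rule nn_Leb_cong)
    fix y assume y: "y \<in> Rn (k + m)"
    have "(\<integral>\<^sup>+t. w (y(k + m := t)) * ennreal (F (y(k + m := t))) \<partial>lborel) =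
        w y * (\<integral>\<^sup>+t. ennreal (F (y(k + m := t))) \<partial>lborel)"
      using measurable_compose[OF measurable_upd_const[of y "k + m"] sym_logconcD(1)[OF F]]
      by (simp add: assms(3) nn_integral_cmult)
    thus "(\<integral>\<^sup>+t. w (y(k + m := t)) * ennreal (F (y(k + m := t))) \<partial>lborel) = w y * ennreal (marginal (k + m) F y)"
      by (simp add: marginal_nn(1)[OF F y])
  qed
  also have "\<dots> = (\<integral>\<^sup>+y. w y * ennreal (marginals k m (marginal (k + m) F) y) \<partial>Leb k)"
    by (rule Suc.IH[OF marginal_logconc[OF F]])
  finally show ?case by simp
qed simp

text \<open>For the indicator of a body, the case \<open>y = 0\<close> identifies the value of the
  marginal with the volume of a central section.\<close>

lemma marginals_fibre:
  assumes "sym_logconc (k + m) B R F" "y \<in> Rn k"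
  shows "(\<integral>\<^sup>+x. ennreal (F (y + shift_by k x)) \<partial>Leb m) = ennreal (marginals k m F y)"
  using assms(1)
proof (induction m arbitrary: B F)
  case 0
  note [measurable] = sym_logconcD(1)[OF 0]
  have "(\<integral>\<^sup>+x. ennreal (F (y + shift_by k x)) \<partial>Leb 0) = ennreal (F (y + shift_by k 0))"
  proof (rule nn_Leb_0)
    have [measurable]: "shift_by k \<in> borel_measurable borel"
      by (rule measurable_funI) (simp add: shift_by_def)
    show "(\<lambda>x. ennreal (F (y + shift_by k x))) \<in> borel_measurable borel" by measurable
  qed
  moreover have "y + shift_by k 0 = y" by (auto simp: shift_by_def)
  ultimately show ?case by (simp only: marginals.simps)
next
  case (Suc m)
  note [measurable] = sym_logconcD(1)[OF Suc.prems]
  have [measurable]: "shift_by k \<in> borel_measurable borel"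
    by (rule measurable_funI) (simp add: shift_by_def)
  have F: "sym_logconc (Suc (k + m)) B R F" using Suc.prems by simp
  have "(\<integral>\<^sup>+x. ennreal (F (y + shift_by k x)) \<partial>Leb (Suc m)) =
      (\<integral>\<^sup>+x. (\<integral>\<^sup>+t. ennreal (F (y + shift_by k (x(m := t)))) \<partial>lborel) \<partial>Leb m)"
    by (rule nn_Leb_Suc) measurable
  also have "\<dots> = (\<integral>\<^sup>+x. ennreal (marginal (k + m) F (y + shift_by k x)) \<partial>Leb m)"
  proof (rule nn_Leb_cong)
    fix x assume x: "x \<in> Rn m"
    have "y + shift_by k (x(m := t)) = (y + shift_by k x)(k + m := t)" for t
      using assms(2) by (auto simp: shift_by_def Rn_iff fun_eq_iff)
    moreover have "y + shift_by k x \<in> Rn (k + m)" using x assms(2) by (auto simp: shift_by_def Rn_iff)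
    ultimately show "(\<integral>\<^sup>+t. ennreal (F (y + shift_by k (x(m := t)))) \<partial>lborel) = ennreal (marginal (k + m) F (y + shift_by k x))"
      by (simp add: marginal_nn(1)[OF F])
  qed
  also have "\<dots> = ennreal (marginals k m (marginal (k + m) F) y)"
    by (rule Suc.IH[OF marginal_logconc[OF F]])
  finally show ?case by (simp only: marginals.simps)
qed

lemma sym_body_logconc:
  assumes K: "sym_body n K" shows "\<exists>R. sym_logconc n 1 R (indicator K)"
proof -
  obtain R where R: "0 < R" "\<And>y. y \<in> K \<Longrightarrow> nrm n y \<le> R" using sym_body_bounds[OF K] by metis
  have [measurable]: "K \<in> sets borel" using K by measurable
  have "indicator K x powr (1 - t) * indicator K y powr t \<le> (indicator K ((1 - t) *\<^sub>R x + t *\<^sub>R y) :: real)"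
    if "0 < t" "t < 1" for x y t
  proof (cases "x \<in> K \<and> y \<in> K")
    case True
    hence "(1 - t) *\<^sub>R x + t *\<^sub>R y \<in> K" using that by (intro convexD[OF sym_body_convex[OF K]]) auto
    thus ?thesis using True by simp
  qed (auto simp: indicator_def)
  moreover have "indicator K (- x) = (indicator K x :: real)" for x
    using sym_body_uminus[OF K, of x] sym_body_uminus[OF K, of "- x"] by (auto simp: indicator_def)
  moreover have "\<bar>x i\<bar> \<le> R" if "i < n" "indicator K x \<noteq> (0::real)" for x i
    using coord_le_nrm[OF that(1), of x] R(2)[of x] that(2) by (auto simp: indicator_def split: if_splits)
  ultimately have "sym_logconc n 1 R (indicator K)"
    unfolding sym_logconc_def using R(1) by (auto simp: indicator_def)
  thus ?thesis by blast
qed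

section \<open>Ball's body of a log-concave function\<close>

subsection \<open>One-dimensional moments\<close>

lemma measure_eqI_atMost:
  fixes M N :: "real measure"
  assumes "sets M = sets borel" "sets N = sets borel"
    and "\<And>a. emeasure M {..a} = emeasure N {..a}" "\<And>a. emeasure M {..a} \<noteq> \<infinity>"
  shows "M = N"
proof (rule measure_eqI_generator_eq[where E = "range (\<lambda>a::real. {..a})" and \<Omega> = UNIV and A = "\<lambda>N. {..real N}"])
  show "Int_stable (range (\<lambda>a::real. {..a}))"
    by (rule Int_stableI_image) (auto intro!: exI[of _ "min _ _"])
  show "sets M = sigma_sets UNIV (range (\<lambda>a::real. {..a}))" "sets N = sigma_sets UNIV (range (\<lambda>a::real. {..a}))"
    using assms(1,2) by (simp_all add: borel_eq_atMost)
  show "(\<Union>N. {..real N}) = UNIV" by (auto intro: real_arch_simple)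
qed (use assms in auto)

text \<open>The substitution \<open>r = 1 / v\<close>. Both measures give a half-line
  \<open>{..a}\<close> the mass \<open>max 0 a\<close>, so they coincide.\<close>

lemma nn_integral_inversion:
  assumes f[measurable]: "f \<in> borel_measurable borel"
  shows "(\<integral>\<^sup>+v. indicator {0<..} v * ennreal (1 / v\<^sup>2) * f (1 / v) \<partial>lborel) =
    (\<integral>\<^sup>+r. indicator {0<..} r * f r \<partial>(lborel :: real measure))"
proof -
  let ?D = "density lborel (\<lambda>v::real. indicator {0<..} v * ennreal (1 / v\<^sup>2))"
  let ?M = "distr ?D borel (\<lambda>v. 1 / v)" and ?N = "density lborel (indicator {0<..} :: real \<Rightarrow> ennreal)"
  have e: "emeasure ?M {..a} = ennreal (max 0 a)" for a
  proof -
    have "emeasure ?M {..a} = (\<integral>\<^sup>+v. indicator {0<..} v * ennreal (1 / v\<^sup>2) * indicator {v. 1 / v \<le> a} v \<partial>lborel)"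
      by (subst emeasure_distr) (auto simp: emeasure_density vimage_def)
    also have "\<dots> = ennreal (max 0 a)"
    proof (cases "0 < a")
      case True
      have "(\<integral>\<^sup>+v. indicator {0<..} v * ennreal (1 / v\<^sup>2) * indicator {v. 1 / v \<le> a} v \<partial>lborel) =
          (\<integral>\<^sup>+v. ennreal (1 / v\<^sup>2) * indicator {1/a..} v \<partial>lborel)"
      proof (rule nn_integral_cong)
        fix v :: real
        have "1 / v \<le> a \<longleftrightarrow> 1 / a \<le> v" if "0 < v" using that True by (simp add: field_simps)
        moreover have "0 < v" if "1 / a \<le> v" using that True by (meson divide_pos_pos less_le_trans zero_less_one)
        ultimately show "indicator {0<..} v * ennreal (1 / v\<^sup>2) * indicator {v. 1 / v \<le> a} v =
            ennreal (1 / v\<^sup>2) * indicator {1/a..} v"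
          by (auto simp: indicator_def)
      qed
      also have "\<dots> = ennreal (0 - (- 1 / (1 / a)))"
      proof (rule nn_integral_FTC_atLeast)
        fix v assume "1 / a \<le> v"
        hence v: "0 < v" using True by (meson divide_pos_pos less_le_trans zero_less_one)
        show "((\<lambda>v. - 1 / v) has_real_derivative 1 / v\<^sup>2) (at v)"
          using v by (auto intro!: derivative_eq_intros simp: power2_eq_square)
        show "0 \<le> 1 / v\<^sup>2" by simp
      next
        show "((\<lambda>v::real. - 1 / v) \<longlongrightarrow> 0) at_top" by (intro tendsto_divide_0[OF tendsto_const] filterlim_at_top_imp_at_infinity filterlim_ident)
      qed measurable
      finally show ?thesis using True by simp
    next
      case False
      hence "indicator {0<..} v * ennreal (1 / v\<^sup>2) * indicator {v. 1 / v \<le> a} v = 0" for v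
        by (auto simp: indicator_def not_less) (meson divide_pos_pos dual_order.trans not_le zero_less_one)
      thus ?thesis using False by (simp del: mult_eq_0_iff)
    qed
    finally show ?thesis .
  qed
  have "?M = ?N"
  proof (rule measure_eqI_atMost)
    fix a :: real
    have "emeasure ?N {..a} = (\<integral>\<^sup>+r. indicator {0<..a} r \<partial>lborel)"
    proof (subst emeasure_density)
      show "(\<integral>\<^sup>+x. indicator {0<..} x * indicator {..a} x \<partial>lborel) = (\<integral>\<^sup>+r. indicator {0<..a} r \<partial>lborel)"
        by (rule nn_integral_cong) (auto simp: indicator_def)
    qed auto
    also have "\<dots> = ennreal (max 0 a)" by (cases "0 \<le> a") auto
    finally show "emeasure ?M {..a} = emeasure ?N {..a}" by (simp add: e)
    show "emeasure ?M {..a} \<noteq> \<infinity>" by (simp add: e)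
  qed auto
  hence "(\<integral>\<^sup>+r. f r \<partial>?N) = (\<integral>\<^sup>+r. f r \<partial>?M)" by simp
  also have "\<dots> = (\<integral>\<^sup>+v. f (1 / v) \<partial>?D)" by (rule nn_integral_distr) auto
  also have "\<dots> = (\<integral>\<^sup>+v. indicator {0<..} v * ennreal (1 / v\<^sup>2) * f (1 / v) \<partial>lborel)"
    by (rule nn_integral_density) measurable
  also have "(\<integral>\<^sup>+r. f r \<partial>?N) = (\<integral>\<^sup>+r. indicator {0<..} r * f r \<partial>lborel)"
    by (rule nn_integral_density) measurable
  finally show ?thesis ..
qed

lemma exp_moment:
  assumes a: "0 < (a::real)"
  shows "integrable lborel (\<lambda>r. indicator {0<..} r * (exp (- a * r) * r ^ j))"
    and "(LINT r|lborel. indicator {0<..} r * (exp (- a * r) * r ^ j)) = fact j / a ^ (j + 1)"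
proof -
  let ?g = "\<lambda>x::real. ennreal (x ^ j * exp (- x)) * indicator {0..} x"
  have "ennreal (fact j) = (\<integral>\<^sup>+x. ?g x \<partial>lborel)"
    by (subst nn_intergal_power_times_exp_Ici) simp
  also have "\<dots> = ennreal \<bar>a\<bar> * (\<integral>\<^sup>+x. ?g (0 + a * x) \<partial>lborel)"
    by (rule nn_integral_real_affine) (use a in auto)
  also have "(\<integral>\<^sup>+x. ?g (0 + a * x) \<partial>lborel) =
      (\<integral>\<^sup>+r. ennreal (a ^ j) * ennreal (indicator {0<..} r * (exp (- a * r) * r ^ j)) \<partial>lborel)"
  proof (rule nn_integral_cong_AE, rule AE_I[where N = "{0}"])
    show "{x \<in> space lborel. ?g (0 + a * x) \<noteq> ennreal (a ^ j) * ennreal (indicator {0<..} x * (exp (- a * x) * x ^ j))} \<subseteq> {0}"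
      using a by (auto simp: indicator_def ennreal_mult[symmetric] power_mult_distrib zero_le_mult_iff mult_ac split: if_splits)
  qed auto
  also have "\<dots> = ennreal (a ^ j) * (\<integral>\<^sup>+r. ennreal (indicator {0<..} r * (exp (- a * r) * r ^ j)) \<partial>lborel)"
    by (rule nn_integral_cmult) measurable
  finally have e: "ennreal (fact j) = ennreal (a ^ (j + 1)) * (\<integral>\<^sup>+r. ennreal (indicator {0<..} r * (exp (- a * r) * r ^ j)) \<partial>lborel)"
    using a by (simp add: mult.assoc[symmetric] ennreal_mult[symmetric])
  have "(\<integral>\<^sup>+r. ennreal (indicator {0<..} r * (exp (- a * r) * r ^ j)) \<partial>lborel) =
      ennreal (1 / a ^ (j + 1)) * (ennreal (a ^ (j + 1)) * (\<integral>\<^sup>+r. ennreal (indicator {0<..} r * (exp (- a * r) * r ^ j)) \<partial>lborel))"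
  proof -
    have "ennreal (1 / a ^ (j + 1)) * ennreal (a ^ (j + 1)) = 1"
      using a by (subst ennreal_mult[symmetric]) auto
    thus ?thesis by (simp add: mult.assoc[symmetric])
  qed
  also have "\<dots> = ennreal (fact j / a ^ (j + 1))"
    unfolding e[symmetric] using a by (subst ennreal_mult[symmetric]) auto
  finally have nn: "(\<integral>\<^sup>+r. ennreal (indicator {0<..} r * (exp (- a * r) * r ^ j)) \<partial>lborel) = ennreal (fact j / a ^ (j + 1))" .
  have nonneg: "0 \<le> indicator {0<..} r * (exp (- a * r) * r ^ j)" for r by (auto simp: indicator_def)
  show int: "integrable lborel (\<lambda>r. indicator {0<..} r * (exp (- a * r) * r ^ j))"
    by (rule integrableI_nn_integral_finite[OF _ _ nn]) (use nonneg a in auto)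
  show "(LINT r|lborel. indicator {0<..} r * (exp (- a * r) * r ^ j)) = fact j / a ^ (j + 1)"
    using nn nonneg a by (subst integral_eq_nn_integral) auto
qed

text \<open>
  An exponential with the same moment of order \<open>k - 1\<close> as \<open>h\<close> crosses \<open>h\<close> once, from below to
  above, say at \<open>r\<^sub>0\<close>; so the difference has the opposite sign of \<open>r\<^sup>2 - r\<^sub>0\<^sup>2\<close> everywhere.
\<close>
lemma moment_comparison:
  fixes h :: "real \<Rightarrow> real"
  assumes m[measurable]: "h \<in> borel_measurable borel" and h: "\<And>r. 0 \<le> h r" "\<And>r. h r \<le> 1" "\<And>r. \<rho> < r \<Longrightarrow> h r = 0" "h 0 = 1"
    and lc: "\<And>r s. 0 < r \<Longrightarrow> r < s \<Longrightarrow> h s powr (r / s) \<le> h r"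
    and k: "1 \<le> k" and a: "0 < a"
    and eq: "(LINT r|lborel. indicator {0<..} r * (h r * r ^ (k - 1))) = fact (k - 1) / a ^ k"
  shows "(LINT r|lborel. indicator {0<..} r * (h r * r ^ (k + 1))) \<le> fact (k + 1) / a ^ (k + 2)"
proof -
  have hint: "integrable lborel (\<lambda>r. indicator {0<..} r * (h r * r ^ j))" for j
  proof (rule Bochner_Integration.integrable_bound[where f = "\<lambda>r. \<bar>\<rho>\<bar> ^ j * indicator {0..\<bar>\<rho>\<bar>} r"])
    show "integrable lborel (\<lambda>r. \<bar>\<rho>\<bar> ^ j * indicator {0..\<bar>\<rho>\<bar>} r)"
      by (intro integrable_mult_right) (simp add: integrable_indicator_iff)
    show "AE r in lborel. norm (indicator {0<..} r * (h r * r ^ j)) \<le> norm (\<bar>\<rho>\<bar> ^ j * indicator {0..\<bar>\<rho>\<bar>} r)"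
    proof (rule AE_I2)
      fix r :: real
      show "norm (indicator {0<..} r * (h r * r ^ j)) \<le> norm (\<bar>\<rho>\<bar> ^ j * indicator {0..\<bar>\<rho>\<bar>} r)"
      proof (cases "0 < r \<and> r \<le> \<rho>")
        case True
        have "h r * r ^ j \<le> 1 * \<bar>\<rho>\<bar> ^ j"
          using True h(1,2)[of r] by (intro mult_mono power_mono) auto
        thus ?thesis using True h(1)[of r] by (simp add: abs_mult)
      qed (use h(3)[of r] in \<open>auto simp: indicator_def\<close>)
    qed
  qed measurable
  \<comment> \<open>The supremum of this set is the crossing point: if \<open>s\<close> belongs to
    it, log-concavity along the ray, \<open>h s powr (r / s) \<le> h r\<close>, puts every smaller
    positive \<open>r\<close> into it as well.\<close>
  define S where "S = {r. 0 \<le> r \<and> exp (- a * r) \<le> h r}"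
  have S0: "0 \<in> S" by (simp add: S_def h)
  have "r \<le> \<bar>\<rho>\<bar>" if "r \<in> S" for r
  proof (rule ccontr)
    assume "\<not> r \<le> \<bar>\<rho>\<bar>"
    hence "h r = 0" using h(3) by simp
    thus False using that exp_gt_zero[of "- a * r"] by (simp add: S_def del: exp_gt_zero)
  qed
  hence bdd: "bdd_above S" by (auto simp: bdd_above_def)
  define r0 where "r0 = Sup S"
  have r0: "0 \<le> r0" unfolding r0_def by (rule cSup_upper[OF S0 bdd])
  have below: "exp (- a * r) \<le> h r" if r: "0 < r" "r < r0" for r
  proof -
    obtain s where s: "s \<in> S" "r < s" using r(2) S0 unfolding r0_def by (subst (asm) less_cSup_iff[OF _ bdd]) auto
    have "exp (- a * r) = exp (- a * s) powr (r / s)" using r s by (simp add: powr_def)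
    also have "\<dots> \<le> h s powr (r / s)" using s r by (intro powr_mono2) (auto simp: S_def)
    also have "\<dots> \<le> h r" by (rule lc[OF r(1) s(2)])
    finally show ?thesis .
  qed
  have above: "h r \<le> exp (- a * r)" if r: "r0 < r" for r
  proof (rule ccontr)
    assume "\<not> h r \<le> exp (- a * r)"
    hence "r \<in> S" using r r0 by (simp add: S_def)
    hence "r \<le> r0" unfolding r0_def by (intro cSup_upper bdd)
    thus False using r by simp
  qed
  have pw: "indicator {0<..} r * (h r * r ^ (k + 1)) - indicator {0<..} r * (exp (- a * r) * r ^ (k + 1))
      \<le> r0\<^sup>2 * (indicator {0<..} r * (h r * r ^ (k - 1)) - indicator {0<..} r * (exp (- a * r) * r ^ (k - 1)))" for r
  proof (cases "0 < r")
    case True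
    have rk: "r ^ (k + 1) = r\<^sup>2 * r ^ (k - 1)" using k by (simp add: power_add[symmetric])
    have "(h r - exp (- a * r)) * (r\<^sup>2 - r0\<^sup>2) \<le> 0"
    proof (cases "r < r0")
      case lt: True
      have "r\<^sup>2 \<le> r0\<^sup>2" using lt True by (intro power_mono) auto
      thus ?thesis using below[OF True lt] by (intro mult_nonneg_nonpos) auto
    next
      case False
      have "r0\<^sup>2 \<le> r\<^sup>2" using False r0 by (intro power_mono) auto
      moreover have "r = r0 \<or> h r \<le> exp (- a * r)" using above[of r] False by linarith
      ultimately show ?thesis by (elim disjE) (simp_all add: mult_nonpos_nonneg)
    qed
    hence "(h r - exp (- a * r)) * (r\<^sup>2 - r0\<^sup>2) * r ^ (k - 1) \<le> 0"
      by (rule mult_nonpos_nonneg) (use True in auto)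
    thus ?thesis using True unfolding rk by (simp add: algebra_simps)
  qed simp
  have "(LINT r|lborel. indicator {0<..} r * (h r * r ^ (k + 1)) - indicator {0<..} r * (exp (- a * r) * r ^ (k + 1)))
      \<le> (LINT r|lborel. r0\<^sup>2 * (indicator {0<..} r * (h r * r ^ (k - 1)) - indicator {0<..} r * (exp (- a * r) * r ^ (k - 1))))"
    using hint exp_moment(1)[OF a] pw
    by (intro integral_mono Bochner_Integration.integrable_diff integrable_mult_right) blast+
  also have "\<dots> = r0\<^sup>2 * (fact (k - 1) / a ^ k - fact (k - 1) / a ^ (k - 1 + 1))"
    using hint exp_moment[OF a] eq by (simp del: power_Suc)
  also have "k - 1 + 1 = k" using k by simp
  finally have "(LINT r|lborel. indicator {0<..} r * (h r * r ^ (k + 1)) - indicator {0<..} r * (exp (- a * r) * r ^ (k + 1))) \<le> 0"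
    by simp
  thus ?thesis
    using hint exp_moment[OF a, of "k + 1"] by (simp add: Bochner_Integration.integral_diff del: power_Suc fact_Suc)
qed

subsection \<open>The triangle inequality\<close>

definition ray_moment :: "((nat \<Rightarrow> real) \<Rightarrow> real) \<Rightarrow> nat \<Rightarrow> (nat \<Rightarrow> real) \<Rightarrow> ennreal" where
  "ray_moment F j x = (\<integral>\<^sup>+r. indicator {0<..} r * ennreal (F (r *\<^sub>R x) * r ^ j) \<partial>lborel)"

text \<open>The integrand of \<open>ray_moment F (q - 2) x\<close> after the substitution
  \<open>u = 1 / r\<close>; the differential accounts for two of the \<open>q\<close> powers of
  \<open>u\<close>.\<close>

definition inverse_ray :: "((nat \<Rightarrow> real) \<Rightarrow> real) \<Rightarrow> nat \<Rightarrow> (nat \<Rightarrow> real) \<Rightarrow> real \<Rightarrow> real" where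
  "inverse_ray F q x u = (if 0 < u then F ((1 / u) *\<^sub>R x) / u ^ q else 0)"

lemma inverse_ray_measurable:
  assumes "F \<in> borel_measurable borel" shows "inverse_ray F q x \<in> borel_measurable borel"
proof -
  note [measurable] = measurable_compose[OF measurable_scaleR_const[of x] assms]
  show ?thesis unfolding inverse_ray_def[abs_def] by measurable
qed

lemma ray_moment_inverse:
  assumes [measurable]: "F \<in> borel_measurable borel" and F0: "\<And>x. 0 \<le> F x"
  shows "ray_moment F j x = (\<integral>\<^sup>+u. ennreal (inverse_ray F (j + 2) x u) \<partial>lborel)"
proof -
  note [measurable] = measurable_compose[OF measurable_scaleR_const[of x] assms(1)]
  have "ray_moment F j x = (\<integral>\<^sup>+v. indicator {0<..} v * ennreal (1 / v\<^sup>2) * ennreal (F ((1 / v) *\<^sub>R x) * (1 / v) ^ j) \<partial>lborel)"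
    unfolding ray_moment_def by (rule nn_integral_inversion[symmetric]) measurable
  also have "\<dots> = (\<integral>\<^sup>+u. ennreal (inverse_ray F (j + 2) x u) \<partial>lborel)"
  proof (rule nn_integral_cong)
    fix v :: real
    show "indicator {0<..} v * ennreal (1 / v\<^sup>2) * ennreal (F ((1 / v) *\<^sub>R x) * (1 / v) ^ j) = ennreal (inverse_ray F (j + 2) x v)"
    proof (cases "0 < v")
      case True
      thus ?thesis using F0[of "(1 / v) *\<^sub>R x"]
        by (simp add: inverse_ray_def ennreal_mult[symmetric] power_add power_divide power2_eq_square mult_ac)
    qed (simp add: inverse_ray_def)
  qed
  finally show ?thesis .
qed

lemma ray_moment_scale:
  assumes F[measurable]: "F \<in> borel_measurable borel" and F0: "\<And>x. 0 \<le> F x" and s: "0 < s"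
  shows "ray_moment F j (s *\<^sub>R x) = ennreal (1 / s ^ (j + 1)) * ray_moment F j x"
proof -
  note [measurable] = measurable_compose[OF measurable_scaleR_const[of x] F]
  let ?g = "\<lambda>r. indicator {0<..} r * ennreal (F (r *\<^sub>R x) * r ^ j)"
  have "ray_moment F j x = ennreal \<bar>s\<bar> * (\<integral>\<^sup>+r. ?g (0 + s * r) \<partial>lborel)"
    unfolding ray_moment_def by (rule nn_integral_real_affine) (use s in auto)
  also have "(\<integral>\<^sup>+r. ?g (0 + s * r) \<partial>lborel) =
      (\<integral>\<^sup>+r. ennreal (s ^ j) * (indicator {0<..} r * ennreal (F (r *\<^sub>R (s *\<^sub>R x)) * r ^ j)) \<partial>lborel)"
  proof (rule nn_integral_cong)
    fix r :: real
    show "?g (0 + s * r) = ennreal (s ^ j) * (indicator {0<..} r * ennreal (F (r *\<^sub>R (s *\<^sub>R x)) * r ^ j))"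
      using s F0 by (cases "0 < r")
        (auto simp: indicator_def ennreal_mult[symmetric] power_mult_distrib mult_ac zero_less_mult_iff)
  qed
  also have "\<dots> = ennreal (s ^ j) * ray_moment F j (s *\<^sub>R x)"
  proof -
    note [measurable] = measurable_compose[OF measurable_scaleR_const[of "s *\<^sub>R x"] F]
    show ?thesis unfolding ray_moment_def by (rule nn_integral_cmult) measurable
  qed
  finally have e: "ray_moment F j x = ennreal (s ^ (j + 1)) * ray_moment F j (s *\<^sub>R x)"
    using s by (simp add: mult.assoc[symmetric] ennreal_mult[symmetric])
  have "ennreal (1 / s ^ (j + 1)) * ennreal (s ^ (j + 1)) = 1"
    using s by (subst ennreal_mult[symmetric]) auto
  thus ?thesis unfolding e by (simp add: mult.assoc[symmetric])
qed

lemma weighted_harmonic_le_geometric: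
  fixes a b l :: real
  assumes "0 < a" "0 < b" "0 < l" "l < 1"
  shows "1 / ((1 - l) / a + l / b) \<le> a powr (1 - l) * b powr l"
proof -
  have "(1 / a) powr (1 - l) * (1 / b) powr l \<le> (1 - l) * (1 / a) + l * (1 / b)"
    using assms by (intro Youngs_inequality_0) auto
  hence le: "1 / (a powr (1 - l) * b powr l) \<le> (1 - l) / a + l / b"
    using assms by (simp add: powr_divide)
  have p: "0 < a powr (1 - l) * b powr l" using assms by simp
  have "0 < (1 - l) / a + l / b" using assms by (intro add_pos_pos) auto
  thus ?thesis using le p by (simp add: field_simps)
qed

text \<open>
  The substitution \<open>u = 1/r\<close> turns the radial weight into one for which the superlevel sets
  combine linearly: if \<open>F (x/u) > a u\<^sup>q\<close> and \<open>F (y/v) > b v\<^sup>q\<close> then \<open>F (z/w) > \<kappa> w\<^sup>q\<close> at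
  \<open>z = (1-t) x + t y\<close>, \<open>w = (1-t) u + t v\<close>, with \<open>\<kappa>\<close> the mean of \<open>a\<close> and \<open>b\<close> of order \<open>-1/q\<close>.
\<close>
lemma inverse_ray_combine:
  assumes F: "sym_logconc k B R F" and x: "x \<in> Rn k" and y: "y \<in> Rn k" and t: "0 < t" "t < 1"
    and q: "1 \<le> q" and ab: "0 < a" "0 < b" and gt: "a ^ q < inverse_ray F q x u" "b ^ q < inverse_ray F q y v"
  shows "(1 / ((1 - t) / a + t / b)) ^ q < inverse_ray F q ((1 - t) *\<^sub>R x + t *\<^sub>R y) ((1 - t) * u + t * v)"
proof -
  note D = sym_logconcD[OF F]
  have "0 < a ^ q" "0 < b ^ q" using ab by auto
  hence uv: "0 < u" "0 < v" using gt by (auto simp: inverse_ray_def split: if_splits)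
  let ?w = "(1 - t) * u + t * v" and ?z = "(1 - t) *\<^sub>R x + t *\<^sub>R y"
  have w: "0 < ?w" using uv t by (intro add_pos_pos) auto
  \<comment> \<open>The weight for which \<open>(1 - l) x / u + l y / v\<close> equals
    \<open>z / w\<close>. It also turns \<open>w\<close> times the harmonic mean of \<open>a\<close>
    and \<open>b\<close> into the harmonic mean of \<open>a u\<close> and
    \<open>b v\<close>.\<close>
  define l where "l = t * v / ?w"
  have l: "0 < l" "l < 1" "1 - l = (1 - t) * u / ?w"
    using uv t w by (auto simp: l_def field_simps intro!: add_pos_pos)
  have Fx: "(a * u) ^ q < F ((1 / u) *\<^sub>R x)" and Fy: "(b * v) ^ q < F ((1 / v) *\<^sub>R y)"
    using gt uv by (auto simp: inverse_ray_def power_mult_distrib pos_less_divide_eq)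
  have au: "0 < a * u" "0 < b * v" using ab uv by auto
  have "(?w * (1 / ((1 - t) / a + t / b))) ^ q \<le> ((a * u) powr (1 - l) * (b * v) powr l) ^ q"
  proof (rule power_mono)
    have "(1 - l) / (a * u) + l / (b * v) = ((1 - t) / a + t / b) / ?w"
      unfolding l(3) unfolding l_def using uv ab w by (simp add: add_divide_distrib mult.commute)
    hence "?w * (1 / ((1 - t) / a + t / b)) = 1 / ((1 - l) / (a * u) + l / (b * v))" using w by simp
    also have "\<dots> \<le> (a * u) powr (1 - l) * (b * v) powr l"
      by (rule weighted_harmonic_le_geometric) (use au l in auto)
    finally show "?w * (1 / ((1 - t) / a + t / b)) \<le> (a * u) powr (1 - l) * (b * v) powr l" .
    show "0 \<le> ?w * (1 / ((1 - t) / a + t / b))" using w ab t by simp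
  qed
  also have "\<dots> = ((a * u) ^ q) powr (1 - l) * ((b * v) ^ q) powr l"
  proof -
    have "(c powr e) ^ q = (c ^ q) powr e" if "0 < c" for c e :: real
      using that by (simp add: powr_realpow[symmetric] powr_powr mult.commute)
    thus ?thesis using au by (simp only: power_mult_distrib[of "_ powr _"])
  qed
  also have "\<dots> < F ((1 / u) *\<^sub>R x) powr (1 - l) * F ((1 / v) *\<^sub>R y) powr l"
    using Fx Fy l au by (intro mult_strict_mono powr_less_mono2) auto
  also have "\<dots> \<le> F ((1 - l) *\<^sub>R ((1 / u) *\<^sub>R x) + l *\<^sub>R ((1 / v) *\<^sub>R y))"
    by (rule D(7)) (use x y l in \<open>auto intro!: Rn_closed_ops(4)\<close>)
  also have "(1 - l) *\<^sub>R ((1 / u) *\<^sub>R x) + l *\<^sub>R ((1 / v) *\<^sub>R y) = (1 / ?w) *\<^sub>R ?z"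
    unfolding l(3) unfolding l_def using uv by (simp add: scaleR_add_right)
  finally have "(1 / ((1 - t) / a + t / b)) ^ q * ?w ^ q < F ((1 / ?w) *\<^sub>R ?z)"
    by (simp only: power_mult_distrib mult.commute)
  hence "(1 / ((1 - t) / a + t / b)) ^ q < F ((1 / ?w) *\<^sub>R ?z) / ?w ^ q"
    using w by (simp only: pos_less_divide_eq zero_less_power)
  thus ?thesis using w by (simp only: inverse_ray_def if_True)
qed

text \<open>Convexity is \<open>inverse_ray_combine\<close> with \<open>x = y\<close> and
  \<open>a = b\<close>. Boundedness holds because the function is at most
  \<open>B / u\<^sup>q\<close> and vanishes for \<open>u \<le> 0\<close>.\<close>

lemma inverse_ray_level_sets:
  assumes F: "sym_logconc k B R F" and x: "x \<in> Rn k" and q: "1 \<le> q" and c: "0 < c"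
  shows "convex {u. c < inverse_ray F q x u} \<and> bounded {u. c < inverse_ray F q x u}"
proof
  note D = sym_logconcD[OF F]
  define a where "a = root q c"
  have a: "0 < a" "a ^ q = c" using q c by (auto simp: a_def real_root_pow_pos2)
  show "convex {u. c < inverse_ray F q x u}"
    unfolding convex_alt
  proof (intro ballI allI impI, elim conjE)
    fix u v t :: real assume uv: "u \<in> {u. c < inverse_ray F q x u}" "v \<in> {u. c < inverse_ray F q x u}" and t: "0 \<le> t" "t \<le> 1"
    consider "t = 0" | "t = 1" | "0 < t" "t < 1" using t by linarith
    thus "(1 - t) *\<^sub>R u + t *\<^sub>R v \<in> {u. c < inverse_ray F q x u}"
    proof cases
      case 3
      have "(1 / ((1 - t) / a + t / a)) ^ q < inverse_ray F q ((1 - t) *\<^sub>R x + t *\<^sub>R x) ((1 - t) * u + t * v)"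
        using uv by (intro inverse_ray_combine[OF F x x 3 q a(1) a(1)]) (auto simp: a)
      also have "(1 / ((1 - t) / a + t / a)) ^ q = c" using a by (simp add: add_divide_distrib[symmetric])
      also have "(1 - t) *\<^sub>R x + t *\<^sub>R x = x" by (simp add: scaleR_add_left[symmetric])
      finally show ?thesis by simp
    qed (use uv in auto)
  qed
  have "u \<le> max 1 (B / c)" "0 < u" if u: "c < inverse_ray F q x u" for u
  proof -
    show u0: "0 < u" using u c by (auto simp: inverse_ray_def split: if_splits)
    show "u \<le> max 1 (B / c)"
    proof (cases "1 \<le> u")
      case True
      have "c * u ^ q < F ((1 / u) *\<^sub>R x)" using u u0 by (simp add: inverse_ray_def pos_less_divide_eq)
      also have "\<dots> \<le> B" using x by (intro D(4) Rn_closed_ops(4))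
      finally have "u ^ q \<le> B / c" using c by (simp add: field_simps)
      moreover have "u ^ 1 \<le> u ^ q" using True q by (intro power_increasing) auto
      ultimately show ?thesis by simp
    qed simp
  qed
  hence "{u. c < inverse_ray F q x u} \<subseteq> {0..max 1 (B / c)}" by fastforce
  thus "bounded {u. c < inverse_ray F q x u}" by (rule bounded_subset[OF bounded_closed_interval])
qed


lemma convex_comb_power_le:
  fixes x y t :: real
  assumes "0 \<le> x" "0 \<le> y" "0 \<le> t" "t \<le> 1"
  shows "((1 - t) * x + t * y) ^ q \<le> (1 - t) * x ^ q + t * y ^ q"
proof (induction q)
  case (Suc q)
  let ?s = "(1 - t) * x + t * y"
  have "0 \<le> (x - y) * (x ^ q - y ^ q)"
  proof (cases "x \<le> y")
    case True
    hence "x ^ q \<le> y ^ q" using assms by (intro power_mono)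
    thus ?thesis using True by (simp add: mult_nonpos_nonpos)
  next
    case False
    hence "y ^ q \<le> x ^ q" using assms by (intro power_mono) auto
    thus ?thesis using False by simp
  qed
  hence "0 \<le> (1 - t) * t * ((x - y) * (x ^ q - y ^ q))" using assms by simp
  moreover have "?s * ?s ^ q \<le> ?s * ((1 - t) * x ^ q + t * y ^ q)"
    using assms by (intro mult_left_mono[OF Suc.IH]) auto
  moreover have "(1 - t) * x ^ Suc q + t * y ^ Suc q - ?s * ((1 - t) * x ^ q + t * y ^ q)
      = (1 - t) * t * ((x - y) * (x ^ q - y ^ q))"
    by (simp add: algebra_simps)
  ultimately show ?case by simp
qed simp

lemma logconc_nrm_support:
  assumes F: "sym_logconc k B R F" and x: "x \<in> Rn k" and "F x \<noteq> 0"
  shows "nrm k x \<le> real k * R"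
proof -
  have "nrm k x \<le> (\<Sum>i<k. \<bar>x i\<bar>)" by (rule nrm_le_sum)
  also have "\<dots> \<le> (\<Sum>i<k. R)" using sym_logconcD(5)[OF F x _ assms(3)] by (intro sum_mono) auto
  finally show ?thesis by simp
qed

lemma inverse_ray_upper:
  assumes F: "sym_logconc k B R F" and x: "x \<in> Rn k" "x \<noteq> 0"
  shows "inverse_ray F q x u \<le> B * (real k * R / nrm k x) ^ q"
proof -
  note D = sym_logconcD[OF F]
  have B: "0 \<le> B" using D(3)[of x] D(4)[OF x(1)] by linarith
  have nx: "0 < nrm k x" by (rule nrm_pos[OF x])
  show ?thesis
  proof (cases "0 < u \<and> F ((1 / u) *\<^sub>R x) \<noteq> 0")
    case True
    have xu: "(1 / u) *\<^sub>R x \<in> Rn k" by (rule Rn_closed_ops(4)[OF x(1)])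
    have "nrm k ((1 / u) *\<^sub>R x) \<le> real k * R" using logconc_nrm_support[OF F xu] True by simp
    hence "nrm k x \<le> real k * R * u" using True by (simp add: field_simps)
    hence "1 / u \<le> real k * R / nrm k x" using True nx by (simp add: field_simps)
    hence "(1 / u) ^ q \<le> (real k * R / nrm k x) ^ q" using True by (intro power_mono) auto
    hence "F ((1 / u) *\<^sub>R x) * (1 / u) ^ q \<le> B * (real k * R / nrm k x) ^ q"
      using D(3,4) xu B True by (intro mult_mono) auto
    thus ?thesis using True by (simp add: inverse_ray_def power_divide)
  next
    case False
    moreover have "0 \<le> B * (real k * R / nrm k x) ^ q" using B nx D(2) by simp
    ultimately show ?thesis by (auto simp: inverse_ray_def)
  qed
qed

text \<open>Convexity of Ball's body in disguise: the common moment \<open>m\<close> expresses that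
  \<open>x\<close> and \<open>y\<close> lie on its boundary. The suprema \<open>a\<^sup>q\<close>
  and \<open>b\<^sup>q\<close> along the two rays are unknown; they are eliminated at the end by
  convexity of the power \<open>q\<close>, applied at \<open>1 / a\<close> and
  \<open>1 / b\<close>.\<close>

lemma ray_moment_combine:
  assumes F: "sym_logconc k B R F" and x: "x \<in> Rn k" "x \<noteq> 0" and y: "y \<in> Rn k" "y \<noteq> 0"
    and t: "0 < t" "t < 1" and m: "0 < m" "ray_moment F j x = ennreal m" "ray_moment F j y = ennreal m"
  shows "ennreal m \<le> ray_moment F j ((1 - t) *\<^sub>R x + t *\<^sub>R y)"
proof -
  note D = sym_logconcD[OF F]
  define q where "q = j + 2"
  have q: "1 \<le> q" "0 < q" by (auto simp: q_def)
  let ?f = "inverse_ray F q"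
  define z where "z = (1 - t) *\<^sub>R x + t *\<^sub>R y"
  have z: "z \<in> Rn k" unfolding z_def by (intro Rn_closed_ops x y)
  have fm: "?f w \<in> borel_measurable borel" for w by (rule inverse_ray_measurable[OF D(1)])
  have f0: "0 \<le> ?f w u" for w u using D(3) by (simp add: inverse_ray_def)
  have I: "ray_moment F j w = (\<integral>\<^sup>+u. ennreal (?f w u) \<partial>lborel)" for w
    unfolding q_def by (rule ray_moment_inverse[OF D(1,3)])
  define s where "s w = Sup (range (?f w))" for w
  have bdd: "bdd_above (range (?f w))" if "w \<in> Rn k" "w \<noteq> 0" for w
    using inverse_ray_upper[OF F that] by (auto simp: bdd_above_def)
  have fs: "?f w u \<le> s w" if "w \<in> Rn k" "w \<noteq> 0" for w u
    unfolding s_def by (rule cSup_upper[OF _ bdd[OF that]]) simp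
  have sf: "\<exists>u. c < ?f w u" if "w \<in> Rn k" "w \<noteq> 0" "c < s w" for w c
    using that(3) unfolding s_def by (subst (asm) less_cSup_iff[OF _ bdd[OF that(1,2)]]) auto
  have spos: "0 < s w" if "w \<in> Rn k" "w \<noteq> 0" "ray_moment F j w = ennreal m" for w
  proof (rule ccontr)
    assume "\<not> 0 < s w"
    hence "?f w u = 0" for u using fs[OF that(1,2), of u] f0[of w u] by linarith
    thus False using that(3) m(1) by (simp add: I)
  qed
  define \<alpha> \<beta> where "\<alpha> = s x" and "\<beta> = s y"
  have pos: "0 < \<alpha>" "0 < \<beta>" using spos x y m by (auto simp: \<alpha>_def \<beta>_def)
  define a b where "a = root q \<alpha>" and "b = root q \<beta>"
  have ab: "0 < a" "0 < b" "a ^ q = \<alpha>" "b ^ q = \<beta>" using q pos by (auto simp: a_def b_def real_root_pow_pos2)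
  define \<kappa> where "\<kappa> = (1 / ((1 - t) / a + t / b)) ^ q"
  have den: "0 < (1 - t) / a + t / b" using t ab by (intro add_pos_pos) auto
  hence \<kappa>: "0 < \<kappa>" by (simp add: \<kappa>_def)
  have "ennreal (1 - t) * (\<integral>\<^sup>+u. ennreal (?f x u / \<alpha>) \<partial>lborel) + ennreal t * (\<integral>\<^sup>+u. ennreal (?f y u / \<beta>) \<partial>lborel)
      \<le> (\<integral>\<^sup>+u. ennreal (?f z u / \<kappa>) \<partial>lborel)"
  proof (rule superlevel_inequality[OF fm fm fm f0 _ _ f0 _ _ f0 _ _ _ t pos \<kappa>])
    fix c u v assume c: "0 < c" "c < 1" "\<alpha> * c < ?f x u" "\<beta> * c < ?f y v"
    \<comment> \<open>With the \<open>q\<close>-th root of \<open>c\<close> the two heights are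
      again \<open>q\<close>-th powers, of \<open>a * c'\<close> and \<open>b * c'\<close>, and the
      harmonic mean is homogeneous in \<open>c'\<close>.\<close>
    define c' where "c' = root q c"
    have c': "0 < c'" "c' ^ q = c" using q c by (auto simp: c'_def real_root_pow_pos2)
    have "(1 / ((1 - t) / (a * c') + t / (b * c'))) ^ q < ?f z ((1 - t) * u + t * v)"
      unfolding z_def
      by (rule inverse_ray_combine[OF F x(1) y(1) t q(1)]) (use c c' ab in \<open>auto simp: power_mult_distrib\<close>)
    moreover have "(1 - t) / (a * c') + t / (b * c') = ((1 - t) / a + t / b) / c'" by (simp add: add_divide_distrib)
    ultimately show "\<kappa> * c < ?f z ((1 - t) * u + t * v)"
      using c' by (simp add: \<kappa>_def power_divide)
  qed (use fs sf inverse_ray_level_sets[OF F _ q(1)] x y z in \<open>auto simp: \<alpha>_def \<beta>_def\<close>)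
  moreover have "(\<integral>\<^sup>+u. ennreal (?f w u / \<gamma>) \<partial>lborel) = ray_moment F j w / ennreal \<gamma>" if "0 < \<gamma>" for w \<gamma>
  proof -
    have "(\<integral>\<^sup>+u. ennreal (?f w u / \<gamma>) \<partial>lborel) = (\<integral>\<^sup>+u. ennreal (?f w u) / ennreal \<gamma> \<partial>lborel)"
      using f0 that by (intro nn_integral_cong) (simp add: divide_ennreal)
    thus ?thesis unfolding I using fm[of w] by (subst nn_integral_divide[symmetric]) auto
  qed
  ultimately have le: "ennreal (1 - t) * ennreal (m / \<alpha>) + ennreal t * ennreal (m / \<beta>) \<le> ray_moment F j z / ennreal \<kappa>"
    using pos \<kappa> m by (simp add: divide_ennreal)
  show ?thesis
  proof (cases "ray_moment F j z = top")
    case True thus ?thesis by (simp add: z_def)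
  next
    case False
    then obtain mz where mz: "0 \<le> mz" "ray_moment F j z = ennreal mz" by (cases "ray_moment F j z") auto
    have "(1 - t) * (m / \<alpha>) + t * (m / \<beta>) \<le> mz / \<kappa>"
      by (rule ennreal_combination_leD) (use le t m pos \<kappa> mz in \<open>auto simp: divide_ennreal\<close>)
    hence "m * ((1 - t) * (1 / a) ^ q + t * (1 / b) ^ q) \<le> mz * ((1 - t) / a + t / b) ^ q"
      by (simp add: ab(3,4)[symmetric] \<kappa>_def power_divide algebra_simps)
    moreover have "m * ((1 - t) / a + t / b) ^ q \<le> m * ((1 - t) * (1 / a) ^ q + t * (1 / b) ^ q)"
      using convex_comb_power_le[of "1 / a" "1 / b" t q] ab t m by (intro mult_left_mono) auto
    ultimately have "m * ((1 - t) / a + t / b) ^ q \<le> mz * ((1 - t) / a + t / b) ^ q" by linarith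
    hence "m \<le> mz" using den by (simp add: mult_le_cancel_right)
    thus ?thesis using mz by (simp add: z_def[symmetric] ennreal_leI)
  qed
qed

lemma ray_moment_bounds:
  assumes F: "sym_logconc k B R F" and low: "0 < d" "0 < e" "\<And>y. y \<in> Rn k \<Longrightarrow> nrm k y \<le> d \<Longrightarrow> e \<le> F y"
    and x: "x \<in> Rn k" "x \<noteq> 0"
  shows "ray_moment F j x \<le> ennreal (B * (real k * R / nrm k x) ^ (j + 1))"
    and "ennreal (e * (d / (2 * nrm k x)) ^ (j + 1)) \<le> ray_moment F j x"
proof -
  note D = sym_logconcD[OF F]
  have nx: "0 < nrm k x" by (rule nrm_pos[OF x])
  have rx: "r *\<^sub>R x \<in> Rn k" for r by (rule Rn_closed_ops(4)[OF x(1)])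
  have B: "0 \<le> B" using D(3)[of x] D(4)[OF x(1)] by linarith
  let ?\<rho> = "real k * R / nrm k x"
  have \<rho>: "0 \<le> ?\<rho>" using D(2) by simp
  have "ray_moment F j x \<le> (\<integral>\<^sup>+r. ennreal (B * ?\<rho> ^ j) * indicator {0..?\<rho>} r \<partial>lborel)"
    unfolding ray_moment_def
  proof (rule nn_integral_mono)
    fix r :: real
    show "indicator {0<..} r * ennreal (F (r *\<^sub>R x) * r ^ j) \<le> ennreal (B * ?\<rho> ^ j) * indicator {0..?\<rho>} r"
    proof (cases "0 < r \<and> F (r *\<^sub>R x) \<noteq> 0")
      case True
      hence "nrm k (r *\<^sub>R x) \<le> real k * R" by (intro logconc_nrm_support[OF F rx]) simp
      hence r: "r \<le> ?\<rho>" using True nx by (simp add: field_simps)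
      have "F (r *\<^sub>R x) * r ^ j \<le> B * ?\<rho> ^ j"
        using D(3,4) rx B True r by (intro mult_mono power_mono) auto
      thus ?thesis using True r by (simp add: ennreal_leI)
    qed (auto simp: indicator_def)
  qed
  also have "\<dots> = ennreal (B * ?\<rho> ^ j) * ennreal ?\<rho>" using \<rho> by (simp add: nn_integral_cmult)
  also have "\<dots> = ennreal (B * ?\<rho> ^ (j + 1))"
    using \<rho> B by (subst ennreal_mult[symmetric]) (auto simp: mult_ac)
  finally show "ray_moment F j x \<le> ennreal (B * ?\<rho> ^ (j + 1))" .
  \<comment> \<open>For radii between \<open>?s\<close> and \<open>2 * ?s\<close> the point
    \<open>r *\<^sub>R x\<close> has norm at most \<open>d\<close>, where \<open>F\<close> is at
    least \<open>e\<close>.\<close>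
  let ?s = "d / (2 * nrm k x)"
  have s: "0 < ?s" using nx low by simp
  have "ennreal (e * ?s ^ (j + 1)) = ennreal (e * ?s ^ j) * ennreal (2 * ?s - ?s)"
    using s low by (subst ennreal_mult[symmetric]) (auto simp: mult_ac)
  also have "\<dots> = (\<integral>\<^sup>+r. ennreal (e * ?s ^ j) * indicator {?s..2 * ?s} r \<partial>lborel)"
    using s by (simp add: nn_integral_cmult)
  also have "\<dots> \<le> ray_moment F j x"
    unfolding ray_moment_def
  proof (rule nn_integral_mono)
    fix r :: real
    show "ennreal (e * ?s ^ j) * indicator {?s..2 * ?s} r \<le> indicator {0<..} r * ennreal (F (r *\<^sub>R x) * r ^ j)"
    proof (cases "?s \<le> r \<and> r \<le> 2 * ?s")
      case True
      have r: "0 < r" using True s by linarith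
      have "2 * ?s * nrm k x = d" using nx by simp
      hence "nrm k (r *\<^sub>R x) \<le> d" using True r nx mult_right_mono[of r "2 * ?s" "nrm k x"] by simp
      hence "e \<le> F (r *\<^sub>R x)" by (rule low(3)[OF rx])
      hence "e * ?s ^ j \<le> F (r *\<^sub>R x) * r ^ j"
        using True s low D(3) by (intro mult_mono power_mono) auto
      thus ?thesis using True r by (simp add: ennreal_leI)
    qed (auto simp: indicator_def)
  qed
  finally show "ennreal (e * ?s ^ (j + 1)) \<le> ray_moment F j x" .
qed

subsection \<open>Volume and second moments of Ball's body\<close>

lemma powr_root_power: "0 < c \<Longrightarrow> (c powr (1 / real p)) ^ k = c powr (real k / real p)"
  by (simp add: powr_realpow[symmetric] powr_powr)

lemma powr_inverse_power: "0 < c \<Longrightarrow> 0 < p \<Longrightarrow> (c powr (1 / real p)) ^ p = c"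
  by (simp add: powr_root_power)

lemma power_powr_divide: "0 < a \<Longrightarrow> 0 < p \<Longrightarrow> (a ^ p) powr (real k / real p) = a ^ k"
  by (simp add: powr_realpow[symmetric] powr_powr)

lemma power_powr_minus_inverse: "0 < s \<Longrightarrow> 0 < p \<Longrightarrow> (s ^ p) powr (- 1 / real p) = 1 / s"
  by (simp add: powr_realpow[symmetric] powr_powr powr_minus_divide)

lemma radial_power_cut:
  assumes k: "1 \<le> k" and s: "0 \<le> s"
  shows "(\<integral>\<^sup>+r. ennreal (r ^ d) * indicator {..s} r \<partial>radial_measure k) =
    ennreal (real k * unit_ball_vol (real k) / real (k + d) * s ^ (k + d))"
proof -
  let ?c = "real k * unit_ball_vol (real k)"
  have "(\<integral>\<^sup>+r. ennreal (r ^ d) * indicator {..s} r \<partial>radial_measure k) =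
      (\<integral>\<^sup>+r. ennreal (?c * r ^ (k - 1)) * indicator {0<..} r * (ennreal (r ^ d) * indicator {..s} r) \<partial>lborel)"
    by (rule nn_radial) measurable
  also have "\<dots> = (\<integral>\<^sup>+r. ennreal (?c * r ^ (k + d - 1)) * indicator {0..s} r \<partial>lborel)"
  proof (rule nn_integral_cong_AE, rule AE_I[where N = "{0}"])
    have "k + d - 1 = k - 1 + d" using k by simp
    thus "{r \<in> space lborel. ennreal (?c * r ^ (k - 1)) * indicator {0<..} r * (ennreal (r ^ d) * indicator {..s} r) \<noteq>
        ennreal (?c * r ^ (k + d - 1)) * indicator {0..s} r} \<subseteq> {0}"
      by (auto simp: indicator_def ennreal_mult[symmetric] power_add mult_ac split: if_splits)
  qed auto
  also have "\<dots> = ennreal (?c / real (k + d) * s ^ (k + d) - ?c / real (k + d) * 0 ^ (k + d))"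
    by (rule nn_integral_FTC_Icc) (use k s in \<open>auto intro!: derivative_eq_intros\<close>)
  finally show ?thesis using k by (simp add: power_0_left)
qed

text \<open>The degree \<open>d\<close> of the weight is 0 for volumes and 2 for second
  moments.\<close>

lemma body_polar:
  assumes K: "sym_body n K" and \<iota>: "iso_onto m n E \<iota>" and m: "1 \<le> m"
    and w[measurable]: "w \<in> borel_measurable borel" "\<And>x. 0 \<le> w x" and hom: "\<And>r u. 0 < r \<Longrightarrow> w (r *\<^sub>R u) = r ^ d * w u"
  shows "(\<integral>\<^sup>+x. indicator K (\<iota> x) * ennreal (w (\<iota> x)) \<partial>Leb m) =
    (\<integral>\<^sup>+u. ennreal (w u * (real m * unit_ball_vol (real m) / real (m + d) * (1 / norm_of K u) ^ (m + d))) \<partial>sphere_haar n E)"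
proof -
  have [measurable]: "K \<in> sets borel" using K by measurable
  note S = sphere_haar_facts[OF sphere_haar_is_haar[OF \<iota> m]]
  have "(\<integral>\<^sup>+x. indicator K (\<iota> x) * ennreal (w (\<iota> x)) \<partial>Leb m) =
      (\<integral>\<^sup>+u. (\<integral>\<^sup>+r. indicator K (r *\<^sub>R u) * ennreal (w (r *\<^sub>R u)) \<partial>radial_measure m) \<partial>sphere_haar n E)"
    by (rule nn_polar[OF \<iota> m]) measurable
  also have "\<dots> = (\<integral>\<^sup>+u. ennreal (w u * (real m * unit_ball_vol (real m) / real (m + d) * (1 / norm_of K u) ^ (m + d))) \<partial>sphere_haar n E)"
  proof (rule nn_integral_cong)
    fix u assume "u \<in> space (sphere_haar n E)"
    hence u: "u \<in> Rn n" "nrm n u = 1" by (auto simp: S(3) unit_sphere_iff)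
    hence u0: "u \<noteq> 0" by auto
    have p: "0 < norm_of K u" by (rule norm_of_pos[OF K u(1) u0])
    have "AE r in radial_measure m. 0 < r"
      unfolding radial_measure_def by (subst AE_density) (auto simp: indicator_def)
    hence "(\<integral>\<^sup>+r. indicator K (r *\<^sub>R u) * ennreal (w (r *\<^sub>R u)) \<partial>radial_measure m) =
        (\<integral>\<^sup>+r. ennreal (w u) * (ennreal (r ^ d) * indicator {..1 / norm_of K u} r) \<partial>radial_measure m)"
    proof (intro nn_integral_cong_AE, eventually_elim)
      fix r :: real assume r: "0 < r"
      have "r *\<^sub>R u \<in> K \<longleftrightarrow> norm_of K (r *\<^sub>R u) \<le> 1"
        by (rule norm_of_le_1_iff[symmetric, OF K Rn_closed_ops(4)[OF u(1)]])
      also have "\<dots> \<longleftrightarrow> r \<le> 1 / norm_of K u"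
        using r p by (simp add: norm_of_scale[OF K u(1)] pos_le_divide_eq)
      finally show "indicator K (r *\<^sub>R u) * ennreal (w (r *\<^sub>R u)) =
          ennreal (w u) * (ennreal (r ^ d) * indicator {..1 / norm_of K u} r)"
        using r w(2) by (simp add: hom indicator_def ennreal_mult mult.commute)
    qed
    also have "\<dots> = ennreal (w u) * (\<integral>\<^sup>+r. ennreal (r ^ d) * indicator {..1 / norm_of K u} r \<partial>radial_measure m)"
      by (rule nn_integral_cmult) measurable
    also have "\<dots> = ennreal (w u * (real m * unit_ball_vol (real m) / real (m + d) * (1 / norm_of K u) ^ (m + d)))"
    proof (subst radial_power_cut[OF m])
      show "ennreal (w u) * ennreal (real m * unit_ball_vol (real m) / real (m + d) * (1 / norm_of K u) ^ (m + d)) =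
          ennreal (w u * (real m * unit_ball_vol (real m) / real (m + d) * (1 / norm_of K u) ^ (m + d)))"
        by (rule ennreal_mult[symmetric]) (use p w(2) in auto)
    qed (use p in simp)
    finally show "(\<integral>\<^sup>+r. indicator K (r *\<^sub>R u) * ennreal (w (r *\<^sub>R u)) \<partial>radial_measure m) =
        ennreal (w u * (real m * unit_ball_vol (real m) / real (m + d) * (1 / norm_of K u) ^ (m + d)))" .
  qed
  finally show ?thesis .
qed

text \<open>The counterpart of \<open>body_polar\<close> for a function; comparing the two ray by
  ray gives the volume and the second moments of Ball's body.\<close>

lemma polar_ray_moment:
  assumes k: "1 \<le> k" and F[measurable]: "F \<in> borel_measurable borel" and F0: "\<And>x. 0 \<le> F x"
    and w[measurable]: "w \<in> borel_measurable borel" "\<And>x. 0 \<le> w x" and hom: "\<And>r u. 0 < r \<Longrightarrow> w (r *\<^sub>R u) = r ^ d * w u"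
  shows "(\<integral>\<^sup>+x. ennreal (w x) * ennreal (F x) \<partial>Leb k) =
    (\<integral>\<^sup>+u. ennreal (w u * (real k * unit_ball_vol (real k))) * ray_moment F (k - 1 + d) u \<partial>sigma_sphere k)"
proof -
  let ?c = "real k * unit_ball_vol (real k)"
  have "(\<integral>\<^sup>+x. ennreal (w x) * ennreal (F x) \<partial>Leb k) =
      (\<integral>\<^sup>+u. (\<integral>\<^sup>+r. ennreal (w (r *\<^sub>R u)) * ennreal (F (r *\<^sub>R u)) \<partial>radial_measure k) \<partial>sigma_sphere k)"
    by (rule nn_polar[OF iso_onto_id k]) measurable
  also have "\<dots> = (\<integral>\<^sup>+u. ennreal (w u * ?c) * ray_moment F (k - 1 + d) u \<partial>sigma_sphere k)"
  proof (rule nn_integral_cong)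
    fix u :: "nat \<Rightarrow> real"
    note [measurable] = measurable_compose[OF measurable_scaleR_const[of u] F] measurable_compose[OF measurable_scaleR_const[of u] w(1)]
    have "(\<integral>\<^sup>+r. ennreal (w (r *\<^sub>R u)) * ennreal (F (r *\<^sub>R u)) \<partial>radial_measure k) =
        (\<integral>\<^sup>+r. ennreal (?c * r ^ (k - 1)) * indicator {0<..} r * (ennreal (w (r *\<^sub>R u)) * ennreal (F (r *\<^sub>R u))) \<partial>lborel)"
      by (rule nn_radial) measurable
    also have "\<dots> = (\<integral>\<^sup>+r. ennreal (w u * ?c) * (indicator {0<..} r * ennreal (F (r *\<^sub>R u) * r ^ (k - 1 + d))) \<partial>lborel)"
    proof (rule nn_integral_cong)
      fix r :: real
      show "ennreal (?c * r ^ (k - 1)) * indicator {0<..} r * (ennreal (w (r *\<^sub>R u)) * ennreal (F (r *\<^sub>R u))) =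
          ennreal (w u * ?c) * (indicator {0<..} r * ennreal (F (r *\<^sub>R u) * r ^ (k - 1 + d)))"
        using w(2)[of u] F0[of "r *\<^sub>R u"]
        by (cases "0 < r") (auto simp: hom ennreal_mult[symmetric] power_add mult_ac)
    qed
    also have "\<dots> = ennreal (w u * ?c) * ray_moment F (k - 1 + d) u"
      unfolding ray_moment_def by (rule nn_integral_cmult) measurable
    finally show "(\<integral>\<^sup>+r. ennreal (w (r *\<^sub>R u)) * ennreal (F (r *\<^sub>R u)) \<partial>radial_measure k) =
        ennreal (w u * ?c) * ray_moment F (k - 1 + d) u" .
  qed
  finally show ?thesis .
qed

text \<open>The radial function satisfies \<open>\<rho>(u)\<^sup>k\<^sup>+\<^sup>2 = (k + 2) / F 0 *
  \<integral> F (r u) r\<^sup>k\<^sup>+\<^sup>1 dr\<close>. For the indicator of a symmetric body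
  this is the norm of that body.\<close>

definition ball_norm :: "nat \<Rightarrow> ((nat \<Rightarrow> real) \<Rightarrow> real) \<Rightarrow> (nat \<Rightarrow> real) \<Rightarrow> real" where
  "ball_norm k F x = (if x = 0 then 0
     else (real (k + 2) * enn2real (ray_moment F (k + 1) x) / F 0) powr (- 1 / real (k + 2)))"

definition ball_body :: "nat \<Rightarrow> ((nat \<Rightarrow> real) \<Rightarrow> real) \<Rightarrow> (nat \<Rightarrow> real) set" where
  "ball_body k F = {x \<in> Rn k. ball_norm k F x \<le> 1}"

text \<open>The origin is the midpoint of \<open>x\<close> and \<open>- x\<close>, at which an even
  function takes the same value.\<close>

lemma logconc_max:
  assumes F: "sym_logconc k B R F" and x: "x \<in> Rn k" shows "F x \<le> F 0"
proof -
  note D = sym_logconcD[OF F]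
  have "F x = F x powr (1 - 1/2) * F (- x) powr (1/2)"
    using D(3)[of x] by (simp only: D(6)[OF x]) (simp add: powr_half_sqrt)
  also have "\<dots> \<le> F ((1 - 1/2) *\<^sub>R x + (1/2) *\<^sub>R (- x))"
    by (rule D(7)) (auto intro!: x Rn_closed_ops)
  also have "(1 - 1/2) *\<^sub>R x + (1/2) *\<^sub>R (- x) = 0" by (auto simp: fun_eq_iff)
  finally show ?thesis .
qed

context
  fixes k :: nat and B R d e :: real and F :: "(nat \<Rightarrow> real) \<Rightarrow> real"
  assumes F: "sym_logconc k B R F" and k: "1 \<le> k"
    and low: "0 < d" "0 < e" "\<And>y. y \<in> Rn k \<Longrightarrow> nrm k y \<le> d \<Longrightarrow> e \<le> F y"
begin

private abbreviation "rm j x \<equiv> enn2real (ray_moment F j x)"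
private abbreviation "N \<equiv> ball_norm k F"

private lemma F0: "0 < F 0"
  using low(3)[of 0] low(1,2) by simp

private lemma rm:
  assumes "x \<in> Rn k" "x \<noteq> 0"
  shows "ray_moment F j x = ennreal (rm j x)" "0 < rm j x"
    "rm j x \<le> B * (real k * R / nrm k x) ^ (j + 1)" "e * (d / (2 * nrm k x)) ^ (j + 1) \<le> rm j x"
proof -
  have b: "ray_moment F j x \<le> ennreal (B * (real k * R / nrm k x) ^ (j + 1))"
    "ennreal (e * (d / (2 * nrm k x)) ^ (j + 1)) \<le> ray_moment F j x"
    using ray_moment_bounds[OF F low(1,2) _ assms] low(3) by blast+
  have p: "0 < nrm k x" by (rule nrm_pos[OF assms])
  have "ray_moment F j x < top" using b(1) ennreal_less_top by (rule le_less_trans)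
  thus eq: "ray_moment F j x = ennreal (rm j x)" by simp
  have B: "0 \<le> B" using F0 sym_logconcD(4)[OF F, of 0] by simp
  show "rm j x \<le> B * (real k * R / nrm k x) ^ (j + 1)"
    using b(1) B sym_logconcD(2)[OF F] p by (subst (asm) eq) (simp add: ennreal_le_iff)
  show le: "e * (d / (2 * nrm k x)) ^ (j + 1) \<le> rm j x"
    using b(2) by (subst (asm) eq) (simp add: ennreal_le_iff)
  have "0 < e * (d / (2 * nrm k x)) ^ (j + 1)" using low p by simp
  thus "0 < rm j x" using le by linarith
qed

private lemma rm_scale:
  assumes "x \<in> Rn k" "x \<noteq> 0" "0 < s" shows "rm j (s *\<^sub>R x) = rm j x / s ^ (j + 1)"
  using ray_moment_scale[OF sym_logconcD(1,3)[OF F] assms(3), of j x] assms(3)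
  by (simp add: enn2real_mult)

private lemma N_eq:
  assumes "x \<in> Rn k" "x \<noteq> 0"
  shows "N x = (real (k + 2) * rm (k + 1) x / F 0) powr (- 1 / real (k + 2))" "0 < N x"
  using assms rm(2)[OF assms, of "k + 1"] F0 by (auto simp: ball_norm_def)

private lemma N_scale_pos:
  assumes x: "x \<in> Rn k" "x \<noteq> 0" and s: "0 < s"
  shows "N (s *\<^sub>R x) = s * N x"
proof -
  have sx: "s *\<^sub>R x \<in> Rn k" "s *\<^sub>R x \<noteq> 0" using x s by (auto intro!: Rn_closed_ops(4))
  let ?c = "real (k + 2) * rm (k + 1) x / F 0"
  have c: "0 < ?c" using rm(2)[OF x, of "k + 1"] F0 by simp
  have "N (s *\<^sub>R x) = (?c / s ^ (k + 2)) powr (- 1 / real (k + 2))"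
    using N_eq(1)[OF sx] rm_scale[OF x s, of "k + 1"] by (simp add: mult.commute)
  also have "\<dots> = ?c powr (- 1 / real (k + 2)) / (s ^ (k + 2)) powr (- 1 / real (k + 2))"
    using c s by (simp only: powr_divide)
  also have "(s ^ (k + 2)) powr (- 1 / real (k + 2)) = 1 / s" by (rule power_powr_minus_inverse[OF s]) simp
  also have "?c powr (- 1 / real (k + 2)) / (1 / s) = s * N x" unfolding N_eq(1)[OF x] by simp
  finally show ?thesis .
qed

private lemma N_minus: "x \<in> Rn k \<Longrightarrow> N (- x) = N x"
proof -
  assume x: "x \<in> Rn k"
  have "F (r *\<^sub>R (- x)) = F (r *\<^sub>R x)" for r
    using sym_logconcD(6)[OF F Rn_closed_ops(4)[OF x, of r]] by simp
  hence "ray_moment F j (- x) = ray_moment F j x" for j by (simp only: ray_moment_def)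
  thus ?thesis by (simp add: ball_norm_def)
qed

private lemma N_scale:
  assumes x: "x \<in> Rn k" shows "N (c *\<^sub>R x) = \<bar>c\<bar> * N x"
proof (cases "x = 0 \<or> c = 0")
  case True thus ?thesis by (auto simp: ball_norm_def)
next
  case False
  show ?thesis
  proof (cases "0 < c")
    case True thus ?thesis using False N_scale_pos[OF x] by simp
  next
    case c: False
    have "N (c *\<^sub>R x) = N (- ((- c) *\<^sub>R x))" by simp
    also have "\<dots> = N ((- c) *\<^sub>R x)" by (rule N_minus[OF Rn_closed_ops(4)[OF x]])
    also have "\<dots> = (- c) * N x" using c False by (intro N_scale_pos x) auto
    finally show ?thesis using c by simp
  qed
qed

private lemma N_le_1_iff:
  assumes x: "x \<in> Rn k" "x \<noteq> 0"
  shows "N x \<le> 1 \<longleftrightarrow> F 0 / real (k + 2) \<le> rm (k + 1) x"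
proof -
  let ?c = "real (k + 2) * rm (k + 1) x / F 0"
  have c: "0 < ?c" using rm(2)[OF x, of "k + 1"] F0 by simp
  have "N x \<le> 1 \<longleftrightarrow> 1 \<le> ?c"
  proof
    assume "1 \<le> ?c"
    hence "?c powr (- 1 / real (k + 2)) \<le> 1 powr (- 1 / real (k + 2))" by (intro powr_mono2') auto
    thus "N x \<le> 1" using N_eq(1)[OF x] by simp
  next
    assume N: "N x \<le> 1"
    show "1 \<le> ?c"
    proof (rule ccontr)
      assume "\<not> 1 \<le> ?c"
      hence "1 powr (- 1 / real (k + 2)) < ?c powr (- 1 / real (k + 2))"
        using c by (intro powr_less_mono2_neg) auto
      thus False using N N_eq(1)[OF x] by simp
    qed
  qed
  also have "\<dots> \<longleftrightarrow> F 0 / real (k + 2) \<le> rm (k + 1) x" using F0 by (simp add: field_simps)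
  finally show ?thesis .
qed

private lemma N_triangle:
  assumes x: "x \<in> Rn k" and y: "y \<in> Rn k" shows "N (x + y) \<le> N x + N y"
proof (cases "x = 0 \<or> y = 0")
  case True thus ?thesis by (auto simp: ball_norm_def)
next
  case False
  let ?a = "N x" and ?b = "N y"
  have ab: "0 < ?a" "0 < ?b" using N_eq(2) x y False by auto
  define x' y' where "x' = (1 / ?a) *\<^sub>R x" and "y' = (1 / ?b) *\<^sub>R y"
  have x': "x' \<in> Rn k" "x' \<noteq> 0" and y': "y' \<in> Rn k" "y' \<noteq> 0"
    using x y False ab by (auto simp: x'_def y'_def intro!: Rn_closed_ops(4))
  have one: "rm (k + 1) ((1 / N w) *\<^sub>R w) = F 0 / real (k + 2)" if w: "w \<in> Rn k" "w \<noteq> 0" for w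
  proof -
    let ?c = "real (k + 2) * rm (k + 1) w / F 0"
    have c: "0 < ?c" using rm(2)[OF w, of "k + 1"] F0 by simp
    have "(1 / N w) ^ (k + 2) = (?c powr (1 / real (k + 2))) ^ (k + 2)"
      unfolding N_eq(1)[OF w] by (simp only: minus_divide_left[symmetric] powr_minus_divide) simp
    also have "\<dots> = ?c" by (rule powr_inverse_power[OF c]) simp
    finally have "rm (k + 1) w / (1 / N w) ^ (k + 2) = F 0 / real (k + 2)"
      using rm(2)[OF w, of "k + 1"] F0 by simp
    thus ?thesis using rm_scale[OF w, of "1 / N w" "k + 1"] N_eq(2)[OF w] by simp
  qed
  \<comment> \<open>The weight for which \<open>x + y\<close> is \<open>?a + ?b\<close> times a
    convex combination of the normalised vectors \<open>x'\<close> and \<open>y'\<close>.\<close>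
  define t where "t = ?b / (?a + ?b)"
  have t: "0 < t" "t < 1" "1 - t = ?a / (?a + ?b)" using ab by (auto simp: t_def field_simps)
  define z where "z = (1 - t) *\<^sub>R x' + t *\<^sub>R y'"
  have z: "z \<in> Rn k" unfolding z_def by (intro Rn_closed_ops x' y')
  have m: "0 < F 0 / real (k + 2)" using F0 by simp
  have Iz: "ennreal (F 0 / real (k + 2)) \<le> ray_moment F (k + 1) z"
    unfolding z_def
    by (rule ray_moment_combine[OF F x' y' t(1,2) m])
       (use rm(1)[OF x', of "k + 1"] rm(1)[OF y', of "k + 1"] one[of x] one[of y] x y False in \<open>auto simp: x'_def y'_def\<close>)
  have "N z \<le> 1"
  proof (cases "z = 0")
    case False
    have "F 0 / real (k + 2) \<le> rm (k + 1) z" using Iz rm(1)[OF z False, of "k + 1"] by (metis ennreal_le_iff enn2real_nonneg)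
    thus ?thesis using N_le_1_iff[OF z False] by simp
  qed (simp add: ball_norm_def)
  moreover have "x + y = (?a + ?b) *\<^sub>R z"
    unfolding z_def t(3) unfolding t_def x'_def y'_def using ab by (simp add: scaleR_add_right)
  ultimately show ?thesis using N_scale[OF z, of "?a + ?b"] ab mult_left_mono[of "N z" 1 "?a + ?b"] by simp
qed

private lemma N_bounds:
  "\<exists>a b. 0 < a \<and> 0 < b \<and> (\<forall>x\<in>Rn k. a * nrm k x \<le> N x \<and> N x \<le> b * nrm k x)"
proof -
  let ?p = "- 1 / real (k + 2)"
  define c1 c2 where "c1 = real (k + 2) * (e * (d / 2) ^ (k + 2)) / F 0" and "c2 = real (k + 2) * (B * (real k * R) ^ (k + 2)) / F 0"
  have B: "0 < B" using F0 sym_logconcD(4)[OF F, of 0] by simp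
  have c: "0 < c1" "0 < c2" using F0 low B k sym_logconcD(2)[OF F] by (auto simp: c1_def c2_def)
  have "c2 powr ?p * nrm k x \<le> N x \<and> N x \<le> c1 powr ?p * nrm k x" if x: "x \<in> Rn k" for x
  proof (cases "x = 0")
    case False
    have nx: "0 < nrm k x" by (rule nrm_pos[OF x False])
    let ?c = "real (k + 2) * rm (k + 1) x / F 0"
    have s: "(q / nrm k x ^ (k + 2)) powr ?p = q powr ?p * nrm k x" if "0 < q" for q
    proof -
      have "(nrm k x ^ (k + 2)) powr ?p = 1 / nrm k x" by (rule power_powr_minus_inverse[OF nx]) simp
      moreover have "(q / nrm k x ^ (k + 2)) powr ?p = q powr ?p / (nrm k x ^ (k + 2)) powr ?p"
        using that nx by (simp only: powr_divide)
      ultimately show ?thesis by simp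
    qed
    have "c1 / nrm k x ^ (k + 2) = real (k + 2) * (e * (d / (2 * nrm k x)) ^ (k + 1 + 1)) / F 0"
      by (simp add: c1_def power_divide power_mult_distrib)
    also have "\<dots> \<le> ?c" using rm(4)[OF x False, of "k + 1"] F0
      by (intro divide_right_mono mult_left_mono) auto
    finally have l: "c1 / nrm k x ^ (k + 2) \<le> ?c" .
    have "?c \<le> real (k + 2) * (B * (real k * R / nrm k x) ^ (k + 1 + 1)) / F 0"
      using rm(3)[OF x False, of "k + 1"] F0 by (intro divide_right_mono mult_left_mono) auto
    also have "\<dots> = c2 / nrm k x ^ (k + 2)" by (simp add: c2_def power_divide power_mult_distrib)
    finally have u: "?c \<le> c2 / nrm k x ^ (k + 2)" .
    have p: "0 < c1 / nrm k x ^ (k + 2)" "0 < ?c" using c nx rm(2)[OF x False, of "k + 1"] F0 by auto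
    have "?c powr ?p \<le> (c1 / nrm k x ^ (k + 2)) powr ?p" by (rule powr_mono2'[OF _ p(1) l]) simp
    moreover have "(c2 / nrm k x ^ (k + 2)) powr ?p \<le> ?c powr ?p" by (rule powr_mono2'[OF _ p(2) u]) simp
    ultimately show ?thesis using s c N_eq(1)[OF x False] by simp
  qed (simp add: ball_norm_def)
  moreover have "0 < c1 powr ?p" "0 < c2 powr ?p" using c by auto
  ultimately show ?thesis by blast
qed

lemma sym_body_ball_body: "sym_body k (ball_body k F)"
proof -
  obtain a b where ab: "0 < a" "0 < b" "\<And>x. x \<in> Rn k \<Longrightarrow> a * nrm k x \<le> N x \<and> N x \<le> b * nrm k x"
    using N_bounds by blast
  show ?thesis unfolding ball_body_def
    by (rule sym_body_of_norm[OF ab(1,2)]) (use ab(3) N_scale N_triangle in blast)+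
qed

private lemma norm_of_ball_body:
  assumes x: "x \<in> Rn k" shows "norm_of (ball_body k F) x = N x"
proof -
  note K = sym_body_ball_body
  have le: "norm_of (ball_body k F) x \<le> t \<longleftrightarrow> N x \<le> t" if t: "0 < t" for t
  proof -
    have "norm_of (ball_body k F) x \<le> t \<longleftrightarrow> N ((1 / t) *\<^sub>R x) \<le> 1"
      using norm_of_le_iff[OF K x t] Rn_closed_ops(4)[OF x] by (simp add: ball_body_def)
    thus ?thesis using t by (simp add: N_scale[OF x] field_simps)
  qed
  have N0: "0 \<le> N x" using N_eq(2)[OF x] by (cases "x = 0") (auto simp: ball_norm_def)
  show ?thesis
  proof (rule antisym)
    show "norm_of (ball_body k F) x \<le> N x"
      by (rule field_le_epsilon) (use le N0 in \<open>simp add: add_nonneg_pos\<close>)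
    show "N x \<le> norm_of (ball_body k F) x"
      by (rule field_le_epsilon) (use le norm_of_nonneg[OF K x] in \<open>simp add: add_nonneg_pos flip: le\<close>)
  qed
qed

private lemma inverse_N_power:
  assumes u: "u \<in> Rn k" "u \<noteq> 0"
  shows "(1 / N u) ^ (k + 2) = real (k + 2) * rm (k + 1) u / F 0"
proof -
  let ?c = "real (k + 2) * rm (k + 1) u / F 0"
  have c: "0 < ?c" using rm(2)[OF u, of "k + 1"] F0 by simp
  have "(1 / N u) ^ (k + 2) = (?c powr (1 / real (k + 2))) ^ (k + 2)"
    unfolding N_eq(1)[OF u] by (simp only: minus_divide_left[symmetric] powr_minus_divide) simp
  also have "\<dots> = ?c" by (rule powr_inverse_power[OF c]) simp
  finally show ?thesis .
qed

text \<open>An equality, because along each ray both sides integrate the same moment, of order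
  \<open>k + 1\<close>.\<close>

lemma ball_body_second_moment:
  "second_moment k (ball_body k F) \<theta> = (\<integral>\<^sup>+x. ennreal ((dot k x \<theta>)\<^sup>2) * ennreal (F x) \<partial>Leb k) / ennreal (F 0)"
proof -
  note D = sym_logconcD[OF F]
  note S = sphere_haar_facts[OF sphere_haar_is_haar[OF iso_onto_id k]]
  let ?v = "unit_ball_vol (real k)"
  have hom: "(dot k (r *\<^sub>R u) \<theta>)\<^sup>2 = r ^ 2 * (dot k u \<theta>)\<^sup>2" for r u by (simp add: power_mult_distrib)
  have wm: "(\<lambda>x. (dot k x \<theta>)\<^sup>2) \<in> borel_measurable borel" by measurable
  have "second_moment k (ball_body k F) \<theta> =
      (\<integral>\<^sup>+u. ennreal ((dot k u \<theta>)\<^sup>2 * (real k * ?v / real (k + 2) * (1 / norm_of (ball_body k F) u) ^ (k + 2))) \<partial>sigma_sphere k)"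
    unfolding second_moment_def
    by (rule body_polar[OF sym_body_ball_body iso_onto_id k wm _ hom]) auto
  also have "\<dots> = (\<integral>\<^sup>+u. (ennreal ((dot k u \<theta>)\<^sup>2 * (real k * ?v)) * ray_moment F (k - 1 + 2) u) / ennreal (F 0) \<partial>sigma_sphere k)"
  proof (rule nn_integral_cong)
    fix u assume "u \<in> space (sigma_sphere k)"
    hence u: "u \<in> Rn k" "u \<noteq> 0" by (auto simp: S(3) unit_sphere_iff)
    have kk: "k - 1 + 2 = k + 1" using k by simp
    have "real k * ?v / real (k + 2) * (1 / norm_of (ball_body k F) u) ^ (k + 2) = real k * ?v * rm (k + 1) u / F 0"
      unfolding norm_of_ball_body[OF u(1)] inverse_N_power[OF u] by simp
    thus "ennreal ((dot k u \<theta>)\<^sup>2 * (real k * ?v / real (k + 2) * (1 / norm_of (ball_body k F) u) ^ (k + 2))) =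
        (ennreal ((dot k u \<theta>)\<^sup>2 * (real k * ?v)) * ray_moment F (k - 1 + 2) u) / ennreal (F 0)"
      unfolding kk using F0
      by (subst rm(1)[OF u, of "k + 1"]) (simp add: ennreal_mult[symmetric] divide_ennreal mult.assoc)
  qed
  also have "\<dots> = (\<integral>\<^sup>+u. ennreal ((dot k u \<theta>)\<^sup>2 * (real k * ?v)) * ray_moment F (k - 1 + 2) u \<partial>sigma_sphere k) / ennreal (F 0)"
  proof (rule nn_integral_divide)
    note [measurable] = D(1)
    have "ray_moment F (k - 1 + 2) \<in> borel_measurable borel" unfolding ray_moment_def by measurable
    hence "(\<lambda>u. ennreal ((dot k u \<theta>)\<^sup>2 * (real k * ?v)) * ray_moment F (k - 1 + 2) u) \<in> borel_measurable borel"
      by measurable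
    thus "(\<lambda>u. ennreal ((dot k u \<theta>)\<^sup>2 * (real k * ?v)) * ray_moment F (k - 1 + 2) u) \<in> borel_measurable (sigma_sphere k)"
      by (rule measurable_sphere[OF S(2)])
  qed
  also have "(\<integral>\<^sup>+u. ennreal ((dot k u \<theta>)\<^sup>2 * (real k * ?v)) * ray_moment F (k - 1 + 2) u \<partial>sigma_sphere k) =
      (\<integral>\<^sup>+x. ennreal ((dot k x \<theta>)\<^sup>2) * ennreal (F x) \<partial>Leb k)"
    by (rule polar_ray_moment[symmetric, OF k D(1,3) wm _ hom]) auto
  finally show ?thesis .
qed

text \<open>The volume of the body involves the power \<open>k\<close> of its radial function, hence
  a power of the moment of order \<open>k + 1\<close>, whereas the mass of \<open>F\<close> is made
  of the moments of order \<open>k - 1\<close>. \<open>moment_comparison\<close> bridges the two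
  orders, and the factor in front of the right-hand side is the one for exponentials.\<close>

private lemma inverse_N_le:
  assumes u: "u \<in> Rn k" "u \<noteq> 0"
  shows "(1 / N u) ^ k \<le> fact (k + 2) powr (real k / real (k + 2)) / fact k * real k * rm (k - 1) u / F 0"
proof -
  note D = sym_logconcD[OF F]
  define h where "h r = (if 0 \<le> r then F (r *\<^sub>R u) / F 0 else 0)" for r :: real
  have Rr: "r *\<^sub>R u \<in> Rn k" for r by (rule Rn_closed_ops(4)[OF u(1)])
  have nu: "0 < nrm k u" by (rule nrm_pos[OF u])
  have hm: "h \<in> borel_measurable borel"
  proof -
    note [measurable] = measurable_compose[OF measurable_scaleR_const[of u] D(1)]
    show ?thesis unfolding h_def by measurable
  qed
  have h: "0 \<le> h r" "h r \<le> 1" for r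
    using D(3) F0 logconc_max[OF F Rr] by (auto simp: h_def)
  have hsupp: "h r = 0" if "real k * R / nrm k u < r" for r
  proof (rule ccontr)
    assume "h r \<noteq> 0"
    hence r: "F (r *\<^sub>R u) \<noteq> 0" "0 \<le> r" by (auto simp: h_def split: if_splits)
    have "nrm k (r *\<^sub>R u) \<le> real k * R" by (rule logconc_nrm_support[OF F Rr r(1)])
    thus False using that r nu by (simp add: field_simps)
  qed
  have lc: "h s powr (r / s) \<le> h r" if "0 < r" "r < s" for r s
  proof -
    have t: "0 < r / s" "r / s < 1" using that by auto
    have "F 0 powr (1 - r / s) * F (s *\<^sub>R u) powr (r / s) \<le> F ((1 - r / s) *\<^sub>R 0 + (r / s) *\<^sub>R (s *\<^sub>R u))"
      by (rule D(7)[OF Rn_closed_ops(5) Rr t])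
    also have "(1 - r / s) *\<^sub>R 0 + (r / s) *\<^sub>R (s *\<^sub>R u) = r *\<^sub>R u" using that by simp
    finally have le: "F 0 powr (1 - r / s) * F (s *\<^sub>R u) powr (r / s) \<le> F (r *\<^sub>R u)" .
    have "F 0 powr (1 - r / s) = F 0 / F 0 powr (r / s)" using F0 by (simp add: powr_diff)
    hence "F 0 * (F (s *\<^sub>R u) / F 0) powr (r / s) \<le> F (r *\<^sub>R u)"
      using le D(3) F0 by (simp add: powr_divide)
    thus ?thesis using that F0 by (simp add: h_def field_simps)
  qed
  have int: "(LINT r|lborel. indicator {0<..} r * (h r * r ^ j)) = rm j u / F 0" for j
  proof -
    note [measurable] = hm D(1) measurable_compose[OF measurable_scaleR_const[of u] D(1)]
    have "(LINT r|lborel. indicator {0<..} r * (h r * r ^ j)) =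
        enn2real (\<integral>\<^sup>+r. ennreal (indicator {0<..} r * (h r * r ^ j)) \<partial>lborel)"
      by (rule integral_eq_nn_integral) (measurable, auto simp: indicator_def h)
    also have "(\<integral>\<^sup>+r. ennreal (indicator {0<..} r * (h r * r ^ j)) \<partial>lborel) =
        (\<integral>\<^sup>+r. (indicator {0<..} r * ennreal (F (r *\<^sub>R u) * r ^ j)) / ennreal (F 0) \<partial>lborel)"
      using F0 D(3) by (intro nn_integral_cong) (auto simp: h_def indicator_def divide_ennreal)
    also have "\<dots> = ray_moment F j u / ennreal (F 0)"
      unfolding ray_moment_def by (rule nn_integral_divide) measurable
    also have "\<dots> = ennreal (rm j u) / ennreal (F 0)" by (simp only: rm(1)[OF u, symmetric])
    finally show ?thesis using F0 by (simp add: divide_ennreal)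
  qed
  let ?m = "rm (k - 1) u / F 0"
  have m: "0 < ?m" using rm(2)[OF u] F0 by simp
  \<comment> \<open>The rate of the exponential that has the same moment of order
    \<open>k - 1\<close> as the normalised ray function \<open>h\<close>.\<close>
  define a where "a = (fact (k - 1) / ?m) powr (1 / real k)"
  have "F 0 \<noteq> 0" "rm (k - 1) u \<noteq> 0" using m by auto
  hence a: "0 < a" by (simp add: a_def)
  have ak: "a ^ k = fact (k - 1) / ?m"
    unfolding a_def by (rule powr_inverse_power[OF divide_pos_pos[OF _ m]]) (use k in simp_all)
  have "(LINT r|lborel. indicator {0<..} r * (h r * r ^ (k + 1))) \<le> fact (k + 1) / a ^ (k + 2)"
  proof (rule moment_comparison[OF hm h hsupp _ lc k a])
    show "h 0 = 1" using F0 by (simp add: h_def)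
    show "(LINT r|lborel. indicator {0<..} r * (h r * r ^ (k - 1))) = fact (k - 1) / a ^ k"
      unfolding int ak using m by simp
  qed
  hence le: "real (k + 2) * (rm (k + 1) u / F 0) \<le> real (k + 2) * (fact (k + 1) / a ^ (k + 2))"
    unfolding int by (intro mult_left_mono) auto
  let ?c = "real (k + 2) * rm (k + 1) u / F 0"
  have c: "0 < ?c" using rm(2)[OF u, of "k + 1"] F0 by simp
  have "(1 / N u) ^ k = (?c powr (1 / real (k + 2))) ^ k"
    unfolding N_eq(1)[OF u] by (simp only: minus_divide_left[symmetric] powr_minus_divide) simp
  also have "\<dots> = ?c powr (real k / real (k + 2))" by (rule powr_root_power[OF c])
  also have "\<dots> \<le> (fact (k + 2) / a ^ (k + 2)) powr (real k / real (k + 2))"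
  proof (rule powr_mono2)
    have k2: "k + 2 = Suc (k + 1)" by simp
    have "fact (k + 2) = real (k + 2) * fact (k + 1)" unfolding k2 by (rule fact_Suc)
    thus "?c \<le> fact (k + 2) / a ^ (k + 2)" using le by (simp only: times_divide_eq_right)
  qed (use c in auto)
  also have "\<dots> = fact (k + 2) powr (real k / real (k + 2)) / (a ^ (k + 2)) powr (real k / real (k + 2))"
    by (simp only: powr_divide)
  also have "(a ^ (k + 2)) powr (real k / real (k + 2)) = a ^ k"
    by (rule power_powr_divide[OF a]) simp
  also have "\<dots> = fact (k - 1) / ?m" by (rule ak)
  also have "fact (k + 2) powr (real k / real (k + 2)) / (fact (k - 1) / ?m) =
      fact (k + 2) powr (real k / real (k + 2)) / fact k * real k * rm (k - 1) u / F 0"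
  proof -
    have nz: "F 0 \<noteq> 0" "rm (k - 1) u \<noteq> 0" using rm(2)[OF u, of "k - 1"] F0 by auto
    have fk: "fact k = real k * fact (k - 1)" using k fact_reduce[of k, where 'a = real] by simp
    have "p / (q / (x / y)) = p / (real k * q) * real k * x / y"
      if "x \<noteq> 0" "y \<noteq> 0" "q \<noteq> 0" for p q x y :: real using that k by simp
    from this[OF nz(2,1)] show ?thesis unfolding fk by simp
  qed
  finally show ?thesis .
qed

lemma ball_body_volume:
  "emeasure (Leb k) (ball_body k F) \<le>
    ennreal (fact (k + 2) powr (real k / real (k + 2)) / fact k / F 0) * (\<integral>\<^sup>+x. ennreal (F x) \<partial>Leb k)"
proof -
  note D = sym_logconcD[OF F]
  note S = sphere_haar_facts[OF sphere_haar_is_haar[OF iso_onto_id k]]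
  let ?v = "unit_ball_vol (real k)" and ?D = "fact (k + 2) powr (real k / real (k + 2)) / fact k :: real"
  have [measurable]: "ball_body k F \<in> sets borel" using sym_body_ball_body by measurable
  have "emeasure (Leb k) (ball_body k F) = (\<integral>\<^sup>+x. indicator (ball_body k F) x * ennreal 1 \<partial>Leb k)" by simp
  also have "\<dots> = (\<integral>\<^sup>+u. ennreal (1 * (real k * ?v / real (k + 0) * (1 / norm_of (ball_body k F) u) ^ (k + 0))) \<partial>sigma_sphere k)"
    by (rule body_polar[OF sym_body_ball_body iso_onto_id k]) auto
  also have "\<dots> \<le> (\<integral>\<^sup>+u. ennreal (?D / F 0) * (ennreal (1 * (real k * ?v)) * ray_moment F (k - 1 + 0) u) \<partial>sigma_sphere k)"
  proof (rule nn_integral_mono)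
    fix u assume "u \<in> space (sigma_sphere k)"
    hence u: "u \<in> Rn k" "u \<noteq> 0" by (auto simp: S(3) unit_sphere_iff)
    have "1 * (real k * ?v / real (k + 0) * (1 / norm_of (ball_body k F) u) ^ (k + 0)) = ?v * (1 / N u) ^ k"
      using k by (simp add: norm_of_ball_body[OF u(1)])
    also have "\<dots> \<le> ?v * (?D * real k * rm (k - 1) u / F 0)"
      by (intro mult_left_mono inverse_N_le[OF u]) simp
    also have "\<dots> = (?D / F 0) * ((1 * (real k * ?v)) * rm (k - 1) u)" by simp
    finally show "ennreal (1 * (real k * ?v / real (k + 0) * (1 / norm_of (ball_body k F) u) ^ (k + 0)))
        \<le> ennreal (?D / F 0) * (ennreal (1 * (real k * ?v)) * ray_moment F (k - 1 + 0) u)"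
      unfolding add_0_right using F0
      by (subst rm(1)[OF u, of "k - 1"], subst ennreal_mult[symmetric], simp, simp, subst ennreal_mult[symmetric])
         (auto intro!: ennreal_leI simp del: fact_Suc)
  qed
  also have "\<dots> = ennreal (?D / F 0) * (\<integral>\<^sup>+u. ennreal (1 * (real k * ?v)) * ray_moment F (k - 1 + 0) u \<partial>sigma_sphere k)"
  proof (rule nn_integral_cmult)
    note [measurable] = D(1)
    have "ray_moment F (k - 1 + 0) \<in> borel_measurable borel" unfolding ray_moment_def by measurable
    hence "(\<lambda>u. ennreal (1 * (real k * ?v)) * ray_moment F (k - 1 + 0) u) \<in> borel_measurable borel" by measurable
    thus "(\<lambda>u. ennreal (1 * (real k * ?v)) * ray_moment F (k - 1 + 0) u) \<in> borel_measurable (sigma_sphere k)"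
      by (rule measurable_sphere[OF S(2)])
  qed
  also have "(\<integral>\<^sup>+u. ennreal (1 * (real k * ?v)) * ray_moment F (k - 1 + 0) u \<partial>sigma_sphere k) =
      (\<integral>\<^sup>+x. ennreal 1 * ennreal (F x) \<partial>Leb k)"
    by (rule polar_ray_moment[symmetric, OF k D(1,3)]) auto
  finally show ?thesis by (simp only: ennreal_1 mult_1_left)
qed

end

section \<open>Isotropic constants\<close>

lemma LINT_second_moment:
  assumes [measurable]: "A \<in> sets borel"
  shows "(LINT x:A|Leb k. (dot k x \<theta>)\<^sup>2) = enn2real (second_moment k A \<theta>)"
proof -
  have "(\<lambda>x. (dot k x \<theta>)\<^sup>2) \<in> borel_measurable (Leb k)" by measurable
  hence m: "(\<lambda>x. indicator A x *\<^sub>R (dot k x \<theta>)\<^sup>2) \<in> borel_measurable (Leb k)"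
    by (intro borel_measurable_scaleR borel_measurable_indicator) simp_all
  have "(LINT x:A|Leb k. (dot k x \<theta>)\<^sup>2) = enn2real (\<integral>\<^sup>+x. ennreal (indicator A x *\<^sub>R (dot k x \<theta>)\<^sup>2) \<partial>Leb k)"
    unfolding set_lebesgue_integral_def by (rule integral_eq_nn_integral[OF m]) (intro AE_I2, simp)
  also have "(\<integral>\<^sup>+x. ennreal (indicator A x *\<^sub>R (dot k x \<theta>)\<^sup>2) \<partial>Leb k) = second_moment k A \<theta>"
    unfolding second_moment_def by (intro nn_integral_cong) (auto simp: indicator_def)
  finally show ?thesis .
qed

lemma linear_image_compact:
  fixes T :: "(nat \<Rightarrow> real) \<Rightarrow> nat \<Rightarrow> real"
  assumes K: "sym_body k K" and T: "linear T"
  shows "compact (T ` K)"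
proof -
  have "continuous_on UNIV (\<lambda>x::nat \<Rightarrow> real. T (trunc k x))"
    unfolding linear_trunc_expand[OF T]
  proof (rule continuous_on_coordinatewise_then_product)
    fix j
    show "continuous_on UNIV (\<lambda>x::nat \<Rightarrow> real. (\<Sum>i<k. x i *\<^sub>R T (axis_vec i)) j)"
      by (simp add: sum_fun_apply) (intro continuous_intros continuous_on_product_coordinates)
  qed
  hence "compact ((\<lambda>x. T (trunc k x)) ` K)"
    using sym_body_compact(1)[OF K] by (intro compact_continuous_image) (auto intro: continuous_on_subset)
  moreover have "(\<lambda>x. T (trunc k x)) ` K = T ` K"
    using sym_body_compact(2)[OF K] by (intro image_cong) (auto simp: trunc_id simp del: topspace_Euclidean_space)
  ultimately show ?thesis by simp
qed

context
  fixes k :: nat and K :: "(nat \<Rightarrow> real) set" and c V :: real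
  assumes K: "sym_body k K" and k: "1 \<le> k" and c: "0 < c" and V: "V = measure (Leb k) K"
    and moment: "\<And>v. v \<in> Rn k \<Longrightarrow> second_moment k K v = ennreal (c * (nrm k v)\<^sup>2)"
begin

private lemma V_pos: "0 < V" unfolding V by (rule measure_sym_body_pos[OF K])

private lemma emeasure_K: "emeasure (Leb k) K = ennreal V"
  using emeasure_sym_body_finite[OF K] unfolding V
  by (metis emeasure_eq_ennreal_measure infinity_ennreal_def less_irrefl)

text \<open>
  A normalising map \<open>T\<close> of an isotropic body satisfies \<open>|T\<^sup>* \<theta>| = \<tau> |\<theta>|\<close>, so it is a multiple of an
  isometry, and its volume condition determines \<open>\<tau>\<close>.
\<close>
private lemma normalising_map_unique:
  assumes T: "linear T" "bij_betw T (Rn k) (Rn k)" and vol: "measure (Leb k) (T ` K) = 1"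
    and L: "0 \<le> L" "\<And>\<theta>. \<theta> \<in> unit_sphere k \<Longrightarrow> (LINT x:T ` K|Leb k. (dot k x \<theta>)\<^sup>2) = L\<^sup>2"
  shows "L\<^sup>2 = c / V powr (1 + 2 / real k)"
proof -
  have onto: "T ` Rn k = Rn k" and inj: "inj_on T (Rn k)" using T(2) by (auto simp: bij_betw_def)
  note KR = sym_body_compact(2)[OF K]
  have TK[measurable]: "T ` K \<in> sets borel"
    using linear_image_compact[OF K T(1)] by (intro borel_closed compact_imp_closed)
  have [measurable]: "K \<in> sets borel" using K by measurable
  have eTK: "emeasure (Leb k) (T ` K) = 1"
  proof -
    have "emeasure (Leb k) (T ` K) \<noteq> top" using vol by (auto simp: measure_def)
    thus ?thesis using vol by (simp add: emeasure_eq_ennreal_measure)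
  qed
  have mem: "T x \<in> T ` K \<longleftrightarrow> x \<in> K" if "x \<in> Rn k" for x
    using that inj KR by (metis image_eqI image_iff inj_onD subset_iff)
  define w where "w = emeasure (Leb k) {x. nrm k (T (trunc k x)) \<le> 1}"
  let ?v = "unit_ball_vol (real k)"
  have cov: "(\<integral>\<^sup>+x. f (T x) \<partial>Leb k) * ennreal ?v = (\<integral>\<^sup>+x. f x \<partial>Leb k) * w"
    if "f \<in> borel_measurable borel" for f
    unfolding w_def by (rule nn_Leb_linear[OF that T(1) onto])
  \<comment> \<open>The indicator of the image of \<open>K\<close>, whose volume is 1, determines
    the unknown factor of the change of variables.\<close>
  have "(\<integral>\<^sup>+x. indicator (T ` K) (T x) \<partial>Leb k) = (\<integral>\<^sup>+x. indicator K x \<partial>Leb k)"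
    by (rule nn_Leb_cong) (simp add: mem indicator_def)
  hence w: "w = ennreal V * ennreal ?v"
    using cov[of "indicator (T ` K)"] by (simp add: eTK emeasure_K)
  have cov': "(\<integral>\<^sup>+x. f (T x) \<partial>Leb k) = (\<integral>\<^sup>+x. f x \<partial>Leb k) * ennreal V"
    if "f \<in> borel_measurable borel" for f
  proof -
    have "(\<integral>\<^sup>+x. f (T x) \<partial>Leb k) * ennreal ?v = ((\<integral>\<^sup>+x. f x \<partial>Leb k) * ennreal V) * ennreal ?v"
      using cov[OF that] by (simp add: w mult.assoc)
    thus ?thesis using unit_ball_vol_pos[of "real k", THEN less_imp_neq]
      by (auto simp: ennreal_mult_cancel_left mult.commute[of _ "ennreal ?v"])
  qed
  \<comment> \<open>The adjoint of \<open>T\<close>, given by its matrix and extended to a linear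
    map on the whole space.\<close>
  define S where "S \<theta> = (\<lambda>i. if i < k then dot k (T (axis_vec i)) \<theta> else 0)" for \<theta>
  have S_lin: "linear S" by (rule linearI) (auto simp: S_def fun_eq_iff)
  have S_Rn: "S \<theta> \<in> Rn k" for \<theta> by (auto simp: S_def Rn_iff)
  have adj: "dot k (T x) \<theta> = dot k x (S \<theta>)" if x: "x \<in> Rn k" for x \<theta>
  proof -
    have "T x = (\<Sum>i<k. x i *\<^sub>R T (axis_vec i))" using linear_trunc_expand[OF T(1), of k x] trunc_id[OF x] by simp
    thus ?thesis by (simp add: dot_sum_left) (simp add: dot_def[of k x] S_def)
  qed
  have sm: "second_moment k (T ` K) \<theta> * ennreal V = ennreal (c * (nrm k (S \<theta>))\<^sup>2)" for \<theta>
  proof -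
    have "second_moment k (T ` K) \<theta> * ennreal V = (\<integral>\<^sup>+x. indicator (T ` K) (T x) * ennreal ((dot k (T x) \<theta>)\<^sup>2) \<partial>Leb k)"
      unfolding second_moment_def by (rule cov'[symmetric]) measurable
    also have "\<dots> = second_moment k K (S \<theta>)"
      unfolding second_moment_def by (rule nn_Leb_cong) (simp add: mem adj indicator_def)
    finally show ?thesis by (simp only: moment[OF S_Rn])
  qed
  have smr: "enn2real (second_moment k (T ` K) \<theta>) * V = c * (nrm k (S \<theta>))\<^sup>2" for \<theta>
    using arg_cong[OF sm[of \<theta>], of enn2real] V_pos c by (simp add: enn2real_mult)
  have S_unit: "c * (nrm k (S \<theta>))\<^sup>2 = L\<^sup>2 * V" if "\<theta> \<in> unit_sphere k" for \<theta>
    using smr[of \<theta>] L(2)[OF that] by (simp only: LINT_second_moment[OF TK])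
  define \<tau> where "\<tau> = sqrt (L\<^sup>2 * V / c)"
  have \<tau>0: "0 \<le> \<tau>" using V_pos c by (simp add: \<tau>_def)
  have \<tau>sq: "c * \<tau>\<^sup>2 = L\<^sup>2 * V" using V_pos c by (simp add: \<tau>_def)
  have S_nrm: "nrm k (S \<theta>) = \<tau> * nrm k \<theta>" if th: "\<theta> \<in> Rn k" for \<theta>
  proof (cases "\<theta> = 0")
    case True thus ?thesis using linear_0[OF S_lin] by simp
  next
    case False
    hence p: "0 < nrm k \<theta>" by (rule nrm_pos[OF th])
    let ?u = "(1 / nrm k \<theta>) *\<^sub>R \<theta>"
    have "?u \<in> unit_sphere k" using p th by (auto simp: unit_sphere_iff intro!: Rn_closed_ops(4))
    hence "c * (nrm k (S ?u))\<^sup>2 = c * \<tau>\<^sup>2" using S_unit \<tau>sq by simp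
    hence "nrm k (S ?u) = \<tau>" using c \<tau>0 by simp
    thus ?thesis using p by (simp add: linear_scale[OF S_lin] field_simps)
  qed
  have \<tau>: "0 < \<tau>"
  proof (rule ccontr)
    assume "\<not> 0 < \<tau>"
    hence "nrm k (S (axis_vec 0)) = 0" using \<tau>0 S_nrm[OF axis_vec_in_Rn[of 0 k]] k by simp
    hence "S (axis_vec 0) = 0" using nrm_eq_0_iff[OF S_Rn] by simp
    moreover obtain x where x: "x \<in> Rn k" "T x = axis_vec 0"
      using onto axis_vec_in_Rn[of 0 k] k by (metis One_nat_def Suc_le_lessD imageE)
    ultimately have "dot k (axis_vec 0) (axis_vec 0) = 0" using adj[OF x(1), of "axis_vec 0"] by simp
    thus False using k by (simp add: dot_axis) (simp add: axis_vec_def)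
  qed
  define U where "U \<theta> = (1 / \<tau>) *\<^sub>R S \<theta>" for \<theta>
  have U: "iso_onto k k (Rn k) U"
  proof (rule iso_ontoI)
    show "linear U" unfolding U_def by (rule linear_compose_scale_right[OF S_lin])
    show "U ` Rn k \<subseteq> Rn k" using S_Rn by (auto simp: U_def intro!: Rn_closed_ops(4))
    fix \<theta> assume "\<theta> \<in> Rn k"
    hence "nrm k (U \<theta>) = nrm k \<theta>" using \<tau> by (simp add: U_def S_nrm)
    thus "dot k (U \<theta>) (U \<theta>) = dot k \<theta> \<theta>" by (simp only: nrm_sq[symmetric])
  qed
  have TU: "T (U \<xi>) = \<tau> *\<^sub>R \<xi>" if \<xi>: "\<xi> \<in> Rn k" for \<xi>
  proof
    fix i
    have UR: "U \<xi> \<in> Rn k" using iso_onto_mem[OF U \<xi>] by simp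
    show "T (U \<xi>) i = (\<tau> *\<^sub>R \<xi>) i"
    proof (cases "i < k")
      case True
      note e = axis_vec_in_Rn[OF True]
      have "T (U \<xi>) i = dot k (T (U \<xi>)) (axis_vec i)" using True by (simp add: dot_axis)
      also have "\<dots> = dot k (U \<xi>) (S (axis_vec i))" by (rule adj[OF UR])
      also have "S (axis_vec i) = \<tau> *\<^sub>R U (axis_vec i)" using \<tau> by (simp add: U_def)
      also have "dot k (U \<xi>) (\<tau> *\<^sub>R U (axis_vec i)) = \<tau> * dot k \<xi> (axis_vec i)"
        by (simp add: iso_onto_dot[OF U \<xi> e])
      finally show ?thesis using True by (simp add: dot_axis)
    next
      case False
      moreover have "T (U \<xi>) \<in> Rn k" using onto UR by blast
      ultimately show ?thesis using \<xi> by (simp add: Rn_iff)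
    qed
  qed
  \<comment> \<open>The same change of variables for the unit ball: there \<open>T\<close> composed
    with the isometry \<open>U\<close> is the dilation by \<open>\<tau>\<close>, which yields
    \<open>\<tau> ^ k * V = 1\<close>.\<close>
  define f :: "(nat \<Rightarrow> real) \<Rightarrow> ennreal" where "f = indicator {x. nrm k x \<le> 1}"
  have fm[measurable]: "f \<in> borel_measurable borel" unfolding f_def by measurable
  have If: "(\<integral>\<^sup>+x. f x \<partial>Leb k) = ennreal ?v" unfolding f_def using emeasure_Leb_nrm_le[of 1 k] by simp
  have "(\<integral>\<^sup>+x. f x \<partial>Leb k) = ennreal (\<tau> ^ k) * (\<integral>\<^sup>+x. f (\<tau> *\<^sub>R x) \<partial>Leb k)"
    using nn_Leb_scale[OF fm, of \<tau> k] \<tau> by simp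
  also have "(\<integral>\<^sup>+x. f (\<tau> *\<^sub>R x) \<partial>Leb k) = (\<integral>\<^sup>+x. f (T (trunc k (U x))) \<partial>Leb k)"
    by (rule nn_Leb_cong) (use TU iso_onto_mem[OF U] in \<open>simp add: trunc_id del: topspace_Euclidean_space\<close>)
  also have "\<dots> = (\<integral>\<^sup>+x. f (T (trunc k x)) \<partial>Leb k)"
    by (rule nn_Leb_isometry[OF measurable_compose[OF measurable_linear_trunc[OF T(1)] fm] U])
  also have "\<dots> = (\<integral>\<^sup>+x. f (T x) \<partial>Leb k)" by (rule nn_Leb_cong) (simp add: trunc_id del: topspace_Euclidean_space)
  also have "\<dots> = ennreal ?v * ennreal V" by (simp add: cov'[OF fm] If)
  finally have "ennreal ?v = ennreal (\<tau> ^ k * (?v * V))"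
    using \<tau> V_pos by (simp add: If ennreal_mult)
  hence "?v = \<tau> ^ k * (?v * V)" using \<tau> V_pos by (subst (asm) ennreal_inj) auto
  hence kV: "\<tau> ^ k * V = 1" using unit_ball_vol_pos[of "real k", THEN less_imp_neq] by auto
  have "\<tau>\<^sup>2 = 1 / V powr (2 / real k)"
  proof -
    have "V = 1 / \<tau> ^ k" using kV \<tau> by (simp add: field_simps)
    hence "V powr (2 / real k) = (1 / \<tau> ^ k) powr (2 / real k)" by simp
    also have "\<dots> = 1 / (\<tau> ^ k) powr (real 2 / real k)" by (simp add: powr_divide)
    also have "(\<tau> ^ k) powr (real 2 / real k) = \<tau>\<^sup>2" by (rule power_powr_divide[OF \<tau>]) (use k in simp)
    finally show ?thesis by simp
  qed
  moreover have "L\<^sup>2 = c * \<tau>\<^sup>2 / V" using \<tau>sq V_pos by simp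
  ultimately have "L\<^sup>2 = c * (1 / V powr (2 / real k)) / V" by simp
  also have "\<dots> = c / V powr (1 + 2 / real k)" using V_pos by (simp add: powr_add)
  finally show ?thesis .
qed

text \<open>An isotropic body only has to be dilated to volume 1. With the preceding uniqueness, the
  definite description in \<open>isotropic_constant\<close> denotes this value.\<close>

private lemma normalising_map_exists:
  defines "T \<equiv> \<lambda>x :: nat \<Rightarrow> real. (V powr (- 1 / real k)) *\<^sub>R x"
  shows "linear T" "bij_betw T (Rn k) (Rn k)" "measure (Leb k) (T ` K) = 1" "isotropic k (T ` K)"
    "\<And>\<theta>. \<theta> \<in> unit_sphere k \<Longrightarrow> (LINT x:T ` K|Leb k. (dot k x \<theta>)\<^sup>2) = c / V powr (1 + 2 / real k)"
proof -
  define s where "s = V powr (- 1 / real k)"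
  have s: "0 < s" using V_pos by (simp add: s_def)
  have T: "T x = s *\<^sub>R x" for x by (simp add: T_def s_def)
  show lin: "linear T" unfolding T_def by (rule linear_scaleR)
  show "bij_betw T (Rn k) (Rn k)"
  proof (rule bij_betw_byWitness[where f' = "\<lambda>x. (1 / s) *\<^sub>R x"])
    show "T ` Rn k \<subseteq> Rn k" "(\<lambda>x. (1 / s) *\<^sub>R x) ` Rn k \<subseteq> Rn k"
      by (auto simp: T intro!: Rn_closed_ops(4))
  qed (use s in \<open>auto simp: T\<close>)
  have TK[measurable]: "T ` K \<in> sets borel"
    using linear_image_compact[OF K lin] by (intro borel_closed compact_imp_closed)
  have [measurable]: "K \<in> sets borel" using K by measurable
  have mem: "s *\<^sub>R x \<in> T ` K \<longleftrightarrow> x \<in> K" for x using s by (auto simp: T)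
  have sk: "s ^ k = 1 / V"
  proof -
    have "s ^ k = (1 / V powr (1 / real k)) ^ k" by (simp add: s_def powr_minus_divide minus_divide_left[symmetric])
    also have "\<dots> = 1 / V" using powr_inverse_power[OF V_pos, of k] k by (simp add: power_divide)
    finally show ?thesis .
  qed
  have "emeasure (Leb k) (T ` K) = (\<integral>\<^sup>+x. indicator (T ` K) x \<partial>Leb k)" by simp
  also have "\<dots> = ennreal (\<bar>s\<bar> ^ k) * (\<integral>\<^sup>+x. indicator (T ` K) (s *\<^sub>R x) \<partial>Leb k)"
    by (rule nn_Leb_scale) (use s in auto)
  also have "(\<integral>\<^sup>+x. indicator (T ` K) (s *\<^sub>R x) \<partial>Leb k) = (\<integral>\<^sup>+x. indicator K x \<partial>Leb k)"
    by (intro nn_integral_cong) (simp only: indicator_def mem)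
  also have "\<dots> = ennreal V" by (simp add: emeasure_K)
  also have "ennreal (\<bar>s\<bar> ^ k) * ennreal V = ennreal 1"
    using s sk V_pos by (subst ennreal_mult[symmetric]) auto
  finally show "measure (Leb k) (T ` K) = 1" by (simp add: measure_def)
  have s2: "s\<^sup>2 = 1 / V powr (2 / real k)"
  proof -
    have "s\<^sup>2 = (1 / V powr (1 / real k))\<^sup>2" by (simp add: s_def powr_minus_divide minus_divide_left[symmetric])
    also have "\<dots> = 1 / V powr (real 2 / real k)" by (simp only: power_divide powr_root_power[OF V_pos]) simp
    finally show ?thesis by simp
  qed
  show LT: "(LINT x:T ` K|Leb k. (dot k x \<theta>)\<^sup>2) = c / V powr (1 + 2 / real k)" if th: "\<theta> \<in> unit_sphere k" for \<theta>
  proof -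
    have "second_moment k (T ` K) \<theta> =
        ennreal (\<bar>s\<bar> ^ k) * (\<integral>\<^sup>+x. indicator (T ` K) (s *\<^sub>R x) * ennreal ((dot k (s *\<^sub>R x) \<theta>)\<^sup>2) \<partial>Leb k)"
      unfolding second_moment_def by (rule nn_Leb_scale) (use s in auto)
    also have "(\<integral>\<^sup>+x. indicator (T ` K) (s *\<^sub>R x) * ennreal ((dot k (s *\<^sub>R x) \<theta>)\<^sup>2) \<partial>Leb k) =
        second_moment k K (s *\<^sub>R \<theta>)"
      unfolding second_moment_def by (intro nn_integral_cong) (simp only: indicator_def mem dot_simps)
    also have "\<dots> = ennreal (c * s\<^sup>2)"
      using th s moment[OF Rn_closed_ops(4), of \<theta> s] by (simp add: unit_sphere_iff del: topspace_Euclidean_space)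
    also have "ennreal (\<bar>s\<bar> ^ k) * ennreal (c * s\<^sup>2) = ennreal (c / V powr (1 + 2 / real k))"
      using s c V_pos by (subst ennreal_mult[symmetric]) (auto simp: sk s2 powr_add)
    finally show ?thesis using c V_pos by (simp add: LINT_second_moment[OF TK])
  qed
  thus "isotropic k (T ` K)" unfolding isotropic_def by blast
qed

lemma isotropic_constant_eq: "isotropic_constant k K = sqrt (c / V powr (1 + 2 / real k))"
  unfolding isotropic_constant_def
proof (rule the_equality)
  have p: "0 \<le> c / V powr (1 + 2 / real k)" using c by simp
  note T = normalising_map_exists
  show "0 \<le> sqrt (c / V powr (1 + 2 / real k)) \<and>
      (\<exists>T. linear T \<and> bij_betw T (Rn k) (Rn k) \<and> measure (Leb k) (T ` K) = 1 \<and> isotropic k (T ` K) \<and>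
         (\<forall>\<theta>\<in>unit_sphere k. (LINT x:T ` K|Leb k. (dot k x \<theta>)\<^sup>2) = (sqrt (c / V powr (1 + 2 / real k)))\<^sup>2))"
    unfolding real_sqrt_pow2[OF p] using T p by (intro conjI exI[of _ "\<lambda>x. (V powr (- 1 / real k)) *\<^sub>R x"]) auto
next
  fix L assume L: "0 \<le> L \<and>
      (\<exists>T. linear T \<and> bij_betw T (Rn k) (Rn k) \<and> measure (Leb k) (T ` K) = 1 \<and> isotropic k (T ` K) \<and>
         (\<forall>\<theta>\<in>unit_sphere k. (LINT x:T ` K|Leb k. (dot k x \<theta>)\<^sup>2) = L\<^sup>2))"
  hence "L\<^sup>2 = c / V powr (1 + 2 / real k)" using normalising_map_unique by blast
  thus "L = sqrt (c / V powr (1 + 2 / real k))" using L by (metis real_sqrt_unique)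
qed

end

section \<open>Sections of isotropic bodies\<close>

lemma dot_Rn_mono: "k \<le> n \<Longrightarrow> y \<in> Rn k \<Longrightarrow> dot n x y = dot k x y"
  unfolding dot_def by (rule sum.mono_neutral_right) (auto simp: Rn_iff)

lemma nrm_Rn_mono: "k \<le> n \<Longrightarrow> y \<in> Rn k \<Longrightarrow> nrm n y = nrm k y"
  by (simp add: nrm_def dot_Rn_mono del: topspace_Euclidean_space)

section \<open>Rotations and marginals of bodies\<close>

definition rotate_body :: "nat \<Rightarrow> ((nat \<Rightarrow> real) \<Rightarrow> nat \<Rightarrow> real) \<Rightarrow> (nat \<Rightarrow> real) set \<Rightarrow> (nat \<Rightarrow> real) set" where
  "rotate_body n U K = {x \<in> Rn n. U x \<in> K}"

lemma sym_body_rotate: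
  assumes K: "sym_body n K" and U: "iso_onto n n (Rn n) U"
  shows "sym_body n (rotate_body n U K)"
proof -
  obtain a b where ab: "0 < a" "0 < b" "\<And>x. x \<in> Rn n \<Longrightarrow> a * nrm n x \<le> norm_of K x"
    "\<And>x. x \<in> Rn n \<Longrightarrow> norm_of K x \<le> b * nrm n x" using norm_of_equiv[OF K] by blast
  have UR: "U x \<in> Rn n" if "x \<in> Rn n" for x using iso_onto_mem[OF U that] by simp
  have "sym_body n {x \<in> Rn n. norm_of K (U x) \<le> 1}"
  proof (rule sym_body_of_norm[OF ab(1,2)])
    fix x y :: "nat \<Rightarrow> real" and c :: real assume x: "x \<in> Rn n"
    show "a * nrm n x \<le> norm_of K (U x)" "norm_of K (U x) \<le> b * nrm n x"
      using ab(3,4)[OF UR[OF x]] by (simp_all only: iso_onto_nrm[OF U x])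
    show "norm_of K (U (c *\<^sub>R x)) = \<bar>c\<bar> * norm_of K (U x)"
      by (simp only: linear_scale[OF iso_onto_linear[OF U]] norm_of_scale[OF K UR[OF x]])
    show "norm_of K (U (x + y)) \<le> norm_of K (U x) + norm_of K (U y)" if "y \<in> Rn n"
      unfolding linear_add[OF iso_onto_linear[OF U]] by (intro norm_of_triangle[OF K] UR x that)
  qed
  also have "{x \<in> Rn n. norm_of K (U x) \<le> 1} = rotate_body n U K"
    unfolding rotate_body_def using norm_of_le_1_iff[OF K UR] by blast
  finally show ?thesis .
qed

lemma nn_rotate_body:
  assumes K: "sym_body n K" and U: "iso_onto n n (Rn n) U" and [measurable]: "w \<in> borel_measurable borel"
  shows "(\<integral>\<^sup>+x. indicator (rotate_body n U K) x * w (U x) \<partial>Leb n) = (\<integral>\<^sup>+x. indicator K x * w x \<partial>Leb n)"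
proof -
  have [measurable]: "K \<in> sets borel" using K by measurable
  have "(\<integral>\<^sup>+x. indicator (rotate_body n U K) x * w (U x) \<partial>Leb n) = (\<integral>\<^sup>+x. indicator K (U x) * w (U x) \<partial>Leb n)"
    by (rule nn_Leb_cong) (simp add: rotate_body_def indicator_def del: topspace_Euclidean_space)
  also have "\<dots> = (\<integral>\<^sup>+x. indicator K x * w x \<partial>Leb n)" by (rule nn_Leb_isometry[OF _ U]) measurable
  finally show ?thesis .
qed

lemma emeasure_rotate_body:
  assumes K: "sym_body n K" and U: "iso_onto n n (Rn n) U"
  shows "emeasure (Leb n) (rotate_body n U K) = emeasure (Leb n) K"
proof -
  have "K \<in> sets borel" "rotate_body n U K \<in> sets borel" using K sym_body_rotate[OF K U] by measurable
  thus ?thesis using nn_rotate_body[OF K U, of "\<lambda>_. 1"] by simp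
qed

lemma second_moment_rotate_body:
  assumes K: "sym_body n K" and U: "iso_onto n n (Rn n) U" and v: "v \<in> Rn n"
  shows "second_moment n (rotate_body n U K) v = second_moment n K (U v)"
proof -
  have "second_moment n (rotate_body n U K) v = (\<integral>\<^sup>+x. indicator (rotate_body n U K) x * ennreal ((dot n (U x) (U v))\<^sup>2) \<partial>Leb n)"
    unfolding second_moment_def
    by (rule nn_Leb_cong) (simp only: iso_onto_dot[OF U _ v])
  also have "\<dots> = second_moment n K (U v)"
    unfolding second_moment_def by (rule nn_rotate_body[OF K U]) measurable
  finally show ?thesis .
qed

text \<open>The marginal on the first \<open>k\<close> coordinates keeps the volume and the second
  moments of the body, and its value at 0 is the volume of the central section. These are the data
  that enter Ball's body.\<close>

lemma body_marginal:
  assumes K: "sym_body (k + m) K" and V: "V = measure (Leb (k + m)) K"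
    and moment: "\<And>v. v \<in> Rn (k + m) \<Longrightarrow> second_moment (k + m) K v = ennreal (c * (nrm (k + m) v)\<^sup>2)"
  obtains B R d e F where "sym_logconc k B R F" "0 < d" "0 < e"
    "\<And>y. y \<in> Rn k \<Longrightarrow> nrm k y \<le> d \<Longrightarrow> e \<le> F y" "(\<integral>\<^sup>+x. ennreal (F x) \<partial>Leb k) = ennreal V"
    "\<And>\<theta>. \<theta> \<in> Rn k \<Longrightarrow> (\<integral>\<^sup>+x. ennreal ((dot k x \<theta>)\<^sup>2) * ennreal (F x) \<partial>Leb k) = ennreal (c * (nrm k \<theta>)\<^sup>2)"
    "ennreal (F 0) = (\<integral>\<^sup>+x. indicator K (shift_by k x) \<partial>Leb m)"
    "\<And>w. w \<in> borel_measurable borel \<Longrightarrow> (\<And>y j t. k \<le> j \<Longrightarrow> w (y(j := t)) = w y) \<Longrightarrow>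
      (\<integral>\<^sup>+x. indicator K x * w x \<partial>Leb (k + m)) = (\<integral>\<^sup>+y. w y * ennreal (F y) \<partial>Leb k)"
proof -
  obtain R where R: "sym_logconc (k + m) 1 R (indicator K)" using sym_body_logconc[OF K] by blast
  define F where "F = marginals k m (indicator K)"
  obtain B where B: "sym_logconc k B R F" unfolding F_def using marginals_logconc[OF R] by blast
  have Km: "K \<in> sets borel" using K by measurable
  have w: "(\<integral>\<^sup>+x. indicator K x * w x \<partial>Leb (k + m)) = (\<integral>\<^sup>+y. w y * ennreal (F y) \<partial>Leb k)"
    if "w \<in> borel_measurable borel" "\<And>y j t. k \<le> j \<Longrightarrow> w (y(j := t)) = w y" for w
    using marginals_nn[OF R that] by (simp add: F_def ennreal_indicator mult.commute)
  have total: "(\<integral>\<^sup>+x. ennreal (F x) \<partial>Leb k) = ennreal V"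
  proof -
    have "(\<integral>\<^sup>+x. ennreal (F x) \<partial>Leb k) = emeasure (Leb (k + m)) K"
      using w[of "\<lambda>_. 1"] Km by simp
    also have "\<dots> = ennreal V"
      unfolding V by (rule emeasure_eq_ennreal_measure) (use emeasure_sym_body_finite[OF K] in simp)
    finally show ?thesis .
  qed
  have fib: "ennreal (F y) = (\<integral>\<^sup>+x. indicator K (y + shift_by k x) \<partial>Leb m)" if "y \<in> Rn k" for y
    using marginals_fibre[OF R that] by (simp add: F_def ennreal_indicator)
  have mom: "(\<integral>\<^sup>+x. ennreal ((dot k x \<theta>)\<^sup>2) * ennreal (F x) \<partial>Leb k) = ennreal (c * (nrm k \<theta>)\<^sup>2)" if th: "\<theta> \<in> Rn k" for \<theta>
  proof -
    have "(\<integral>\<^sup>+x. ennreal ((dot k x \<theta>)\<^sup>2) * ennreal (F x) \<partial>Leb k) = (\<integral>\<^sup>+x. indicator K x * ennreal ((dot k x \<theta>)\<^sup>2) \<partial>Leb (k + m))"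
    proof (rule w[symmetric])
      fix y :: "nat \<Rightarrow> real" and j t assume "k \<le> j"
      hence "dot k (y(j := t)) \<theta> = dot k y \<theta>" unfolding dot_def by (intro sum.cong) auto
      thus "ennreal ((dot k (y(j := t)) \<theta>)\<^sup>2) = ennreal ((dot k y \<theta>)\<^sup>2)" by simp
    qed measurable
    also have "\<dots> = second_moment (k + m) K \<theta>"
      unfolding second_moment_def by (simp only: dot_Rn_mono[OF le_add1 th])
    also have "\<dots> = ennreal (c * (nrm k \<theta>)\<^sup>2)"
      using moment[OF Rn_mono[OF le_add1 th]] by (simp only: nrm_Rn_mono[OF le_add1 th])
    finally show ?thesis .
  qed
  obtain d where d: "0 < d" "\<And>y. y \<in> Rn (k + m) \<Longrightarrow> nrm (k + m) y \<le> d \<Longrightarrow> y \<in> K"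
    using sym_body_bounds[OF K] by metis
  \<comment> \<open>Over a point of norm at most \<open>d / 2\<close> the fibre contains a ball of
    radius \<open>d / 2\<close>, whose volume is \<open>e\<close>.\<close>
  define e where "e = unit_ball_vol (real m) * (d / 2) ^ m"
  have e: "0 < e" using d by (simp add: e_def)
  have low: "e \<le> F y" if y: "y \<in> Rn k" "nrm k y \<le> d / 2" for y
  proof -
    have "ennreal e = (\<integral>\<^sup>+x. indicator {x. nrm m x \<le> d / 2} x \<partial>Leb m)"
      unfolding e_def using d emeasure_Leb_nrm_le[of "d / 2" m] by simp
    also have "\<dots> = (\<integral>\<^sup>+x. indicator {x \<in> Rn m. nrm m x \<le> d / 2} x \<partial>Leb m)"
      by (rule nn_Leb_cong) (simp add: indicator_def)
    also have "\<dots> \<le> (\<integral>\<^sup>+x. indicator K (y + shift_by k x) \<partial>Leb m)"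
    proof (rule nn_integral_mono)
      fix x
      show "indicator {x \<in> Rn m. nrm m x \<le> d / 2} x \<le> (indicator K (y + shift_by k x) :: ennreal)"
      proof (cases "x \<in> {x \<in> Rn m. nrm m x \<le> d / 2}")
        case True
        hence x: "x \<in> Rn m" "nrm m x \<le> d / 2" by auto
        have iso: "iso_onto m (k + m) (tail_space (k + m) m) (shift_by k)"
          using iso_onto_shift_by[of m "k + m"] by simp
        have s: "shift_by k x \<in> Rn (k + m)" "nrm (k + m) (shift_by k x) = nrm m x"
          using iso_onto_mem[OF iso x(1)] iso_onto_nrm[OF iso x(1)] by auto
        have y': "y \<in> Rn (k + m)" "nrm (k + m) y = nrm k y"
          by (rule Rn_mono[OF le_add1 y(1)], rule nrm_Rn_mono[OF le_add1 y(1)])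
        have "nrm (k + m) (y + shift_by k x) \<le> d"
          using nrm_triangle[of "k + m" y "shift_by k x"] s y' x y by linarith
        hence "y + shift_by k x \<in> K" by (rule d(2)[OF Rn_closed_ops(1)[OF y'(1) s(1)]])
        thus ?thesis by (simp add: indicator_def)
      qed simp
    qed
    also have "\<dots> = ennreal (F y)" by (rule fib[OF y(1), symmetric])
    finally show ?thesis using sym_logconcD(3)[OF B] by (simp add: ennreal_le_iff)
  qed
  show ?thesis
    by (rule that[where d = "d / 2", OF B _ e low total mom _ w]) (use d fib[OF Rn_closed_ops(5)] in simp_all)
qed

section \<open>The volume of central sections\<close>

text \<open>A single term of the series of \<open>exp (real k)\<close>.\<close>

lemma power_div_exp_le_fact: "(real k / exp 1) ^ k \<le> fact k"
proof -
  have "(\<Sum>n\<in>{k}. real k ^ n /\<^sub>R fact n) \<le> (\<Sum>n. real k ^ n /\<^sub>R fact n)"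
    by (rule sum_le_suminf[OF summable_exp_generic]) auto
  hence "real k ^ k / fact k \<le> exp (real k)" by (simp add: exp_def divide_inverse mult.commute)
  also have "exp (real k) = exp 1 ^ k" by (simp add: exp_of_nat_mult[symmetric])
  finally show ?thesis by (simp add: power_divide field_simps)
qed

text \<open>The exponent reduces the expression to \<open>(k + 1) (k + 2)\<close> divided by the
  power \<open>2 / k\<close> of \<open>fact k\<close>; since
  \<open>fact k \<ge> (k / e)\<^sup>k\<close>, this is at most
  \<open>6 e\<^sup>2 \<le> 54\<close>.\<close>

lemma ball_body_constant_le:
  assumes k: "1 \<le> k"
  shows "(fact (k + 2) powr (real k / real (k + 2)) / fact k :: real) powr (1 + 2 / real k) \<le> 54"
proof -
  let ?f = "fact k :: real"
  have e: "1 + 2 / real k = real (k + 2) / real k" using k by (simp add: field_simps)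
  have n: "(fact (k + 2) powr (real k / real (k + 2))) powr (1 + 2 / real k) = (fact (k + 2) :: real)"
    unfolding e using k by (simp add: powr_powr del: fact_Suc)
  have d: "?f powr (1 + 2 / real k) = ?f * ?f powr (2 / real k)" by (simp add: powr_add)
  have s: "(fact (k + 2) :: real) = ((real k + 1) * (real k + 2)) * ?f" by (simp add: algebra_simps)
  have "(fact (k + 2) powr (real k / real (k + 2)) / ?f :: real) powr (1 + 2 / real k) =
      ((real k + 1) * (real k + 2)) * ?f / (?f * ?f powr (2 / real k))"
    by (simp only: powr_divide n d) (simp only: s)
  also have "\<dots> = ((real k + 1) * (real k + 2)) / ?f powr (2 / real k)" by simp
  also have "\<dots> \<le> (6 * (real k)\<^sup>2) / (real k / exp 1)\<^sup>2"
  proof (rule frac_le)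
    have "(real k / exp 1)\<^sup>2 = ((real k / exp 1) ^ k) powr (real 2 / real k)"
      by (rule power_powr_divide[symmetric]) (use k in auto)
    also have "\<dots> \<le> ?f powr (real 2 / real k)"
      by (intro powr_mono2 power_div_exp_le_fact) auto
    finally show "(real k / exp 1)\<^sup>2 \<le> ?f powr (2 / real k)" by simp
    have "1 \<le> real k" using k by simp
    hence "real k + 1 \<le> 2 * real k" "real k + 2 \<le> 3 * real k" by auto
    hence "(real k + 1) * (real k + 2) \<le> (2 * real k) * (3 * real k)" by (intro mult_mono) auto
    thus "(real k + 1) * (real k + 2) \<le> 6 * (real k)\<^sup>2" by (simp add: power2_eq_square)
  qed (use k in auto)
  also have "\<dots> = 6 * (exp 1)\<^sup>2" using k by (simp add: power_divide)
  also have "\<dots> \<le> 6 * 3\<^sup>2" using exp_le by (intro mult_left_mono power_mono) auto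
  also have "6 * 3\<^sup>2 = (54::real)" by simp
  finally show ?thesis .
qed

text \<open>\<open>Q\<close> is Ball's body of the marginal: isotropic with second moment
  \<open>c / S\<close>, and of volume at most a constant times \<open>V / S\<close>. Both are
  inserted into the formula for the isotropic constant. The exact second moment and constant are
  returned too, for the case of codimension 1.\<close>

lemma section_bound:
  assumes K: "sym_body (k + m) K" and k: "1 \<le> k" and V: "V = measure (Leb (k + m)) K" and c: "0 < c"
    and moment: "\<And>v. v \<in> Rn (k + m) \<Longrightarrow> second_moment (k + m) K v = ennreal (c * (nrm (k + m) v)\<^sup>2)"
    and S: "ennreal S = (\<integral>\<^sup>+x. indicator K (shift_by k x) \<partial>Leb m)" "0 \<le> S"
  obtains Q where "sym_body k Q" "0 < S" "(S / V) powr (2 / real k) * (c / V) \<le> 54 * (isotropic_constant k Q)\<^sup>2"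
    "isotropic_constant k Q > 0" "\<And>v. v \<in> Rn k \<Longrightarrow> second_moment k Q v = ennreal (c / S * (nrm k v)\<^sup>2)"
    "isotropic_constant k Q = sqrt (c / S / measure (Leb k) Q powr (1 + 2 / real k))"
proof -
  obtain B R d e F where F: "sym_logconc k B R F" and low: "0 < d" "0 < e"
    "\<And>y. y \<in> Rn k \<Longrightarrow> nrm k y \<le> d \<Longrightarrow> e \<le> F y"
    and total: "(\<integral>\<^sup>+x. ennreal (F x) \<partial>Leb k) = ennreal V"
    and mom: "\<And>\<theta>. \<theta> \<in> Rn k \<Longrightarrow> (\<integral>\<^sup>+x. ennreal ((dot k x \<theta>)\<^sup>2) * ennreal (F x) \<partial>Leb k) = ennreal (c * (nrm k \<theta>)\<^sup>2)"
    and F0: "ennreal (F 0) = (\<integral>\<^sup>+x. indicator K (shift_by k x) \<partial>Leb m)"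
    by (rule body_marginal[OF K V moment]) (assumption | rule that)+
  have FS: "F 0 = S" using F0 S sym_logconcD(3)[OF F, of 0] by (metis ennreal_inj)
  have Spos: "0 < S" using low(3)[of 0] low(1,2) FS by simp
  have Vpos: "0 < V" unfolding V by (rule measure_sym_body_pos[OF K])
  define Q where "Q = ball_body k F"
  have Q: "sym_body k Q" unfolding Q_def by (rule sym_body_ball_body[OF F k low])
  have smQ: "second_moment k Q v = ennreal (c / S * (nrm k v)\<^sup>2)" if "v \<in> Rn k" for v
    unfolding Q_def using ball_body_second_moment[OF F k low, of v] mom[OF that] FS Spos c
    by (simp add: divide_ennreal)
  define v where "v = measure (Leb k) Q"
  have v: "0 < v" unfolding v_def by (rule measure_sym_body_pos[OF Q])
  have cS: "0 < c / S" using c Spos by simp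
  have L: "isotropic_constant k Q = sqrt (c / S / v powr (1 + 2 / real k))"
    by (rule isotropic_constant_eq[OF Q k cS v_def smQ])
  let ?D = "fact (k + 2) powr (real k / real (k + 2)) / fact k :: real"
  have "ennreal v = emeasure (Leb k) Q"
    using emeasure_sym_body_finite[OF Q] unfolding v_def by (simp add: emeasure_eq_ennreal_measure less_top)
  also have "\<dots> \<le> ennreal (?D / F 0) * ennreal V"
    unfolding Q_def using ball_body_volume[OF F k low] total by simp
  also have "\<dots> = ennreal (?D * (V / S))"
    using Spos Vpos FS by (subst ennreal_mult[symmetric]) (auto simp del: fact_Suc)
  finally have "v \<le> ?D * (V / S)" using Spos Vpos by (subst (asm) ennreal_le_iff) (auto simp del: fact_Suc)
  hence "v powr (1 + 2 / real k) \<le> (?D * (V / S)) powr (1 + 2 / real k)"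
    using v by (intro powr_mono2) auto
  also have "\<dots> = ?D powr (1 + 2 / real k) * (V / S) powr (1 + 2 / real k)" by (rule powr_mult)
  also have "\<dots> \<le> 54 * (V / S) powr (1 + 2 / real k)"
    by (intro mult_right_mono ball_body_constant_le k) simp
  finally have vle: "v powr (1 + 2 / real k) \<le> 54 * (V / S) powr (1 + 2 / real k)" .
  have vp: "0 < v powr (1 + 2 / real k)" using v by simp
  have "(V / S) powr (1 + 2 / real k) = (V / S) * (V / S) powr (2 / real k)"
    using Vpos Spos by (simp add: powr_add)
  moreover have "(V / S) powr (2 / real k) * (S / V) powr (2 / real k) = 1"
    using Vpos Spos by (simp add: powr_mult[symmetric])
  ultimately have "(S / V) powr (2 / real k) * (V / S) powr (1 + 2 / real k) = V / S"
    by (simp add: mult.left_commute mult.commute)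
  hence "(c / V) * ((S / V) powr (2 / real k) * (V / S) powr (1 + 2 / real k)) = (c / V) * (V / S)" by simp
  hence id: "(S / V) powr (2 / real k) * (c / V) * (V / S) powr (1 + 2 / real k) = c / S"
    using Vpos by (simp add: mult_ac)
  have "(S / V) powr (2 / real k) * (c / V) * v powr (1 + 2 / real k) \<le>
      (S / V) powr (2 / real k) * (c / V) * (54 * (V / S) powr (1 + 2 / real k))"
    using c Vpos by (intro mult_left_mono vle) auto
  also have "\<dots> = 54 * ((S / V) powr (2 / real k) * (c / V) * (V / S) powr (1 + 2 / real k))"
    by (simp only: mult_ac)
  also have "\<dots> = 54 * (c / S)" by (simp only: id)
  finally have "(S / V) powr (2 / real k) * (c / V) \<le> 54 * (c / S) / v powr (1 + 2 / real k)"
    using vp by (simp only: pos_le_divide_eq)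
  hence "(S / V) powr (2 / real k) * (c / V) \<le> 54 * (c / S / v powr (1 + 2 / real k))"
    by (simp only: times_divide_eq_right)
  also have "c / S / v powr (1 + 2 / real k) = (isotropic_constant k Q)\<^sup>2"
    unfolding L by (rule real_sqrt_pow2[symmetric], rule divide_nonneg_pos[OF less_imp_le[OF cS] vp])
  finally have "(S / V) powr (2 / real k) * (c / V) \<le> 54 * (isotropic_constant k Q)\<^sup>2" .
  moreover have "0 < isotropic_constant k Q" unfolding L by (simp only: real_sqrt_gt_0_iff divide_pos_pos[OF cS vp])
  ultimately show ?thesis using that[OF Q Spos _ _ smQ L[unfolded v_def]] by blast
qed

subsection \<open>Volumes of Euclidean balls\<close>

text \<open>The Gaussian measure of the ball of radius \<open>sqrt n\<close> is at most 1, and on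
  this ball the density is at least its value at the boundary.\<close>

lemma unit_ball_vol_le:
  assumes n: "1 \<le> n" shows "unit_ball_vol (real n) \<le> (2 * pi * exp 1 / real n) powr (real n / 2)"
proof -
  let ?v = "unit_ball_vol (real n)" and ?w = "(1 / sqrt (2 * pi)) ^ n * exp (- real n / 2)"
  have "ennreal (?w * (?v * sqrt (real n) ^ n)) = ennreal ?w * emeasure (Leb n) {x. nrm n x \<le> sqrt (real n)}"
    using n by (subst emeasure_Leb_nrm_le) (auto simp: ennreal_mult)
  also have "\<dots> = (\<integral>\<^sup>+x. ennreal ?w * indicator {x. nrm n x \<le> sqrt (real n)} x \<partial>Leb n)"
    by (simp add: nn_integral_cmult)
  also have "\<dots> \<le> (\<integral>\<^sup>+x. ennreal (gauss_weight n x) \<partial>Leb n)"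
  proof (rule nn_integral_mono)
    fix x
    have "?w \<le> gauss_weight n x" if "nrm n x \<le> sqrt (real n)"
    proof -
      have "(nrm n x)\<^sup>2 \<le> (sqrt (real n))\<^sup>2" using that by (intro power_mono) auto
      thus ?thesis unfolding gauss_weight_def by (intro mult_left_mono) auto
    qed
    thus "ennreal ?w * indicator {x. nrm n x \<le> sqrt (real n)} x \<le> ennreal (gauss_weight n x)"
      by (auto simp: indicator_def intro!: ennreal_leI)
  qed
  also have "\<dots> = ennreal 1" by (simp add: nn_gauss_weight)
  finally have "?w * (?v * sqrt (real n) ^ n) \<le> 1" by (subst (asm) ennreal_le_iff) auto
  hence le: "?v \<le> 1 / (?w * sqrt (real n) ^ n)" using n by (simp add: field_simps)
  have s: "sqrt x ^ n = x powr (real n / 2)" if "0 < x" for x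
    using that by (simp add: powr_half_sqrt[symmetric] powr_realpow[symmetric] powr_powr)
  have "exp (- real n / 2) = 1 / exp 1 powr (real n / 2)"
    by (simp add: powr_def exp_minus inverse_eq_divide)
  hence "?w * sqrt (real n) ^ n = real n powr (real n / 2) / ((2 * pi) powr (real n / 2) * exp 1 powr (real n / 2))"
    using n s[of "2 * pi"] s[of "real n"] by (simp add: power_divide)
  hence "1 / (?w * sqrt (real n) ^ n) = (2 * pi * exp 1 / real n) powr (real n / 2)"
    by (simp add: powr_mult powr_divide)
  thus ?thesis using le by simp
qed

text \<open>Log-convexity of the Gamma function between 1, where its logarithm vanishes, and
  \<open>n / 2 + 1\<close>.\<close>

lemma unit_ball_vol_interpolate:
  assumes "1 \<le> n" "m \<le> n"
  shows "unit_ball_vol (real n) powr (real m / real n) \<le> unit_ball_vol (real m)"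
proof -
  let ?t = "real m / real n"
  have t: "0 \<le> ?t" "?t \<le> 1" using assms by auto
  let ?G = "Gamma (real n / 2 + 1)"
  have G: "0 < ?G" by (rule Gamma_real_pos) simp
  have "(ln \<circ> Gamma) ((1 - ?t) *\<^sub>R 1 + ?t *\<^sub>R (real n / 2 + 1)) \<le> (1 - ?t) * (ln \<circ> Gamma) 1 + ?t * (ln \<circ> Gamma) (real n / 2 + 1)"
    by (rule convex_onD[OF log_convex_Gamma_real t]) auto
  also have "(1 - ?t) *\<^sub>R 1 + ?t *\<^sub>R (real n / 2 + 1) = real m / 2 + 1" using assms by (simp add: field_simps)
  finally have "ln (Gamma (real m / 2 + 1)) \<le> ?t * ln ?G" by simp
  also have "\<dots> = ln (?G powr ?t)" using G by (simp add: ln_powr less_imp_neq[THEN not_sym])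
  finally have "Gamma (real m / 2 + 1) \<le> ?G powr ?t"
    using less_imp_neq[OF G] Gamma_real_pos[of "real m / 2 + 1"] by (subst (asm) ln_le_cancel_iff) auto
  moreover have "unit_ball_vol (real n) powr ?t = pi powr (real m / 2) / ?G powr ?t"
    unfolding unit_ball_vol_def powr_divide using assms by (simp add: powr_powr)
  ultimately show ?thesis
    unfolding unit_ball_vol_def using Gamma_real_pos[of "real m / 2 + 1"] less_imp_neq[OF G]
    by (auto intro!: divide_left_mono mult_pos_pos)
qed

text \<open>Interpolation bounds the ratio by the power \<open>k / n\<close> of the volume of the
  unit ball of dimension \<open>n\<close>.\<close>

lemma unit_ball_vol_ratio:
  assumes k: "1 \<le> k" "k \<le> n"
  shows "unit_ball_vol (real n) / unit_ball_vol (real (n - k)) \<le> (2 * pi * exp 1 / real n) powr (real k / 2)"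
proof -
  let ?v = "unit_ball_vol (real n)"
  have n: "1 \<le> n" using k by simp
  have v: "0 < ?v" by simp
  have "?v / unit_ball_vol (real (n - k)) \<le> ?v / ?v powr (real (n - k) / real n)"
    using unit_ball_vol_interpolate[OF n, of "n - k"] less_imp_neq[OF v]
    by (intro divide_left_mono mult_pos_pos unit_ball_vol_pos) auto
  also have "\<dots> = ?v powr (1 - real (n - k) / real n)" using v by (simp add: powr_diff)
  also have "1 - real (n - k) / real n = real k / real n" using k n by (simp add: of_nat_diff field_simps)
  also have "?v powr (real k / real n) \<le> ((2 * pi * exp 1 / real n) powr (real n / 2)) powr (real k / real n)"
    by (intro powr_mono2 unit_ball_vol_le n) auto
  also have "\<dots> = (2 * pi * exp 1 / real n) powr (real k / 2)" using n by (simp add: powr_powr)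
  finally show ?thesis .
qed

section \<open>Busemann-Petty bodies\<close>

lemma central_section_finite:
  assumes K: "sym_body (k + m) K"
    and moment: "\<And>v. v \<in> Rn (k + m) \<Longrightarrow> second_moment (k + m) K v = ennreal (c * (nrm (k + m) v)\<^sup>2)"
  obtains S where "ennreal S = (\<integral>\<^sup>+x. indicator K (shift_by k x) \<partial>Leb m)" "0 \<le> S"
proof (rule body_marginal[OF K refl moment])
  fix B R d e :: real and F assume "sym_logconc k B R F" "ennreal (F 0) = (\<integral>\<^sup>+x. indicator K (shift_by k x) \<partial>Leb m)"
  thus ?thesis using that[of "F 0"] sym_logconcD(3) by blast
qed

lemma isotropic_constant_le_max: "sym_body k Q \<Longrightarrow> ereal (isotropic_constant k Q) \<le> max_isotropic_constant k"
  unfolding max_isotropic_constant_def sym_body_def by (rule SUP_upper) simp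

text \<open>Constants: \<open>54 * 8 = 432\<close> comes from \<open>section_bound\<close> and
  \<open>isotropic_moment_lower\<close>, and the ratio of ball volumes contributes
  \<open>2 * pi * e / n\<close>, so the dimension cancels. Finally
  \<open>864 * pi * e \<le> 864 * 12 \<le> 102\<^sup>2\<close>.\<close>

lemma central_section_le:
  assumes K: "sym_body (k + m) K" and k: "1 \<le> k" and V: "measure (Leb (k + m)) K = unit_ball_vol (real (k + m))" and c: "0 \<le> c"
    and moment: "\<And>v. v \<in> Rn (k + m) \<Longrightarrow> second_moment (k + m) K v = ennreal (c * (nrm (k + m) v)\<^sup>2)"
    and S: "ennreal S = (\<integral>\<^sup>+x. indicator K (shift_by k x) \<partial>Leb m)" "0 \<le> S"
  obtains Q where "sym_body k Q" "0 < isotropic_constant k Q" "S \<le> unit_ball_vol (real m) * (102 * isotropic_constant k Q) ^ k"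
proof -
  let ?n = "k + m"
  let ?V = "unit_ball_vol (real ?n)" and ?v = "unit_ball_vol (real m)"
  have n: "1 \<le> ?n" using k by simp
  have low: "?V \<le> 8 * real ?n * c" by (rule isotropic_moment_lower[OF K n V c moment])
  have pos: "0 < ?V" "0 < ?v" by auto
  have "?V \<le> 0" if "c = 0" using low that by simp
  with pos(1) c have c0: "0 < c" by (metis order_le_less not_less)
  obtain Q where Q: "sym_body k Q" "0 < S" "(S / ?V) powr (2 / real k) * (c / ?V) \<le> 54 * (isotropic_constant k Q)\<^sup>2"
    "0 < isotropic_constant k Q"
    by (rule section_bound[OF K k V[symmetric] c0 moment S])
  define L where "L = isotropic_constant k Q"
  have "1 / (8 * real ?n) \<le> c / ?V" using low pos n by (simp add: field_simps)
  hence "(S / ?V) powr (2 / real k) * (1 / (8 * real ?n)) \<le> (S / ?V) powr (2 / real k) * (c / ?V)"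
    by (intro mult_left_mono) auto
  also have "\<dots> \<le> 54 * L\<^sup>2" using Q(3) by (simp only: L_def)
  finally have "(S / ?V) powr (2 / real k) \<le> 432 * real ?n * L\<^sup>2" using n by (simp add: field_simps)
  hence "((S / ?V) powr (2 / real k)) powr (real k / 2) \<le> (432 * real ?n * L\<^sup>2) powr (real k / 2)"
    by (intro powr_mono2) auto
  moreover have "((S / ?V) powr (2 / real k)) powr (real k / 2) = S / ?V"
    using k Q(2) pos by (simp add: powr_powr)
  ultimately have SV: "S / ?V \<le> (432 * real ?n * L\<^sup>2) powr (real k / 2)" by simp
  have VV: "?V / ?v \<le> (2 * pi * exp 1 / real ?n) powr (real k / 2)"
    using unit_ball_vol_ratio[of k ?n] k by simp
  have "S / ?v = (S / ?V) * (?V / ?v)" using less_imp_neq[OF pos(1)] by simp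
  also have "\<dots> \<le> (432 * real ?n * L\<^sup>2) powr (real k / 2) * (2 * pi * exp 1 / real ?n) powr (real k / 2)"
    by (rule mult_mono[OF SV VV]) (use pos in \<open>auto intro: divide_nonneg_pos\<close>)
  also have "\<dots> = ((432 * real ?n * L\<^sup>2) * (2 * pi * exp 1 / real ?n)) powr (real k / 2)" by (rule powr_mult[symmetric])
  also have "(432 * real ?n * L\<^sup>2) * (2 * pi * exp 1 / real ?n) = 864 * (pi * exp 1) * L\<^sup>2"
    using n by (simp add: divide_simps del: of_nat_add)
  also have "(864 * (pi * exp 1) * L\<^sup>2) powr (real k / 2) \<le> ((102 * L)\<^sup>2) powr (real k / 2)"
  proof (rule powr_mono2)
    have "pi * exp 1 \<le> 4 * (3 :: real)" using pi_less_4 exp_le by (intro mult_mono) auto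
    hence "864 * (pi * exp 1) * L\<^sup>2 \<le> 10404 * L\<^sup>2" by (intro mult_right_mono) auto
    thus "864 * (pi * exp 1) * L\<^sup>2 \<le> (102 * L)\<^sup>2" by (simp add: power_mult_distrib)
  qed auto
  also have "((102 * L)\<^sup>2) powr (real k / 2) = (102 * L) ^ k"
    using power_powr_divide[of "102 * L" 2 k] Q(4) by (simp add: L_def)
  finally have "S \<le> ?v * (102 * L) ^ k" using pos by (simp add: field_simps)
  thus ?thesis using that[OF Q(1,4)] by (simp only: L_def)
qed

text \<open>In polar coordinates on \<open>E\<close>, the mean of \<open>\<rho>\<^sup>m\<close> over
  the sphere of \<open>E\<close> is the volume of the section by \<open>E\<close> divided by that of
  the unit ball of dimension \<open>m\<close>. A rotation puts \<open>E\<close> into coordinate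
  position.\<close>

lemma radon_radial_le:
  assumes K: "sym_body (k + m) K" and km: "1 \<le> k" "1 \<le> m" and V: "measure (Leb (k + m)) K = unit_ball_vol (real (k + m))" and c: "0 \<le> c"
    and moment: "\<And>v. v \<in> Rn (k + m) \<Longrightarrow> second_moment (k + m) K v = ennreal (c * (nrm (k + m) v)\<^sup>2)"
    and E: "E \<in> grassmannian (k + m) m" and \<L>: "max_isotropic_constant k = ereal \<L>"
  shows "radon (k + m) (\<lambda>\<theta>. radial K \<theta> ^ m) E \<le> (102 * \<L>) ^ k"
proof -
  let ?n = "k + m"
  let ?v = "unit_ball_vol (real m)"
  obtain U where U: "iso_onto ?n ?n (Rn ?n) U" "U ` tail_space ?n m = E" using grassmannian_rotate[OF E] by metis
  have \<iota>: "iso_onto m ?n E (\<lambda>x. U (shift_by k x))" using grassmannian_section[OF _ U] by simp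
  have sh: "iso_onto m ?n (tail_space ?n m) (shift_by k)" using iso_onto_shift_by[of m ?n] by simp
  note S = sphere_haar_facts[OF sphere_haar_is_haar[OF \<iota> km(2)]]
  let ?K = "rotate_body ?n U K"
  have K': "sym_body ?n ?K" by (rule sym_body_rotate[OF K U(1)])
  have V': "measure (Leb ?n) ?K = unit_ball_vol (real ?n)"
    using V by (simp add: measure_def emeasure_rotate_body[OF K U(1)])
  have mom': "second_moment ?n ?K v = ennreal (c * (nrm ?n v)\<^sup>2)" if v: "v \<in> Rn ?n" for v
    using iso_onto_mem[OF U(1) v] by (simp only: second_moment_rotate_body[OF K U(1) v] moment iso_onto_nrm[OF U(1) v])
  obtain s where s: "ennreal s = (\<integral>\<^sup>+x. indicator ?K (shift_by k x) \<partial>Leb m)" "0 \<le> s"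
    by (rule central_section_finite[OF K' mom'])
  obtain Q where Q: "sym_body k Q" "0 < isotropic_constant k Q" "s \<le> ?v * (102 * isotropic_constant k Q) ^ k"
    by (rule central_section_le[OF K' km(1) V' c mom' s])
  have "isotropic_constant k Q \<le> \<L>" using isotropic_constant_le_max[OF Q(1)] \<L> by simp
  hence "?v * (102 * isotropic_constant k Q) ^ k \<le> ?v * (102 * \<L>) ^ k"
    using Q(2) by (intro mult_left_mono power_mono) auto
  with Q(3) have "s \<le> (102 * \<L>) ^ k * ?v" by (simp only: mult.commute[of _ ?v])
  hence sL: "s / ?v \<le> (102 * \<L>) ^ k" by (simp only: pos_divide_le_eq[OF unit_ball_vol_pos[of "real m"]] of_nat_0_le_iff)
  have L0: "0 \<le> (102 * \<L>) ^ k" using \<open>isotropic_constant k Q \<le> \<L>\<close> Q(2) by auto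
  have "ennreal s = (\<integral>\<^sup>+x. indicator K (U (shift_by k x)) * ennreal 1 \<partial>Leb m)"
    unfolding s(1) using iso_onto_mem[OF sh]
    by (intro nn_Leb_cong) (auto simp: rotate_body_def indicator_def simp del: topspace_Euclidean_space)
  also have "\<dots> = (\<integral>\<^sup>+u. ennreal (1 * (real m * ?v / real (m + 0) * (1 / norm_of K u) ^ (m + 0))) \<partial>sphere_haar ?n E)"
    by (rule body_polar[OF K \<iota> km(2)]) auto
  also have "\<dots> = (\<integral>\<^sup>+u. ennreal ?v * ennreal ((1 / norm_of K (trunc ?n u)) ^ m) \<partial>sphere_haar ?n E)"
  proof (rule nn_integral_cong)
    fix u assume "u \<in> space (sphere_haar ?n E)"
    hence u: "u \<in> Rn ?n" using S(3) by (auto simp: unit_sphere_iff simp del: topspace_Euclidean_space)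
    show "ennreal (1 * (real m * ?v / real (m + 0) * (1 / norm_of K u) ^ (m + 0))) =
        ennreal ?v * ennreal ((1 / norm_of K (trunc ?n u)) ^ m)"
      unfolding trunc_id[OF u] using km(2) norm_of_nonneg[OF K u] by (simp add: ennreal_mult)
  qed
  also have "\<dots> = ennreal ?v * (\<integral>\<^sup>+u. ennreal ((1 / norm_of K (trunc ?n u)) ^ m) \<partial>sphere_haar ?n E)"
  proof (rule nn_integral_cmult, rule measurable_sphere[OF S(2)])
    note [measurable] = norm_of_measurable[OF K]
    show "(\<lambda>u. ennreal ((1 / norm_of K (trunc ?n u)) ^ m)) \<in> borel_measurable borel" by measurable
  qed
  finally have eq: "ennreal ?v * (\<integral>\<^sup>+u. ennreal ((1 / norm_of K (trunc ?n u)) ^ m) \<partial>sphere_haar ?n E) = ennreal s" ..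
  have "(\<integral>\<^sup>+u. ennreal (radial K u ^ m) \<partial>sphere_haar ?n E) =
      (\<integral>\<^sup>+u. ennreal ((1 / norm_of K (trunc ?n u)) ^ m) \<partial>sphere_haar ?n E)"
  proof (rule nn_integral_cong)
    fix u assume "u \<in> space (sphere_haar ?n E)"
    hence u: "u \<in> Rn ?n" "u \<noteq> 0" using S(3) by (auto simp: unit_sphere_iff simp del: topspace_Euclidean_space)
    show "ennreal (radial K u ^ m) = ennreal ((1 / norm_of K (trunc ?n u)) ^ m)"
      by (simp only: radial_eq[OF K u] trunc_id[OF u(1)])
  qed
  also have "\<dots> = ennreal (1 / ?v) * (ennreal ?v * (\<integral>\<^sup>+u. ennreal ((1 / norm_of K (trunc ?n u)) ^ m) \<partial>sphere_haar ?n E))"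
    using less_imp_neq[OF unit_ball_vol_pos[of "real m"]] by (simp add: mult.assoc[symmetric] ennreal_mult[symmetric])
  also have "\<dots> = ennreal (s / ?v)" unfolding eq using s(2) by (simp add: ennreal_mult[symmetric])
  finally have "(\<integral>\<^sup>+u. ennreal (radial K u ^ m) \<partial>sphere_haar ?n E) \<le> ennreal ((102 * \<L>) ^ k)"
    by (simp only: ennreal_leI[OF sL])
  note bound = this
  show ?thesis unfolding radon_def
  proof (rule LINT_le_nn[OF _ bound L0])
    fix u assume "u \<in> space (sphere_haar ?n E)"
    hence u: "u \<in> Rn ?n" "u \<noteq> 0" using S(3) by (auto simp: unit_sphere_iff simp del: topspace_Euclidean_space)
    show "0 \<le> radial K u ^ m" unfolding radial_eq[OF K u] using norm_of_nonneg[OF K u(1)] by simp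
  qed
qed

lemma radial_continuous:
  assumes K: "sym_body n K" shows "continuous_on (unit_sphere n) (radial K)"
proof -
  have u: "u \<in> Rn n" "u \<noteq> 0" if "u \<in> unit_sphere n" for u
    using that by (auto simp: unit_sphere_iff simp del: topspace_Euclidean_space)
  have "continuous_on (unit_sphere n) (\<lambda>u. 1 / norm_of K (trunc n u))"
    by (intro continuous_on_divide continuous_on_const norm_of_continuous[OF K] ballI)
      (use u norm_of_pos[OF K] in \<open>force simp: trunc_id simp del: topspace_Euclidean_space\<close>)
  thus ?thesis
    by (rule continuous_on_eq) (use u in \<open>simp add: radial_eq[OF K] trunc_id del: topspace_Euclidean_space\<close>)
qed

text \<open>Applied to the Radon transform as a function on the Grassmannian, whose integrability is
  not established; the default value 0 of the integral obeys the bound too.\<close>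

lemma LINT_le_const:
  fixes f :: "'a \<Rightarrow> real"
  assumes "finite_measure \<mu>" "\<And>x. x \<in> space \<mu> \<Longrightarrow> f x \<le> B" "0 \<le> B"
  shows "(LINT x|\<mu>. f x) \<le> B * measure \<mu> (space \<mu>)"
proof (cases "integrable \<mu> f")
  case True
  interpret finite_measure \<mu> by fact
  have "(LINT x|\<mu>. f x) \<le> (LINT x|\<mu>. B)" by (rule integral_mono[OF True]) (use assms(2) in auto)
  thus ?thesis by (simp add: mult.commute)
qed (simp add: not_integrable_integral_eq assms(3))

theorem mean_radial_BP_ge:
  assumes K: "sym_body n K" and iso: "isotropic n K" and V: "measure (Leb n) K = unit_ball_vol (real n)"
    and k: "1 \<le> k" "k < n" and BP: "in_BP k n K"
  shows "ereal (1 / 102) / max_isotropic_constant k \<le> ereal (mean_radial n k K)"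
proof -
  define m where "m = n - k"
  have m: "1 \<le> m" and nkm: "n = k + m" and n: "1 \<le> n" and nk: "n - k = m" using k by (auto simp: m_def)
  note S = sphere_haar_facts[OF sphere_haar_is_haar[OF iso_onto_id n]]
  obtain c where c: "0 \<le> c" "\<And>v. v \<in> Rn n \<Longrightarrow> second_moment n K v = ennreal (c * (nrm n v)\<^sup>2)"
    using iso isotropic_iff[OF K n] by blast
  note facts = K[unfolded nkm] V[unfolded nkm] c(1) c(2)[unfolded nkm]
  have u: "u \<in> Rn n" "u \<noteq> 0" if "u \<in> space (sigma_sphere n)" for u
    using that S(3) by (auto simp: unit_sphere_iff simp del: topspace_Euclidean_space)
  have rad: "0 \<le> radial K \<theta>" if "\<theta> \<in> space (sigma_sphere n)" for \<theta>
    unfolding radial_eq[OF K u[OF that]] using norm_of_nonneg[OF K u(1)[OF that]] by simp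
  define I where "I = (LINT \<theta>|sigma_sphere n. radial K \<theta> ^ k)"
  have I0: "0 \<le> I" unfolding I_def using rad by (intro Bochner_Integration.integral_nonneg) auto
  have mr: "mean_radial n k K = root k I" by (simp add: mean_radial_def I_def)
  have mr0: "0 \<le> mean_radial n k K" unfolding mr by (rule real_root_ge_zero[OF I0])
  obtain s where s: "ennreal s = (\<integral>\<^sup>+x. indicator K (shift_by k x) \<partial>Leb m)" "0 \<le> s"
    by (rule central_section_finite[OF facts(1,4)])
  \<comment> \<open>A body with positive isotropic constant excludes a supremum that is 0 or
    negative. If the supremum is infinite, the quotient in the claim is 0 and the claim
    holds.\<close>
  obtain Q where "sym_body k Q" "0 < isotropic_constant k Q"
    by (rule central_section_le[OF facts(1) k(1) facts(2,3,4) s])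
  hence maxpos: "0 < max_isotropic_constant k"
    using isotropic_constant_le_max[of k Q] by (metis ereal_less(2) less_le_trans)
  show ?thesis
  proof (cases "max_isotropic_constant k")
    case (real \<L>)
    have \<L>: "0 < \<L>" using maxpos real by simp
    obtain \<mu> :: "(nat \<Rightarrow> real) set measure" where \<mu>: "finite_measure \<mu>"
      "sets \<mu> = sets (sigma (grassmannian n (n - k)) {U. openin (grassmann_topology n (n - k)) U})"
      "\<And>f. continuous_on (unit_sphere n) f \<Longrightarrow> (LINT \<theta>|sigma_sphere n. f \<theta> * radial K \<theta> ^ k) = (LINT E|\<mu>. radon n f E)"
      using BP unfolding in_BP_def by blast
    have sp: "space \<mu> = grassmannian n m"
    proof -
      have "{U. openin (grassmann_topology n m) U} \<subseteq> Pow (grassmannian n m)"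
        by (auto simp: grassmann_topology_def openin_pullback_topology)
      thus ?thesis using sets_eq_imp_space_eq[OF \<mu>(2)] unfolding nk by (simp add: space_measure_of)
    qed
    have "I = (LINT \<theta>|sigma_sphere n. 1 * radial K \<theta> ^ k)" by (simp add: I_def)
    also have "\<dots> = (LINT E|\<mu>. radon n (\<lambda>_. 1) E)" by (rule \<mu>(3)) simp
    also have "\<dots> = (LINT E|\<mu>. 1)"
    proof (rule Bochner_Integration.integral_cong[OF refl])
      fix E assume "E \<in> space \<mu>"
      then obtain U where U: "m \<le> n" "iso_onto n n (Rn n) U" "U ` tail_space n m = E" using grassmannian_rotate sp by metis
      interpret prob_space "sphere_haar n E"
        by (rule sphere_haar_facts(1)[OF sphere_haar_is_haar[OF grassmannian_section[OF U] m]])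
      show "radon n (\<lambda>_. 1) E = 1" by (simp add: radon_def prob_space)
    qed
    finally have I: "I = measure \<mu> (space \<mu>)" by simp
    \<comment> \<open>In polar coordinates the volume normalisation of \<open>K\<close> says that
      \<open>\<rho>\<^sup>n\<close> has mean 1 on the sphere.\<close>
    have "(\<integral>\<^sup>+x. indicator K x * ennreal 1 \<partial>Leb n) =
        (\<integral>\<^sup>+u. ennreal (1 * (real n * unit_ball_vol (real n) / real (n + 0) * (1 / norm_of K u) ^ (n + 0))) \<partial>sigma_sphere n)"
      by (rule body_polar[OF K iso_onto_id n]) auto
    also have "\<dots> = (\<integral>\<^sup>+u. ennreal (unit_ball_vol (real n) * radial K u ^ n) \<partial>sigma_sphere n)"
      using n by (intro nn_integral_cong) (simp add: radial_eq[OF K u])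
    also have "(\<integral>\<^sup>+x. indicator K x * ennreal 1 \<partial>Leb n) = emeasure (Leb n) K"
      using sym_body_borel[OF K] by simp
    also have "\<dots> = ennreal (unit_ball_vol (real n))"
      unfolding V[symmetric] by (rule emeasure_eq_ennreal_measure) (use emeasure_sym_body_finite[OF K] in simp)
    finally have eq: "ennreal (unit_ball_vol (real n)) = (\<integral>\<^sup>+u. ennreal (unit_ball_vol (real n) * radial K u ^ n) \<partial>sigma_sphere n)" .
    have "unit_ball_vol (real n) = enn2real (ennreal (unit_ball_vol (real n)))" by simp
    also have "\<dots> = enn2real (\<integral>\<^sup>+u. ennreal (unit_ball_vol (real n) * radial K u ^ n) \<partial>sigma_sphere n)"
      by (simp only: eq)
    also have "\<dots> = (LINT u|sigma_sphere n. unit_ball_vol (real n) * radial K u ^ n)"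
    proof (rule integral_eq_nn_integral[symmetric])
      have "(\<lambda>u. unit_ball_vol (real n) * (1 / norm_of K (trunc n u)) ^ n) \<in> borel_measurable (sigma_sphere n)"
        by (rule measurable_sphere[OF S(2)]) (use norm_of_measurable[OF K] in measurable)
      moreover have "unit_ball_vol (real n) * (1 / norm_of K (trunc n u)) ^ n = unit_ball_vol (real n) * radial K u ^ n"
        if "u \<in> space (sigma_sphere n)" for u
        using u[OF that] by (simp add: radial_eq[OF K] trunc_id del: topspace_Euclidean_space)
      ultimately show "(\<lambda>u. unit_ball_vol (real n) * radial K u ^ n) \<in> borel_measurable (sigma_sphere n)"
        by (simp cong: measurable_cong)
    qed (use rad in auto)
    finally have "unit_ball_vol (real n) * 1 = unit_ball_vol (real n) * (LINT u|sigma_sphere n. radial K u ^ n)" by simp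
    hence "1 = (LINT u|sigma_sphere n. radial K u ^ n)"
      using less_imp_neq[OF unit_ball_vol_pos[of "real n"]] unfolding mult_cancel_left by simp
    also have "\<dots> = (LINT u|sigma_sphere n. radial K u ^ m * radial K u ^ k)"
      by (simp add: nkm power_add mult.commute)
    also have "\<dots> = (LINT E|\<mu>. radon n (\<lambda>\<theta>. radial K \<theta> ^ m) E)"
      by (rule \<mu>(3)) (intro continuous_on_power radial_continuous[OF K])
    also have "\<dots> \<le> (102 * \<L>) ^ k * measure \<mu> (space \<mu>)"
      using radon_radial_le[OF facts(1) k(1) m facts(2,3,4) _ real] \<L> sp
      by (intro LINT_le_const[OF \<mu>(1)]) (auto simp: nkm)
    finally have "1 \<le> (102 * \<L>) ^ k * I" by (simp only: I)
    hence "root k 1 \<le> root k ((102 * \<L>) ^ k * I)" using k by (intro real_root_le_mono) auto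
    also have "\<dots> = 102 * \<L> * root k I" using k \<L> by (simp add: real_root_mult real_root_power_cancel)
    finally have "1 / 102 / \<L> \<le> root k I" using k \<L> by (simp add: field_simps)
    thus ?thesis using \<L> by (simp add: real mr)
  qed (use maxpos mr0 in auto)
qed

section \<open>Subspaces of $L_p$\<close>

text \<open>A symmetric body on the line contains the interval between \<open>- x\<close> and
  \<open>x\<close> for each of its points, so a body of length \<open>q\<close> lies within distance
  \<open>q / 2\<close> of the origin. The integrand is bounded by its maximum.\<close>

lemma isotropic_moment_line_le:
  assumes Q: "sym_body 1 Q" and b: "0 \<le> b" and moment: "second_moment 1 Q (axis_vec 0) = ennreal b"
  shows "4 * b \<le> measure (Leb 1) Q ^ 3"
proof -
  define q where "q = measure (Leb 1) Q"
  have [measurable]: "Q \<in> sets borel" using Q by measurable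
  have q: "emeasure (Leb 1) Q = ennreal q"
    unfolding q_def by (rule emeasure_eq_ennreal_measure) (use emeasure_sym_body_finite[OF Q] in simp)
  have q0: "0 \<le> q" by (simp add: q_def)
  have two: "unit_ball_vol (real 1) = 2" by (simp add: unit_ball_vol_1)
  have x0: "(x 0)\<^sup>2 \<le> q\<^sup>2 / 4" if x: "x \<in> Q" for x
  proof (cases "x 0 = 0")
    case False
    have xR: "x \<in> Rn 1" using sym_body_compact(2)[OF Q] x by blast
    have "ennreal (2 * \<bar>x 0\<bar>) = emeasure (Leb 1) {y. nrm 1 y \<le> \<bar>x 0\<bar>}"
      using emeasure_Leb_nrm_le[of "\<bar>x 0\<bar>" 1] False two by simp
    also have "\<dots> = emeasure (Leb 1) ({y. nrm 1 y \<le> \<bar>x 0\<bar>} \<inter> Rn 1)"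
      using AE_Leb_Rn[of 1] by (intro emeasure_eq_AE) auto
    also have "\<dots> \<le> emeasure (Leb 1) Q"
    proof (rule emeasure_mono)
      show "{y. nrm 1 y \<le> \<bar>x 0\<bar>} \<inter> Rn 1 \<subseteq> Q"
      proof
        fix y assume y: "y \<in> {y. nrm 1 y \<le> \<bar>x 0\<bar>} \<inter> Rn 1"
        hence yR: "y \<in> Rn 1" by blast
        have "\<bar>y 0\<bar> \<le> \<bar>x 0\<bar>" using y coord_le_nrm[of 0 1 y] by auto
        hence le: "\<bar>y 0 / x 0\<bar> \<le> 1" using False by (simp add: divide_le_eq_1)
        have yx: "y = (y 0 / x 0) *\<^sub>R x"
        proof (rule ext)
          fix i show "y i = ((y 0 / x 0) *\<^sub>R x) i" using xR yR False by (cases "i = 0") (auto simp: Rn_iff)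
        qed
        have "norm_of Q y = \<bar>y 0 / x 0\<bar> * norm_of Q x" by (subst yx) (rule norm_of_scale[OF Q xR])
        also have "\<dots> \<le> 1 * 1" using le norm_of_le[OF Q x] norm_of_nonneg[OF Q xR] by (intro mult_mono) auto
        finally have "norm_of Q y \<le> 1" by simp
        thus "y \<in> Q" by (simp only: norm_of_le_1_iff[OF Q yR])
      qed
    qed simp
    also have "\<dots> = ennreal q" by (rule q)
    finally have "2 * \<bar>x 0\<bar> \<le> q" using q0 by (simp add: ennreal_le_iff)
    hence "(2 * \<bar>x 0\<bar>)\<^sup>2 \<le> q\<^sup>2" by (intro power_mono) auto
    thus ?thesis by (simp add: power_mult_distrib)
  qed simp
  have "ennreal b = (\<integral>\<^sup>+x. indicator Q x * ennreal ((dot 1 x (axis_vec 0))\<^sup>2) \<partial>Leb 1)"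
    using moment by (simp add: second_moment_def)
  also have "\<dots> \<le> (\<integral>\<^sup>+x. ennreal (q\<^sup>2 / 4) * indicator Q x \<partial>Leb 1)"
  proof (rule nn_integral_mono)
    fix x show "indicator Q x * ennreal ((dot 1 x (axis_vec 0))\<^sup>2) \<le> ennreal (q\<^sup>2 / 4) * indicator Q x"
      using x0[of x] dot_axis[of 0 1 x] by (auto simp: indicator_def intro!: ennreal_leI)
  qed
  also have "\<dots> = ennreal (q\<^sup>2 / 4 * q)" using q0 by (simp add: nn_integral_cmult q[unfolded One_nat_def] ennreal_mult[symmetric])
  finally have "b \<le> q\<^sup>2 / 4 * q" using q0 by (subst (asm) ennreal_le_iff) auto
  thus ?thesis by (simp add: q_def power3_eq_cube power2_eq_square)
qed

text \<open>Used with \<open>s\<^sup>p \<le> \<bar>t\<bar>\<^sup>p + max 0 (s\<^sup>p -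
  \<bar>t\<bar>\<^sup>p)\<close>: for a bounded density this integral controls the second
  summand.\<close>

lemma powr_deficit_integral:
  fixes s p :: real
  assumes s: "0 < s" and p: "0 < p"
  shows "(\<integral>\<^sup>+t. ennreal (max 0 (s powr p - \<bar>t\<bar> powr p)) \<partial>lborel) = ennreal (2 * (s * s powr p * (p / (p + 1))))"
proof -
  let ?g = "\<lambda>t::real. max 0 (s powr p - \<bar>t\<bar> powr p)"
  let ?I = "s * s powr p * (p / (p + 1))"
  have I0: "0 \<le> ?I" using s p by simp
  have "((\<lambda>t. s powr p - t powr p) has_integral (s powr p * s - s powr (p + 1) / (p + 1))) {0..s}"
    using has_integral_const_real[of "s powr p" 0 s] s p
    by (intro has_integral_diff has_integral_powr_from_0) (auto simp: mult.commute)
  also have "s powr p * s - s powr (p + 1) / (p + 1) = ?I"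
    using s p by (simp add: powr_add field_simps)
  finally have "(\<integral>\<^sup>+t. ennreal (s powr p - t powr p) * indicator {0..s} t \<partial>lborel) = ennreal ?I"
    by (intro nn_integral_has_integral_lebesgue') (use p in \<open>auto intro!: powr_mono2\<close>)
  also have "(\<integral>\<^sup>+t. ennreal (s powr p - t powr p) * indicator {0..s} t \<partial>lborel) =
      (\<integral>\<^sup>+t. ennreal (?g t) * indicator {0..} t \<partial>lborel)"
  proof (rule nn_integral_cong)
    fix t :: real
    have "s powr p \<le> t powr p" if "s < t" using that s p by (intro powr_mono2) auto
    moreover have "t powr p \<le> s powr p" if "t \<le> s" "0 \<le> t" using that p by (intro powr_mono2) auto
    ultimately show "ennreal (s powr p - t powr p) * indicator {0..s} t = ennreal (?g t) * indicator {0..} t"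
      by (auto simp: indicator_def max_def)
  qed
  finally have right: "(\<integral>\<^sup>+t. ennreal (?g t) * indicator {0..} t \<partial>lborel) = ennreal ?I" .
  have "(\<integral>\<^sup>+t. ennreal (?g t) * indicator {..<0} t \<partial>lborel) = (\<integral>\<^sup>+t. ennreal (?g (- t)) * indicator {..<0} (- t) \<partial>lborel)"
    by (subst nn_integral_real_affine[where c = "-1" and t = 0]) auto
  also have "\<dots> = (\<integral>\<^sup>+t. ennreal (?g t) * indicator {0..} t \<partial>lborel)"
    by (rule nn_integral_cong_AE) (use AE_lborel_singleton[of 0] in \<open>auto elim!: eventually_mono simp: indicator_def\<close>)
  finally have left: "(\<integral>\<^sup>+t. ennreal (?g t) * indicator {..<0} t \<partial>lborel) = ennreal ?I" by (simp only: right)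
  have "(\<integral>\<^sup>+t. ennreal (?g t) \<partial>lborel) =
      (\<integral>\<^sup>+t. ennreal (?g t) * indicator {0..} t + ennreal (?g t) * indicator {..<0} t \<partial>lborel)"
    by (intro nn_integral_cong) (auto simp: indicator_def)
  also have "\<dots> = ennreal ?I + ennreal ?I"
    using left right by (subst nn_integral_add) auto
  also have "\<dots> = ennreal (2 * ?I)" by (simp only: ennreal_plus[OF I0 I0, symmetric] mult_2)
  finally show ?thesis .
qed

text \<open>
  The marginal of \<open>K\<close> in direction \<open>v\<close> is bounded by \<open>4 V sqrt (V / c)\<close>, and a density bounded by \<open>A\<close>
  has its \<open>p\<close>-th moment minimal when it is the constant \<open>A\<close> on an interval around \<open>0\<close>.
\<close>
lemma linear_functional_moment_lower:
  assumes K: "sym_body n K" and n: "1 \<le> n" and V: "V = measure (Leb n) K" and c: "0 < c"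
    and moment: "\<And>v. v \<in> Rn n \<Longrightarrow> second_moment n K v = ennreal (c * (nrm n v)\<^sup>2)"
    and p: "0 < p" and v: "v \<in> Rn n"
  shows "ennreal (V * (sqrt (c / V) / 8 * nrm n v) powr p / (p + 1)) \<le> (\<integral>\<^sup>+x. indicator K x * ennreal (\<bar>dot n x v\<bar> powr p) \<partial>Leb n)"
proof (cases "v = 0")
  case True thus ?thesis using p by simp
next
  case False
  obtain m where m: "n = 1 + m" using n le_Suc_ex by blast
  define r where "r = nrm n v"
  have r: "0 < r" unfolding r_def by (rule nrm_pos[OF v False])
  \<comment> \<open>By rotation and homogeneity the functional becomes the first coordinate, whose
    law on the body is the marginal of dimension 1.\<close>
  have "(1 / r) *\<^sub>R v \<in> unit_sphere n"
    using v r by (simp add: unit_sphere_iff nrm_scaleR r_def[symmetric] Rn_closed_ops(4) del: topspace_Euclidean_space)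
  then obtain U where U: "iso_onto n n (Rn n) U" "U (axis_vec 0) = (1 / r) *\<^sub>R v"
    using rotate_axis n by (metis less_le_trans zero_less_one)
  have vU: "v = r *\<^sub>R U (axis_vec 0)" using r by (simp add: U(2))
  let ?K = "rotate_body n U K"
  have K': "sym_body n ?K" by (rule sym_body_rotate[OF K U(1)])
  have V': "V = measure (Leb n) ?K"
    unfolding V by (simp add: measure_def emeasure_rotate_body[OF K U(1)])
  have mom': "second_moment n ?K v = ennreal (c * (nrm n v)\<^sup>2)" if v: "v \<in> Rn n" for v
    using iso_onto_mem[OF U(1) v] by (simp only: second_moment_rotate_body[OF K U(1) v] moment iso_onto_nrm[OF U(1) v])
  note facts = K'[unfolded m] V'[unfolded m] mom'[unfolded m]
  have Vpos: "0 < V" unfolding V by (rule measure_sym_body_pos[OF K])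
  obtain B R d e F where F: "sym_logconc 1 B R F"
    and F0: "ennreal (F 0) = (\<integral>\<^sup>+x. indicator (rotate_body (1 + m) U K) (shift_by 1 x) \<partial>Leb m)"
    and fib: "\<And>w. w \<in> borel_measurable borel \<Longrightarrow> (\<And>y j t. 1 \<le> j \<Longrightarrow> w (y(j := t)) = w y) \<Longrightarrow>
      (\<integral>\<^sup>+x. indicator (rotate_body (1 + m) U K) x * w x \<partial>Leb (1 + m)) = (\<integral>\<^sup>+y. w y * ennreal (F y) \<partial>Leb 1)"
  proof (rule body_marginal[OF facts])
    fix B R d e :: real and F
    assume "sym_logconc 1 B R F" "ennreal (F 0) = (\<integral>\<^sup>+x. indicator (rotate_body (1 + m) U K) (shift_by 1 x) \<partial>Leb m)"
      and "\<And>w. w \<in> borel_measurable borel \<Longrightarrow> (\<And>y j t. 1 \<le> j \<Longrightarrow> w (y(j := t)) = w y) \<Longrightarrow>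
        (\<integral>\<^sup>+x. indicator (rotate_body (1 + m) U K) x * w x \<partial>Leb (1 + m)) = (\<integral>\<^sup>+y. w y * ennreal (F y) \<partial>Leb 1)"
    thus thesis by (rule that)
  qed
  define A where "A = F 0"
  have A0: "0 \<le> A" unfolding A_def by (rule sym_logconcD(3)[OF F])
  obtain Q where Q: "sym_body 1 Q" "0 < A" "(A / V) powr (2 / real 1) * (c / V) \<le> 54 * (isotropic_constant 1 Q)\<^sup>2"
    "\<And>v. v \<in> Rn 1 \<Longrightarrow> second_moment 1 Q v = ennreal (c / A * (nrm 1 v)\<^sup>2)"
    "isotropic_constant 1 Q = sqrt (c / A / measure (Leb 1) Q powr (1 + 2 / real 1))"
  proof (rule section_bound[OF facts(1) order_refl facts(2) c facts(3) F0[folded A_def] A0])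
    fix Q assume "sym_body 1 Q" "0 < A" "(A / V) powr (2 / real 1) * (c / V) \<le> 54 * (isotropic_constant 1 Q)\<^sup>2"
      and "\<And>v. v \<in> Rn 1 \<Longrightarrow> second_moment 1 Q v = ennreal (c / A * (nrm 1 v)\<^sup>2)"
      "isotropic_constant 1 Q = sqrt (c / A / measure (Leb 1) Q powr (1 + 2 / real 1))"
    thus thesis by (rule that)
  qed
  have cA: "0 < c / A" using c Q(2) by simp
  have q: "0 < measure (Leb 1) Q" by (rule measure_sym_body_pos[OF Q(1)])
  have "4 * (c / A) \<le> measure (Leb 1) Q ^ 3"
    using Q(4)[OF axis_vec_in_Rn[of 0 1]] cA by (intro isotropic_moment_line_le[OF Q(1)]) (auto simp: nrm_axis)
  hence "c / A \<le> 1 / 4 * measure (Leb 1) Q ^ 3" by linarith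
  hence "c / A / measure (Leb 1) Q ^ 3 \<le> 1 / 4" by (simp only: pos_divide_le_eq[OF zero_less_power[OF q]])
  moreover have "measure (Leb 1) Q powr (1 + 2 / real 1) = measure (Leb 1) Q ^ 3"
    using powr_realpow[OF q, of 3] by simp
  moreover have "0 \<le> c / A / measure (Leb 1) Q ^ 3" 
    by (rule divide_nonneg_nonneg[OF less_imp_le[OF cA] zero_le_power[OF less_imp_le[OF q]]])
  ultimately have "(isotropic_constant 1 Q)\<^sup>2 \<le> 1 / 4" by (simp only: Q(5) real_sqrt_pow2)
  with Q(3) have "(A / V) powr (2 / real 1) * (c / V) \<le> 54 * (1 / 4)" by linarith
  moreover have "(A / V) powr (2 / real 1) = (A / V)\<^sup>2" using Q(2) Vpos by simp
  ultimately have "(A / V)\<^sup>2 * (c / V) \<le> 54 * (1 / 4)" by (simp only:)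
  \<comment> \<open>The isotropic constant in dimension 1 is at most 1/2, and 54/4 is rounded up to
    a square; this is the origin of the bound 4.\<close>
  also have "54 * (1 / 4) \<le> (4\<^sup>2 :: real)" by simp
  finally have "(A / V)\<^sup>2 * (c / V) \<le> 4\<^sup>2" .
  hence "sqrt ((A / V)\<^sup>2 * (c / V)) \<le> sqrt (4\<^sup>2)" by (rule real_sqrt_le_mono)
  hence AV: "A / V * sqrt (c / V) \<le> 4"
    using Q(2) Vpos by (simp only: real_sqrt_mult real_sqrt_abs abs_of_pos divide_pos_pos abs_numeral)
  \<comment> \<open>Chosen so that \<open>2 * A * s \<le> V\<close>: the constant density
    \<open>A\<close> on the interval from \<open>- s\<close> to \<open>s\<close> has at most the
    mass of \<open>K\<close>.\<close>
  define s where "s = sqrt (c / V) / 8"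
  have s: "0 < s" using c Vpos by (simp add: s_def)
  have As: "2 * A * s \<le> V" using AV Vpos by (simp add: s_def field_simps)
  let ?h = "\<lambda>x :: nat \<Rightarrow> real. \<bar>x 0\<bar> powr p" and ?g = "\<lambda>x :: nat \<Rightarrow> real. max 0 (s powr p - \<bar>x 0\<bar> powr p)"
  have [measurable]: "?K \<in> sets borel" using K' by measurable
  have eK: "emeasure (Leb n) ?K = ennreal V"
    unfolding V' by (rule emeasure_eq_ennreal_measure) (use emeasure_sym_body_finite[OF K'] in simp)
  have "(\<integral>\<^sup>+x. indicator ?K x * ennreal (?g x) \<partial>Leb n) = (\<integral>\<^sup>+y. ennreal (?g y) * ennreal (F y) \<partial>Leb 1)"
    unfolding m
  proof (rule fib[of "\<lambda>x. ennreal (?g x)"])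
    show "(\<lambda>x. ennreal (?g x)) \<in> borel_measurable borel" by measurable
  qed simp
  also have "\<dots> \<le> (\<integral>\<^sup>+y. ennreal (?g y) * ennreal A \<partial>Leb 1)"
  proof (rule nn_integral_mono_AE)
    have "ennreal (?g y) * ennreal (F y) \<le> ennreal (?g y) * ennreal A" if "y \<in> Rn 1" for y
      unfolding A_def by (intro mult_left_mono ennreal_leI logconc_max[OF F that]) simp
    thus "AE y in Leb 1. ennreal (?g y) * ennreal (F y) \<le> ennreal (?g y) * ennreal A"
      using AE_Leb_Rn[of 1] by (auto elim!: eventually_mono)
  qed
  also have "\<dots> = (\<integral>\<^sup>+y. ennreal (?g y) \<partial>Leb 1) * ennreal A" by (rule nn_integral_multc) measurable
  also have "(\<integral>\<^sup>+y. ennreal (?g y) \<partial>Leb 1) = (\<integral>\<^sup>+t. ennreal (max 0 (s powr p - \<bar>t\<bar> powr p)) \<partial>lborel)"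
  proof -
    have "(\<integral>\<^sup>+y. ennreal (?g y) \<partial>Leb (Suc 0)) =
        (\<integral>\<^sup>+y. (\<integral>\<^sup>+t. ennreal (max 0 (s powr p - \<bar>(y(0 := t)) 0\<bar> powr p)) \<partial>lborel) \<partial>Leb 0)"
      by (rule nn_Leb_Suc) measurable
    also have "\<dots> = (\<integral>\<^sup>+t. ennreal (max 0 (s powr p - \<bar>t\<bar> powr p)) \<partial>lborel)"
      by (subst nn_Leb_0) simp_all
    finally show ?thesis by (simp only: One_nat_def)
  qed
  also have "\<dots> * ennreal A = ennreal (2 * (s * s powr p * (p / (p + 1))) * A)"
    unfolding powr_deficit_integral[OF s p] by (rule ennreal_mult[symmetric]) (use A0 s p in auto)
  also have "\<dots> \<le> ennreal (V * s powr p * (p / (p + 1)))"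
  proof (rule ennreal_leI)
    have "(2 * A * s) * (s powr p * (p / (p + 1))) \<le> V * (s powr p * (p / (p + 1)))"
      using p by (intro mult_right_mono As) auto
    thus "2 * (s * s powr p * (p / (p + 1))) * A \<le> V * s powr p * (p / (p + 1))" by (simp only: mult_ac)
  qed
  finally have def: "(\<integral>\<^sup>+x. indicator ?K x * ennreal (?g x) \<partial>Leb n) \<le> ennreal (V * s powr p * (p / (p + 1)))" .
  have "ennreal (V * s powr p) = (\<integral>\<^sup>+x. indicator ?K x * ennreal (s powr p) \<partial>Leb n)"
    using Vpos by (simp add: nn_integral_multc eK ennreal_mult)
  also have "\<dots> \<le> (\<integral>\<^sup>+x. indicator ?K x * ennreal (?h x) + indicator ?K x * ennreal (?g x) \<partial>Leb n)"
  proof (rule nn_integral_mono)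
    fix x :: "nat \<Rightarrow> real"
    have "ennreal (s powr p) \<le> ennreal (?h x + ?g x)" by (intro ennreal_leI) simp
    thus "indicator ?K x * ennreal (s powr p) \<le> indicator ?K x * ennreal (?h x) + indicator ?K x * ennreal (?g x)"
      by (simp add: indicator_def)
  qed
  also have "\<dots> = (\<integral>\<^sup>+x. indicator ?K x * ennreal (?h x) \<partial>Leb n) + (\<integral>\<^sup>+x. indicator ?K x * ennreal (?g x) \<partial>Leb n)"
    by (rule nn_integral_add) measurable
  also have "\<dots> \<le> (\<integral>\<^sup>+x. indicator ?K x * ennreal (?h x) \<partial>Leb n) + ennreal (V * s powr p * (p / (p + 1)))"
    by (rule add_left_mono[OF def])
  finally have "ennreal (V * s powr p) - ennreal (V * s powr p * (p / (p + 1))) \<le> (\<integral>\<^sup>+x. indicator ?K x * ennreal (?h x) \<partial>Leb n)"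
    by (simp add: ennreal_minus_le_iff add.commute)
  also have "ennreal (V * s powr p) - ennreal (V * s powr p * (p / (p + 1))) = ennreal (V * s powr p / (p + 1))"
  proof -
    have "V * s powr p - V * s powr p * (p / (p + 1)) = V * s powr p / (p + 1)" using p by (simp add: field_simps)
    thus ?thesis using Vpos p by (subst ennreal_minus) auto
  qed
  finally have low: "ennreal (V * s powr p / (p + 1)) \<le> (\<integral>\<^sup>+x. indicator ?K x * ennreal (?h x) \<partial>Leb n)" .
  have "ennreal (V * (s * r) powr p / (p + 1)) = ennreal (r powr p) * ennreal (V * s powr p / (p + 1))"
    using Vpos p s r by (simp add: powr_mult ennreal_mult[symmetric] mult_ac)
  also have "\<dots> \<le> ennreal (r powr p) * (\<integral>\<^sup>+x. indicator ?K x * ennreal (?h x) \<partial>Leb n)"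
    by (rule mult_left_mono[OF low]) simp
  also have "\<dots> = (\<integral>\<^sup>+x. ennreal (r powr p) * (indicator ?K x * ennreal (?h x)) \<partial>Leb n)"
    by (rule nn_integral_cmult[symmetric]) measurable
  also have "\<dots> = (\<integral>\<^sup>+x. indicator ?K x * ennreal (\<bar>dot n (U x) v\<bar> powr p) \<partial>Leb n)"
  proof (rule nn_Leb_cong)
    fix x assume x: "x \<in> Rn n"
    have n0: "0 < n" using n by simp
    have "dot n (U x) v = r * dot n (U x) (U (axis_vec 0))" by (subst vU) simp
    also have "\<dots> = r * x 0" by (simp only: iso_onto_dot[OF U(1) x axis_vec_in_Rn[OF n0]] dot_axis[OF n0])
    finally have "\<bar>dot n (U x) v\<bar> powr p = r powr p * ?h x" using r by (simp add: abs_mult powr_mult)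
    thus "ennreal (r powr p) * (indicator ?K x * ennreal (?h x)) = indicator ?K x * ennreal (\<bar>dot n (U x) v\<bar> powr p)"
      by (simp add: indicator_def ennreal_mult)
  qed
  also have "\<dots> = (\<integral>\<^sup>+x. indicator K x * ennreal (\<bar>dot n x v\<bar> powr p) \<partial>Leb n)"
    by (rule nn_rotate_body[OF K U(1)]) measurable
  finally show ?thesis by (simp only: s_def r_def)
qed

section \<open>Moments of linear functionals on the sphere\<close>

text \<open>The quotient of the factorials of \<open>2 * j\<close> and \<open>j\<close> is a product
  of \<open>j\<close> factors, each at most \<open>2 * j\<close>.\<close>

lemma fact_double_div_le: "fact (2 * j) / (2 ^ j * fact j) \<le> (real j ^ j :: real)"
proof -
  have "fact (2 * j) div fact j \<le> (2 * j) ^ j" using fact_div_fact_le_pow[of j "2 * j"] by simp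
  hence "(2 * j) ^ j * fact j \<ge> fact (2 * j) div fact j * fact j" by (rule mult_le_mono1)
  also have "fact (2 * j) div fact j * fact j = (fact (2 * j) :: nat)"
    by (rule dvd_div_mult_self) (simp add: fact_dvd)
  finally have "real (fact (2 * j)) \<le> real ((2 * j) ^ j * fact j)" by (rule of_nat_mono)
  hence "fact (2 * j) \<le> real j ^ j * (2 ^ j * fact j :: real)" by (simp add: power_mult_distrib mult_ac)
  thus ?thesis by (simp add: pos_divide_le_eq)
qed

text \<open>Jensen's inequality for the power \<open>j\<close> of the squared norm, which has mean
  \<open>n\<close>. The tangent at \<open>n\<close> lies below the power by Bernoulli's
  inequality.\<close>

lemma gauss_nrm_moment_ge:
  assumes n: "1 \<le> n" and j: "1 \<le> j"
  shows "ennreal (real n ^ j) \<le> (\<integral>\<^sup>+x. ennreal (nrm n x powr real (2 * j)) * ennreal (gauss_weight n x) \<partial>Leb n)"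
proof -
  let ?w = "\<lambda>x. ennreal (gauss_weight n x)" and ?q = "real n ^ (j - 1)"
  have q: "real n ^ j = real n * ?q" using j by (cases j) auto
  have tangent: "real j * ?q * y \<le> y ^ j + (real j - 1) * (real n * ?q)" if y: "0 \<le> y" for y :: real
  proof -
    have "1 + real j * (y / real n - 1) \<le> (1 + (y / real n - 1)) ^ j"
      by (rule Bernoulli_inequality) (use y n in simp)
    hence "real n ^ j * (1 + real j * (y / real n - 1)) \<le> real n ^ j * (y / real n) ^ j" by (intro mult_left_mono) auto
    also have "\<dots> = y ^ j" using n by (simp add: power_divide)
    finally have "real n * ?q * (1 + real j * (y / real n - 1)) \<le> y ^ j" by (simp only: q)
    moreover have "real n * ?q * (1 + real j * (y / real n - 1)) = real j * ?q * y - (real j - 1) * (real n * ?q)"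
      using n by (simp add: field_simps)
    ultimately show ?thesis by linarith
  qed
  have "ennreal (real j * (real n * ?q)) = ennreal (real j * ?q) * (\<integral>\<^sup>+x. ennreal ((nrm n x)\<^sup>2) * ?w x \<partial>Leb n)"
    unfolding gauss_nrm_sq[OF n] by (simp add: ennreal_mult[symmetric] mult_ac)
  also have "\<dots> = (\<integral>\<^sup>+x. ennreal (real j * ?q) * (ennreal ((nrm n x)\<^sup>2) * ?w x) \<partial>Leb n)"
    by (rule nn_integral_cmult[symmetric]) measurable
  also have "\<dots> \<le> (\<integral>\<^sup>+x. ennreal (nrm n x powr real (2 * j)) * ?w x + ennreal ((real j - 1) * (real n * ?q)) * ?w x \<partial>Leb n)"
  proof (rule nn_integral_mono)
    fix x
    have j1: "0 \<le> (real j - 1) * (real n * ?q)" using j by simp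
    have "nrm n x powr real (2 * j) = ((nrm n x)\<^sup>2) ^ j"
    proof (cases "nrm n x = 0")
      case False
      hence "0 < nrm n x" using nrm_nonneg[of n x] by linarith
      thus ?thesis by (simp add: powr_realpow power_mult del: of_nat_mult)
    qed (use j in simp)
    hence "ennreal (real j * ?q * (nrm n x)\<^sup>2) \<le> ennreal (nrm n x powr real (2 * j) + (real j - 1) * (real n * ?q))"
      using tangent[of "(nrm n x)\<^sup>2"] by (intro ennreal_leI) simp
    also have "\<dots> = ennreal (nrm n x powr real (2 * j)) + ennreal ((real j - 1) * (real n * ?q))"
      by (rule ennreal_plus[OF _ j1]) simp
    finally have "ennreal (real j * ?q) * ennreal ((nrm n x)\<^sup>2) \<le> \<dots>" by (simp add: ennreal_mult[symmetric])
    from mult_right_mono[OF this, of "?w x"]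
    show "ennreal (real j * ?q) * (ennreal ((nrm n x)\<^sup>2) * ?w x) \<le>
        ennreal (nrm n x powr real (2 * j)) * ?w x + ennreal ((real j - 1) * (real n * ?q)) * ?w x"
      by (simp only: mult.assoc distrib_right) simp
  qed
  also have "\<dots> = (\<integral>\<^sup>+x. ennreal (nrm n x powr real (2 * j)) * ?w x \<partial>Leb n) + ennreal ((real j - 1) * (real n * ?q))"
    by (subst nn_integral_add) (simp_all add: nn_integral_cmult nn_gauss_weight)
  finally have "ennreal (real j * (real n * ?q)) - ennreal ((real j - 1) * (real n * ?q)) \<le>
      (\<integral>\<^sup>+x. ennreal (nrm n x powr real (2 * j)) * ?w x \<partial>Leb n)"
    by (simp add: ennreal_minus_le_iff add.commute)
  moreover have "real j * (real n * ?q) - (real j - 1) * (real n * ?q) = real n ^ j" unfolding q by (simp add: algebra_simps)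
  ultimately show ?thesis using j by (subst (asm) ennreal_minus) auto
qed

text \<open>The Gaussian moment of the functional is the spherical one times a moment of the norm.
  The former is known exactly, the latter is bounded from below.\<close>

lemma sphere_even_moment_le:
  assumes n: "1 \<le> n" and j: "1 \<le> j"
  shows "(\<integral>\<^sup>+u. ennreal ((dot n u v) ^ (2 * j)) \<partial>sigma_sphere n) \<le> ennreal (nrm n v ^ (2 * j) * (real j / real n) ^ j)"
proof -
  let ?J = "\<integral>\<^sup>+u. ennreal ((dot n u v) ^ (2 * j)) \<partial>sigma_sphere n"
  let ?N = "\<integral>\<^sup>+x. ennreal (nrm n x powr real (2 * j)) * ennreal (gauss_weight n x) \<partial>Leb n"
  have "ennreal (real n ^ j) * ?J \<le> ?N * ?J" by (intro mult_right_mono gauss_nrm_moment_ge[OF n j]) simp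
  also have "\<dots> = (\<integral>\<^sup>+x. ennreal ((dot n x v) ^ (2 * j)) * ennreal (gauss_weight n x) \<partial>Leb n)"
  proof (rule gauss_polar[OF n, symmetric])
    fix r :: real and u assume "0 < r"
    hence "(r * dot n u v) ^ (2 * j) = r powr real (2 * j) * (dot n u v) ^ (2 * j)"
      by (simp only: power_mult_distrib powr_realpow)
    thus "ennreal ((dot n (r *\<^sub>R u) v) ^ (2 * j)) = ennreal (r powr real (2 * j)) * ennreal ((dot n u v) ^ (2 * j))"
      by (simp add: ennreal_mult)
  qed measurable
  also have "\<dots> = ennreal (nrm n v ^ (2 * j) * (fact (2 * j) / (2 ^ j * fact j)))" by (rule gauss_dot_moment[OF n])
  also have "\<dots> \<le> ennreal (nrm n v ^ (2 * j) * real j ^ j)"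
    by (intro ennreal_leI mult_left_mono fact_double_div_le) simp
  finally have le: "ennreal (real n ^ j) * ?J \<le> ennreal (nrm n v ^ (2 * j) * real j ^ j)" .
  have "?J = ennreal (1 / real n ^ j) * (ennreal (real n ^ j) * ?J)"
    using n by (simp add: mult.assoc[symmetric] ennreal_mult[symmetric])
  also have "\<dots> \<le> ennreal (1 / real n ^ j) * ennreal (nrm n v ^ (2 * j) * real j ^ j)" by (rule mult_left_mono[OF le]) simp
  also have "\<dots> = ennreal (nrm n v ^ (2 * j) * (real j / real n) ^ j)"
    by (simp add: ennreal_mult[symmetric] power_divide)
  finally show ?thesis .
qed

text \<open>Jensen's inequality for a concave power, through its tangent at \<open>a\<close>; the
  slope is positive, so an upper bound \<open>a\<close> for the mean suffices.\<close>

lemma nn_powr_le_powr_nn: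
  fixes Z :: "'a \<Rightarrow> real"
  assumes M: "prob_space M" and Z[measurable]: "Z \<in> borel_measurable M" "\<And>x. 0 \<le> Z x" and a: "0 < a"
    and le: "(\<integral>\<^sup>+x. ennreal (Z x) \<partial>M) \<le> ennreal a" and q: "0 < q" "q \<le> 1"
  shows "(\<integral>\<^sup>+x. ennreal (Z x powr q) \<partial>M) \<le> ennreal (a powr q)"
proof -
  interpret prob_space M by fact
  let ?b = "(1 - q) * a powr q" and ?c = "q * a powr q / a"
  have bc: "0 \<le> ?b" "0 \<le> ?c" using q a by auto
  have "Z x powr q \<le> ?b + ?c * Z x" for x
  proof (cases "Z x = 0")
    case False
    hence "Z x / a > 0" using Z(2)[of x] a by (simp add: less_le)
    hence "1 powr (1 - q) * (Z x / a) powr q \<le> (1 - q) * 1 + q * (Z x / a)"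
      using q by (intro Youngs_inequality_0) auto
    hence "a powr q * (Z x / a) powr q \<le> a powr q * ((1 - q) + q * (Z x / a))"
      by (intro mult_left_mono) auto
    also have "a powr q * (Z x / a) powr q = Z x powr q" using a by (simp add: powr_divide)
    finally show ?thesis by (simp add: algebra_simps)
  qed (use bc in simp)
  hence "(\<integral>\<^sup>+x. ennreal (Z x powr q) \<partial>M) \<le> (\<integral>\<^sup>+x. ennreal ?b + ennreal ?c * ennreal (Z x) \<partial>M)"
  proof (intro nn_integral_mono)
    fix x
    assume le: "\<And>x. Z x powr q \<le> ?b + ?c * Z x"
    have "ennreal (Z x powr q) \<le> ennreal (?b + ?c * Z x)" by (rule ennreal_leI[OF le])
    also have "\<dots> = ennreal ?b + ennreal (?c * Z x)" by (rule ennreal_plus[OF bc(1) mult_nonneg_nonneg[OF bc(2) Z(2)]])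
    also have "ennreal (?c * Z x) = ennreal ?c * ennreal (Z x)" by (rule ennreal_mult[OF bc(2) Z(2)])
    finally show "ennreal (Z x powr q) \<le> ennreal ?b + ennreal ?c * ennreal (Z x)" .
  qed
  also have "\<dots> = ennreal ?b + ennreal ?c * (\<integral>\<^sup>+x. ennreal (Z x) \<partial>M)"
    by (subst nn_integral_add) (simp_all add: nn_integral_cmult emeasure_space_1)
  also have "\<dots> \<le> ennreal ?b + ennreal ?c * ennreal a" by (intro add_left_mono mult_left_mono le) simp
  also have "\<dots> = ennreal (?b + ?c * a)"
    using less_imp_le[OF a] by (simp only: ennreal_plus[OF bc(1) mult_nonneg_nonneg[OF bc(2)]] ennreal_mult[OF bc(2)])
  also have "?b + ?c * a = a powr q" using a by (simp add: algebra_simps)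
  finally show ?thesis .
qed

text \<open>For \<open>p < n\<close> the moment is compared with that of the next even order
  \<open>2 * j\<close>, where \<open>j \<le> p / 2 + 1\<close> is at most
  \<open>3 * p\<^sub>0\<close>. For \<open>p \<ge> n\<close> one has \<open>p\<^sub>0 = n\<close>,
  the constant is at least 1, and Cauchy--Schwarz is enough.\<close>

lemma sphere_moment_le:
  assumes n: "1 \<le> n" and p: "0 < p"
  shows "(\<integral>\<^sup>+u. ennreal (\<bar>dot n u v\<bar> powr p) \<partial>sigma_sphere n) \<le>
    ennreal ((3 * max 1 (min p (real n)) / real n) powr (p / 2) * nrm n v powr p)"
proof -
  let ?p0 = "max 1 (min p (real n))"
  note S = sphere_haar_facts[OF sphere_haar_is_haar[OF iso_onto_id n]]
  interpret prob_space "sigma_sphere n" by (rule S(1))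
  have CS: "\<bar>dot n u v\<bar> \<le> nrm n v" if "u \<in> space (sigma_sphere n)" for u
    using dot_le_nrm[of n u v] that S(3) by (auto simp: unit_sphere_iff)
  show ?thesis
  proof (cases "p < real n \<and> nrm n v \<noteq> 0")
    case False
    have "(\<integral>\<^sup>+u. ennreal (\<bar>dot n u v\<bar> powr p) \<partial>sigma_sphere n) \<le>
        (\<integral>\<^sup>+u. ennreal ((3 * ?p0 / real n) powr (p / 2) * nrm n v powr p) \<partial>sigma_sphere n)"
    proof (intro nn_integral_mono ennreal_leI)
      fix u assume u: "u \<in> space (sigma_sphere n)"
      show "\<bar>dot n u v\<bar> powr p \<le> (3 * ?p0 / real n) powr (p / 2) * nrm n v powr p"
      proof (cases "nrm n v = 0")
        case True thus ?thesis using CS[OF u] by simp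
      next
        case nz: False
        hence "?p0 = real n" using False n by auto
        hence "1 \<le> (3 * ?p0 / real n) powr (p / 2)" using n p by (simp add: ge_one_powr_ge_zero)
        hence "1 * nrm n v powr p \<le> (3 * ?p0 / real n) powr (p / 2) * nrm n v powr p" by (intro mult_right_mono) auto
        moreover have "\<bar>dot n u v\<bar> powr p \<le> nrm n v powr p" using p by (intro powr_mono2 CS[OF u]) auto
        ultimately show ?thesis by linarith
      qed
    qed
    thus ?thesis by (simp add: emeasure_space_1)
  next
    case True
    hence v: "0 < nrm n v" using nrm_nonneg[of n v] by linarith
    define j where "j = nat \<lceil>p / 2\<rceil>"
    have pj: "p / 2 \<le> real j" "real j < p / 2 + 1" using p by (auto simp: j_def ceiling_correct) linarith+
    hence j: "1 \<le> j" using p by (cases j) auto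
    have jp: "real j \<le> 3 * ?p0" using pj True by linarith
    define a where "a = nrm n v ^ (2 * j) * (3 * ?p0 / real n) ^ j"
    have a: "0 < a" using v n by (simp add: a_def)
    define q where "q = p / real (2 * j)"
    have q: "0 < q" "q \<le> 1" using p pj j by (auto simp: q_def field_simps)
    have "(\<integral>\<^sup>+u. ennreal ((dot n u v) ^ (2 * j)) \<partial>sigma_sphere n) \<le> ennreal (nrm n v ^ (2 * j) * (real j / real n) ^ j)"
      by (rule sphere_even_moment_le[OF n j])
    also have "\<dots> \<le> ennreal a"
      unfolding a_def using jp by (intro ennreal_leI mult_left_mono power_mono divide_right_mono) auto
    finally have "(\<integral>\<^sup>+u. ennreal (((dot n u v) ^ (2 * j)) powr q) \<partial>sigma_sphere n) \<le> ennreal (a powr q)"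
      by (intro nn_powr_le_powr_nn[OF S(1) _ _ a _ q] measurable_sphere[OF S(2)]) auto
    moreover have "((dot n u v) ^ (2 * j)) powr q = \<bar>dot n u v\<bar> powr p" for u
    proof (cases "dot n u v = 0")
      case False
      have "(dot n u v) ^ (2 * j) = \<bar>dot n u v\<bar> ^ (2 * j)" by (simp add: power_even_abs)
      also have "\<dots> = \<bar>dot n u v\<bar> powr real (2 * j)" using powr_realpow[of "\<bar>dot n u v\<bar>" "2 * j"] False by simp
      finally show ?thesis using j by (simp add: powr_powr q_def)
    qed (use j p in simp)
    moreover have "a powr q = (3 * ?p0 / real n) powr (p / 2) * nrm n v powr p"
    proof -
      have "0 < 3 * ?p0 / real n" using n by simp
      hence "a = nrm n v powr real (2 * j) * (3 * ?p0 / real n) powr real j"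
        unfolding a_def using v by (simp only: powr_realpow)
      moreover have "real (2 * j) * q = p" "real j * q = p / 2" using j by (simp_all add: q_def)
      ultimately show ?thesis by (simp only: powr_mult powr_powr mult.commute)
    qed
    ultimately show ?thesis by simp
  qed
qed

section \<open>The embedding into L_p in coordinates\<close>

text \<open>The representatives \<open>J x\<close> are linear in \<open>x\<close> only up to null
  sets that depend on \<open>x\<close>. Replacing them by combinations of the values at the axis
  vectors gives an integrand that is linear in \<open>x\<close> everywhere and jointly measurable in
  \<open>x\<close> and \<open>t\<close>, as Fubini requires.\<close>

lemma in_SL_coordinates:
  assumes "in_SL p n K" and p: "0 < p"
  obtains v :: "real \<Rightarrow> nat \<Rightarrow> real" where "\<And>i. (\<lambda>t. v t i) \<in> borel_measurable (lebesgue_on {0..1})" "\<And>t. v t \<in> Rn n"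
    "\<And>x. x \<in> Rn n \<Longrightarrow> (\<integral>\<^sup>+t. ennreal (\<bar>dot n x (v t)\<bar> powr p) \<partial>lebesgue_on {0..1}) = ennreal (norm_of K x powr p)"
proof -
  let ?M = "lebesgue_on {0..1::real}"
  obtain J :: "(nat \<Rightarrow> real) \<Rightarrow> real \<Rightarrow> real" where
    meas: "\<And>x. x \<in> Rn n \<Longrightarrow> J x \<in> borel_measurable ?M"
    and int: "\<And>x. x \<in> Rn n \<Longrightarrow> integrable ?M (\<lambda>t. \<bar>J x t\<bar> powr p)"
    and lin: "\<And>x y a b. x \<in> Rn n \<Longrightarrow> y \<in> Rn n \<Longrightarrow> AE t in ?M. J (a *\<^sub>R x + b *\<^sub>R y) t = a * J x t + b * J y t"
    and nm: "\<And>x. x \<in> Rn n \<Longrightarrow> norm_of K x = (LINT t|?M. \<bar>J x t\<bar> powr p) powr (1 / p)"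
    using assms(1) unfolding in_SL_def by blast
  define v where "v t i = (if i < n then J (axis_vec i) t else 0)" for t i
  show ?thesis
  proof (rule that)
    show "(\<lambda>t. v t i) \<in> borel_measurable ?M" for i
      unfolding v_def using meas[OF axis_vec_in_Rn] by (cases "i < n") auto
    show "v t \<in> Rn n" for t by (auto simp: v_def Rn_iff)
    fix x assume x: "x \<in> Rn n"
    have "AE t in ?M. J (\<Sum>i<l. x i *\<^sub>R axis_vec i) t = (\<Sum>i<l. x i * J (axis_vec i) t)" if "l \<le> n" for l
      using that
    proof (induction l)
      case 0
      have "AE t in ?M. J 0 t = 0" using lin[OF x x, of 0 0] by simp
      thus ?case by (simp only: lessThan_0 sum.empty)
    next
      case (Suc l)
      let ?y = "\<Sum>i<l. x i *\<^sub>R axis_vec i"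
      have a: "axis_vec l \<in> Rn n" using Suc.prems by (intro axis_vec_in_Rn) simp
      have y: "?y \<in> Rn n"
        using Suc.prems by (intro subspace_sum[OF Rn_subspace] Rn_closed_ops(4) axis_vec_in_Rn) simp
      have "AE t in ?M. J ?y t = (\<Sum>i<l. x i * J (axis_vec i) t)"
        by (rule Suc.IH[OF Suc_leD[OF Suc.prems]])
      with lin[OF y a, of 1 "x l"] show ?case
        by eventually_elim (simp only: sum.lessThan_Suc scaleR_one mult_1_left)
    qed
    from this[OF order_refl] have "AE t in ?M. J x t = dot n x (v t)"
      unfolding Rn_expand[OF x, symmetric] by (simp add: dot_def v_def)
    hence "(\<integral>\<^sup>+t. ennreal (\<bar>dot n x (v t)\<bar> powr p) \<partial>?M) = (\<integral>\<^sup>+t. ennreal (\<bar>J x t\<bar> powr p) \<partial>?M)"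
      by (intro nn_integral_cong_AE) auto
    also have "\<dots> = ennreal (LINT t|?M. \<bar>J x t\<bar> powr p)" by (rule nn_integral_eq_integral[OF int[OF x]]) simp
    also have "(LINT t|?M. \<bar>J x t\<bar> powr p) = norm_of K x powr p"
      unfolding nm[OF x] using p by (simp add: powr_powr)
    finally show "(\<integral>\<^sup>+t. ennreal (\<bar>dot n x (v t)\<bar> powr p) \<partial>?M) = ennreal (norm_of K x powr p)" .
  qed
qed

lemma measurable_dot_pair:
  assumes "\<And>i. (\<lambda>x. x i) \<in> borel_measurable N" "\<And>i. (\<lambda>t. v t i) \<in> borel_measurable M"
  shows "(\<lambda>z. dot n (fst z) (v (snd z))) \<in> borel_measurable (N \<Otimes>\<^sub>M M)"
  unfolding dot_def
  by (intro borel_measurable_sum borel_measurable_times measurable_compose[OF measurable_fst assms(1)]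
    measurable_compose[OF measurable_snd assms(2)])

theorem mean_norm_SL_le:
  assumes K: "sym_body n K" and n: "1 \<le> n" and iso: "isotropic n K" and V: "measure (Leb n) K = unit_ball_vol (real n)"
    and p: "0 < p" and SL: "in_SL p n K"
  shows "mean_norm n p K \<le> 120 * sqrt (max 1 (min p (real n)))"
proof -
  let ?M = "lebesgue_on {0..1::real}" and ?p0 = "max 1 (min p (real n))" and ?V = "unit_ball_vol (real n)"
  note S = sphere_haar_facts[OF sphere_haar_is_haar[OF iso_onto_id n]]
  interpret M: finite_measure ?M by (rule finite_measure_lebesgue_on) simp
  interpret \<sigma>: prob_space "sigma_sphere n" by (rule S(1))
  interpret LM: pair_sigma_finite "Leb n" ?M ..
  interpret \<sigma>M: pair_sigma_finite "sigma_sphere n" ?M ..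
  obtain c where c: "0 \<le> c" "\<And>v. v \<in> Rn n \<Longrightarrow> second_moment n K v = ennreal (c * (nrm n v)\<^sup>2)"
    using iso isotropic_iff[OF K n] by blast
  have low: "?V \<le> 8 * real n * c" by (rule isotropic_moment_lower[OF K n V c])
  have Vpos: "0 < ?V" by simp
  have "?V \<le> 0" if "c = 0" using low that by simp
  with Vpos c(1) have c0: "0 < c" by (metis order_le_less not_less)
  define s where "s = sqrt (c / ?V) / 8"
  have s: "0 < s" using c0 by (simp add: s_def)
  obtain v :: "real \<Rightarrow> nat \<Rightarrow> real" where vm: "\<And>i. (\<lambda>t. v t i) \<in> borel_measurable ?M" and vR: "\<And>t. v t \<in> Rn n"
    and vK: "\<And>x. x \<in> Rn n \<Longrightarrow> (\<integral>\<^sup>+t. ennreal (\<bar>dot n x (v t)\<bar> powr p) \<partial>?M) = ennreal (norm_of K x powr p)"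
    by (rule in_SL_coordinates[OF SL p]) (rule that)
  \<comment> \<open>The quantity that links the two sides: moments on \<open>K\<close> bound it from
    above, since the norm is at most 1 there, and it bounds the mean over the sphere.\<close>
  define A where "A = (\<integral>\<^sup>+t. ennreal (nrm n (v t) powr p) \<partial>?M)"
  have [measurable]: "(\<lambda>t. nrm n (v t)) \<in> borel_measurable ?M"
    unfolding nrm_def dot_def using vm by measurable
  have [measurable]: "(\<lambda>t. dot n x (v t)) \<in> borel_measurable ?M" for x
    unfolding dot_def by (intro borel_measurable_sum borel_measurable_times vm borel_measurable_const)
  have [measurable]: "K \<in> sets borel" using K by measurable
  have [measurable]: "(\<lambda>z. dot n (fst z) (v (snd z))) \<in> borel_measurable (Leb n \<Otimes>\<^sub>M ?M)"
    by (rule measurable_dot_pair[OF _ vm]) measurable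
  have [measurable]: "(\<lambda>z. dot n (fst z) (v (snd z))) \<in> borel_measurable (sigma_sphere n \<Otimes>\<^sub>M ?M)"
    by (rule measurable_dot_pair[OF measurable_sphere[OF S(2)] vm]) measurable
  have [measurable]: "(\<lambda>z. indicator K (fst z) :: ennreal) \<in> borel_measurable (Leb n \<Otimes>\<^sub>M ?M)"
    by (rule measurable_compose[OF measurable_fst]) measurable
  have "ennreal (?V * s powr p / (p + 1)) * A = (\<integral>\<^sup>+t. ennreal (?V * (s * nrm n (v t)) powr p / (p + 1)) \<partial>?M)"
    unfolding A_def using p s
    by (subst nn_integral_cmult[symmetric]) (auto simp: ennreal_mult[symmetric] powr_mult mult_ac intro!: nn_integral_cong)
  also have "\<dots> \<le> (\<integral>\<^sup>+t. (\<integral>\<^sup>+x. indicator K x * ennreal (\<bar>dot n x (v t)\<bar> powr p) \<partial>Leb n) \<partial>?M)"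
    unfolding s_def
    by (intro nn_integral_mono linear_functional_moment_lower[OF K n V[symmetric] c0 c(2) p vR])
  also have "\<dots> = (\<integral>\<^sup>+x. (\<integral>\<^sup>+t. indicator K x * ennreal (\<bar>dot n x (v t)\<bar> powr p) \<partial>?M) \<partial>Leb n)"
    by (rule LM.Fubini') (simp add: case_prod_beta)
  also have "\<dots> = (\<integral>\<^sup>+x. indicator K x * ennreal (norm_of K x powr p) \<partial>Leb n)"
    by (rule nn_Leb_cong) (simp add: nn_integral_cmult vK del: topspace_Euclidean_space)
  also have "\<dots> \<le> (\<integral>\<^sup>+x. indicator K x \<partial>Leb n)"
  proof (rule nn_integral_mono)
    fix x
    have "norm_of K x powr p \<le> 1 powr p" if "x \<in> K"
      using norm_of_le[OF K that] norm_of_nonneg[OF K] sym_body_compact(2)[OF K] that p by (intro powr_mono2) auto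
    thus "indicator K x * ennreal (norm_of K x powr p) \<le> indicator K x" by (auto simp: indicator_def)
  qed
  also have "\<dots> = emeasure (Leb n) K" by simp
  also have "\<dots> = ennreal ?V"
    unfolding V[symmetric] by (rule emeasure_eq_ennreal_measure) (use emeasure_sym_body_finite[OF K] in simp)
  finally have A: "ennreal (?V * s powr p / (p + 1)) * A \<le> ennreal ?V" .
  define a where "a = (p + 1) / s powr p"
  have "A = ennreal (a / ?V) * (ennreal (?V * s powr p / (p + 1)) * A)"
    using less_imp_neq[OF Vpos] p s by (simp add: mult.assoc[symmetric] ennreal_mult[symmetric] a_def)
  also have "\<dots> \<le> ennreal (a / ?V) * ennreal ?V" by (rule mult_left_mono[OF A]) simp
  also have "\<dots> = ennreal a" using less_imp_neq[OF Vpos] p by (simp add: ennreal_mult[symmetric] a_def)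
  finally have A: "A \<le> ennreal a" .
  have a0: "0 \<le> a" using p by (simp add: a_def)
  define b where "b = (3 * ?p0 / real n) powr (p / 2)"
  have b0: "0 \<le> b" by (simp add: b_def)
  have "(\<integral>\<^sup>+u. ennreal (norm_of K u powr p) \<partial>sigma_sphere n) =
      (\<integral>\<^sup>+u. (\<integral>\<^sup>+t. ennreal (\<bar>dot n u (v t)\<bar> powr p) \<partial>?M) \<partial>sigma_sphere n)"
    using S(3) by (intro nn_integral_cong vK[symmetric]) (simp add: unit_sphere_iff)
  also have "\<dots> = (\<integral>\<^sup>+t. (\<integral>\<^sup>+u. ennreal (\<bar>dot n u (v t)\<bar> powr p) \<partial>sigma_sphere n) \<partial>?M)"
    by (rule \<sigma>M.Fubini'[symmetric]) (simp add: case_prod_beta)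
  also have "\<dots> \<le> (\<integral>\<^sup>+t. ennreal b * ennreal (nrm n (v t) powr p) \<partial>?M)"
    unfolding b_def
    by (intro nn_integral_mono order_trans[OF sphere_moment_le[OF n p]]) (simp add: ennreal_mult)
  also have "\<dots> = ennreal b * A" unfolding A_def by (rule nn_integral_cmult) measurable
  also have "\<dots> \<le> ennreal b * ennreal a" by (rule mult_left_mono[OF A]) simp
  also have "\<dots> = ennreal (b * a)" by (rule ennreal_mult[symmetric, OF b0 a0])
  finally have "(LINT u|sigma_sphere n. norm_of K u powr p) \<le> b * a"
    by (intro LINT_le_nn) (use a0 b0 in auto)
  hence "mean_norm n p K \<le> (b * a) powr (1 / p)"
    unfolding mean_norm_def using p by (intro powr_mono2) (auto intro: Bochner_Integration.integral_nonneg)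
  also have "\<dots> = b powr (1 / p) * ((p + 1) powr (1 / p) / (s powr p) powr (1 / p))"
    unfolding a_def by (simp only: powr_mult powr_divide)
  also have "b powr (1 / p) = sqrt (3 * ?p0 / real n)"
    unfolding b_def using p by (simp add: powr_powr powr_half_sqrt)
  also have "(s powr p) powr (1 / p) = s" using p s by (simp add: powr_powr)
  \<comment> \<open>Origin of 120: \<open>(p + 1) powr (1 / p) \<le> e \<le> 3\<close> and
    \<open>1 / s \<le> 8 * sqrt (8 * n)\<close> give the factor 24, and
    \<open>sqrt (3 * 8 * p\<^sub>0) \<le> 5 * sqrt p\<^sub>0\<close> gives the factor 5.\<close>
  also have "sqrt (3 * ?p0 / real n) * ((p + 1) powr (1 / p) / s) \<le> sqrt (3 * ?p0 / real n) * (3 / (1 / (8 * sqrt (8 * real n))))"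
  proof (intro mult_left_mono frac_le)
    have "(p + 1) powr (1 / p) \<le> (exp p) powr (1 / p)" using p exp_ge_add_one_self[of p] by (intro powr_mono2) (auto simp: add.commute)
    also have "\<dots> = exp 1" using p by (simp add: powr_def)
    finally show "(p + 1) powr (1 / p) \<le> 3" using exp_le by linarith
    have "1 / (8 * real n) \<le> c / ?V" using low Vpos n by (simp add: field_simps)
    hence "sqrt (1 / (8 * real n)) \<le> sqrt (c / ?V)" by (rule real_sqrt_le_mono)
    thus "1 / (8 * sqrt (8 * real n)) \<le> s" by (simp add: s_def real_sqrt_divide)
  qed (use n in auto)
  also have "\<dots> = 24 * (sqrt (3 * ?p0 / real n) * sqrt (8 * real n))" by simp
  also have "sqrt (3 * ?p0 / real n) * sqrt (8 * real n) = sqrt (24 * ?p0)"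
    using n by (subst real_sqrt_mult[symmetric]) simp
  also have "24 * sqrt (24 * ?p0) \<le> 24 * (5 * sqrt ?p0)"
  proof -
    have "sqrt (24 * ?p0) \<le> sqrt (5\<^sup>2 * ?p0)" by (intro real_sqrt_le_mono mult_right_mono) auto
    thus ?thesis by (simp only: real_sqrt_mult real_sqrt_abs abs_numeral mult_le_cancel_left_pos zero_less_numeral)
  qed
  finally show ?thesis by simp
qed

section \<open>The three estimates with common constants\<close>

theorem mainTheorem6:
  shows "\<exists>C C' :: real. 0 < C \<and> 0 < C' \<and>
    (\<forall>n\<ge>1. \<forall>K.
       convex_body n K \<and> centrally_symmetric K \<and> isotropic n K \<and>
       measure (Leb n) K = measure (Leb n) (unit_ball n) \<longrightarrow>
         mean_norm n 2 K \<le> C * type2_const n K \<and>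
         (\<forall>p>0. in_SL p n K \<longrightarrow>
            mean_norm n p K \<le> C * sqrt (max 1 (min p (real n)))) \<and>
         (\<forall>k\<in>{1..n - 1}. in_BP k n K \<longrightarrow>
            ereal C' / max_isotropic_constant k \<le> ereal (mean_radial n k K)))"
proof (rule exI[of _ 120], rule exI[of _ "1 / 102"], (intro conjI allI impI ballI; (elim conjE)?))
  fix n K assume n: "1 \<le> n" and "convex_body n K" "centrally_symmetric K" and iso: "isotropic n K"
    and "measure (Leb n) K = measure (Leb n) (unit_ball n)"
  hence K: "sym_body n K" and V: "measure (Leb n) K = unit_ball_vol (real n)"
    by (simp_all add: sym_body_def unit_ball_measure)
  show "mean_norm n 2 K \<le> 120 * type2_const n K"
  proof -
    have type2: "type2_const n K = Inf (Collect (type2_bound n K))"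
      unfolding type2_const_def type2_bound_def ..
    \<comment> \<open>The estimate holds for every admissible \<open>T\<close> and so passes to the
      infimum; its constant 3 is absorbed in the 120 of the second estimate.\<close>
    have "mean_norm n 2 K / 120 \<le> Inf (Collect (type2_bound n K))"
    proof (rule cInf_greatest)
      show "Collect (type2_bound n K) \<noteq> {}" using type2_bound_exists[OF K n] by blast
      fix T assume "T \<in> Collect (type2_bound n K)"
      hence T: "type2_bound n K T" by simp
      hence "0 < T" by (simp add: type2_bound_def)
      thus "mean_norm n 2 K / 120 \<le> T" using mean_norm_le_type2[OF K n iso V T] by simp
    qed
    thus ?thesis unfolding type2 by simp
  qed
  show "mean_norm n p K \<le> 120 * sqrt (max 1 (min p (real n)))" if "0 < p" "in_SL p n K" for p
    by (rule mean_norm_SL_le[OF K n iso V that])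
  show "ereal (1 / 102) / max_isotropic_constant k \<le> ereal (mean_radial n k K)" if "k \<in> {1..n - 1}" "in_BP k n K" for k
    using that by (intro mean_radial_BP_ge[OF K iso V]) auto
qed simp_all


end
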